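(* Consider the factor model $X=\Lambda^0F^{0\top}+E$ with principal components (PC) estimators $\hat\lambda_i,\hat f_t,\hat m_{it}$ and matching matrix $H$ as defined in the context. Consider the following assumptions. (A) (i) $T^{-1}\sum_{t=1}^T f_t^0f_t^{0\top}\to_p\Sigma_F$ with $\Sigma_F$ an $r\times r$ positive definite matrix; (ii) $N^{-\alpha}\sum_{i=1}^N\lambda_i^0\lambda_i^{0\top}\to\Sigma_\Lambda$ for some $\alpha\in(0,1]$ with $\Sigma_\Lambda$ an $r\times r$ positive definite matrix; (iii) the eigenvalues of $\Sigma_\Lambda\Sigma_F$ are distinct; (iv) for some constant $C>0$, $\mathbb E\|f_t^0\|^2\le C$ for all $t$, and there is a constant $C'>0$ such that for each $i$ there is a parameter $\alpha_i\le1$ with $\|\lambda_i^0\|\le C'N^{(\alpha_i-1)/2}$. (B'(i)) $\mathbb E[\epsilon_{it}]=0$, $\mathbb E[\epsilon_{it}^6]\le C$ for a constant $C>0$; $E$ is independent of $M^0$; the vectors $e_i=(\epsilon_{i1},\dots,\epsilon_{iT})^\top$, $i\in[N]$, are independent across $i$. (B'(ii)) With probability converging to 1, $\|E\|\lesssim\max\{\sqrt N,\sqrt T\}$. (B'(iii)) There is a constant $C>0$ such that $\sum_{s=1}^T|\mathrm{Cov}(\epsilon_{it},\epsilon_{is})|\le C$ for all $i\in[N],t\in[T]$, and $\sum_{s=1}^T|\mathrm{Cov}(\epsilon_{it}\epsilon_{ik},\epsilon_{is}\epsilon_{ik})|\le C$ for all $i\in[N]$, $t,k\in[T]$. (B'(iv))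 There is a sequence $\delta\to\infty$ with $\delta\asymp(\log N)^\nu$ for some constant $\nu>0$ and $$\sum_{j=1}^N\Big(\mathbb E[\epsilon_{jt}\mid(\epsilon_{js})_{s\in\mathcal N_\delta(t)^c}]-\mathbb E[\epsilon_{jt}]\Big)^2=O_p(N^{1/3}),$$ where $\mathcal N_\delta(t)^c=\{1,\dots,t-\delta-1\}\cup\{t+\delta+1,\dots,T\}$. Suppose $\max\{N,T\}(\log N)^{2\nu}=o(N^\alpha T)$. (i) If (A) and (B'(i))–(B'(iii)) hold, then $$\|\hat\lambda_i-H^{-1}\lambda_i^0\|=O_p\Big(\frac1{\sqrt T}+\sqrt{\frac{N^{\alpha_i}}{N}}\,\frac{\max\{N,T\}}{N^\alpha T}\Big).$$ (ii) If (A) and (B'(i))–(B'(iv)) hold, then $$\|\hat f_t-H^\top f_t^0\|=O_p\Big(\frac1{\sqrt{N^\alpha}}+\frac{\max\{N,T\}N^{1/6}}{N^\alpha T}+\frac{\sqrt N\max\{N^{3/2},T^{3/2}\}(\log N)^{\nu/2}}{N^{2\alpha}T^{3/2}}\Big),$$ $$|\hat m_{it}-m^0_{it}|=O_p\Big(\frac1{\sqrt T}+\sqrt{\frac{N^{\alpha_i}}N}\frac1{\sqrt{N^\alpha}}+\sqrt{\frac{N^{\alpha_i}}N}\frac{\max\{N,T\}N^{1/6}}{N^\alpha T}+\frac{\sqrt{N^{\alpha_i}}\max\{N^{3/2},T^{3/2}\}(\log N)^{\nu/2}}{N^{2\alpha}T^{3/2}}+\frac{\max\{N,T\}N^{1/6}}{N^\alpha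 T^{3/2}}+\frac{\sqrt N\max\{N^{3/2},T^{3/2}\}(\log N)^{\nu/2}}{N^{2\alpha}T^2}\Big).$$
   Context: Asymptotics are as $N,T\to\infty$ jointly, for given $i$ and $t$; the number of factors $r$ is fixed; $[K]=\{1,\dots,K\}$. $\|\cdot\|$ is the spectral norm of matrices and the $\ell_2$ norm of vectors; $a\lesssim b$ means $|a|\le C|b|$ for a constant $C>0$; $a\asymp b$ means $a\lesssim b$ and $b\lesssim a$. Model: $x_{it}=\lambda_i^{0\top}f_t^0+\epsilon_{it}$, $1\le i\le N$, $1\le t\le T$, i.e. $X=\Lambda^0F^{0\top}+E$ with $X=(x_{it})$, $E=(\epsilon_{it})\in\mathbb R^{N\times T}$, $\Lambda^0=(\lambda_1^0,\dots,\lambda_N^0)^\top\in\mathbb R^{N\times r}$, $F^0=(f_1^0,\dots,f_T^0)^\top\in\mathbb R^{T\times r}$, $M^0=(m^0_{it})=\Lambda^0F^{0\top}$. PC estimator: let $U_rD_rV_r^\top$ be the top-$r$ part of the singular value decomposition of $X$ ($D_r$ diagonal with the $r$ largest singular values in decreasing order, $U_r,V_r$ the corresponding left and right singular vectors). Put $\hat\Lambda=T^{-1/2}U_rD_r$ and $\hat F=\sqrt T\,V_r$; $\hat\lambda_i^\top$ is the $i$-th row of $\hat\Lambda$, $\hat f_t^\top$ the $t$-th row of $\hat F$, and $\hat m_{it}=\hat\lambda_i^\top\hat f_t$. Matching matrix: let $Y_r=U_rD_r^{1/2}$, $Z_r=V_rD_r^{1/2}$. Let $M^0=U_r^0D_r^0V_r^{0\top}$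 be the reduced SVD, $Y_r^0=U_r^0(D_r^0)^{1/2}$, $Z_r^0=V_r^0(D_r^0)^{1/2}$. Let $H^0\in\mathbb R^{r\times r}$ be the invertible matrix with $F^0=T^{1/2}Z_r^0H^0$ and $\Lambda^0=T^{-1/2}Y_r^0(H^0)^{-\top}$. Let $O=\arg\min_{R}\left\|\begin{bmatrix}Y_r\\Z_r\end{bmatrix}R-\begin{bmatrix}Y_r^0\\Z_r^0\end{bmatrix}\right\|_{\rm F}^2$ over $r\times r$ orthogonal matrices $R$. Then $H=(D_r^{1/2}OH^0)^{-1}$. *)

theory Defs
  imports
    "HOL-Probability.Probability"
    "HOL-Library.Landau_Symbols"
    "Jordan_Normal_Form.Spectral_Radius"
    "Jordan_Normal_Form.Gauss_Jordan_Elimination"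
begin

(* Matrices are those of Jordan_Normal_Form, since their sizes N x T, N x r, T x r vary along the
   asymptotics.  All indices start at 0: unit i \<in> [N] is "i < N", period t \<in> [T] is "t < T". *)

definition vec_l2_norm :: "real vec \<Rightarrow> real" where
  "vec_l2_norm v = sqrt (v \<bullet> v)"

definition spectral_norm :: "real mat \<Rightarrow> real" where
  "spectral_norm A =
     (SUP v\<in>{v \<in> carrier_vec (dim_col A). vec_l2_norm v \<le> 1}. vec_l2_norm (A *\<^sub>v v))"

definition frobenius_norm :: "real mat \<Rightarrow> real" where
  "frobenius_norm A = sqrt (\<Sum>i<dim_row A. \<Sum>j<dim_col A. (A $$ (i, j))\<^sup>2)"

definition pos_def_mat :: "nat \<Rightarrow> real mat \<Rightarrow> bool" where
  "pos_def_mat r A \<longleftrightarrow>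
     A \<in> carrier_mat r r \<and> A\<^sup>T = A \<and> (\<forall>v\<in>carrier_vec r. v \<noteq> 0\<^sub>v r \<longrightarrow> v \<bullet> (A *\<^sub>v v) > 0)"

(* The orthogonal_mat of Jordan_Normal_Form does not normalise the columns. *)
definition orthogonal_matrices :: "nat \<Rightarrow> real mat set" where
  "orthogonal_matrices r = {R \<in> carrier_mat r r. R\<^sup>T * R = 1\<^sub>m r \<and> R * R\<^sup>T = 1\<^sub>m r}"

(* With k = min (dim_row A) (dim_col A) this is the singular value decomposition listing every
   singular value, zeros included. *)
definition is_svd :: "nat \<Rightarrow> real mat \<Rightarrow> real mat \<Rightarrow> (nat \<Rightarrow> real) \<Rightarrow> real mat \<Rightarrow> bool" where
  "is_svd k A U s V \<longleftrightarrow>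
     U \<in> carrier_mat (dim_row A) k \<and> V \<in> carrier_mat (dim_col A) k \<and>
     U\<^sup>T * U = 1\<^sub>m k \<and> V\<^sup>T * V = 1\<^sub>m k \<and>
     (\<forall>j<k. 0 \<le> s j) \<and> (\<forall>i j. i \<le> j \<and> j < k \<longrightarrow> s j \<le> s i) \<and>
     A = U * mat_diag k s * V\<^sup>T"

definition first_cols :: "nat \<Rightarrow> real mat \<Rightarrow> real mat" where
  "first_cols r A = mat (dim_row A) r (\<lambda>(i, j). A $$ (i, j))"

(* Singular vectors are not unique, so this is a relation.  Only s 0, ..., s (r-1) matter. *)
definition is_top_svd :: "nat \<Rightarrow> real mat \<Rightarrow> real mat \<Rightarrow> (nat \<Rightarrow> real) \<Rightarrow> real mat \<Rightarrow> bool" where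
  "is_top_svd r A Ur s Vr \<longleftrightarrow>
     r \<le> min (dim_row A) (dim_col A) \<and>
     (\<exists>U s' V. is_svd (min (dim_row A) (dim_col A)) A U s' V \<and>
        Ur = first_cols r U \<and> Vr = first_cols r V \<and> (\<forall>j<r. s j = s' j))"

(* Reduced SVD of a matrix of rank r: only the r nonzero singular values are kept. *)
definition is_reduced_svd :: "nat \<Rightarrow> real mat \<Rightarrow> real mat \<Rightarrow> (nat \<Rightarrow> real) \<Rightarrow> real mat \<Rightarrow> bool" where
  "is_reduced_svd r A U s V \<longleftrightarrow> is_svd r A U s V \<and> (\<forall>j<r. 0 < s j)"

definition pc_loadings :: "nat \<Rightarrow> nat \<Rightarrow> real mat \<Rightarrow> (nat \<Rightarrow> real) \<Rightarrow> real mat" where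
  "pc_loadings T r U d = (1 / sqrt (real T)) \<cdot>\<^sub>m (U * mat_diag r d)"

definition pc_factors :: "nat \<Rightarrow> real mat \<Rightarrow> real mat" where
  "pc_factors T V = sqrt (real T) \<cdot>\<^sub>m V"

(* mat_inverse A is None exactly when A is not an invertible square matrix, so the equations
   "mat_inverse _ = Some _" below include invertibility. *)
definition is_matching_matrix ::
  "nat \<Rightarrow> nat \<Rightarrow> real mat \<Rightarrow> real mat \<Rightarrow> real mat \<Rightarrow> (nat \<Rightarrow> real) \<Rightarrow> real mat \<Rightarrow> real mat \<Rightarrow> bool" where
  "is_matching_matrix r T \<Lambda> F U d V H \<longleftrightarrow>
     (\<exists>U0 d0 V0 H0 H0inv Orth.
        let D12 = mat_diag r (\<lambda>j. sqrt (d j));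
            D012 = mat_diag r (\<lambda>j. sqrt (d0 j));
            Y = U * D12; Z = V * D12; Y0 = U0 * D012; Z0 = V0 * D012
        in is_reduced_svd r (\<Lambda> * F\<^sup>T) U0 d0 V0 \<and>
           H0 \<in> carrier_mat r r \<and> mat_inverse H0 = Some H0inv \<and>
           F = sqrt (real T) \<cdot>\<^sub>m (Z0 * H0) \<and>
           \<Lambda> = (1 / sqrt (real T)) \<cdot>\<^sub>m (Y0 * H0inv\<^sup>T) \<and>
           is_arg_min (\<lambda>R. (frobenius_norm ((Y @\<^sub>r Z) * R - (Y0 @\<^sub>r Z0)))\<^sup>2)
             (\<lambda>R. R \<in> orthogonal_matrices r) Orth \<and>
           mat_inverse (D12 * Orth * H0) = Some H)"

(* Z_n = O_p(a_n).  The event is quantified rather than taken to be {|Z n| <= K a_n}, because the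
   singular vectors are chosen outcome by outcome and need not be measurable in the outcome; for
   random variables Z n this is the usual P(|Z_n| > K a_n) <= e. *)
definition bounded_in_prob :: "'a measure \<Rightarrow> (nat \<Rightarrow> 'a \<Rightarrow> real) \<Rightarrow> (nat \<Rightarrow> real) \<Rightarrow> bool" where
  "bounded_in_prob M Z a \<longleftrightarrow>
     (\<forall>e>0. \<exists>K>0. \<forall>\<^sub>F n in sequentially.
        \<exists>A\<in>sets M. measure M A \<ge> 1 - e \<and> (\<forall>\<omega>\<in>A. \<bar>Z n \<omega>\<bar> \<le> K * a n))"

definition mat_tendsto_in_prob :: "'a measure \<Rightarrow> (nat \<Rightarrow> 'a \<Rightarrow> real mat) \<Rightarrow> real mat \<Rightarrow> bool" where
  "mat_tendsto_in_prob M S L \<longleftrightarrow>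
     (\<forall>e>0. (\<lambda>n. measure M {\<omega> \<in> space M. spectral_norm (S n \<omega> - L) > e}) \<longlonglongrightarrow> 0)"

definition covariance :: "'a measure \<Rightarrow> ('a \<Rightarrow> real) \<Rightarrow> ('a \<Rightarrow> real) \<Rightarrow> real" where
  "covariance M X Y =
     (\<integral>\<omega>. (X \<omega> - (\<integral>\<omega>'. X \<omega>' \<partial>M)) * (Y \<omega> - (\<integral>\<omega>'. Y \<omega>' \<partial>M)) \<partial>M)"

(* Restricted to I, so that the random matrix A becomes a random element of PiM I. *)
definition entries :: "(nat \<times> nat) set \<Rightarrow> ('a \<Rightarrow> real mat) \<Rightarrow> 'a \<Rightarrow> nat \<times> nat \<Rightarrow> real" where
  "entries I A \<omega> = (\<lambda>p\<in>I. A \<omega> $$ p)"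

definition entries_sigma :: "'a measure \<Rightarrow> (nat \<times> nat) set \<Rightarrow> ('a \<Rightarrow> real mat) \<Rightarrow> 'a measure" where
  "entries_sigma M I A = vimage_algebra (space M) (entries I A) (PiM I (\<lambda>_. borel))"

(* Sums instead of differences, as t - \<delta> would truncate at 0. *)
definition nbhd_compl :: "nat \<Rightarrow> nat \<Rightarrow> nat \<Rightarrow> nat set" where
  "nbhd_compl T \<delta> t = {s. s < T \<and> (s + \<delta> < t \<or> t + \<delta> < s)}"

end

(*
  The singular value decomposition of X is a perturbation of that of the signal, and the matching
  matrix H is controlled by a second-order expansion: the singular vectors and their optimal
  rotation satisfy coupled Sylvester equations, so that the first-order error only enters through
  the r x r matrix of inner products of loadings, noise and factors.  The remaining error of row i is
  e_i' V, where V depends on e_i.  It is replaced by the right singular vectors of X without row i,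
  which are independent of e_i; they may be chosen measurably from a countable dense set of
  near-optimal subspaces.  For factor t one removes the time periods close to t instead, and the
  conditional means of the noise given the remaining periods are bounded by (B'(iv)), while the
  conditional second moments are O(N^{1/3}) uniformly over units by the sixth moments.
*)
theory Submission
  imports Defs "HOL-Real_Asymp.Real_Asymp"
begin

text \<open>The crude bound for \<open>tp V * e_i\<close> is \<open>norm e_i\<close>, of order
  \<open>sqrt T\<close>, whereas the rates need a bounded quantity; a second moment gives that only
  for a fixed matrix in place of \<open>V\<close>. The candidates therefore range over a countable
  set, and the first one that passes all tests is taken: the events of first success are disjoint,
  so Markov's inequality is summed over them without a union bound. The tests are strict
  inequalities, which candidates inherit by continuity from exact singular vectors. Comparing
  \<open>V\<close> with the candidate brings back \<open>tp V * e_i\<close>, but with a factor at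
  most 1/2, so it is absorbed. For a period the candidate must also lie almost inside the loading
  space; its part outside is of order \<open>sqrt m / s\<close>, and this factor pays for
  conditional second moments of order N^(1/3). Distances to the truth are deterministic inequalities
  for one outcome with explicit constants; probability only supplies the events on which their
  hypotheses hold.\<close>

abbreviation Ev (binder "EV " 10) where "Ev P \<equiv> eventually P sequentially"

section \<open>Finitely supported matrices as a normed algebra\<close>

text \<open>Extending matrices by zero makes sums and products of matrices of all sizes total operations
 of one normed algebra without unit, whose norm is the Frobenius norm; the identity matrices
 become idempotents.\<close>

typedef fmat = "{f :: nat => nat => real. EX n. ALL i j. n <= i | n <= j --> f i j = 0}"
 morphisms entry Abs_fmat
 by (rule exI[of _ "%i j. 0"]) simp

setup_lifting type_definition_fmat

definition supp_in :: "nat => fmat => bool" where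
 "supp_in n A \<longleftrightarrow> (ALL i j. n <= i | n <= j --> entry A i j = 0)"

lemma supp_in_mono: "supp_in n A ==> n <= m ==> supp_in m A"
 unfolding supp_in_def by (meson le_trans)

lemma supp_in_ex: "EX n. supp_in n A"
 unfolding supp_in_def by transfer simp

lemma supp_in_ex2: "EX n. supp_in n A & supp_in n B"
 by (meson supp_in_ex supp_in_mono linear)

lemma supp_in_ex3: "EX n. supp_in n A & supp_in n B & supp_in n C"
 by (meson supp_in_ex2 supp_in_ex supp_in_mono linear)

lemma entry_eqI: "(!!i j. entry A i j = entry B i j) ==> A = B"
 by transfer blast

lemma fmat_eq_iff: "A = B \<longleftrightarrow> (ALL i j. entry A i j = entry B i j)"
 by (auto intro: entry_eqI)

instantiation fmat :: real_vector
begin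

lift_definition zero_fmat :: fmat is "%i j. 0" by simp

lift_definition plus_fmat :: "fmat => fmat => fmat" is "%f g i j. f i j + g i j"
proof -
 fix f g :: "nat => nat => real"
 assume "EX n. ALL i j. n <= i | n <= j --> f i j = 0" "EX n. ALL i j. n <= i | n <= j --> g i j = 0"
 then obtain n m where "ALL i j. n <= i | n <= j --> f i j = 0" "ALL i j. m <= i | m <= j --> g i j = 0"
  by blast
 then show "EX n. ALL i j. n <= i | n <= j --> f i j + g i j = 0"
  by (intro exI[of _ "max n m"]) auto
qed

lift_definition uminus_fmat :: "fmat => fmat" is "%f i j. - f i j" by simp

definition minus_fmat :: "fmat => fmat => fmat" where "minus_fmat A B = A + (- B)"

lift_definition scaleR_fmat :: "real => fmat => fmat" is "%c f i j. c * f i j"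
 by (metis mult_zero_right)

lemma entry_zero [simp]: "entry 0 i j = 0" by transfer simp
lemma entry_plus [simp]: "entry (A + B) i j = entry A i j + entry B i j" by transfer simp
lemma entry_uminus [simp]: "entry (- A) i j = - entry A i j" by transfer simp
lemma entry_minus [simp]: "entry (A - B) i j = entry A i j - entry B i j"
 by (simp add: minus_fmat_def)
lemma entry_scaleR [simp]: "entry (c *\<^sub>R A) i j = c * entry A i j" by transfer simp

instance
 by standard (simp_all add: fmat_eq_iff algebra_simps)

end

lemma entry_sum [simp]: "entry (\<Sum>x\<in>I. f x) i j = (\<Sum>x\<in>I. entry (f x) i j)"
 by (induction I rule: infinite_finite_induct) auto

lemma supp_in_zero [simp]: "supp_in n 0"
 and supp_in_plus: "supp_in n A ==> supp_in n B ==> supp_in n (A + B)"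
 and supp_in_scaleR: "supp_in n A ==> supp_in n (c *\<^sub>R A)"
 by (auto simp: supp_in_def)

instantiation fmat :: real_algebra
begin

lift_definition times_fmat :: "fmat => fmat => fmat" is
 "%f g i j. \<Sum>k | f i k ~= 0 & g k j ~= 0. f i k * g k j"
proof -
 fix f g :: "nat => nat => real"
 assume "EX n. ALL i j. n <= i | n <= j --> f i j = 0" "EX n. ALL i j. n <= i | n <= j --> g i j = 0"
 then obtain n m where "ALL i j. n <= i | n <= j --> f i j = 0" "ALL i j. m <= i | m <= j --> g i j = 0"
  by blast
 then show "EX n. ALL i j. n <= i | n <= j --> (\<Sum>k | f i k ~= 0 & g k j ~= 0. f i k * g k j) = 0"
  by (intro exI[of _ "max n m"]) (auto intro!: sum.neutral)
qed

text \<open>The product sums over the indices at which both factors are nonzero, so its definition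
  mentions no size. Any initial segment that covers these indices gives the same value, and each
  calculation picks the segment that suits it.\<close>

lemma entry_mult_gen:
 assumes "!!k. n <= k ==> entry A i k = 0 | entry B k j = 0"
 shows "entry (A * B) i j = (\<Sum>k<n. entry A i k * entry B k j)"
proof -
 have "entry (A * B) i j = (\<Sum>k | entry A i k ~= 0 & entry B k j ~= 0. entry A i k * entry B k j)"
  by transfer simp
 also have "... = (\<Sum>k<n. entry A i k * entry B k j)"
  using assms by (intro sum.mono_neutral_left) (auto simp: not_less[symmetric])
 finally show ?thesis .
qed

lemma entry_mult: "supp_in n A | supp_in n B ==> entry (A * B) i j = (\<Sum>k<n. entry A i k * entry B k j)"
 by (rule entry_mult_gen) (auto simp: supp_in_def)

lemma supp_in_mult: "supp_in n A ==> supp_in n B ==> supp_in n (A * B)"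
 by (auto simp: supp_in_def[of n "A * B"] entry_mult[of n]) (auto simp: supp_in_def)

instance
proof
 fix A B C :: fmat and c :: real
 show "A * B * C = A * (B * C)"
 proof (rule entry_eqI)
  fix i j
  obtain n where n: "supp_in n A" "supp_in n B" "supp_in n C" using supp_in_ex3 by blast
  show "entry (A * B * C) i j = entry (A * (B * C)) i j"
   by (simp add: entry_mult[of n] n supp_in_mult sum_distrib_left sum_distrib_right mult.assoc) (rule sum.swap)
 qed
 show "(A + B) * C = A * C + B * C"
 proof (rule entry_eqI)
  fix i j
  obtain n where n: "supp_in n C" using supp_in_ex by blast
  show "entry ((A + B) * C) i j = entry (A * C + B * C) i j"
   by (simp add: entry_mult[of n] n sum.distrib algebra_simps)
 qed
 show "A * (B + C) = A * B + A * C"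
 proof (rule entry_eqI)
  fix i j
  obtain n where n: "supp_in n A" using supp_in_ex by blast
  show "entry (A * (B + C)) i j = entry (A * B + A * C) i j"
   by (simp add: entry_mult[of n] n sum.distrib algebra_simps)
 qed
 obtain n where n: "supp_in n A" "supp_in n B" using supp_in_ex2 by blast
 show "c *\<^sub>R A * B = c *\<^sub>R (A * B)" "A * c *\<^sub>R B = c *\<^sub>R (A * B)"
  by (rule entry_eqI, simp add: entry_mult[of n] n sum_distrib_left algebra_simps)+
qed

end

instantiation fmat :: real_inner
begin

lift_definition inner_fmat :: "fmat => fmat => real" is
 "%f g. \<Sum>(i, j) | f i j ~= 0 & g i j ~= 0. f i j * g i j" .

definition norm_fmat :: "fmat => real" where "norm_fmat A = sqrt (inner A A)"
definition sgn_fmat :: "fmat => fmat" where "sgn_fmat A = inverse (norm A) *\<^sub>R A"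
definition dist_fmat :: "fmat => fmat => real" where "dist_fmat A B = norm (A - B)"
definition uniformity_fmat :: "(fmat \<times> fmat) filter" where
 "uniformity_fmat = (INF e\<in>{0<..}. principal {(x, y). dist x y < e})"
definition open_fmat :: "fmat set => bool" where
 "open_fmat S \<longleftrightarrow> (ALL x:S. \<forall>\<^sub>F (x', y) in uniformity. x' = x --> y : S)"

lemma inner_fmat_gen:
 assumes "!!i j. n <= i | m <= j ==> entry A i j = 0 | entry B i j = 0"
 shows "inner A B = (\<Sum>i<n. \<Sum>j<m. entry A i j * entry B i j)"
proof -
 have "inner A B = (\<Sum>(i, j) | entry A i j ~= 0 & entry B i j ~= 0. entry A i j * entry B i j)"
  by transfer simp
 also have "... = (\<Sum>(i, j)\<in>{..<n} \<times> {..<m}. entry A i j * entry B i j)"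
  using assms by (intro sum.mono_neutral_left) (auto simp: not_less[symmetric])
 finally show ?thesis by (simp add: sum.cartesian_product)
qed

lemma inner_fmat: "supp_in n A | supp_in n B ==> inner A B = (\<Sum>i<n. \<Sum>j<n. entry A i j * entry B i j)"
 by (rule inner_fmat_gen) (auto simp: supp_in_def)

instance
proof
 fix A B C :: fmat and c :: real and S :: "fmat set"
 show "dist A B = norm (A - B)" "sgn A = inverse (norm A) *\<^sub>R A" "norm A = sqrt (inner A A)"
  by (simp_all add: dist_fmat_def sgn_fmat_def norm_fmat_def)
 show "uniformity = (INF e\<in>{0<..}. principal {(x :: fmat, y). dist x y < e})"
  by (simp add: uniformity_fmat_def)
 show "open S \<longleftrightarrow> (ALL x:S. \<forall>\<^sub>F (x', y) in uniformity. x' = x --> y : S)"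
  by (simp add: open_fmat_def)
 obtain n where n: "supp_in n A" "supp_in n B" "supp_in n C" using supp_in_ex3 by blast
 show "inner A B = inner B A"
  by (simp add: inner_fmat[of n] n mult.commute)
 show "inner (A + B) C = inner A C + inner B C"
  by (simp add: inner_fmat[of n] n sum.distrib algebra_simps)
 show "inner (c *\<^sub>R A) B = c * inner A B"
  by (simp add: inner_fmat[of n] n sum_distrib_left mult.assoc)
 show "0 <= inner A A"
  by (simp add: inner_fmat[of n] n sum_nonneg)
 show "inner A A = 0 \<longleftrightarrow> A = 0"
 proof
  assume "inner A A = 0"
  then have "ALL i<n. ALL j<n. entry A i j = 0"
   by (simp add: inner_fmat[of n] n sum_nonneg_eq_0_iff sum_nonneg)
  then show "A = 0"
   using n(1) by (auto simp: fmat_eq_iff supp_in_def) (meson not_le)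
 qed (simp add: inner_fmat[of n])
qed

end

lemma norm_fmat_sq: "supp_in n A ==> (norm A)^2 = (\<Sum>i<n. \<Sum>j<n. (entry A i j)^2)"
 unfolding power2_norm_eq_inner by (simp add: inner_fmat power2_eq_square)

text \<open>Cauchy-Schwarz in the inner index of the product. The idempotents \<open>idm n\<close>
  have norm \<open>sqrt n\<close>, which is where the factors \<open>sqrt r\<close> in later bounds
  come from.\<close>

instance fmat :: real_normed_algebra
proof
 fix A B :: fmat
 obtain n where n: "supp_in n A" "supp_in n B" using supp_in_ex2 by blast
 have "(norm (A * B))^2 = (\<Sum>i<n. \<Sum>j<n. (\<Sum>k<n. entry A i k * entry B k j)^2)"
  by (simp add: norm_fmat_sq[of n] supp_in_mult n entry_mult[of n])
 also have "... <= (\<Sum>i<n. \<Sum>j<n. (\<Sum>k<n. (entry A i k)^2) * (\<Sum>k<n. (entry B k j)^2))"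
  by (intro sum_mono Cauchy_Schwarz_ineq_sum)
 also have "... = (\<Sum>i<n. \<Sum>k<n. (entry A i k)^2) * (\<Sum>j<n. \<Sum>k<n. (entry B k j)^2)"
  by (simp add: sum_product)
 also have "... = (norm A)^2 * (norm B)^2"
  using sum.swap[of "%k j. (entry B k j)^2" "{..<n}" "{..<n}"] by (simp add: norm_fmat_sq[of n] n)
 finally show "norm (A * B) <= norm A * norm B"
  unfolding power_mult_distrib[symmetric] by (rule power2_le_imp_le) simp
qed

lift_definition tp :: "fmat => fmat" is "%f i j. f j i" by blast

lemma entry_tp [simp]: "entry (tp A) i j = entry A j i" by transfer simp
lemma tp_tp [simp]: "tp (tp A) = A" by (simp add: fmat_eq_iff)
lemma tp_zero [simp]: "tp 0 = 0" by (simp add: fmat_eq_iff)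
lemma tp_plus: "tp (A + B) = tp A + tp B" by (simp add: fmat_eq_iff)
lemma tp_minus: "tp (A - B) = tp A - tp B" by (simp add: fmat_eq_iff)
lemma tp_uminus: "tp (- A) = - tp A" by (simp add: fmat_eq_iff)
lemma tp_scaleR: "tp (c *\<^sub>R A) = c *\<^sub>R tp A" by (simp add: fmat_eq_iff)
lemma supp_in_tp [simp]: "supp_in n (tp A) = supp_in n A" by (auto simp: supp_in_def)

lemma tp_mult: "tp (A * B) = tp B * tp A"
proof -
 obtain n where n: "supp_in n A" "supp_in n B" using supp_in_ex2 by blast
 show ?thesis by (simp add: fmat_eq_iff entry_mult[of n] n mult.commute)
qed

lemmas tp_simps = tp_plus tp_minus tp_uminus tp_scaleR tp_mult

lemma inner_tp: "inner (tp A) (tp B) = inner A B"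
proof -
 obtain n where n: "supp_in n A" "supp_in n B" using supp_in_ex2 by blast
 show ?thesis by (simp add: inner_fmat[of n] n) (rule sum.swap)
qed

lemma norm_tp [simp]: "norm (tp A) = norm A"
 by (simp add: norm_eq_sqrt_inner inner_tp)

lemma bounded_linear_tp: "bounded_linear tp"
 by (rule bounded_linear_intro[of _ 1]) (simp_all add: tp_simps)

lemma continuous_on_tp [continuous_intros]: "continuous_on S f ==> continuous_on S (%x. tp (f x))"
 by (rule bounded_linear.continuous_on[OF bounded_linear_tp])

text \<open>The inner product is the trace form, so \<open>tp A\<close> is the adjoint of
  multiplication by \<open>A\<close>. Together with its mirror image below this replaces all trace
  manipulations.\<close>

lemma inner_mult_left: "inner (A * B) C = inner B (tp A * C)"
proof -
 obtain n where n: "supp_in n A" "supp_in n B" "supp_in n C" using supp_in_ex3 by blast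
 have "inner (A * B) C = (\<Sum>i<n. \<Sum>j<n. \<Sum>k<n. entry A i k * entry B k j * entry C i j)"
  by (simp add: inner_fmat[of n] n entry_mult[of n] sum_distrib_right)
 also have "... = (\<Sum>j<n. \<Sum>i<n. \<Sum>k<n. entry A i k * entry B k j * entry C i j)"
  by (rule sum.swap)
 also have "... = (\<Sum>j<n. \<Sum>k<n. \<Sum>i<n. entry A i k * entry B k j * entry C i j)"
  by (rule sum.cong[OF refl]) (rule sum.swap)
 also have "... = (\<Sum>k<n. \<Sum>j<n. \<Sum>i<n. entry A i k * entry B k j * entry C i j)"
  by (rule sum.swap)
 also have "... = inner B (tp A * C)"
  by (simp add: inner_fmat[of n] n entry_mult[of n] sum_distrib_left mult_ac)
 finally show ?thesis .
qed

lemma inner_mult_right: "inner (A * B) C = inner A (C * tp B)"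
proof -
 have "inner (A * B) C = inner (tp B * tp A) (tp C)"
  by (metis inner_tp tp_mult)
 also have "... = inner A (C * tp B)"
  by (metis inner_mult_left inner_tp tp_mult tp_tp)
 finally show ?thesis .
qed

section \<open>Diagonal matrices, matrix units and columns\<close>

lift_definition dg :: "nat => (nat => real) => fmat" is
 "%n f i j. if i = j & i < n then f i else 0"
 by (metis leD)

abbreviation idm :: "nat => fmat" where "idm n \<equiv> dg n (%_. 1)"

text \<open>Matrix units. They also encode columns: a column vector is a matrix \<open>W\<close>
  with \<open>W * un 0 0 = W\<close>, and \<open>A * un j 0\<close> is column \<open>j\<close> of
  \<open>A\<close> moved to position 0. In the same spirit, \<open>idm n * A = A\<close> confines
  \<open>A\<close> to its first \<open>n\<close> rows.\<close>

lift_definition un :: "nat => nat => fmat" is "%a b i j. if i = a & j = b then 1 else 0"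
proof -
 fix a b :: nat
 show "EX n. ALL i j. n <= i | n <= j --> (if i = a & j = b then 1 else 0) = (0::real)"
  by (intro exI[of _ "Suc (max a b)"]) auto
qed

lemma entry_dg [simp]: "entry (dg n f) i j = (if i = j & i < n then f i else 0)"
 by transfer simp

lemma entry_un [simp]: "entry (un a b) i j = (if i = a & j = b then 1 else 0)"
 by transfer simp

lemma supp_in_dg [simp]: "supp_in n (dg n f)" by (auto simp: supp_in_def)

lemma dg_cong: "(!!i. i < n ==> f i = g i) ==> dg n f = dg n g" by (auto simp: fmat_eq_iff)

lemma tp_dg [simp]: "tp (dg n f) = dg n f" by (auto simp: fmat_eq_iff)

lemma tp_un [simp]: "tp (un a b) = un b a" by (auto simp: fmat_eq_iff)

lemma entry_dg_mult: "entry (dg n f * A) i j = (if i < n then f i * entry A i j else 0)"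
proof -
 have "(\<Sum>k<n. (if i = k then f i * entry A k j else 0)) = (if i < n then f i * entry A i j else 0)"
  by (simp add: sum.delta')
 then show ?thesis
  by (subst entry_mult[of n]) (auto simp: if_distrib[of "%x. x * _"] cong: if_cong)
qed

lemma entry_mult_dg: "entry (A * dg n f) i j = (if j < n then entry A i j * f j else 0)"
proof -
 have "entry (A * dg n f) i j = entry (tp (dg n f * tp A)) i j" by (simp add: tp_mult)
 then show ?thesis by (simp only: entry_tp entry_dg_mult) (simp add: mult.commute)
qed

lemma idm_supp: assumes "supp_in n A" shows "A * idm n = A" "idm n * A = A"
 using assms by (auto simp: fmat_eq_iff entry_mult_dg entry_dg_mult supp_in_def not_less)

lemma idm_mult_idm: "idm n * idm m = idm (min n m)"
 by (auto simp: fmat_eq_iff entry_mult_dg)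

lemma dg_mult: "dg n f * dg n g = dg n (%i. f i * g i)"
 by (auto simp: fmat_eq_iff entry_dg_mult)

lemma dg_mult_assoc: "dg n f * (dg n g * A) = dg n (%i. f i * g i) * A"
 by (metis dg_mult mult.assoc)

lemma entry_mult_un: "entry (A * un a b) i j = (if j = b then entry A i a else 0)"
proof -
 obtain n where n: "supp_in n A" using supp_in_ex by blast
 have n': "supp_in (max n (Suc a)) A" using n by (rule supp_in_mono) simp
 have "entry (A * un a b) i j = (\<Sum>k<max n (Suc a). entry A i k * (if k = a & j = b then 1 else 0))"
  by (simp add: entry_mult[of "max n (Suc a)"] n')
 also have "... = (\<Sum>k<max n (Suc a). if k = a then (if j = b then entry A i a else 0) else 0)"
  by (rule sum.cong) auto
 finally show ?thesis by (subst (asm) sum.delta) auto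
qed

lemma entry_un_mult: "entry (un a b * A) i j = (if i = a then entry A b j else 0)"
proof -
 have "entry (un a b * A) i j = entry (tp (tp A * un b a)) i j" by (simp add: tp_mult)
 then show ?thesis by (simp only: entry_tp entry_mult_un)
qed

lemma un_mult_un: "un a b * un c d = (if b = c then un a d else 0)"
 by (auto simp: fmat_eq_iff entry_mult_un)

lemma norm_un [simp]: "norm (un a b) = 1"
proof -
 have s: "supp_in (Suc (max a b)) (un a b)" by (auto simp: supp_in_def)
 have "(norm (un a b))^2 = (\<Sum>i<Suc (max a b). \<Sum>j<Suc (max a b). (if i = a then (if j = b then 1 else 0) else 0))"
  unfolding norm_fmat_sq[OF s] by (intro sum.cong) (auto simp: power2_eq_square)
 also have "... = (\<Sum>i<Suc (max a b). (if i = a then 1 else 0))"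
  by (intro sum.cong refl) (auto simp: sum.delta)
 also have "... = 1" by (subst sum.delta) auto
 finally show ?thesis by (metis norm_ge_zero one_power2 power2_eq_imp_eq zero_le_one)
qed

lemma dg_eq_sum: "dg n f = (\<Sum>i<n. f i *\<^sub>R un i i)"
 by (auto simp: fmat_eq_iff if_distrib[of "%x. _ * x"] sum.delta' cong: if_cong intro!: sum.neutral[symmetric])

lemma fmat_eq_sum:
 assumes "idm n * A = A" "A * idm m = A"
 shows "A = (\<Sum>i<n. \<Sum>j<m. entry A i j *\<^sub>R un i j)"
proof (rule entry_eqI)
 fix a b
 have z: "entry A a b = 0" if "~ (a < n & b < m)"
  using arg_cong[OF assms(1), of "%A. entry A a b"] arg_cong[OF assms(2), of "%A. entry A a b"] that
  by (auto simp: entry_dg_mult entry_mult_dg split: if_splits)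
 have "entry (\<Sum>i<n. \<Sum>j<m. entry A i j *\<^sub>R un i j) a b
   = (\<Sum>i<n. \<Sum>j<m. if j = b then (if i = a then entry A a b else 0) else 0)"
  unfolding entry_sum entry_scaleR entry_un by (intro sum.cong) auto
 also have "... = (\<Sum>i<n. if i = a then (if b < m then entry A a b else 0) else 0)"
  by (intro sum.cong refl) (auto simp: sum.delta)
 also have "... = entry A a b"
  using z by (auto simp: sum.delta)
 finally show "entry A a b = entry (\<Sum>i<n. \<Sum>j<m. entry A i j *\<^sub>R un i j) a b" ..
qed

lemma norm_sq_sum_cols:
 assumes "A * idm m = A"
 shows "(norm A)^2 = (\<Sum>j<m. (norm (A * un j 0))^2)"
proof -
 obtain n where "supp_in n A" using supp_in_ex by blast
 then have n: "supp_in (Suc n) A" using supp_in_mono by simp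
 have z: "entry A i j = 0" if "m <= j" for i j
  using arg_cong[OF assms, of "%A. entry A i j"] that by (auto simp: entry_mult_dg split: if_splits)
 have "(norm (A * un j 0))^2 = (\<Sum>i<Suc n. (entry A i j)^2)" for j
 proof -
  have "(norm (A * un j 0))^2 = (\<Sum>i<Suc n. \<Sum>k<Suc 0. (entry A i j)^2)"
   unfolding power2_norm_eq_inner
   by (subst inner_fmat_gen[of "Suc n" "Suc 0"])
   (use n in "auto simp: entry_mult_un power2_eq_square supp_in_def")
  then show ?thesis by simp
 qed
 moreover have "(norm A)^2 = (\<Sum>i<Suc n. \<Sum>j<m. (entry A i j)^2)"
  unfolding power2_norm_eq_inner
  by (subst inner_fmat_gen[of "Suc n" m]) (use n z in "auto simp: power2_eq_square supp_in_def")
 ultimately show ?thesis by (simp only: sum.swap[of "%i j. (entry A i j)^2" "{..<m}"])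
qed

text \<open>Squared Frobenius norms add up over columns, so an inequality between norms that holds
  for single columns holds for all matrices. This is how vector estimates reach the predicate
  \<open>opb\<close>.\<close>

lemma col_bound:
 assumes "!!W. W * un 0 0 = W ==> norm (A * (C * W)) <= c * norm (B * (C * W))" and "0 <= c"
 shows "norm (A * (C * W)) <= c * norm (B * (C * W))"
proof -
 obtain n where "supp_in n W" using supp_in_ex by blast
 then have W: "W * idm n = W" by (rule idm_supp)
 have "(norm (A * (C * W)))^2 = (\<Sum>j<n. (norm (A * (C * (W * un j 0))))^2)"
  using norm_sq_sum_cols[of "A * (C * W)" n] by (simp add: mult.assoc W)
 also have "... <= (\<Sum>j<n. (c * norm (B * (C * (W * un j 0))))^2)"
  by (intro sum_mono power_mono assms) (auto simp: mult.assoc un_mult_un)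
 also have "... = c^2 * (\<Sum>j<n. (norm (B * (C * (W * un j 0))))^2)"
  by (simp add: power_mult_distrib sum_distrib_left)
 also have "... = (c * norm (B * (C * W)))^2"
  using norm_sq_sum_cols[of "B * (C * W)" n] by (simp add: mult.assoc W power_mult_distrib)
 finally show ?thesis
  by (rule power2_le_imp_le) (use assms(2) in simp)
qed

text \<open>The spectral norm of \<open>A\<close> is at most \<open>a\<close>. Test matrices with
  many columns give the same condition as test vectors, and a predicate avoids suprema
  altogether.\<close>

definition opb :: "fmat => real => bool" where
 "opb A a \<longleftrightarrow> (ALL W. norm (A * W) <= a * norm W)"

lemma opbD: "opb A a ==> norm (A * W) <= a * norm W"
 by (simp add: opb_def)

lemma opb_nonneg: "opb A a ==> 0 <= a"
 by (metis mult.right_neutral norm_ge_zero norm_un opb_def order_trans)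

lemma opb_mono: "opb A a ==> a <= b ==> opb A b"
 unfolding opb_def by (meson mult_right_mono norm_ge_zero order_trans)

lemma opb_norm: "opb A (norm A)"
 by (simp add: opb_def norm_mult_ineq)

text \<open>The square of \<open>norm (tp A * W)\<close> equals
  \<open>inner W (A * (tp A * W))\<close>; Cauchy-Schwarz and the bound for \<open>A\<close> leave
  one factor \<open>norm (tp A * W)\<close> to cancel.\<close>

lemma opb_tp: assumes "opb A a" shows "opb (tp A) a"
 unfolding opb_def
proof
 fix W
 have "(norm (tp A * W))^2 = inner W (A * (tp A * W))"
  unfolding power2_norm_eq_inner by (simp add: inner_mult_left)
 also have "... <= norm W * norm (A * (tp A * W))"
  by (rule norm_cauchy_schwarz)
 also have "... <= norm W * (a * norm (tp A * W))"
  by (intro mult_left_mono opbD assms) simp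
 finally have "norm (tp A * W) * norm (tp A * W) <= (a * norm W) * norm (tp A * W)"
  by (simp add: power2_eq_square mult_ac)
 then show "norm (tp A * W) <= a * norm W"
  using opb_nonneg[OF assms] by (cases "norm (tp A * W) = 0") auto
qed

lemma opbD_left: assumes "opb A a" shows "norm (W * A) <= a * norm W"
 using opbD[OF opb_tp[OF assms], of "tp W"] by (metis norm_tp tp_mult)

lemma opb_plus: "opb A a ==> opb B b ==> opb (A + B) (a + b)"
 unfolding opb_def distrib_right by (meson add_mono norm_triangle_ineq order_trans)

lemma opb_minus: "opb A a ==> opb B b ==> opb (A - B) (a + b)"
 unfolding opb_def distrib_right left_diff_distrib by (meson add_mono norm_triangle_ineq4 order_trans)

lemma opb_mult: assumes "opb A a" "opb B b" shows "opb (A * B) (a * b)"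
 unfolding opb_def
proof
 fix W
 have "norm (A * (B * W)) <= a * norm (B * W)" using assms(1) by (rule opbD)
 also have "... <= a * (b * norm W)"
  by (intro mult_left_mono opbD assms opb_nonneg[OF assms(1)])
 finally show "norm (A * B * W) <= a * b * norm W" by (simp add: mult.assoc)
qed

lemma opb_scaleR: "opb A a ==> opb (c *\<^sub>R A) (\<bar>c\<bar> * a)"
 unfolding opb_def by (simp add: mult.assoc mult_left_mono)

lemma opb_proj: assumes "tp P = P" "P * P = P" shows "opb P 1"
 unfolding opb_def
proof
 fix W
 have "(norm (P * W))^2 = inner W (P * W)"
  unfolding power2_norm_eq_inner by (simp add: inner_mult_left assms mult.assoc[symmetric])
 also have "... <= norm W * norm (P * W)" by (rule norm_cauchy_schwarz)
 finally show "norm (P * W) <= 1 * norm W"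
  by (cases "norm (P * W) = 0") (auto simp: power2_eq_square)
qed

lemma opb_dg: assumes "!!i. i < n ==> \<bar>f i\<bar> <= c" "0 <= c" shows "opb (dg n f) c"
 unfolding opb_def
proof
 fix W
 obtain k where "supp_in k W" using supp_in_ex by blast
 then have k: "supp_in (max k n) W" "supp_in (max k n) (dg n f)" by (auto intro: supp_in_mono[OF supp_in_dg] supp_in_mono)
 have "(norm (dg n f * W))^2 <= (\<Sum>i<max k n. \<Sum>j<max k n. (c * entry W i j)^2)"
  unfolding norm_fmat_sq[OF supp_in_mult[OF k(2,1)]] entry_dg_mult
 proof (intro sum_mono)
  fix i j show "(if i < n then f i * entry W i j else 0)^2 <= (c * entry W i j)^2"
   using assms(1)[of i] by (auto simp: power_mult_distrib intro!: mult_right_mono power2_le_iff_abs_le[THEN iffD2] assms(2))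
 qed
 also have "... = (c * norm W)^2"
  unfolding power_mult_distrib norm_fmat_sq[OF k(1)] sum_distrib_left ..
 finally show "norm (dg n f * W) <= c * norm W"
  by (rule power2_le_imp_le) (rule mult_nonneg_nonneg[OF assms(2) norm_ge_zero])
qed

lemma dg_lower: assumes "!!i. i < n ==> c <= \<bar>f i\<bar>" "0 <= c" shows "c * norm (idm n * W) <= norm (dg n f * W)"
proof -
 obtain k where "supp_in k W" using supp_in_ex by blast
 then have k: "supp_in (max k n) W" "supp_in (max k n) (dg n f)" "supp_in (max k n) (idm n)"
  by (auto intro: supp_in_mono[OF supp_in_dg] supp_in_mono)
 have "(c * norm (idm n * W))^2 <= (norm (dg n f * W))^2"
  unfolding power_mult_distrib norm_fmat_sq[OF supp_in_mult[OF k(2,1)]]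
   norm_fmat_sq[OF supp_in_mult[OF k(3,1)]] entry_dg_mult sum_distrib_left
 proof (intro sum_mono)
  fix i j show "c^2 * (if i < n then 1 * entry W i j else 0)^2 <= (if i < n then f i * entry W i j else 0)^2"
   using assms(1)[of i] assms(2)
   by (auto simp: power_mult_distrib intro!: mult_right_mono abs_le_square_iff[THEN iffD1])
 qed
 then show ?thesis by (rule power2_le_imp_le) simp
qed

lemma norm_idm: "norm (idm n) = sqrt (real n)"
proof -
 have "(norm (idm n))^2 = (\<Sum>i<n. \<Sum>j<n. if j = i then 1 else 0)"
  unfolding norm_fmat_sq[OF supp_in_dg] by (intro sum.cong refl) auto
 also have "... = real n" by (simp add: sum.delta)
 finally show ?thesis by (metis norm_ge_zero real_sqrt_unique)
qed

text \<open>Orthonormality already forces all columns beyond the first \<open>n\<close> to vanish: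
  the squared norm of \<open>U * idm n - U\<close> expands into inner products that cancel.\<close>

lemma norm_orthonormal: assumes "tp U * U = idm n" shows "norm U = sqrt (real n)" "U * idm n = U"
proof -
 obtain k where "supp_in k U" using supp_in_ex by blast
 then have U: "U * idm (max k n) = U" by (intro idm_supp supp_in_mono[OF _ max.cobounded1])
 have 1: "inner U (U * A) = inner (idm n) A" if "idm (max k n) * A = A" for A
 proof -
  have "inner U (U * A) = inner (U * idm (max k n)) (U * A)" by (simp add: U)
  also have "... = inner (idm (max k n)) (idm n * A)"
   by (simp only: inner_mult_left assms[symmetric] mult.assoc)
  also have "... = inner (idm n * idm (max k n)) A"
   by (simp add: inner_mult_left)
  finally show ?thesis by (simp add: idm_mult_idm)
 qed
 have n: "idm (max k n) * idm n = idm n" "idm n * idm (max k n) = idm n" by (simp_all add: idm_mult_idm)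
 have a: "inner U U = inner (idm n) (idm n)"
  using 1[of "idm (max k n)"] U n by (simp add: dg_mult inner_mult_left[of "idm n" "idm (max k n)", simplified n])
 have b: "inner U (U * idm n) = inner (idm n) (idm n)" using 1[OF n(1)] .
 have c: "inner (U * idm n) (U * idm n) = inner (idm n) (idm n)"
  by (simp add: inner_mult_left mult.assoc[symmetric] assms dg_mult)
 have "(norm (U * idm n - U))^2 = 0"
  unfolding power2_norm_eq_inner
  by (simp add: inner_diff_left inner_diff_right a b c inner_commute[of "U * idm n" U])
 then show "U * idm n = U" by simp
 show "norm U = sqrt (real n)" using a by (simp add: norm_eq_sqrt_inner norm_idm[unfolded norm_eq_sqrt_inner])
qed

subsection \<open>Separability and compactness\<close>

lemma entry_le_norm: "\<bar>entry A i j\<bar> <= norm A"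
proof -
 have "norm (un i i * (A * un j j)) <= 1 * (norm A * 1)"
  using norm_mult_ineq[of "un i i" "A * un j j"] norm_mult_ineq[of A "un j j"] by simp
 moreover have "un i i * (A * un j j) = entry A i j *\<^sub>R un i j"
  by (auto simp: fmat_eq_iff entry_mult_un entry_un_mult)
 ultimately show ?thesis by simp
qed

lemma countable_dense_fmat: "EX D :: fmat set. countable D & (ALL A. ALL e>0. EX B:D. norm (A - B) < e)"
proof -
 define D where "D = (%(n, l). \<Sum>i<n. \<Sum>j<n. real_of_rat (l ! (i * n + j)) *\<^sub>R un i j) ` (UNIV :: (nat \<times> rat list) set)"
 have "countable D" unfolding D_def by (intro countable_image) auto
 moreover have "EX B:D. norm (A - B) < e" if "e > 0" for A e
 proof -
  obtain n where n: "supp_in n A" using supp_in_ex by blast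
  \<comment> \<open>Errors below \<open>e'\<close> in all n * n entries add up to at most e / 2; the
    summand 1 keeps the quotient meaningful for n = 0.\<close>
  define e' where "e' = e / (2 * (real n * real n + 1))"
  have e': "e' > 0" using that by (simp add: e'_def add_nonneg_pos)
  have "EX q. \<bar>entry A i j - real_of_rat q\<bar> < e'" for i j
  proof -
   obtain q where "entry A i j - e' < real_of_rat q" "real_of_rat q < entry A i j + e'"
   using of_rat_dense[of "entry A i j - e'" "entry A i j + e'"] e' by auto
   then show ?thesis by (intro exI[of _ q]) (simp add: abs_less_iff)
  qed
  then obtain q where q: "!!i j. \<bar>entry A i j - real_of_rat (q i j)\<bar> < e'" by metis
  define l where "l = map (%k. q (k div n) (k mod n)) [0..<n * n]"
  have l: "l ! (i * n + j) = q i j" if "i < n" "j < n" for i j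
  proof -
   have "i * n + j < n * n"
   using that mult_le_mono1[of "Suc i" n n] by simp
   then show ?thesis using that by (simp add: l_def)
  qed
  define B where "B = (\<Sum>i<n. \<Sum>j<n. real_of_rat (l ! (i * n + j)) *\<^sub>R un i j)"
  have "B : D" unfolding D_def B_def by (intro image_eqI[of _ _ "(n, l)"]) auto
  have "A - B = (\<Sum>i<n. \<Sum>j<n. (entry A i j - real_of_rat (q i j)) *\<^sub>R un i j)"
   unfolding B_def using fmat_eq_sum[OF idm_supp(2)[OF n] idm_supp(1)[OF n]]
   by (simp add: l scaleR_left_diff_distrib sum_subtractf)
  then have "norm (A - B) <= (\<Sum>i<n. \<Sum>j<n. norm ((entry A i j - real_of_rat (q i j)) *\<^sub>R un i j))"
   by (auto intro!: sum_norm_le)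
  also have "... <= (\<Sum>i<n. \<Sum>j<n. e')"
   by (intro sum_mono) (simp add: q less_imp_le)
  also have "... = (real n * real n) * e'" by simp
  also have "... <= (real n * real n + 1) * e'" using e' by simp
  also have "... = e / 2"
  proof -
   have "real n * real n + 1 ~= 0" by (metis add_nonneg_pos less_numeral_extra(1) less_numeral_extra(3) mult_nonneg_nonneg of_nat_0_le_iff)
   then show ?thesis unfolding e'_def by (simp add: field_simps)
  qed
  also have "... < e" using that by simp
  finally show ?thesis using \<open>B : D\<close> by blast
 qed
 ultimately show ?thesis by blast
qed

text \<open>Needed for sums and products of measurable matrix-valued maps to be Borel measurable.
  The basis consists of the balls with rational radius around the countable dense set.\<close>

instance fmat :: second_countable_topology
proof
 obtain D :: "fmat set" where D: "countable D" "!!A e. e > 0 ==> EX B:D. norm (A - B) < e"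
  using countable_dense_fmat by blast
 define Bs where "Bs = (%(B, q). ball B (real_of_rat q)) ` (D \<times> UNIV)"
 have "countable Bs" unfolding Bs_def using D(1) by (intro countable_image) auto
 moreover have "topological_basis Bs"
 proof (rule topological_basisI)
  fix O' and x :: fmat assume "open O'" "x : O'"
  then obtain e where e: "e > 0" "ball x e <= O'" by (meson openE)
  obtain q where q: "0 < real_of_rat q" "real_of_rat q < e / 2"
   using of_rat_dense[of 0 "e/2"] e by auto
  obtain B where B: "B : D" "norm (x - B) < real_of_rat q" using D(2) q by blast
  have "ball B (real_of_rat q) <= O'"
  proof
   fix y assume "y : ball B (real_of_rat q)"
   then have "dist x y < e" using B q dist_triangle[of x y B] by (simp add: dist_norm)
   then show "y : O'" using e by auto
  qed
  then show "EX B':Bs. x : B' & B' <= O'"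
   unfolding Bs_def using B by (intro bexI[of _ "ball B (real_of_rat q)"]) (auto simp: dist_norm norm_minus_commute)
 qed (auto simp: Bs_def)
 ultimately show "EX B::fmat set set. countable B & open = generate_topology B"
  by (meson topological_basis_imp_subbasis)
qed

lemma borel_measurable_tp [measurable]: "tp : borel_measurable borel"
 by (intro borel_measurable_continuous_onI continuous_on_tp continuous_on_id)

text \<open>The space of all finitely supported matrices has infinite dimension, so closed balls are
  compact only at a fixed size. There they are closed subsets of a continuous image of a Tychonoff
  cube.\<close>

lemma compact_fmat_cball: "compact {A. idm n * A = A & A * idm m = A & norm A <= c}"
proof -
 define h where "h = (%f :: nat \<times> nat => real. \<Sum>i<n. \<Sum>j<m. f (i, j) *\<^sub>R un i j)"
 define K where "K = PiE (UNIV :: (nat \<times> nat) set) (%_. {-c..c})"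
 have "continuous_on UNIV h"
  unfolding h_def by (intro continuous_intros continuous_on_product_coordinates)
 then have "continuous_on K h" by (rule continuous_on_subset) simp
 moreover have "compact K"
  unfolding K_def
  using compactin_PiE[of "%_ :: nat \<times> nat. euclideanreal" UNIV "%_. {-c..c}"]
  by (simp add: euclidean_product_topology)
 ultimately have "compact (h ` K)" by (rule compact_continuous_image)
 moreover have "closed {A. idm n * A = A & A * idm m = A & norm A <= c}"
  by (intro closed_Collect_conj closed_Collect_eq closed_Collect_le continuous_intros)
 moreover have "{A. idm n * A = A & A * idm m = A & norm A <= c} <= h ` K"
 proof
  fix A assume A: "A : {A. idm n * A = A & A * idm m = A & norm A <= c}"
  then have "A = h (%(i, j). entry A i j)"
   unfolding h_def using fmat_eq_sum[of n A m] by simp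
  moreover have "(%(i, j). entry A i j) : K"
  proof -
   have "- c <= entry A i j & entry A i j <= c" for i j
   using A entry_le_norm[of A i j] by auto
   then show ?thesis unfolding K_def by auto
  qed
  ultimately show "A : h ` K" by blast
 qed
 moreover have "compact (h ` K \<inter> {A. idm n * A = A & A * idm m = A & norm A <= c})"
  by (rule compact_Int_closed) fact+
 ultimately show ?thesis by (simp only: Int_absorb1)
qed

lemma compact_fmat_sub:
 assumes "closed S" and S: "S <= {A. idm n * A = A & A * idm m = A & norm A <= c}"
 shows "compact S"
proof -
 have "compact ({A. idm n * A = A & A * idm m = A & norm A <= c} \<inter> S)"
  by (rule compact_Int_closed[OF compact_fmat_cball assms(1)])
 then show ?thesis using S by (simp only: Int_absorb1)
qed

text \<open>Failure of the bound is an open condition on the test matrix and would therefore occur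
  on the dense set. The quantifier over test matrices becomes countable, which makes spectral norm
  events measurable.\<close>

lemma opb_dense:
 assumes "!!A e. e > 0 ==> EX B:D. norm (A - B) < e" and "!!W. W : D ==> norm (A * W) <= a * norm W"
 shows "opb A a"
proof (rule ccontr)
 assume "~ opb A a"
 then obtain W where W: "norm (A * W) - a * norm W > 0" unfolding opb_def by (auto simp: not_le)
 have "open {W. norm (A * W) - a * norm W > 0}"
  by (intro open_Collect_less continuous_intros)
 then obtain e where e: "e > 0" "ball W e <= {W. norm (A * W) - a * norm W > 0}"
  using W openE[of "{W. norm (A * W) - a * norm W > 0}" W] by blast
 obtain B where B: "B : D" "norm (W - B) < e" using assms(1) e(1) by blast
 then have "B : ball W e" by (simp add: dist_norm)
 then show False using e(2) assms(2)[OF B(1)] by auto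
qed

lemma pred_opb_measurable:
 assumes A: "A : borel_measurable M"
 shows "{\<omega> : space M. opb (A \<omega>) a} : sets M"
proof -
 obtain D :: "fmat set" where D: "countable D" "!!A e. e > 0 ==> EX B:D. norm (A - B) < e"
  using countable_dense_fmat by blast
 have eq: "{\<omega> : space M. opb (A \<omega>) a} = {\<omega> : space M. ALL W:D. norm (A \<omega> * W) <= a * norm W}"
  using opb_dense[OF D(2)] by (auto simp: opb_def)
 show ?thesis unfolding eq using D(1) A by measurable
qed

subsection \<open>Homogeneous linear systems and singular values\<close>

lemma kernel_nontrivial:
 fixes f :: "nat => nat => real"
 assumes "m < n"
 shows "EX x. (EX j<n. x j ~= 0) & (ALL j>=n. x j = 0) & (ALL i<m. (\<Sum>j<n. f i j * x j) = 0)"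
proof -
 define A where "A = Matrix.mat n n (%(i, j). if i < m then f i j else 0)"
 have A: "A : carrier_mat n n" by (simp add: A_def)
 \<comment> \<open>The square padding of the system has a zero row \<open>m\<close>; scaling that
   row by 0 changes nothing, but multiplies the determinant by 0.\<close>
 have "Determinant.det A = 0"
 proof -
  have "multrow m 0 A = A"
   by (rule eq_matI) (use A assms in "auto simp: A_def")
  then show ?thesis using det_multrow[of m n A 0] A assms by simp
 qed
 then obtain v where v: "v : carrier_vec n" "v ~= 0\<^sub>v n" "A *\<^sub>v v = 0\<^sub>v n"
  using det_0_iff_vec_prod_zero[OF A] by blast
 define x where "x = (%j. if j < n then v $ j else 0)"
 have "EX j<n. x j ~= 0"
 proof (rule ccontr)
  assume "~ (EX j<n. x j ~= 0)"
  then have "v = 0\<^sub>v n" using v(1) by (intro eq_vecI) (auto simp: x_def)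
  then show False using v(2) by simp
 qed
 moreover have "(\<Sum>j<n. f i j * x j) = 0" if "i < m" for i
 proof -
  have "(A *\<^sub>v v) $ i = (\<Sum>j<n. f i j * x j)"
   using that assms v(1) by (simp add: A_def scalar_prod_def x_def lessThan_atLeast0)
  then show ?thesis using v(3) that assms by simp
 qed
 ultimately show ?thesis by (intro exI[of _ x]) (auto simp: x_def)
qed

lemma kernel_col:
 assumes "m < n" "idm m * A = A"
 shows "EX c. c ~= 0 & idm n * c = c & c * un 0 0 = c & A * c = 0"
proof -
 obtain x where x: "EX j<n. x j ~= 0" "ALL j>=n. x j = 0" "ALL i<m. (\<Sum>j<n. entry A i j * x j) = 0"
  using kernel_nontrivial[OF assms(1), of "entry A"] by blast
 define c where "c = (\<Sum>j<n. x j *\<^sub>R un j 0)"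
 have ec: "entry c i k = (if k = 0 then x i else 0)" for i k
 proof -
  have "entry c i k = (\<Sum>j<n. if j = i then (if k = 0 then x i else 0) else 0)"
   unfolding c_def entry_sum entry_scaleR entry_un by (intro sum.cong) auto
  also have "... = (if k = 0 then x i else 0)"
   using x(2) by (subst sum.delta) (auto simp: not_less)
  finally show ?thesis .
 qed
 have "A * c = 0"
 proof (rule entry_eqI)
  fix i k
  have 1: "entry (A * c) i k = (\<Sum>j<n. entry A i j * entry c j k)"
   by (rule entry_mult_gen) (use x(2) in "auto simp: ec")
  show "entry (A * c) i k = entry 0 i k"
  proof (cases "i < m")
   case True then show ?thesis unfolding 1 using x(3) by (cases "k = 0") (simp_all add: ec)
  next
   case False
   then have "entry A i j = 0" for j using arg_cong[OF assms(2), of "%A. entry A i j"] by (auto simp: entry_dg_mult)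
   then show ?thesis by (simp add: 1)
  qed
 qed
 moreover have "c ~= 0" using x(1) by (auto simp: fmat_eq_iff ec)
 moreover have "idm n * c = c" "c * un 0 0 = c"
  using x(2) by (auto simp: fmat_eq_iff entry_dg_mult entry_mult_un ec not_less)
 ultimately show ?thesis by blast
qed

text \<open>Leading right singular vectors \<^term>\<open>V\<close> and singular values \<^term>\<open>y\<close> of \<^term>\<open>A\<close>, where
 \<^term>\<open>t\<close> is the number of columns of \<^term>\<open>A\<close>.\<close>
definition rsvd :: "nat => nat => fmat => fmat => (nat => real) => bool" where
 "rsvd t k A V y \<longleftrightarrow> idm t * V = V & tp V * V = idm k & tp A * (A * V) = V * dg k (%j. (y j)^2) &
   (ALL j<k. 0 <= y j) & (ALL i j. i <= j --> j < k --> y j <= y i) &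
   (ALL j<k. ALL W. idm t * W = W --> W * un 0 0 = W --> idm j * (tp V * W) = 0 --> norm (A * W) <= y j * norm W)"

lemma assoc_eq: "A * B = C ==> A * (B * x) = C * (x :: fmat)"
 by (simp add: mult.assoc[symmetric])

lemma idm_Suc: "idm (Suc k) = idm k + un k k"
 by (auto simp: fmat_eq_iff)

lemma dg_Suc: "dg (Suc k) f = dg k f + f k *\<^sub>R un k k"
 by (auto simp: fmat_eq_iff)

lemma un_idm: "un a b * dg k f = (if b < k then f b *\<^sub>R un a b else 0)"
 "dg k f * un a b = (if a < k then f a *\<^sub>R un a b else 0)"
 by (auto simp: fmat_eq_iff entry_mult_dg entry_dg_mult)

lemma un_un_assoc: "un a b * (un c d * A) = (if b = c then un a d * A else 0)"
 by (simp add: mult.assoc[symmetric] un_mult_un)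

lemma col_tp_mult: assumes "w * un 0 0 = w" "v * un 0 0 = v" shows "tp w * v = inner w v *\<^sub>R un 0 0"
proof -
 have e: "entry (tp w * v) i j = 0" if "~ (i = 0 & j = 0)" for i j
 proof -
  have "tp w * v = un 0 0 * ((tp w * v) * un 0 0)"
   using assms by (metis mult.assoc tp_mult tp_un)
  then show ?thesis using that by (metis entry_mult_un entry_un_mult)
 qed
 obtain n where "supp_in n w" "supp_in n v" using supp_in_ex2 by blast
 then have n: "supp_in (Suc n) w" "supp_in (Suc n) v" using supp_in_mono by auto
 have z: "entry w i j = 0" if "j ~= 0" for i j
  using arg_cong[OF assms(1), of "%A. entry A i j"] that by (simp add: entry_mult_un)
 have "inner w v = (\<Sum>i<Suc n. \<Sum>j<Suc 0. entry w i j * entry v i j)"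
  by (rule inner_fmat_gen) (use n z in "auto simp: supp_in_def")
 then have "entry (tp w * v) 0 0 = inner w v"
  by (subst entry_mult[of "Suc n"]) (simp_all add: n)
 then show ?thesis using e by (auto simp: fmat_eq_iff)
qed

lemma append_col:
 assumes V: "tp V * V = idm k" and w: "w * un 0 0 = w" "norm w = 1" "tp V * w = 0"
 shows "tp (V + w * un 0 k) * (V + w * un 0 k) = idm (Suc k)"
proof -
 have Vk: "V * idm k = V" by (rule norm_orthonormal(2)[OF V])
 have ww: "tp w * w = un 0 0" using col_tp_mult[OF w(1) w(1)] w(2) by (simp add: norm_eq_1)
 have wV: "tp w * V = 0" using arg_cong[OF w(3), of tp] by (simp add: tp_mult)
 have a: "un k 0 * (tp w * V) = 0" "un k 0 * (tp w * (w * un 0 k)) = un k k" "tp V * (w * un 0 k) = 0"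
  using wV ww w(3) by (simp_all add: mult.assoc[symmetric] un_mult_un)
 show ?thesis
  by (simp add: tp_simps distrib_left distrib_right V mult.assoc a idm_Suc)
qed

text \<open>First variation: the quadratic form \<open>q\<close> is nonnegative on the complement of
  \<open>V\<close> and vanishes at the maximiser \<open>w\<close>. Moving from \<open>w\<close> in
  the direction of the residual \<open>z\<close> has linear term \<open>- 2 * inner z z\<close>, so
  \<open>z\<close> must be zero.\<close>

lemma first_order_eigen:
 assumes A: "A * idm t = A" and V: "tp A * (A * V) = V * dg k f"
  and w: "idm t * w = w" "w * un 0 0 = w" "tp V * w = 0" "norm w = 1"
  and mx: "!!x. idm t * x = x ==> x * un 0 0 = x ==> tp V * x = 0 ==> norm (A * x) <= norm (A * w) * norm x"
 shows "tp A * (A * w) = (norm (A * w))^2 *\<^sub>R w"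
proof -
 define s where "s = (norm (A * w))^2"
 define z where "z = tp A * (A * w) - s *\<^sub>R w"
 define q where "q = (%x. s * inner x x - inner (A * x) (A * x))"
 have z1: "idm t * z = z"
 proof -
  have "idm t * tp A = tp A" using arg_cong[OF A, of tp] by (simp add: tp_mult)
  then show ?thesis by (simp add: z_def right_diff_distrib w mult.assoc[symmetric])
 qed
 have z2: "z * un 0 0 = z" by (simp add: z_def left_diff_distrib mult.assoc w)
 have z3: "tp V * z = 0"
 proof -
  have "tp V * (tp A * (A * w)) = tp (tp A * (A * V)) * w" by (simp add: tp_mult mult.assoc)
  also have "... = 0" by (simp add: V tp_mult mult.assoc w)
  finally show ?thesis by (simp add: z_def right_diff_distrib w)
 qed
 have qnn: "q x >= 0" if "idm t * x = x" "x * un 0 0 = x" "tp V * x = 0" for x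
 proof -
  have "(norm (A * x))^2 <= (norm (A * w) * norm x)^2"
   by (intro power_mono mx that) simp
  then show ?thesis by (simp add: q_def s_def power_mult_distrib power2_norm_eq_inner)
 qed
 have qw: "q w = 0" using w(4) by (simp add: q_def s_def norm_eq_1 power2_norm_eq_inner)
 have wz: "s * inner w z - inner (A * w) (A * z) = - inner z z"
 proof -
  have "inner (A * w) (A * z) = inner z (tp A * (A * w))"
   by (metis inner_commute inner_mult_left)
  then show ?thesis by (simp add: z_def inner_diff_left inner_diff_right inner_commute algebra_simps)
 qed
 \<comment> \<open>For this step length the quadratic term \<open>u * q z\<close> is at most
   \<open>inner z z\<close> and cannot compensate the linear one; the summand 1 covers
   \<open>q z = 0\<close>.\<close>
 define u where "u = inner z z / (q z + 1)"
 have qz: "q z >= 0" by (rule qnn[OF z1 z2 z3])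
 have "0 <= q (w + u *\<^sub>R z)"
  by (rule qnn) (simp_all add: distrib_left distrib_right w z1 z2 z3)
 also have "q (w + u *\<^sub>R z) = q w + 2 * u * (s * inner w z - inner (A * w) (A * z)) + u * u * q z"
  by (simp add: q_def distrib_left inner_add_left inner_add_right inner_commute algebra_simps)
 also have "... = u * (u * q z - 2 * inner z z)"
  by (simp add: qw wz algebra_simps)
 finally have "0 <= u * (u * q z - 2 * inner z z)" .
 moreover have "u * q z <= inner z z"
  using qz by (simp add: u_def field_simps)
 ultimately have "inner z z = 0"
 proof -
  assume a: "0 <= u * (u * q z - 2 * inner z z)" and b: "u * q z <= inner z z"
  show ?thesis
  proof (rule ccontr)
   assume "inner z z ~= 0"
   then have p: "inner z z > 0" by (simp add: less_le)
   then have "u > 0" using qz by (simp add: u_def)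
   then have "u * q z - 2 * inner z z >= 0" using a by (simp add: zero_le_mult_iff)
   then show False using b p by linarith
  qed
 qed
 then show ?thesis by (simp add: z_def s_def)
qed

text \<open>The next right singular vector maximises \<open>norm (A * w)\<close> over the unit
  sphere in the complement of those already found. The sphere is compact, and nonempty because fewer
  than \<open>t\<close> vectors have been used.\<close>

lemma rsvd_exists:
 assumes A: "A * idm t = A" and k: "k <= t"
 shows "EX V y. rsvd t k A V y"
 using k
proof (induction k)
 case 0
 have "rsvd t 0 A 0 (%_. 0)" by (simp add: rsvd_def) (auto simp: fmat_eq_iff)
 then show ?case by blast
next
 case (Suc k)
 then obtain V y where R: "rsvd t k A V y" by auto
 then have V: "idm t * V = V" "tp V * V = idm k" "tp A * (A * V) = V * dg k (%j. (y j)^2)"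
  and pos: "!!j. j < k ==> 0 <= y j" and dec: "!!i j. i <= j ==> j < k ==> y j <= y i"
  and bd: "!!j W. j < k ==> idm t * W = W ==> W * un 0 0 = W ==> idm j * (tp V * W) = 0 ==> norm (A * W) <= y j * norm W"
  by (auto simp: rsvd_def)
 have Vk: "V * idm k = V" by (rule norm_orthonormal(2)[OF V(2)])
 have kV: "idm k * (tp V * W) = tp V * W" for W
  using arg_cong[OF Vk, of tp] by (simp add: tp_mult mult.assoc[symmetric])
 \<comment> \<open>\<open>w * idm 1 = w\<close> says the same as \<open>w * un 0 0 = w\<close>, in
   the form that the compactness lemma expects.\<close>
 define S where "S = {w. idm t * w = w & w * idm 1 = w & tp V * w = 0 & norm w = 1}"
 have un: "un 0 0 = idm 1" by (auto simp: fmat_eq_iff)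
 have "compact S"
 proof (rule compact_fmat_sub)
  show "closed S" unfolding S_def
   by (intro closed_Collect_conj closed_Collect_eq continuous_intros)
  show "S <= {w. idm t * w = w & w * idm 1 = w & norm w <= 1}" unfolding S_def by auto
 qed
 moreover have "S ~= {}"
 proof -
  have "idm k * tp V = tp V" using arg_cong[OF Vk, of tp] by (simp add: tp_mult)
  then have "EX c. c ~= 0 & idm t * c = c & c * un 0 0 = c & tp V * c = 0"
   by (rule kernel_col[OF Suc_le_lessD[OF Suc.prems]])
  then obtain c where c: "c ~= 0" "idm t * c = c" "c * un 0 0 = c" "tp V * c = 0"
   by blast
  then have "(1 / norm c) *\<^sub>R c : S" by (simp add: S_def un)
  then show ?thesis by blast
 qed
 moreover have "continuous_on S (%w. norm (A * w))" by (intro continuous_intros)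
 ultimately obtain w where w: "w : S" "!!x. x : S ==> norm (A * x) <= norm (A * w)"
  using continuous_attains_sup[of S "%w. norm (A * w)"] by blast
 have ws: "idm t * w = w" "w * un 0 0 = w" "tp V * w = 0" "norm w = 1"
  using w(1) by (simp_all add: S_def un)
 define \<rho> where "\<rho> = norm (A * w)"
 have mx: "norm (A * x) <= \<rho> * norm x" if "idm t * x = x" "x * un 0 0 = x" "tp V * x = 0" for x
 proof (cases "x = 0")
  case False
  then have "(1 / norm x) *\<^sub>R x : S" using that by (simp add: S_def un)
  from w(2)[OF this] show ?thesis using False by (simp add: \<rho>_def field_simps)
 qed simp
 have ev: "tp A * (A * w) = \<rho>^2 *\<^sub>R w"
  unfolding \<rho>_def by (rule first_order_eigen[OF A V(3) ws]) (rule mx[unfolded \<rho>_def])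
 define V' where "V' = V + w * un 0 k"
 define y' where "y' = y(k := \<rho>)"
 have pref: "idm j * (tp V' * W) = idm j * (tp V * W)" if "j <= k" for j W
 proof -
  have "idm j * (un k 0 * (tp w * W)) = 0"
   using that by (simp add: mult.assoc[symmetric] un_idm)
  then show ?thesis by (simp add: V'_def tp_simps distrib_right distrib_left mult.assoc)
 qed
 have "rsvd t (Suc k) A V' y'"
  unfolding rsvd_def
 proof (intro conjI allI impI)
  show "idm t * V' = V'" by (simp add: V'_def distrib_left V ws mult.assoc[symmetric])
  show "tp V' * V' = idm (Suc k)" unfolding V'_def by (rule append_col[OF V(2) ws(2,4,3)])
  have a: "V * un k k = 0"
  proof -
   have "V * (idm k * un k k) = 0" by (simp add: un_idm)
   then show ?thesis by (simp add: mult.assoc[symmetric] Vk)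
  qed
  have b: "dg k (%j. (y' j)^2) = dg k (%j. (y j)^2)" by (rule dg_cong) (simp add: y'_def)
  have c: "w * (un 0 k * dg k (%j. (y j)^2)) = 0" by (simp add: un_idm)
  have "tp A * (A * V') = V * dg k (%j. (y j)^2) + \<rho>^2 *\<^sub>R (w * un 0 k)"
   by (simp add: V'_def distrib_left V(3)) (simp add: mult.assoc[symmetric] ev[unfolded mult.assoc[symmetric]])
  also have "... = V' * dg (Suc k) (%j. (y' j)^2)"
   by (simp add: V'_def dg_Suc distrib_left distrib_right a b c mult.assoc un_mult_un) (simp add: y'_def)
  finally show "tp A * (A * V') = V' * dg (Suc k) (%j. (y' j)^2)" .
  fix j assume "j < Suc k" then show "0 <= y' j" using pos by (auto simp: y'_def \<rho>_def less_Suc_eq)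
 next
  fix i j assume "i <= j" "j < Suc k"
  moreover have "\<rho> <= y i" if "i < k" for i
   using bd[OF that ws(1,2)] ws(3,4) by (simp add: \<rho>_def)
  ultimately show "y' j <= y' i"
   using dec by (auto simp: y'_def less_Suc_eq)
 next
  fix j W assume j: "j < Suc k" and W: "idm t * W = W" "W * un 0 0 = W" "idm j * (tp V' * W) = 0"
  show "norm (A * W) <= y' j * norm W"
  proof (cases "j = k")
   case True
   then have "tp V * W = 0" using W(3) pref[of j W] kV by simp
   then show ?thesis using mx[OF W(1,2)] True by (simp add: y'_def)
  next
   case False
   then show ?thesis using bd[of j W] j W pref[of j W] by (simp add: y'_def)
  qed
 qed
 then show ?case by blast
qed

text \<open>The two halves of Weyl's inequality for a perturbation of a matrix of rank at most \<^term>\<open>r\<close>.\<close>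

lemma rsvd_remainder:
 assumes R: "rsvd t r A V y" and A: "A = C1 * C2 + E" "A * idm t = A" and C: "idm r * C2 = C2" and E: "opb E e"
 shows "opb (A * (idm t - V * tp V)) e"
proof -
 from R have V: "idm t * V = V" "tp V * V = idm r" "tp A * (A * V) = V * dg r (%j. (y j)^2)"
  and pos: "!!j. j < r ==> 0 <= y j"
  and bd: "!!j W. j < r ==> idm t * W = W ==> W * un 0 0 = W ==> idm j * (tp V * W) = 0 ==> norm (A * W) <= y j * norm W"
  by (auto simp: rsvd_def)
 have main: "norm (A * W) <= e * norm W" if W: "idm t * W = W" "W * un 0 0 = W" "tp V * W = 0" for W
 proof (rule ccontr)
  assume "~ ?thesis"
  then have gt: "e * norm W < norm (A * W)" by simp
  then have W0: "W ~= 0" by auto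
  define w where "w = (1 / norm W) *\<^sub>R W"
  have w: "idm t * w = w" "w * un 0 0 = w" "tp V * w = 0" "norm w = 1"
   using W W0 by (simp_all add: w_def)
  define \<beta> where "\<beta> = norm (A * w)"
  have be: "e < \<beta>" using gt W0 by (simp add: \<beta>_def w_def field_simps)
  \<comment> \<open>If \<open>w\<close> violated the bound, \<open>A\<close> would stretch the span
    of the r + 1 orthonormal columns of \<open>V'\<close> by more than \<open>e\<close>. By
    dimension this span contains a vector killed by \<open>C2\<close>, on which \<open>A\<close>
    acts as \<open>E\<close>.\<close>
  define V' where "V' = V + w * un 0 r"
  have V': "tp V' * V' = idm (Suc r)" unfolding V'_def by (rule append_col[OF V(2) w(2,4,3)])
  have "EX c. c ~= 0 & idm (Suc r) * c = c & c * un 0 0 = c & (C2 * V') * c = 0"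
   by (rule kernel_col[of r]) (simp_all add: C mult.assoc[symmetric])
  then obtain c where c: "c ~= 0" "idm (Suc r) * c = c" "C2 * (V' * c) = 0"
   unfolding mult.assoc by blast
  have nx: "norm (V' * c) = norm c"
   using V' c(2) by (simp add: norm_eq_sqrt_inner inner_mult_left mult.assoc[symmetric])
  have "A * (V' * c) = E * (V' * c)" using c(3) by (simp add: A(1) distrib_right mult.assoc)
  then have up: "norm (A * (V' * c)) <= e * norm c" using opbD[OF E, of "V' * c"] nx by simp
  define f where "f = y(r := \<beta>)"
  have AAw: "tp w * (tp A * (A * w)) = \<beta>^2 *\<^sub>R un 0 0"
   using col_tp_mult[of "A * w" "A * w"] w(2) by (simp add: tp_mult mult.assoc \<beta>_def power2_norm_eq_inner)
  have VA: "tp V * (tp A * A) = dg r (%j. (y j)^2) * tp V"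
   using arg_cong[OF V(3), of tp] by (simp add: tp_mult mult.assoc)
  have x1: "tp V * (tp A * (A * w)) = 0"
   using arg_cong[OF VA, of "%B. B * w"] by (simp add: mult.assoc w)
  have x2: "tp w * (tp A * (A * V)) = 0"
  proof -
   have "tp w * (V * B) = 0" for B
   using arg_cong[OF w(3), of tp] by (simp add: tp_mult mult.assoc[symmetric])
   then show ?thesis by (simp add: V)
  qed
  have x3: "tp V * (tp A * (A * V)) = dg r (%j. (y j)^2)"
   by (simp add: V assoc_eq[OF V(2)] dg_mult)
  have y1: "tp V * (tp A * (A * (w * un 0 r))) = 0"
   using x1 by (metis mult.assoc mult_zero_left)
  have y2: "tp w * (tp A * (A * (w * un 0 r))) = \<beta>^2 *\<^sub>R (un 0 0 * un 0 r)"
   using AAw by (metis mult.assoc mult_scaleR_left)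
  \<comment> \<open>No cross terms arise: \<open>V\<close> spans an invariant subspace of
    \<open>tp A * A\<close>, and \<open>w\<close> is orthogonal to it.\<close>
  have G: "tp V' * (tp A * (A * V')) = dg (Suc r) (%j. (f j)^2)"
  proof -
   have "tp V' * (tp A * (A * V')) = dg r (%j. (y j)^2) + \<beta>^2 *\<^sub>R un r r"
   by (simp add: V'_def tp_simps distrib_left distrib_right mult.assoc x2 x3 y1 y2 un_mult_un)
   moreover have "dg r (%j. (f j)^2) = dg r (%j. (y j)^2)" by (rule dg_cong) (simp add: f_def)
   ultimately show ?thesis by (simp add: dg_Suc) (simp add: f_def)
  qed
  have "norm (A * (V' * c)) = norm (dg (Suc r) f * c)"
  proof -
   have "inner (A * (V' * c)) (A * (V' * c)) = inner c (tp V' * (tp A * (A * V')) * c)"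
   by (simp add: inner_mult_left mult.assoc)
   also have "... = inner (dg (Suc r) f * c) (dg (Suc r) f * c)"
   by (simp add: G inner_mult_left dg_mult_assoc power2_eq_square)
   finally show ?thesis by (simp add: norm_eq_sqrt_inner)
  qed
  moreover have "\<beta> * norm (idm (Suc r) * c) <= norm (dg (Suc r) f * c)"
  proof (rule dg_lower)
   fix j assume j: "j < Suc r"
   show "\<beta> <= \<bar>f j\<bar>"
   proof (cases "j = r")
   case False
   then have "j < r" using j by simp
   from bd[OF this w(1,2)] w(3,4) have "\<beta> <= y j" by (simp add: \<beta>_def)
   then show ?thesis using False by (simp add: f_def)
   qed (simp add: f_def)
  qed (simp add: \<beta>_def)
  ultimately have "\<beta> * norm c <= e * norm c" using up c(2) by simp
  then show False using be c(1) by simp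
 qed
 define J where "J = idm t - V * tp V"
 have tJ: "idm t * J = J" by (simp add: J_def right_diff_distrib dg_mult V mult.assoc[symmetric])
 have VJ: "tp V * J = 0"
 proof -
  have "tp V * idm t = tp V" using arg_cong[OF V(1), of tp] by (simp add: tp_mult)
  moreover have "idm r * tp V = tp V" using arg_cong[OF norm_orthonormal(2)[OF V(2)], of tp] by (simp add: tp_mult)
  ultimately show ?thesis by (simp add: J_def right_diff_distrib V(2) mult.assoc[symmetric])
 qed
 have Jp: "opb J 1"
 proof (rule opb_proj)
  show "tp J = J" by (simp add: J_def tp_simps)
  have "J * J = idm t * J - V * (tp V * J)" by (subst J_def) (simp add: left_diff_distrib mult.assoc)
  then show "J * J = J" by (simp add: tJ VJ)
 qed
 show ?thesis unfolding opb_def J_def[symmetric]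
 proof
  fix W
  have "norm (A * (J * W)) <= e * norm (idm t * (J * W))"
  proof (rule col_bound)
   fix W :: fmat assume W: "W * un 0 0 = W"
   have "norm (A * (J * W)) <= e * norm (J * W)"
   by (rule main) (simp_all add: mult.assoc W, simp_all add: mult.assoc[symmetric] tJ VJ)
   then show "norm (A * (J * W)) <= e * norm (idm t * (J * W))"
   by (simp add: mult.assoc[symmetric] tJ)
  qed (rule opb_nonneg[OF E])
  also have "... = e * norm (J * W)" by (simp add: mult.assoc[symmetric] tJ)
  also have "... <= e * (1 * norm W)" by (intro mult_left_mono opbD[OF Jp] opb_nonneg[OF E])
  finally show "norm (A * J * W) <= e * norm W" by (simp add: mult.assoc)
 qed
qed

text \<open>Courant-Fischer: the \<open>r\<close>-dimensional range of \<open>B\<close> meets the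
  complement of the first \<open>r - 1\<close> right singular vectors, and there \<open>A\<close> is
  bounded by its smallest listed singular value.\<close>

lemma rsvd_lower:
 assumes R: "rsvd t r A V y" and A: "A = M + E" and E: "opb E e"
  and B: "idm t * B = B" "B * idm r = B"
  and M: "!!W. idm r * W = W ==> \<mu> * norm (B * W) <= norm (M * (B * W))"
  and inj: "!!W. idm r * W = W ==> B * W = 0 ==> W = 0"
  and j: "j < r"
 shows "\<mu> - e <= y j"
proof -
 from R have dec: "y (r - 1) <= y j" using j by (auto simp: rsvd_def)
 have "EX c. c ~= 0 & idm r * c = c & c * un 0 0 = c & (idm (r - 1) * (tp V * B)) * c = 0"
  by (rule kernel_col[of "r - 1"]) (use j in "simp_all add: dg_mult_assoc")
 then obtain c where c: "c ~= 0" "idm r * c = c" "c * un 0 0 = c" "idm (r - 1) * (tp V * (B * c)) = 0"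
  unfolding mult.assoc by blast
 have "B * c ~= 0" using inj c by blast
 have "norm (A * (B * c)) <= y (r - 1) * norm (B * c)"
 proof -
  have "ALL W. idm t * W = W --> W * un 0 0 = W --> idm (r - 1) * (tp V * W) = 0 --> norm (A * W) <= y (r - 1) * norm W"
   using R j by (simp add: rsvd_def)
  then show ?thesis using c assoc_eq[OF B(1), of c] by (simp add: mult.assoc)
 qed
 moreover have "\<mu> * norm (B * c) - e * norm (B * c) <= norm (A * (B * c))"
  using M[OF c(2)] opbD[OF E, of "B * c"] norm_diff_ineq[of "M * (B * c)" "E * (B * c)"]
  by (simp add: A distrib_right)
 ultimately have "(\<mu> - e) * norm (B * c) <= y (r - 1) * norm (B * c)" by (simp add: left_diff_distrib)
 then have "\<mu> - e <= y (r - 1)" using \<open>B * c ~= 0\<close> by simp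
 then show ?thesis using dec by simp
qed

lemma rsvd_upper:
 assumes R: "rsvd t r A V y" and A: "opb A a" and j: "j < r"
 shows "y j <= a"
proof -
 from R have V: "tp V * V = idm r" "tp A * (A * V) = V * dg r (%j. (y j)^2)" and "0 <= y j"
  using j by (auto simp: rsvd_def)
 have nv: "norm (V * un j 0) = 1"
 proof -
  have "inner (V * un j 0) (V * un j 0) = inner (un j 0) (un j 0)"
   using j by (simp add: inner_mult_left[of V] mult.assoc[symmetric] V un_idm)
  then show ?thesis by (simp add: norm_eq_sqrt_inner norm_un[unfolded norm_eq_sqrt_inner])
 qed
 have "(norm (A * (V * un j 0)))^2 = inner (V * un j 0) (tp A * (A * V) * un j 0)"
  by (simp add: power2_norm_eq_inner inner_mult_left[of A] mult.assoc)
 also have "... = (y j)^2 * inner (V * un j 0) (V * un j 0)"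
  using j by (simp add: V mult.assoc un_idm)
 also have "... = (y j)^2" using nv by (simp add: norm_eq_1)
 finally have "norm (A * (V * un j 0)) = y j" using \<open>0 <= y j\<close> by (simp add: power2_eq_iff_nonneg)
 then show ?thesis using opbD[OF A, of "V * un j 0"] nv by simp
qed

section \<open>Deterministic perturbation bounds\<close>

lemma norm_mult_le: "norm A <= a ==> norm B <= b ==> norm (A * B) <= a * b" for A B :: fmat
 by (meson mult_mono norm_ge_zero norm_mult_ineq order_trans)

lemma norm_opb_le: "opb A a ==> norm B <= b ==> norm (A * B) <= a * b"
 by (meson mult_left_mono opbD opb_nonneg order_trans)

lemma norm_add_le: "norm A <= a ==> norm B <= b ==> norm (A + B) <= a + b" for A B :: fmat
 by (meson add_mono norm_triangle_ineq order_trans)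

lemma norm_diff_le: "norm A <= a ==> norm B <= b ==> norm (A - B) <= a + b" for A B :: fmat
 by (meson add_mono norm_triangle_ineq4 order_trans)

lemma norm_dg_le: assumes "!!i. i < n ==> \<bar>f i\<bar> <= c" "0 <= c" shows "norm (dg n f) <= c * sqrt (real n)"
 using opbD[OF opb_dg[of n f c, OF assms], of "idm n"] by (simp add: dg_mult norm_idm)

lemma inner_dg_lower:
 assumes f: "!!i. i < r ==> m <= f i" and m: "0 < m"
 shows "m * (norm (idm r * P))^2 <= inner P (dg r f * P)"
proof -
 have "sqrt m * norm (idm r * P) <= norm (dg r (%i. sqrt (f i)) * P)"
  by (rule dg_lower) (use f m in "auto simp: abs_of_nonneg order.trans[OF less_imp_le[OF m]]")
 then have "(sqrt m * norm (idm r * P))^2 <= (norm (dg r (%i. sqrt (f i)) * P))^2"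
  by (rule power_mono) (use m in simp)
 also have "... = inner P (dg r (%i. sqrt (f i) * sqrt (f i)) * P)"
  by (simp add: power2_norm_eq_inner inner_mult_left dg_mult_assoc)
 also have "dg r (%i. sqrt (f i) * sqrt (f i)) = dg r f"
  by (rule dg_cong) (use f m in "simp add: order.trans[OF less_imp_le[OF m]]")
 finally show ?thesis using m by (simp add: power_mult_distrib)
qed

lemma inner_dg_lower_right:
 assumes f: "!!i. i < r ==> m <= f i" and m: "0 < m"
 shows "m * (norm (P * idm r))^2 <= inner P (P * dg r f)"
proof -
 have 1: "norm (idm r * tp P) = norm (P * idm r)" by (metis norm_tp tp_dg tp_mult)
 have 2: "inner (tp P) (dg r f * tp P) = inner P (P * dg r f)" by (metis inner_tp tp_dg tp_mult tp_tp)
 have "m * (norm (idm r * tp P))^2 <= inner (tp P) (dg r f * tp P)"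
  by (rule inner_dg_lower) (use f m in auto)
 then show ?thesis unfolding 1 2 .
qed

text \<open>Pair the Sylvester operator with \<open>P\<close> itself: the two coercive terms add up
  to \<open>2 * m\<close> times the squared norm, and Cauchy-Schwarz bounds the result by
  \<open>c * norm P\<close>.\<close>

lemma sylvester_bound:
 assumes "m * (norm P)^2 <= inner P (P * A)" "m * (norm P)^2 <= inner P (B * P)" "0 < m"
  and "norm (P * A + B * P) <= c"
 shows "norm P <= c / (2 * m)"
proof (cases "P = 0")
 case False
 have "2 * m * (norm P * norm P) <= inner P (P * A + B * P)"
  using assms(1,2) by (simp add: inner_add_right power2_eq_square)
 also have "... <= norm P * c"
  by (rule order_trans[OF norm_cauchy_schwarz mult_left_mono[OF assms(4)]]) simp
 finally have "2 * m * norm P <= c" using False by simp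
 then show ?thesis using assms(3) by (simp add: field_simps)
next
 case True
 moreover have "0 <= c" using assms(4) norm_ge_zero order_trans by blast
 ultimately show ?thesis using assms(3) by simp
qed

text \<open>The Sylvester equation satisfied by \<^term>\<open>tp U0 * U - tp V0 * V\<close> shows that the two singular
 bases are rotated by nearly the same matrix, without any gap between the singular values.\<close>

lemma top_svd_perturb:
 fixes h e :: real
 assumes k1: "1 <= h" and rk: "sqrt (real r) <= h"
  and U: "tp U * U = idm r" and V: "tp V * V = idm r"
  and U0: "tp U0 * U0 = idm r" and V0: "tp V0 * V0 = idm r"
  and XV: "(U0 * (dg r d0 * tp V0) + E) * V = U * dg r d"
  and XU: "tp (U0 * (dg r d0 * tp V0) + E) * U = V * dg r d"
  and d: "!!j. j < r ==> 1 / h <= d j & d j <= h" and d0: "!!j. j < r ==> 1 / h <= d0 j & d0 j <= h"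
  and E: "opb E e"
 shows "norm (U * (dg r d * tp U) - U0 * (dg r d0 * tp U0)) <= 20 * h^12 * e"
  and "norm (U * (dg r d * tp V) - U0 * (dg r d0 * tp V0)) <= 20 * h^12 * e"
proof -
 define D where "D = dg r d"
 define D0 where "D0 = dg r d0"
 define Di where "Di = dg r (%j. 1 / d j)"
 define I where "I = idm r"
 have kp: "0 < h" using k1 by simp
 have tD: "tp D = D" "tp D0 = D0" "tp Di = Di" "tp I = I" by (simp_all add: D_def D0_def Di_def I_def)
 have dpos: "0 < d j" "0 < d0 j" if "j < r" for j
  using d[OF that] d0[OF that] kp by (auto intro: less_le_trans[of 0 "1 / h"])
 have DDi: "D * Di = I" unfolding D_def Di_def I_def dg_mult
  by (rule dg_cong) (use dpos in "simp add: less_imp_neq[symmetric]")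
 have nI: "U * I = U" "V * I = V" "U0 * I = U0" "V0 * I = V0"
  unfolding I_def using norm_orthonormal(2)[OF U] norm_orthonormal(2)[OF V]
   norm_orthonormal(2)[OF U0] norm_orthonormal(2)[OF V0] by simp_all
 have ID: "I * D0 = D0" "D * I = D" by (simp_all add: I_def D0_def D_def dg_mult)
 note [simp] = assoc_eq[OF ID(1)] assoc_eq[OF ID(2)]
 have orth: "tp U * U = I" "tp V * V = I" "tp U0 * U0 = I" "tp V0 * V0 = I"
  by (simp_all add: I_def U V U0 V0)
 note orth' = orth orth[THEN assoc_eq]
 have nU: "norm U <= h" "norm V <= h" "norm U0 <= h" "norm V0 <= h"
  using norm_orthonormal(1)[OF U] norm_orthonormal(1)[OF V]
   norm_orthonormal(1)[OF U0] norm_orthonormal(1)[OF V0] rk by simp_all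
 have nUt: "norm (tp U) <= h" "norm (tp V) <= h" "norm (tp U0) <= h" "norm (tp V0) <= h"
  using nU by simp_all
 have ndg: "norm (dg r f) <= h * h" if "!!j. j < r ==> \<bar>f j\<bar> <= h" for f
  by (rule order_trans[OF norm_dg_le[OF that]]) (use kp rk in simp_all)
 have nD: "norm D <= h * h" unfolding D_def by (rule ndg) (use d dpos in force)
 have nD0: "norm D0 <= h * h" unfolding D0_def by (rule ndg) (use d0 dpos in force)
 have nDi: "norm Di <= h * h" unfolding Di_def
 proof (rule ndg)
  fix j assume j: "j < r"
  have "1 / d j <= h" using d[OF j] dpos(1)[OF j] kp by (simp add: field_simps)
  then show "\<bar>1 / d j\<bar> <= h" using dpos(1)[OF j] by simp
 qed
 have XV': "U0 * (D0 * (tp V0 * V)) + E * V = U * D"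
  using XV by (simp add: D_def D0_def distrib_right mult.assoc)
 have XU': "V0 * (D0 * (tp U0 * U)) + tp E * U = V * D"
  using XU by (simp add: D_def D0_def distrib_right mult.assoc tp_simps)
 \<comment> \<open>\<open>a\<close> and \<open>b\<close> are the overlaps of the perturbed left and
   right bases with the original ones. The singular value equations couple them: in
   \<open>aD\<close> and \<open>bD\<close> the signal maps one overlap to the other.\<close>
 define a where "a = tp U0 * U"
 define b where "b = tp V0 * V"
 have na: "norm a <= h * h" "norm b <= h * h" unfolding a_def b_def by (intro norm_mult_le nUt nU)+
 have nat: "norm (tp a) <= h * h" "norm (tp b) <= h * h" using na by simp_all
 have aD: "a * D = D0 * b + tp U0 * (E * V)"
  using arg_cong[OF XV', of "%A. tp U0 * A"] by (simp add: a_def b_def distrib_left orth' mult.assoc)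
 have bD: "b * D = D0 * a + tp V0 * (tp E * U)"
  using arg_cong[OF XU', of "%A. tp V0 * A"] by (simp add: a_def b_def distrib_left orth' mult.assoc)
 define Up where "Up = U - U0 * a"
 define Vp where "Vp = V - V0 * b"
 \<comment> \<open>Outside the span of \<open>U0\<close> the signal contributes nothing, so
   \<open>Up\<close> is a function of the noise alone, and likewise \<open>Vp\<close>.\<close>
 have UpD: "Up * D = E * V - U0 * (tp U0 * (E * V))"
  by (simp add: Up_def left_diff_distrib mult.assoc aD distrib_left XV'[symmetric]) (simp add: b_def)
 have VpD: "Vp * D = tp E * U - V0 * (tp V0 * (tp E * U))"
  by (simp add: Vp_def left_diff_distrib mult.assoc bD distrib_left XU'[symmetric]) (simp add: a_def)
 have aI: "a * I = a" "b * I = b" by (simp_all add: a_def b_def mult.assoc nI)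
 have "Up * D * Di = Up" "Vp * D * Di = Vp"
  by (simp_all add: Up_def Vp_def left_diff_distrib mult.assoc DDi nI aI)
 then have Up': "Up = (E * V - U0 * (tp U0 * (E * V))) * Di"
  "Vp = (tp E * U - V0 * (tp V0 * (tp E * U))) * Di"
  unfolding UpD VpD by simp_all
 have nUp: "norm Up <= (e * h + h * (h * (e * h))) * (h * h)"
  unfolding Up'(1) by (intro norm_mult_le norm_diff_le norm_opb_le[OF E] nU nUt nDi)
 have nVp: "norm Vp <= (e * h + h * (h * (e * h))) * (h * h)"
  unfolding Up'(2) by (intro norm_mult_le norm_diff_le norm_opb_le[OF opb_tp[OF E]] nU nUt nDi)
 \<comment> \<open>Subtracting the two coupled equations exchanges \<open>a\<close> and
   \<open>b\<close> in the signal terms, and the difference solves a Sylvester equation with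
   positive diagonal coefficients.\<close>
 define P where "P = a - b"
 have PI: "P * idm r = P" "idm r * P = P"
  using aI arg_cong[OF nI(3), of tp] arg_cong[OF nI(4), of tp]
  by (simp_all add: P_def left_diff_distrib right_diff_distrib a_def b_def tp_mult mult.assoc[symmetric] tD flip: I_def)
 have "norm P <= (h * (e * h) + h * (e * h)) / (2 * (1 / h))"
 proof (rule sylvester_bound)
  show "1 / h * (norm P)^2 <= inner P (P * D)"
   using inner_dg_lower_right[of r "1 / h" d P] d kp PI by (simp add: D_def)
  show "1 / h * (norm P)^2 <= inner P (D0 * P)"
   using inner_dg_lower[of r "1 / h" d0 P] d0 kp PI by (simp add: D0_def)
  have "P * D + D0 * P = tp U0 * (E * V) - tp V0 * (tp E * U)"
   by (simp add: P_def left_diff_distrib right_diff_distrib aD bD)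
  then show "norm (P * D + D0 * P) <= h * (e * h) + h * (e * h)"
   by (simp only:) (intro norm_diff_le norm_mult_le norm_opb_le[OF E] norm_opb_le[OF opb_tp[OF E]] nU nUt)
 qed (use kp in simp)
 then have nP: "norm P <= h * h * h * e" by (simp add: algebra_simps)
 then have nPt: "norm (tp P) <= h * h * h * e" by simp
 have Ib: "I - tp b * b = tp V * Vp"
  by (simp add: Vp_def right_diff_distrib orth b_def tp_mult mult.assoc)
 \<comment> \<open>Only \<open>tp b * b\<close> is close to the identity by construction, but the
   product in the other order is needed. For a square matrix both defects have the same Frobenius
   norm, term by term.\<close>
 have "norm (I - b * tp b) = norm (I - tp b * b)"
 proof -
  have "inner (I - b * tp b) (I - b * tp b) = inner I I - 2 * inner (b * tp b) I + inner (b * tp b) (b * tp b)"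
   by (simp add: inner_diff_left inner_diff_right inner_commute)
  moreover have "inner (I - tp b * b) (I - tp b * b) = inner I I - 2 * inner (tp b * b) I + inner (tp b * b) (tp b * b)"
   by (simp add: inner_diff_left inner_diff_right inner_commute)
  moreover have "inner (b * tp b) I = inner (tp b) (tp b * I)" by (rule inner_mult_left)
  moreover have "tp b * I = tp b"
  proof -
   have "I * b = b" using arg_cong[OF nI(4), of tp] by (simp add: b_def tp_mult tD mult.assoc[symmetric])
   then show ?thesis using arg_cong[of _ _ tp] by (metis tD(4) tp_mult)
  qed
  moreover have "inner (tp b * b) I = inner b (b * I)" by (simp add: inner_mult_left)
  moreover have "inner (b * tp b) (b * tp b) = inner (tp b * b) (tp b * b)"
   by (metis inner_mult_left inner_mult_right mult.assoc tp_tp)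
  ultimately show ?thesis by (simp add: norm_eq_sqrt_inner aI inner_tp)
 qed
 then have nbb: "norm (I - b * tp b) <= h * ((e * h + h * (h * (e * h))) * (h * h))"
  unfolding Ib using norm_mult_le[OF nUt(2) nVp] by simp
 have e0: "0 <= e" by (rule opb_nonneg[OF E])
 have pw: "h ^ i <= h ^ 12" if "i <= 12" for i by (rule power_increasing[OF that k1])
 have ab: "a * (D * tp b) - D0 = tp U0 * (E * (V * tp b)) - D0 * (I - b * tp b)"
  by (simp add: mult.assoc[symmetric] aD) (simp add: mult.assoc right_diff_distrib distrib_right ID tD D0_def I_def dg_mult)
 have aa: "a * (D * tp a) - D0 = tp U0 * (E * (V * tp a)) + D0 * (b * tp P) - D0 * (I - b * tp b)"
  by (simp add: mult.assoc[symmetric] aD)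
   (simp add: mult.assoc right_diff_distrib distrib_right P_def tp_simps D0_def I_def dg_mult)
 have UU: "U = U0 * a + Up" "V = V0 * b + Vp" by (simp_all add: Up_def Vp_def)
 have K12: "U * (D * tp V) - U0 * (D0 * tp V0)
   = U0 * ((a * (D * tp b) - D0) * tp V0) + (U0 * (a * (D * tp Vp)) + Up * (D * tp V))"
 proof -
  have "U * (D * tp V) = U0 * (a * (D * tp V)) + Up * (D * tp V)"
   by (subst (1) UU(1)) (simp add: distrib_right mult.assoc)
  also have "U0 * (a * (D * tp V)) = U0 * (a * (D * (tp b * tp V0))) + U0 * (a * (D * tp Vp))"
   by (subst (1) UU(2)) (simp add: distrib_left tp_simps)
  finally show ?thesis by (simp add: left_diff_distrib right_diff_distrib mult.assoc)
 qed
 have K11: "U * (D * tp U) - U0 * (D0 * tp U0)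
   = U0 * ((a * (D * tp a) - D0) * tp U0) + (U0 * (a * (D * tp Up)) + Up * (D * tp U))"
 proof -
  have "U * (D * tp U) = U0 * (a * (D * tp U)) + Up * (D * tp U)"
   by (subst (1) UU(1)) (simp add: distrib_right mult.assoc)
  also have "U0 * (a * (D * tp U)) = U0 * (a * (D * (tp a * tp U0))) + U0 * (a * (D * tp Up))"
   by (subst (1) UU(1)) (simp add: distrib_left tp_simps)
  finally show ?thesis by (simp add: left_diff_distrib right_diff_distrib mult.assoc)
 qed
 have nUpt: "norm (tp Up) <= (e * h + h * (h * (e * h))) * (h * h)"
  "norm (tp Vp) <= (e * h + h * (h * (e * h))) * (h * h)" using nUp nVp by simp_all
 let ?u = "(e * h + h * (h * (e * h))) * (h * h)"
 have "norm (U * (D * tp U) - U0 * (D0 * tp U0))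
   <= h * ((h * (e * (h * (h * h))) + h * h * (h * h * (h * h * h * e)) + h * h * (h * ?u)) * h)
   + (h * (h * h * (h * h * ?u)) + ?u * (h * h * h))"
  unfolding K11 aa
  by (intro norm_add_le norm_mult_le norm_diff_le norm_opb_le[OF E] nU nUt nD nD0 na nat nUp nUpt nPt nbb)
 also have "... = (h^6 + h^9 + h^8 + h^10 + (h^8 + h^10) + (h^6 + h^8)) * e"
  by (simp add: algebra_simps power_numeral_reduce)
 \<comment> \<open>Eight monomials of degree at most 10; \<open>20 * h^12\<close> is a generous
   common bound for this estimate and the next.\<close>
 also have "... <= (h^12 + h^12 + h^12 + h^12 + (h^12 + h^12) + (h^12 + h^12)) * e"
  by (intro mult_right_mono add_mono pw e0) simp_all
 also have "... <= 20 * h^12 * e" using e0 kp by simp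
 finally show "norm (U * (dg r d * tp U) - U0 * (dg r d0 * tp U0)) <= 20 * h^12 * e"
  by (simp add: D_def D0_def)
 have "norm (U * (D * tp V) - U0 * (D0 * tp V0))
   <= h * ((h * (e * (h * (h * h))) + h * h * (h * ?u)) * h)
   + (h * (h * h * (h * h * ?u)) + ?u * (h * h * h))"
  unfolding K12 ab
  by (intro norm_add_le norm_mult_le norm_diff_le norm_opb_le[OF E] nU nUt nD nD0 na nat nUp nUpt nPt nbb)
 also have "... = (h^6 + h^8 + h^10 + (h^8 + h^10) + (h^6 + h^8)) * e"
  by (simp add: algebra_simps power_numeral_reduce)
 also have "... <= (h^12 + h^12 + h^12 + (h^12 + h^12) + (h^12 + h^12)) * e"
  by (intro mult_right_mono add_mono pw e0) simp_all
 also have "... <= 20 * h^12 * e" using e0 kp by simp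
 finally show "norm (U * (dg r d * tp V) - U0 * (dg r d0 * tp V0)) <= 20 * h^12 * e"
  by (simp add: D_def D0_def)
qed

section \<open>Optimal rotations\<close>

text \<open>Symmetry and positivity of \<^term>\<open>tp W * W0\<close> express that \<^term>\<open>W\<close> is optimally rotated
 towards \<^term>\<open>W0\<close>; the matrix \<^term>\<open>tp (W - W0) * (W + W0)\<close> is then symmetric.\<close>

lemma procrustes_bound:
 assumes sym: "tp (tp W * W0) = tp W * W0" and psd: "!!A. 0 <= inner (A * (tp W * W0)) A"
  and lower: "m * (norm (W - W0))^2 <= inner ((W - W0) * (tp W0 * W0)) (W - W0)" and m: "0 < m"
  and K: "norm (W * tp W - W0 * tp W0) <= k"
 shows "norm (W - W0) <= 2 * k / sqrt m"
proof -
 define \<Delta> where "\<Delta> = W - W0"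
 define S where "S = W + W0"
 define C where "C = tp \<Delta> * S"
 have s: "tp W0 * W = tp W * W0" using sym by (simp add: tp_mult)
 have C: "tp C = C"
  by (simp add: C_def \<Delta>_def S_def tp_simps left_diff_distrib right_diff_distrib distrib_left distrib_right s)
 have K2: "2 *\<^sub>R (W * tp W - W0 * tp W0) = \<Delta> * tp S + S * tp \<Delta>"
  by (simp add: \<Delta>_def S_def tp_simps left_diff_distrib right_diff_distrib distrib_left distrib_right scaleR_2)
 have "inner (S * tp \<Delta>) (\<Delta> * tp S) = inner C C"
 proof -
  have "inner (S * tp \<Delta>) (\<Delta> * tp S) = inner (tp \<Delta>) (tp S * (\<Delta> * tp S))" by (rule inner_mult_left)
  also have "... = inner (tp \<Delta>) (tp C * tp S)" by (simp add: C_def tp_mult mult.assoc)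
  also have "... = inner (tp \<Delta> * S) (tp C)" by (simp add: inner_mult_right)
  finally show ?thesis by (simp add: C) (simp add: C_def)
 qed
 then have "inner (\<Delta> * tp S) (\<Delta> * tp S) <= inner (2 *\<^sub>R (W * tp W - W0 * tp W0)) (\<Delta> * tp S)"
  unfolding K2 by (simp add: inner_add_left)
 also have "... <= 2 * k * norm (\<Delta> * tp S)"
  using mult_right_mono[OF K, of "norm (\<Delta> * tp S)"] norm_cauchy_schwarz[of "W * tp W - W0 * tp W0" "\<Delta> * tp S"]
  by simp
 finally have "norm (\<Delta> * tp S) * norm (\<Delta> * tp S) <= 2 * k * norm (\<Delta> * tp S)"
  by (simp add: power2_norm_eq_inner power2_eq_square[symmetric])
 moreover have k0: "0 <= k" using K norm_ge_zero order_trans by blast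
 ultimately have nS: "norm (\<Delta> * tp S) <= 2 * k"
  by (cases "norm (\<Delta> * tp S) = 0") auto
 have "m * (norm \<Delta>)^2 <= inner (\<Delta> * (tp W0 * W0)) \<Delta>" using lower by (simp add: \<Delta>_def)
 \<comment> \<open>Adding the nonnegative terms of \<open>W\<close> and of \<open>tp W * W0\<close>
   completes \<open>tp W0 * W0\<close> to \<open>tp S * S\<close>; positivity of the optimal overlap
   is used here.\<close>
 also have "... <= inner (\<Delta> * (tp W * W)) \<Delta> + 2 * inner (\<Delta> * (tp W * W0)) \<Delta> + inner (\<Delta> * (tp W0 * W0)) \<Delta>"
 proof -
  have "inner (\<Delta> * (tp W * W)) \<Delta> = inner (\<Delta> * tp W) (\<Delta> * tp W)"
   by (simp add: mult.assoc[symmetric] inner_mult_right)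
  then show ?thesis using psd[of \<Delta>] by simp
 qed
 also have "... = inner (\<Delta> * (tp S * S)) \<Delta>"
  by (simp add: S_def tp_simps distrib_left distrib_right s inner_add_left)
 also have "... = (norm (\<Delta> * tp S))^2"
  by (simp add: mult.assoc[symmetric] inner_mult_right power2_norm_eq_inner)
 also have "... <= (2 * k)^2" using nS by (rule power_mono) simp
 finally have "(sqrt m * norm \<Delta>)^2 <= (2 * k)^2" using m by (simp add: power_mult_distrib)
 then have "sqrt m * norm \<Delta> <= 2 * k" by (rule power2_le_imp_le) (use k0 in simp)
 then show ?thesis using m by (simp add: \<Delta>_def field_simps)
qed

definition orth :: "nat => fmat => bool" where
 "orth r Q \<longleftrightarrow> idm r * Q = Q & Q * idm r = Q & tp Q * Q = idm r & Q * tp Q = idm r"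

lemma orth_idm: "orth r (idm r)"
 by (simp add: orth_def dg_mult)

lemma orth_mult: "orth r P ==> orth r Q ==> orth r (P * Q)"
 unfolding orth_def tp_mult by (metis mult.assoc)

lemma inner_un: "inner (un a b) A = entry A a b"
proof -
 obtain n where "supp_in n A" using supp_in_ex by blast
 then have n: "supp_in (max n (Suc (max a b))) A" by (rule supp_in_mono) simp
 have "inner (un a b) A = (\<Sum>i<max n (Suc (max a b)). \<Sum>j<max n (Suc (max a b)). if j = b then (if i = a then entry A a b else 0) else 0)"
  unfolding inner_fmat[OF disjI2[OF n]] by (intro sum.cong) auto
 also have "... = (\<Sum>i<max n (Suc (max a b)). if i = a then entry A a b else 0)"
  by (intro sum.cong refl) (subst sum.delta, auto)
 also have "... = entry A a b" by (subst sum.delta) auto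
 finally show ?thesis .
qed

lemma inner_sum_cols: assumes "A * idm m = A" shows "inner B A = (\<Sum>j<m. inner (B * un j 0) (A * un j 0))"
proof -
 have "inner B A = inner B (A * (\<Sum>j<m. un j 0 * un 0 j))"
  using assms by (simp add: dg_eq_sum un_mult_un)
 also have "... = (\<Sum>j<m. inner B ((A * un j 0) * un 0 j))"
  by (simp add: sum_distrib_left inner_sum_right mult.assoc)
 also have "... = (\<Sum>j<m. inner (B * un j 0) (A * un j 0))"
  by (intro sum.cong refl) (metis inner_commute inner_mult_right tp_un)
 finally show ?thesis .
qed

lemma inner_psd_matrix:
 assumes psd: "!!v. idm r * v = v ==> v * un 0 0 = v ==> 0 <= inner (S * v) v"
  and S: "idm r * S = S" "S * idm r = S" "tp S = S"
 shows "0 <= inner (A * S) A"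
proof -
 obtain m where "supp_in m A" using supp_in_ex by blast
 then have m: "tp A * idm m = tp A" by (intro idm_supp) simp
 have "inner (A * S) A = inner (S * tp A) (tp A)"
  by (metis S(3) inner_tp tp_mult)
 also have "... = (\<Sum>j<m. inner (S * (tp A * un j 0)) (tp A * un j 0))"
  using inner_sum_cols[OF m, of "S * tp A"] by (simp add: mult.assoc)
 also have "... = (\<Sum>j<m. inner (S * (idm r * (tp A * un j 0))) (idm r * (tp A * un j 0)))"
 proof (rule sum.cong[OF refl])
  fix j
  have "inner (S * x) x = inner (S * (idm r * x)) (idm r * x)" for x
   by (metis S(1,2) inner_mult_left inner_commute mult.assoc tp_dg)
  then show "inner (S * (tp A * un j 0)) (tp A * un j 0)
   = inner (S * (idm r * (tp A * un j 0))) (idm r * (tp A * un j 0))" .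
 qed
 also have "... >= 0"
  by (intro sum_nonneg psd) (simp_all add: dg_mult_assoc mult.assoc un_mult_un)
 finally show ?thesis .
qed

lemma procrustes_exists: "EX Q. orth r Q & (ALL R. orth r R --> norm (W * Q - W0) <= norm (W * R - W0))"
proof -
 have "compact {Q. orth r Q}"
 proof (rule compact_fmat_sub)
  show "closed {Q. orth r Q}" unfolding orth_def
   by (intro closed_Collect_conj closed_Collect_eq continuous_intros)
  show "{Q. orth r Q} <= {A. idm r * A = A & A * idm r = A & norm A <= sqrt (real r)}"
   by (auto simp: orth_def norm_orthonormal)
 qed
 moreover have "{Q. orth r Q} ~= {}" using orth_idm by blast
 moreover have "continuous_on {Q. orth r Q} (%Q. norm (W * Q - W0))" by (intro continuous_intros)
 ultimately show ?thesis
  using continuous_attains_inf[of "{Q. orth r Q}" "%Q. norm (W * Q - W0)"] by blast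
qed

text \<open>An optimal rotation is compared with its plane rotations, which gives symmetry, and with its
 reflections, which gives positivity.\<close>

lemma procrustes_optimal:
 assumes Q: "orth r Q" and opt: "!!R. orth r R ==> norm (W * Q - W0) <= norm (W * R - W0)"
  and W: "W0 * idm r = W0"
 defines "S \<equiv> tp (W * Q) * W0"
 shows "tp S = S" "0 <= inner (A * S) A"
proof -
 have IS: "idm r * S = S" "S * idm r = S"
  using Q W unfolding orth_def S_def by (metis mult.assoc tp_dg tp_mult)+
 \<comment> \<open>The norm of \<open>W * Q * R\<close> does not depend on the rotation
   \<open>R\<close>, so minimising the distance means maximising \<open>inner R S\<close>.\<close>
 have key: "inner P S <= inner (idm r) S" if P: "orth r P" for P
 proof -
  have 1: "(norm (W * Q * R - W0))^2 = (norm (W * Q))^2 + (norm W0)^2 - 2 * inner R S" if "orth r R" for R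
  proof -
   have "inner (W * Q * R) (W * Q * R) = inner (W * Q) (W * (Q * (R * tp R)))"
   by (subst inner_mult_right) (simp add: mult.assoc)
   also have "... = inner (W * Q) (W * Q)" using that Q by (simp add: orth_def)
   finally have "inner (W * Q * R) (W * Q * R) = inner (W * Q) (W * Q)" .
   moreover have "inner (W * Q * R) W0 = inner R S" by (simp add: S_def inner_mult_left)
   ultimately show ?thesis
   by (simp add: power2_norm_eq_inner inner_diff_left inner_diff_right inner_commute)
  qed
  have "norm (W * Q * idm r - W0) <= norm (W * Q * P - W0)"
   using opt[OF orth_mult[OF Q P]] Q by (simp add: orth_def mult.assoc)
  then have "(norm (W * Q * idm r - W0))^2 <= (norm (W * Q * P - W0))^2" by (rule power_mono) simp
  then show ?thesis unfolding 1[OF P] 1[OF orth_idm] by simp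
 qed
 have sym: "entry S i j = entry S j i" if ij: "i < r" "j < r" "i ~= j" for i j
 proof -
  define a where "a = un i i + un j j"
  define k where "k = un i j - un j i"
  have ak: "a * a = a" "a * k = k" "k * a = k" "k * k = - a" "idm r * a = a" "a * idm r = a"
   "idm r * k = k" "k * idm r = k" "tp a = a" "tp k = - k"
   using ij by (simp_all add: a_def k_def distrib_left distrib_right left_diff_distrib right_diff_distrib
   un_mult_un un_idm tp_simps)
  define \<alpha> where "\<alpha> = inner a S"
  define \<beta> where "\<beta> = inner k S"
  have b: "t * \<beta> <= t^2 * \<alpha>" for t :: real
  proof -
   \<comment> \<open>Rational parametrisation of the unit circle: \<open>P\<close> rotates the plane
     of coordinates \<open>i\<close> and \<open>j\<close>, with first-order part
     \<open>2 * t * k\<close>, and trigonometric functions are avoided.\<close>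
   define c where "c = (1 - t^2) / (1 + t^2)"
   define s where "s = 2 * t / (1 + t^2)"
   have p: "1 + t^2 > 0" by (simp add: add_pos_nonneg)
   have cs: "2 * (c - 1) + (c - 1)^2 + s^2 = 0"
   proof -
   have "c^2 + s^2 = 1"
   proof -
   have "(1 - t^2)^2 + (2 * t)^2 = (1 + t^2)^2" by (simp add: power2_eq_square algebra_simps)
   then show ?thesis
   using p unfolding c_def s_def power_divide add_divide_distrib[symmetric] by simp
   qed
   then show ?thesis by (simp add: power2_eq_square algebra_simps)
   qed
   define P where "P = idm r + (c - 1) *\<^sub>R a + s *\<^sub>R k"
   have "tp P * P = idm r + (2 * (c - 1) + (c - 1)^2 + s^2) *\<^sub>R a"
   and "P * tp P = idm r + (2 * (c - 1) + (c - 1)^2 + s^2) *\<^sub>R a"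
   by (simp_all add: P_def tp_simps distrib_left distrib_right ak dg_mult left_diff_distrib
   right_diff_distrib scaleR_add_left scaleR_add_right power2_eq_square algebra_simps)
   then have "orth r P" using cs by (simp add: orth_def P_def distrib_left distrib_right ak dg_mult)
   from key[OF this] have "(c - 1) * \<alpha> + s * \<beta> <= 0"
   by (simp add: P_def inner_add_left \<alpha>_def \<beta>_def)
   then have "((c - 1) * \<alpha> + s * \<beta>) * (1 + t^2) <= 0"
   using p by (simp add: mult_le_0_iff)
   moreover have "(c - 1) * (1 + t^2) = - 2 * t^2" "s * (1 + t^2) = 2 * t"
   using p by (simp_all add: c_def s_def field_simps)
   moreover have "((c - 1) * \<alpha> + s * \<beta>) * (1 + t^2) = ((c - 1) * (1 + t^2)) * \<alpha> + (s * (1 + t^2)) * \<beta>"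
   by (simp add: algebra_simps)
   ultimately have "- 2 * t^2 * \<alpha> + 2 * t * \<beta> <= 0" by simp
   then show ?thesis by simp
  qed
  have "\<beta> = 0"
  proof (rule ccontr)
   assume nz: "\<beta> ~= 0"
   define u where "u = 1 / (2 * (\<bar>\<alpha>\<bar> + 1))"
   have u: "u > 0" "u * \<alpha> < 1" by (simp_all add: u_def field_simps abs_if)
   \<comment> \<open>The inequality \<open>b\<close> bounds a linear term in \<open>t\<close> by a
     quadratic one; a small multiple of \<open>\<beta>\<close> in place of \<open>t\<close>
     contradicts it unless \<open>\<beta>\<close> is 0.\<close>
   have "u * \<beta>^2 <= u * \<beta>^2 * (u * \<alpha>)" using b[of "u * \<beta>"] by (simp add: power2_eq_square algebra_simps)
   then have "1 <= u * \<alpha>" using nz u(1) by (simp add: mult_le_cancel_left1)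
   then show False using u(2) by simp
  qed
  then show ?thesis by (simp add: \<beta>_def k_def inner_diff_left inner_un)
 qed
 show S: "tp S = S"
 proof (rule entry_eqI)
  fix i j
  have z: "entry S i j = 0" if "~ (i < r & j < r)" for i j
   using that arg_cong[OF IS(1), of "%A. entry A i j"] arg_cong[OF IS(2), of "%A. entry A i j"]
   by (auto simp: entry_dg_mult entry_mult_dg split: if_splits)
  show "entry (tp S) i j = entry S i j"
   using sym[of i j] z[of i j] z[of j i] by (cases "i = j"; cases "i < r & j < r") auto
 qed
 show "0 <= inner (A * S) A"
 proof (rule inner_psd_matrix[OF _ IS S])
  fix v assume v: "idm r * v = v" "v * un 0 0 = v"
  show "0 <= inner (S * v) v"
  proof (cases "v = 0")
   case False
   define q where "q = v * tp v"
   have "tp v * idm r = tp v" using arg_cong[OF v(1), of tp] by (simp add: tp_mult)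
   then have Iq: "idm r * q = q" "q * idm r = q" "tp q = q"
   by (simp_all add: q_def tp_mult mult.assoc assoc_eq[OF v(1)])
   have qq: "q * q = (norm v)^2 *\<^sub>R q"
   proof -
   have "q * q = v * ((tp v * v) * tp v)" by (simp add: q_def mult.assoc)
   also have "... = (norm v)^2 *\<^sub>R ((v * un 0 0) * tp v)"
   by (simp only: col_tp_mult[OF v(2) v(2)] power2_norm_eq_inner) (simp add: mult.assoc)
   finally show ?thesis by (simp add: q_def v)
   qed
   \<comment> \<open>Householder reflection along \<open>v\<close>. Comparing it with the identity
     isolates \<open>inner q S\<close>, the quadratic form of \<open>S\<close> at
     \<open>v\<close>.\<close>
   define P where "P = idm r - (2 / (norm v)^2) *\<^sub>R q"
   have nz: "norm v ~= 0" using False by simp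
   have "P * P = idm r" "tp P = P" using nz
   by (simp_all add: P_def left_diff_distrib right_diff_distrib Iq qq dg_mult tp_simps power2_eq_square)
   (simp add: scaleR_2)
   then have "orth r P" by (simp add: orth_def P_def left_diff_distrib right_diff_distrib Iq dg_mult)
   from key[OF this] have "0 <= inner q S" using nz by (simp add: P_def inner_diff_left zero_le_divide_iff)
   also have "inner q S = inner (S * v) v" unfolding q_def inner_mult_right[of S v v] by (rule inner_commute)
   finally show ?thesis .
  qed simp
 qed
qed

text \<open>\<open>h\<close> is the constant of the first-order Procrustes estimate: 2 * 80 * k^12
  divided by \<open>sqrt (2 / k)\<close>, which is at least 1 / k. The bracket bounds the Sylvester
  equation for the second-order terms, and \<open>k^20\<close> covers the bounded factors multiplied
  to them.\<close>

definition core_const :: "real => real" where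
 "core_const k = (let h = 160 * k^13 in
   k^20 * (k * (k^8 + k^3 * h + h * k^4 + (k^4 * h)^2 + k^4 * h^2) + h^2 + 1))"

text \<open>All matrices are rescaled so that loadings, factors and the leading singular values have order
 one and \<^term>\<open>e\<close> is the noise level relative to the signal.  The isometry \<^term>\<open>St\<close> places the
 right factors below the left ones, so that \<^term>\<open>Y + St * Z\<close> is the stacked matrix.
 The mismatch of the rotated factors is of first order in \<^term>\<open>e\<close>, but its component along the
 factors themselves is only of second order, up to the bilinear form \<^term>\<open>tp L * (E * F)\<close>.\<close>

lemma pc_core:
 fixes k e g :: real
 assumes k1: "1 <= k" and rk: "sqrt (real r) <= k"
  and U: "tp U * U = idm r" and V: "tp V * V = idm r"
  and U0: "tp U0 * U0 = idm r" and V0: "tp V0 * V0 = idm r"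
  and XV: "(L * tp F + E) * V = U * dg r d"
  and XU: "tp (L * tp F + E) * U = V * dg r d"
  and M: "L * tp F = U0 * (dg r d0 * tp V0)"
  and d: "!!j. j < r ==> 1 / k <= d j & d j <= k" and d0: "!!j. j < r ==> 1 / k <= d0 j & d0 j <= k"
  and E: "opb E e"
  and St: "tp St * St = idm t" "idm t * V = V" "idm t * V0 = V0" "tp St * U = 0" "tp St * U0 = 0"
  and Q: "orth r Q"
  and opt: "!!R. orth r R ==>
   norm ((U * dg r (%j. sqrt (d j)) + St * (V * dg r (%j. sqrt (d j)))) * Q
   - (U0 * dg r (%j. sqrt (d0 j)) + St * (V0 * dg r (%j. sqrt (d0 j)))))
   <= norm ((U * dg r (%j. sqrt (d j)) + St * (V * dg r (%j. sqrt (d j)))) * R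
   - (U0 * dg r (%j. sqrt (d0 j)) + St * (V0 * dg r (%j. sqrt (d0 j)))))"
  and F: "F = V0 * (dg r (%j. sqrt (d0 j)) * H0)" and L: "L = U0 * (dg r (%j. sqrt (d0 j)) * tp H0i)"
  and H0: "H0 * H0i = idm r" "H0i * H0 = idm r" "idm r * H0 = H0" "H0i * idm r = H0i"
  and nF: "norm F <= k" and nL: "norm L <= k"
  and g: "norm (tp L * (E * F)) <= g"
 shows "norm (tp V * F - dg r (%j. sqrt (d j)) * (Q * H0)) <= core_const k * (e^2 + g)"
  and "norm (dg r (%j. 1 / d j) * (tp U * L) - dg r (%j. 1 / sqrt (d j)) * (Q * tp H0i)) <= core_const k * (e^2 + g)"
  and "norm (dg r (%j. sqrt (d j)) * (Q * H0)) <= core_const k"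
  and "norm (dg r (%j. 1 / sqrt (d j)) * (Q * tp H0i)) <= core_const k"
proof -
 define R where "R = dg r (%j. sqrt (d j))"
 define Ri where "Ri = dg r (%j. 1 / sqrt (d j))"
 define R0 where "R0 = dg r (%j. sqrt (d0 j))"
 define Ri0 where "Ri0 = dg r (%j. 1 / sqrt (d0 j))"
 define D where "D = dg r d"
 define D0 where "D0 = dg r d0"
 define Di where "Di = dg r (%j. 1 / d j)"
 define h where "h = 160 * k^13"
 have kp: "0 < k" using k1 by simp
 have h0: "0 <= h" using kp by (simp add: h_def)
 have e0: "0 <= e" by (rule opb_nonneg[OF E])
 have g0: "0 <= g" using g norm_ge_zero order_trans by blast
 have dpos: "0 < d j" "0 < d0 j" if "j < r" for j
  using d[OF that] d0[OF that] kp by (auto intro: less_le_trans[of 0 "1 / k"])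
 have tD: "tp R = R" "tp R0 = R0" "tp Ri = Ri" "tp Ri0 = Ri0" "tp D = D" "tp D0 = D0" "tp Di = Di"
  by (simp_all add: R_def R0_def Ri_def Ri0_def D_def D0_def Di_def)
 have ID: "idm r * R = R" "idm r * R0 = R0" "idm r * Ri = Ri" "idm r * Ri0 = Ri0" "idm r * D = D" "idm r * D0 = D0"
  "R * idm r = R" "R0 * idm r = R0" "Ri * idm r = Ri" "D * idm r = D"
  by (simp_all add: R_def R0_def Ri_def Ri0_def D_def D0_def dg_mult)
 have RR: "R * R = D" "R0 * R0 = D0" "Ri * R = idm r" "R * Ri = idm r" "Ri0 * R0 = idm r" "Di * R = Ri" "Ri * D = R"
  unfolding R_def R0_def Ri_def Ri0_def D_def D0_def Di_def dg_mult
  by (auto intro!: dg_cong simp: dpos less_imp_le less_imp_neq[symmetric] real_div_sqrt real_sqrt_divide field_simps)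
 have RDR: "R * (D * R) = D * D"
  unfolding R_def D_def dg_mult by (auto intro!: dg_cong simp: dpos less_imp_le)
 note ID' = ID ID[THEN assoc_eq] and RR' = RR RR[THEN assoc_eq]
 have nI: "U * idm r = U" "V * idm r = V" "U0 * idm r = U0" "V0 * idm r = V0"
  using norm_orthonormal(2)[OF U] norm_orthonormal(2)[OF V]
   norm_orthonormal(2)[OF U0] norm_orthonormal(2)[OF V0] by simp_all
 note orth' = U V U0 V0 U[THEN assoc_eq] V[THEN assoc_eq] U0[THEN assoc_eq] V0[THEN assoc_eq]
 have Q': "idm r * Q = Q" "Q * idm r = Q" "tp Q * Q = idm r" "Q * tp Q = idm r" "idm r * tp Q = tp Q"
 proof -
  show q: "idm r * Q = Q" "Q * idm r = Q" "tp Q * Q = idm r" "Q * tp Q = idm r"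
   using Q by (simp_all add: orth_def)
  show "idm r * tp Q = tp Q" using arg_cong[OF q(2), of tp] by (simp add: tp_mult)
 qed
 note Qs = Q' Q'[THEN assoc_eq]
 have nU: "norm U <= k" "norm V <= k" "norm U0 <= k" "norm V0 <= k" "norm Q <= k"
  using norm_orthonormal(1)[OF U] norm_orthonormal(1)[OF V] norm_orthonormal(1)[OF Q'(3)]
   norm_orthonormal(1)[OF U0] norm_orthonormal(1)[OF V0] rk by simp_all
 have nUt: "norm (tp U) <= k" "norm (tp V) <= k" "norm (tp U0) <= k" "norm (tp V0) <= k" "norm (tp Q) <= k"
  using nU by simp_all
 have ndg: "norm (dg r f) <= k * k" if "!!j. j < r ==> \<bar>f j\<bar> <= k" for f
  by (rule order_trans[OF norm_dg_le[OF that]]) (use kp rk in simp_all)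
 have sq: "sqrt x <= k" if "x <= k" for x
  using that k1 by (intro real_le_lsqrt) (auto intro: order_trans simp: power2_eq_square)
 have inv: "1 / x <= k" if "1 / k <= x" for x
  using that kp less_le_trans[of 0 "1 / k" x] by (simp add: field_simps)
 have isq: "1 / sqrt x <= k" if "1 / k <= x" for x
  using sq[OF inv[OF that]] by (simp add: real_sqrt_divide)
 have nD: "norm R <= k * k" "norm R0 <= k * k" "norm Ri <= k * k" "norm Ri0 <= k * k"
  "norm D <= k * k" "norm Di <= k * k"
  unfolding R_def R0_def Ri_def Ri0_def D_def Di_def
  using d d0 dpos sq inv isq by (auto intro!: ndg simp: abs_of_pos)
 define Y0 where "Y0 = U0 * R0"
 define Z0 where "Z0 = V0 * R0"
 \<comment> \<open>\<open>H0\<close> and its inverse come without bounds; solving the factorisations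
   of \<open>F\<close> and \<open>L\<close> for them provides bounds.\<close>
 have H0Ri: "H0 = Ri0 * (tp V0 * F)" "tp H0i = Ri0 * (tp U0 * L)"
 proof -
  have "idm r * tp H0i = tp H0i" using arg_cong[OF H0(4), of tp] by (simp add: tp_mult)
  then show "H0 = Ri0 * (tp V0 * F)" "tp H0i = Ri0 * (tp U0 * L)"
   unfolding F L by (simp_all add: orth' R0_def[symmetric] ID' RR' H0)
 qed
 have nH: "norm H0 <= k * k * (k * k)" "norm (tp H0i) <= k * k * (k * k)"
  by (subst H0Ri, intro norm_mult_le nD nUt nF nL)+
 have nHt: "norm (tp H0) <= k * k * (k * k)" "norm H0i <= k * k * (k * k)"
  using nH by simp_all
 define Y where "Y = U * R * Q"
 define Z where "Z = V * R * Q"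
 define G where "G = tp Q * (D * Q)"
 define W where "W = Y + St * Z"
 define W0 where "W0 = Y0 + St * Z0"
 have YY: "tp Y * Y = G" "tp Z * Z = G" "tp Y0 * Y0 = D0" "tp Z0 * Z0 = D0"
  by (simp_all add: Y_def Z_def Y0_def Z0_def G_def tp_mult mult.assoc orth' tD ID' RR')
 have St': "tp St * (St * Z) = Z" "tp St * (St * Z0) = Z0" "tp St * Y = 0" "tp St * Y0 = 0"
  "tp Y * (St * x) = 0" "tp Y0 * (St * x) = 0" for x
 proof -
  have a: "tp U * (St * x) = 0" "tp U0 * (St * x) = 0" for x
   using arg_cong[OF St(4), of tp] arg_cong[OF St(5), of tp] by (simp_all add: tp_mult mult.assoc[symmetric])
  show "tp St * (St * Z) = Z" "tp St * (St * Z0) = Z0" "tp St * Y = 0" "tp St * Y0 = 0"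
  "tp Y * (St * x) = 0" "tp Y0 * (St * x) = 0"
   using assoc_eq[OF St(1)] assoc_eq[OF St(2)] assoc_eq[OF St(3)] assoc_eq[OF St(4)] assoc_eq[OF St(5)]
   by (simp_all add: Z_def Z0_def Y_def Y0_def mult.assoc tp_mult a)
 qed
 have opSt: "norm (St * x) <= norm x" for x
 proof -
  have "inner (St * x) (St * x) = inner x (idm t * x)" by (simp add: inner_mult_left mult.assoc[symmetric] St)
  also have "... <= norm x * norm (idm t * x)" by (rule norm_cauchy_schwarz)
  also have "... <= norm x * (1 * norm x)" by (intro mult_left_mono opbD opb_proj) (simp_all add: dg_mult)
  finally have "(norm (St * x))^2 <= (norm x)^2" by (simp add: power2_norm_eq_inner[symmetric] power2_eq_square[symmetric])
  then show ?thesis by (rule power2_le_imp_le) simp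
 qed
 have opSt': "norm (x * tp St) <= norm x" for x using opSt[of "tp x"] by (metis norm_tp tp_mult tp_tp)

 have K11: "norm (Y * tp Y - Y0 * tp Y0) <= 20 * k^12 * e" and K12: "norm (Y * tp Z - Y0 * tp Z0) <= 20 * k^12 * e"
  using top_svd_perturb[OF k1 rk U V U0 V0 XV[unfolded M] XU[unfolded M] d d0 E]
  by (simp_all add: Y_def Z_def Y0_def Z0_def tp_mult mult.assoc Qs tD RR' D_def[symmetric] D0_def[symmetric] ID')
 have K22: "norm (Z * tp Z - Z0 * tp Z0) <= 20 * k^12 * e"
 proof -
  have MT: "V0 * (dg r d0 * tp U0) = tp (L * tp F)" by (simp add: M tp_mult mult.assoc)
  have "(V0 * (dg r d0 * tp U0) + tp E) * U = V * dg r d" "tp (V0 * (dg r d0 * tp U0) + tp E) * V = U * dg r d"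
   using XV XU unfolding MT by (simp_all add: tp_plus)
  from top_svd_perturb(1)[OF k1 rk V U V0 U0 this d d0 opb_tp[OF E]] show ?thesis
   by (simp add: Z_def Z0_def tp_mult mult.assoc Qs tD RR' D_def[symmetric] D0_def[symmetric] ID')
 qed
 \<comment> \<open>Each of the four blocks of the stacked matrix contributes 20; the lower diagonal
   block is the perturbation bound for the transposed problem.\<close>
 have "norm (W * tp W - W0 * tp W0) <= 80 * k^12 * e"
 proof -
  have eq: "W * tp W - W0 * tp W0 = (Y * tp Y - Y0 * tp Y0) + (Y * tp Z - Y0 * tp Z0) * tp St
   + St * tp (Y * tp Z - Y0 * tp Z0) + St * ((Z * tp Z - Z0 * tp Z0) * tp St)"
   by (simp add: W_def W0_def tp_simps distrib_left distrib_right left_diff_distrib right_diff_distrib mult.assoc)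
  have "norm (W * tp W - W0 * tp W0) <= 20 * k^12 * e + 20 * k^12 * e + 20 * k^12 * e + 20 * k^12 * e"
   unfolding eq
   by (intro norm_add_le order_trans[OF opSt] order_trans[OF opSt'] K11 K12 K22) (simp add: K12)
  then show ?thesis by (simp add: mult_ac)
 qed
 note KW = this
 have Seq: "tp W * W0 = tp Y * Y0 + tp Z * Z0"
  by (simp add: W_def W0_def tp_simps distrib_left distrib_right mult.assoc St')
 have WQ: "W = (U * R + St * (V * R)) * Q" by (simp add: W_def Y_def Z_def distrib_right mult.assoc)
 have S: "tp (tp W * W0) = tp W * W0" "0 <= inner (A * (tp W * W0)) A" for A
  using procrustes_optimal[OF Q opt] unfolding R_def[symmetric] R0_def[symmetric]
   WQ[symmetric] Y0_def[symmetric] Z0_def[symmetric] W0_def[symmetric]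
  by (simp_all add: W0_def Y0_def Z0_def distrib_right mult.assoc ID)
 have "norm (W - W0) <= 2 * (80 * k^12 * e) / sqrt (2 / k)"
 proof (rule procrustes_bound[OF S _ _ KW])
  have "tp W0 * W0 = D0 + D0"
   by (simp add: W0_def tp_simps distrib_left distrib_right mult.assoc St' YY)
  moreover have "(W - W0) * idm r = W - W0"
   by (simp add: W_def W0_def Y_def Z_def Y0_def Z0_def left_diff_distrib distrib_right mult.assoc Qs ID)
  moreover have "1 / k * (norm ((W - W0) * idm r))^2 <= inner (W - W0) ((W - W0) * D0)"
   unfolding D0_def by (rule inner_dg_lower_right) (use d0 kp in auto)
  ultimately show "2 / k * (norm (W - W0))^2 <= inner ((W - W0) * (tp W0 * W0)) (W - W0)"
   by (simp add: distrib_left inner_add_right inner_commute[of "_ + _"])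
 qed (use kp in simp)
 also have "... <= h * e"
 proof -
  have "1 / k <= sqrt (2 / k)"
  proof (rule real_le_rsqrt)
   have "(1 / k)^2 <= 1 * (1 / k)" unfolding power2_eq_square using k1 by (intro mult_right_mono) simp_all
   also have "... <= 2 / k" using kp by (simp add: field_simps)
   finally show "(1 / k)^2 <= 2 / k" .
  qed
  then have "2 * (80 * k^12 * e) / sqrt (2 / k) <= 2 * (80 * k^12 * e) / (1 / k)"
   using e0 kp by (intro divide_left_mono) auto
  then show ?thesis by (simp add: h_def power_numeral_reduce mult_ac)
 qed
 finally have nW: "norm (W - W0) <= h * e" .
 define DY where "DY = Y - Y0"
 define DZ where "DZ = Z - Z0"
 \<comment> \<open>The isometry \<open>St\<close> moves the lower block into rows orthogonal to the
   upper one, so the squared norm of \<open>W - W0\<close> splits and bounds each block.\<close>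
 have nDel: "norm DY <= h * e" "norm DZ <= h * e"
 proof -
  have "W - W0 = DY + St * DZ" by (simp add: W_def W0_def DY_def DZ_def algebra_simps)
  moreover have "inner DY (St * DZ) = 0" "inner (St * DZ) DY = 0" "inner (St * DZ) (St * DZ) = inner DZ DZ"
  proof -
   have "tp St * DY = 0" "tp St * (St * DZ) = DZ"
   by (simp_all add: DY_def DZ_def right_diff_distrib St')
   then show "inner (St * DZ) DY = 0" "inner (St * DZ) (St * DZ) = inner DZ DZ"
   by (simp_all add: inner_mult_left[of St DZ])
   then show "inner DY (St * DZ) = 0" by (simp add: inner_commute)
  qed
  ultimately have "(norm (W - W0))^2 = (norm DY)^2 + (norm DZ)^2"
   by (simp add: power2_norm_eq_inner inner_add_left inner_add_right)
  then have "(norm DY)^2 <= (norm (W - W0))^2" "(norm DZ)^2 <= (norm (W - W0))^2" by simp_all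
  then show "norm DY <= h * e" "norm DZ <= h * e"
   using nW by (meson norm_ge_zero order_trans power2_le_imp_le)+
 qed
 have nDelt: "norm (tp DY) <= h * e" "norm (tp DZ) <= h * e" using nDel by simp_all

 \<comment> \<open>\<^term>\<open>tp Y * DY\<close> and \<^term>\<open>tp Z * DZ\<close> are of second order.\<close>
 define A where "A = tp Z * DZ"
 define B where "B = tp Y * DY"
 have ZZ0: "tp Z * Z0 = G - A" "tp Z0 * Z = G - tp A" and YY0: "tp Y * Y0 = G - B" "tp Y0 * Y = G - tp B"
 proof -
  have tG: "tp G = G" by (simp add: G_def tp_mult tD mult.assoc)
  show 1: "tp Z * Z0 = G - A" and 2: "tp Y * Y0 = G - B"
   by (simp_all add: A_def B_def DZ_def DY_def right_diff_distrib YY)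
  show "tp Z0 * Z = G - tp A" "tp Y0 * Y = G - tp B"
   using arg_cong[OF 1, of tp] arg_cong[OF 2, of tp] by (simp_all add: tp_simps tG)
 qed
 have nYZ: "norm (tp Y) <= k * (k * k) * k" "norm (tp Z) <= k * (k * k) * k"
  "norm Z <= k * (k * k) * k"
 proof -
  show "norm Z <= k * (k * k) * k" unfolding Z_def by (intro norm_mult_le nU nD)
  then show "norm (tp Z) <= k * (k * k) * k" by simp
  show "norm (tp Y) <= k * (k * k) * k" unfolding Y_def norm_tp by (intro norm_mult_le nU nD)
 qed
 have nY0: "norm (tp Y0) <= k * (k * k)" unfolding Y0_def norm_tp by (intro norm_mult_le nU nD)
 have nAB: "norm (tp A) <= k * (k * k) * k * (h * e)" "norm B <= k * (k * k) * k * (h * e)"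
  unfolding A_def B_def norm_tp by (intro norm_mult_le nYZ nDel)+
 have nG: "norm G <= k * (k * k * k)" unfolding G_def by (intro norm_mult_le nUt nD nU)
 define R1 where "R1 = tp DZ * DZ - tp DY * DY"
 have nR1: "norm R1 <= h * e * (h * e) + h * e * (h * e)"
  unfolding R1_def by (intro norm_diff_le norm_mult_le nDel nDelt)
 \<comment> \<open>Both \<open>tp Y0 * Y0\<close> and \<open>tp Z0 * Z0\<close> equal
   \<open>D0\<close>; expanding them around \<open>G\<close> shows that the symmetric parts of
   \<open>A\<close> and \<open>B\<close> agree up to the quadratic term \<open>R1\<close>.\<close>
 have R1: "A + tp A - B - tp B = R1"
 proof -
  have "tp Z0 * Z0 = G - A - tp A + tp DZ * DZ" "tp Y0 * Y0 = G - B - tp B + tp DY * DY"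
   using ZZ0 YY0 by (simp_all add: DZ_def DY_def tp_simps left_diff_distrib right_diff_distrib YY)
  then show ?thesis unfolding YY R1_def by (simp add: algebra_simps)
 qed
 have symAB: "A + B = tp A + tp B"
 proof -
  have "tp (tp Y * Y0 + tp Z * Z0) = tp Y * Y0 + tp Z * Z0" using S(1) by (simp add: Seq)
  then have "tp Y0 * Y + tp Z0 * Z = tp Y * Y0 + tp Z * Z0" by (simp add: tp_simps)
  then show ?thesis by (simp add: ZZ0 YY0 algebra_simps)
 qed
 \<comment> \<open>Optimality of the rotation makes the antisymmetric parts of \<open>A\<close> and
   \<open>B\<close> opposite, while their symmetric parts differ by half of \<open>R1\<close>. Hence
   \<open>tp A\<close> is \<open>B\<close> up to a second-order term.\<close>
 have tA: "tp A = B + (1/2) *\<^sub>R R1"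
 proof -
  have "R1 = 2 *\<^sub>R (tp A - B)"
   using R1 symAB by (simp add: scaleR_2 algebra_simps) (metis add.assoc add.commute add_right_cancel)
  then show ?thesis by simp
 qed
 \<comment> \<open>The noise form is computed as the difference of two evaluations: the singular
   value equations give \<open>G * G\<close> for the data, and the signal factors into the overlaps
   \<open>tp Y * Y0\<close> and \<open>tp Z0 * Z\<close>.\<close>
 have YEZ: "tp Y * (E * Z) = B * G + G * tp A - B * tp A"
 proof -
  have X: "(L * tp F + E) * Z = Y * G"
   by (simp add: Z_def Y_def G_def mult.assoc[symmetric] XV D_def[symmetric])
   (simp add: mult.assoc Qs, simp add: mult.assoc[symmetric] R_def D_def dg_mult, simp add: mult.assoc dg_mult mult.commute)
  have "tp Y * (E * Z) = tp Y * ((L * tp F + E) * Z) - tp Y * ((L * tp F) * Z)"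
   by (simp add: distrib_left distrib_right)
  also have "tp Y * ((L * tp F + E) * Z) = G * G" by (simp add: X mult.assoc[symmetric] YY)
  also have "tp Y * ((L * tp F) * Z) = (tp Y * Y0) * (tp Z0 * Z)"
   by (simp add: M Y0_def Z0_def tp_mult tD mult.assoc RR' D0_def[symmetric])
  finally show ?thesis by (simp add: ZZ0 YY0 left_diff_distrib right_diff_distrib)
 qed
 define C1 where "C1 = k * (k^8 + k^3 * h + h * k^4 + (k^4 * h)^2 + k^4 * h^2)"
 \<comment> \<open>Passing from \<open>Y\<close>, \<open>Z\<close> to \<open>Y0\<close>,
   \<open>Z0\<close> costs noise times mismatch, of order \<open>e^2\<close>; what remains is the
   bilinear form bounded by \<open>g\<close>, conjugated by \<open>H0\<close>.\<close>
 have nYEZ: "norm (tp Y * (E * Z)) <= k^8 * g + (k^3 * h + h * k^4) * e^2"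
 proof -
  have "Y0 = L * tp H0" "Z0 = F * H0i"
   unfolding L F
   by (simp_all add: Y0_def Z0_def R0_def[symmetric] mult.assoc H0 ID' flip: tp_mult)
  then have 1: "tp Y0 * (E * Z0) = H0 * ((tp L * (E * F)) * H0i)" by (simp add: tp_mult mult.assoc)
  have "tp Y * (E * Z) = tp Y0 * (E * Z0) + (tp Y0 * (E * DZ) + tp DY * (E * Z))"
   by (simp add: DY_def DZ_def tp_simps left_diff_distrib right_diff_distrib)
  also have "norm ... <= k * k * (k * k) * (g * (k * k * (k * k))) +
   (k * (k * k) * (e * (h * e)) + h * e * (e * (k * (k * k) * k)))"
   unfolding 1 by (intro norm_add_le norm_mult_le norm_opb_le[OF E] nH nHt g nY0 nDel nDelt nYZ)
  finally show ?thesis by (simp add: algebra_simps power_numeral_reduce power2_eq_square)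
 qed
 have nB: "norm B <= C1 * (e^2 + g)"
 proof -
  have "norm B <= ((k^8 * g + (k^3 * h + h * k^4) * e^2) + k * (k * k) * k * (h * e) * (k * (k * k) * k * (h * e))
   + k * (k * k * k) * (h * e * (h * e))) / (2 * (1 / k))"
  proof (rule sylvester_bound)
   have IB: "idm r * B = B" "B * idm r = B"
   by (simp_all add: B_def DY_def Y_def Y0_def tp_mult tD mult.assoc Qs ID' right_diff_distrib left_diff_distrib)
   have low: "1 / k * (norm P)^2 <= inner P (G * P)" if "idm r * P = P" for P
   proof -
   have "1 / k * (norm (idm r * (Q * P)))^2 <= inner (Q * P) (D * (Q * P))"
   unfolding D_def by (rule inner_dg_lower) (use d kp in auto)
   moreover have "norm (idm r * (Q * P)) = norm P"
   by (simp add: Qs norm_eq_sqrt_inner inner_mult_left that)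
   moreover have "inner (Q * P) (D * (Q * P)) = inner P (G * P)"
   by (simp add: G_def inner_mult_left mult.assoc)
   ultimately show ?thesis by simp
   qed
   show "1 / k * (norm B)^2 <= inner B (G * B)" by (rule low[OF IB(1)])
   have "1 / k * (norm (tp B))^2 <= inner (tp B) (G * tp B)"
   by (rule low) (use arg_cong[OF IB(2), of tp] in "simp add: tp_mult")
   moreover have "inner (tp B) (G * tp B) = inner B (B * G)"
   proof -
   have "G * tp B = tp (B * G)" by (simp add: tp_mult G_def tD mult.assoc)
   then show ?thesis by (simp add: inner_tp)
   qed
   ultimately show "1 / k * (norm B)^2 <= inner B (B * G)" by simp
   \<comment> \<open>Substituting \<open>tA\<close> leaves \<open>B\<close> as the only first-order
     unknown, in a Sylvester equation with the positive definite coefficient \<open>G\<close> on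
     both sides.\<close>
   have "B * G + G * B = tp Y * (E * Z) + B * tp A - G * ((1/2) *\<^sub>R R1)"
   unfolding YEZ by (subst (1) tA) (simp add: distrib_left)
   moreover have "norm ((1/2) *\<^sub>R R1) = norm R1 / 2" by simp
   then have "norm ((1/2) *\<^sub>R R1) <= h * e * (h * e)" using nR1 by linarith
   ultimately show "norm (B * G + G * B) <= (k^8 * g + (k^3 * h + h * k^4) * e^2) + k * (k * k) * k * (h * e) * (k * (k * k) * k * (h * e))
   + k * (k * k * k) * (h * e * (h * e))"
   by (simp only:) (intro norm_diff_le norm_add_le norm_mult_le nYEZ nAB nG)
  qed (use kp in simp)
  also have "... = k / 2 * (k^8 * g + (k^3 * h + h * k^4 + (k^4 * h)^2 + k^4 * h^2) * e^2)"
   using kp by (simp add: field_simps power_numeral_reduce power2_eq_square)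
  also have "... <= k * ((k^8 + k^3 * h + h * k^4 + (k^4 * h)^2 + k^4 * h^2) * g
   + (k^8 + k^3 * h + h * k^4 + (k^4 * h)^2 + k^4 * h^2) * e^2)"
   using kp h0 g0 e0 by (intro mult_mono add_mono mult_right_mono) auto
  finally show ?thesis by (simp add: C1_def algebra_simps)
 qed
 have C10: "0 <= C1" using kp h0 by (simp add: C1_def)
 have nA: "norm A <= (C1 + h^2) * (e^2 + g)"
 proof -
  have "norm A = norm (tp A)" by simp
  also have "... <= C1 * (e^2 + g) + h^2 * e^2"
   unfolding tA by (rule norm_add_le[OF nB]) (use nR1 in "simp add: power2_eq_square mult_ac")
  also have "... <= (C1 + h^2) * (e^2 + g)" using g0 by (simp add: algebra_simps)
  finally show ?thesis .
 qed
 have nB': "norm B <= (C1 + h^2) * (e^2 + g)"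
 proof (rule order_trans[OF nB])
  show "C1 * (e^2 + g) <= (C1 + h^2) * (e^2 + g)" using g0 by (intro mult_right_mono) simp_all
 qed
 have CC: "core_const k = k^20 * (C1 + h^2 + 1)"
  by (simp add: core_const_def C1_def h_def Let_def)
 have pw: "k ^ i <= k ^ 20" if "i <= 20" for i by (rule power_increasing[OF that k1])
 have s0: "0 <= e^2 + g" using g0 by simp
 have fin: "k^i * ((C1 + h^2) * (e^2 + g)) <= core_const k * (e^2 + g)" if "i <= 20" for i
  unfolding CC mult.assoc using pw[OF that] kp C10 s0 by (intro mult_mono) auto
 have fin2: "k^i <= core_const k" if "i <= 20" for i
 proof -
  have "k^i * 1 <= k^20 * (C1 + h^2 + 1)" using pw[OF that] kp C10 by (intro mult_mono) auto
  then show ?thesis by (simp add: CC)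
 qed
 have RiQG: "Ri * (Q * G) = R * Q" by (simp add: G_def Qs RR' ID')
 have VZ: "tp V * Z0 = Ri * (Q * (tp Z * Z0))" "tp U * Y0 = Ri * (Q * (tp Y * Y0))"
  using arg_cong[OF nI(1), of tp] arg_cong[OF nI(2), of tp]
  by (simp_all add: Z_def Y_def tp_mult tD mult.assoc Qs RR' ID') (simp_all add: mult.assoc[symmetric] Qs RR)
 have "tp V * F - R * (Q * H0) = - (Ri * (Q * (A * H0)))"
 proof -
  have "tp V * F = (tp V * Z0) * H0" unfolding F by (simp add: Z0_def R0_def mult.assoc)
  also have "... = R * (Q * H0) - Ri * (Q * (A * H0))"
   unfolding VZ ZZ0 by (simp add: right_diff_distrib left_diff_distrib RiQG mult.assoc)
  finally show ?thesis by simp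
 qed
 moreover have "norm (- (Ri * (Q * (A * H0)))) <= k * k * (k * ((C1 + h^2) * (e^2 + g) * (k * k * (k * k))))"
  unfolding norm_minus_cancel by (intro norm_mult_le nD nU nA nH)
 ultimately show "norm (tp V * F - dg r (%j. sqrt (d j)) * (Q * H0)) <= core_const k * (e^2 + g)"
  using fin[of 7] by (simp add: R_def power_numeral_reduce mult_ac)
 have "Di * (tp U * L) - Ri * (Q * tp H0i) = - (Di * (Ri * (Q * (B * tp H0i))))"
 proof -
  have "tp U * L = (tp U * Y0) * tp H0i" unfolding L by (simp add: Y0_def R0_def mult.assoc)
  also have "... = R * (Q * tp H0i) - Ri * (Q * (B * tp H0i))"
   unfolding VZ YY0 by (simp add: right_diff_distrib left_diff_distrib RiQG mult.assoc)
  finally show ?thesis by (simp add: right_diff_distrib RR')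
 qed
 moreover have "norm (- (Di * (Ri * (Q * (B * tp H0i))))) <= k * k * (k * k * (k * ((C1 + h^2) * (e^2 + g) * (k * k * (k * k)))))"
  unfolding norm_minus_cancel by (intro norm_mult_le nD nU nB' nH)
 ultimately show "norm (dg r (%j. 1 / d j) * (tp U * L) - dg r (%j. 1 / sqrt (d j)) * (Q * tp H0i)) <= core_const k * (e^2 + g)"
  using fin[of 9] by (simp add: Di_def Ri_def power_numeral_reduce mult_ac)
 have "norm (R * (Q * H0)) <= k * k * (k * (k * k * (k * k)))" by (intro norm_mult_le nD nU nH)
 then show "norm (dg r (%j. sqrt (d j)) * (Q * H0)) <= core_const k"
  using fin2[of 7] by (simp add: R_def power_numeral_reduce mult_ac)
 have "norm (Ri * (Q * tp H0i)) <= k * k * (k * (k * k * (k * k)))" by (intro norm_mult_le nD nU nH)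
 then show "norm (dg r (%j. 1 / sqrt (d j)) * (Q * tp H0i)) <= core_const k"
  using fin2[of 7] by (simp add: Ri_def power_numeral_reduce mult_ac)
qed

subsection \<open>Leave-out comparison of singular subspaces\<close>

lemma norm_mult_dg_lower:
 assumes f: "!!j. j < r ==> \<mu> <= \<bar>f j\<bar>" and "0 <= \<mu>" "A * idm r = A"
 shows "\<mu> * norm A <= norm (A * dg r f)"
proof -
 have "\<mu> * norm (idm r * tp A) <= norm (dg r f * tp A)"
  by (rule dg_lower) (use assms in auto)
 moreover have "idm r * tp A = tp A" using arg_cong[OF assms(3), of tp] by (simp add: tp_mult)
 moreover have "norm (dg r f * tp A) = norm (A * dg r f)" by (metis norm_tp tp_dg tp_mult)
 ultimately show ?thesis by simp
qed

text \<open>If \<^term>\<open>Vh\<close> almost spans an invariant subspace of \<^term>\<open>tp A * A\<close> containing its leading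
 eigenvalues, then an eigenbasis \<^term>\<open>V\<close> of the perturbation \<^term>\<open>tp A * A + x * tp x\<close> lies
 close to the span of \<^term>\<open>Vh\<close>, with an error governed by \<^term>\<open>J * x * tp x * V\<close> only.\<close>

lemma leave_out_bound:
 assumes V: "idm t * V = V" "V * idm r = V" "norm V <= K"
  and ev: "(tp A * A + x * tp x) * V = V * dg r f" and f: "!!j. j < r ==> \<mu> <= f j" and \<mu>: "0 < \<mu>"
  and Vh: "norm Vh <= K" "Vh * idm r = Vh" "idm t * Vh = Vh"
  and J: "J = idm t - Vh * tp Vh"
  and inv: "norm (J * (tp A * (A * Vh))) <= \<eta>'" and on: "norm (tp Vh * Vh - idm r) <= \<eta>"
  and AJ: "opb (A * J) c" and A: "opb A a" "A * idm t = A" and c: "2 * c^2 <= \<mu>"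
  and y: "norm (J * (x * (tp x * V))) <= y"
  and \<eta>: "c * (a * (K * (\<eta> * (K * K)))) <= K^2"
 shows "norm (J * V) <= 2 / \<mu> * (K^2 * (\<eta>' + 1) + y)"
proof -
 have k0: "0 <= K" using V(3) norm_ge_zero order_trans by blast
 have tJ: "tp J = J" by (simp add: J tp_simps)
 have Vdec: "V = Vh * (tp Vh * V) + J * V"
  by (simp add: J left_diff_distrib V mult.assoc)
 have tVV: "norm (tp Vh * V) <= K * K" by (intro norm_mult_le) (use Vh V in simp_all)
 \<comment> \<open>\<open>Vh\<close> is orthonormal only approximately, so \<open>J\<close> is a
   projection only up to the defect in the second term.\<close>
 have JJ: "J * V = J * (J * V) + Vh * ((idm r - tp Vh * Vh) * (tp Vh * V))"
 proof -
  have "Vh * (idm r * (tp Vh * V)) = Vh * (tp Vh * V)" by (simp add: assoc_eq[OF Vh(2)])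
  moreover have "idm t * (Vh * (tp Vh * V)) = Vh * (tp Vh * V)" by (rule assoc_eq[OF Vh(3)])
  ultimately show ?thesis
   by (simp add: J left_diff_distrib right_diff_distrib mult.assoc V dg_mult_assoc)
 qed
 have on': "norm (idm r - tp Vh * Vh) <= \<eta>" using on by (simp add: norm_minus_commute)
 have AJV: "norm (A * (J * V)) <= c * norm (J * V) + a * (K * (\<eta> * (K * K)))"
 proof -
  have eq: "A * (J * V) = (A * J) * (J * V) + A * (Vh * ((idm r - tp Vh * Vh) * (tp Vh * V)))"
   by (subst JJ) (simp add: distrib_left mult.assoc)
  show ?thesis
   unfolding eq by (intro norm_add_le norm_opb_le[OF AJ] norm_opb_le[OF A(1)] norm_mult_le Vh on' tVV order_refl)
 qed
 have "J * V * dg r f = J * (tp A * (A * Vh)) * (tp Vh * V) + tp (A * J) * (A * (J * V)) + J * (x * (tp x * V))"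
 proof -
  have "J * V * dg r f = J * (tp A * (A * V)) + J * (x * (tp x * V))"
   by (simp add: mult.assoc ev[symmetric] distrib_left distrib_right)
  also have "J * (tp A * (A * V)) = J * (tp A * (A * (Vh * (tp Vh * V)))) + J * (tp A * (A * (J * V)))"
   by (subst (1) Vdec) (simp add: distrib_left)
  finally show ?thesis by (simp add: tp_mult tJ mult.assoc)
 qed
 then have "norm (J * V * dg r f) <= \<eta>' * (K * K) + c * (c * norm (J * V) + a * (K * (\<eta> * (K * K)))) + y"
  by (simp only:) (intro norm_add_le norm_mult_le norm_opb_le[OF opb_tp[OF AJ]] inv tVV AJV y)
 moreover have "\<mu> * norm (J * V) <= norm (J * V * dg r f)"
  by (rule norm_mult_dg_lower) (use f \<mu> V in "auto simp: mult.assoc intro: order_trans[OF _ abs_ge_self]")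
 \<comment> \<open>The expansion returns \<open>c^2 * norm (J * V)\<close>; since
   \<open>2 * c^2 <= \<mu>\<close>, half of the left-hand side absorbs it.\<close>
 moreover have "2 * c^2 * norm (J * V) <= \<mu> * norm (J * V)" by (rule mult_right_mono[OF c]) simp
 ultimately have "\<mu> * norm (J * V) <= 2 * (\<eta>' * K^2 + c * (a * (K * (\<eta> * (K * K)))) + y)"
  by (simp add: power2_eq_square algebra_simps)
 also have "... <= 2 * (\<eta>' * K^2 + K^2 + y)" using \<eta> by simp
 finally show ?thesis using \<mu> by (simp add: field_simps)
qed

lemma rsvd_J:
 assumes R: "rsvd t r A V \<sigma>"
 defines "J \<equiv> idm t - V * tp V"
 shows "J * V = 0" "J * (tp A * (A * V)) = 0" "norm V = sqrt (real r)" "V * idm r = V"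
proof -
 from R have V: "idm t * V = V" "tp V * V = idm r" "tp A * (A * V) = V * dg r (%j. (\<sigma> j)^2)"
  by (auto simp: rsvd_def)
 show Vr: "V * idm r = V" "norm V = sqrt (real r)" using norm_orthonormal[OF V(2)] by simp_all
 show "J * V = 0" by (simp add: J_def left_diff_distrib V mult.assoc Vr)
 then show "J * (tp A * (A * V)) = 0" unfolding V by (simp add: mult.assoc[symmetric])
qed

text \<open>Near-optimal subspaces can be chosen from a countable set, which makes their choice measurable.\<close>

lemma leave_out_exists:
 assumes D: "!!A e. e > 0 ==> EX B:D. norm (A - B) < (e::real)"
  and A: "A = C1 * C2 + E" "C2 * idm t = C2" "E * idm t = E" "idm r * C2 = C2" and E: "opb E e" "0 < e"
  and Li: "Li * C1 = idm r" "norm Li <= l" "norm C1 <= l'" "0 < l" "0 < l'"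
  and r: "1 <= r" "r <= t" and \<eta>: "0 < \<eta>"
  and P: "!!V \<sigma>. rsvd t r A V \<sigma> ==> norm (P * V) < z"
 shows "EX B:D. let Vh = idm t * B * idm r; J = idm t - Vh * tp Vh in
  norm Vh < 2 * sqrt (real r) & norm (J * (tp A * (A * Vh))) < 1 & norm (tp Vh * Vh - idm r) < \<eta> &
  norm (C1 * (C2 * J)) < 3 * (l' * l) * e & norm (P * Vh) < z"
proof -
 have At: "A * idm t = A" by (simp add: A distrib_right mult.assoc)
 obtain V \<sigma> where R: "rsvd t r A V \<sigma>" using rsvd_exists[OF At r(2)] by blast
 note RJ = rsvd_J[OF R]
 from R have V: "idm t * V = V" "tp V * V = idm r" by (auto simp: rsvd_def)
 define J where "J = idm t - V * tp V"
 have AJ: "opb (A * J) e" unfolding J_def by (rule rsvd_remainder[OF R A(1) At A(4) E(1)])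
 have J1: "opb J 1"
 proof (rule opb_proj)
  show "tp J = J" by (simp add: J_def tp_simps)
  have "J * J = J * idm t - J * V * tp V" by (subst (2) J_def) (simp add: right_diff_distrib mult.assoc)
  moreover have "J * idm t = J" using arg_cong[OF V(1), of tp] by (simp add: J_def left_diff_distrib dg_mult mult.assoc tp_mult)
  ultimately show "J * J = J" using RJ(1) by (simp add: J_def)
 qed
 \<comment> \<open>On the complement of the leading singular vectors both \<open>A\<close> and
   \<open>E\<close> are bounded by \<open>e\<close>, hence so is the signal; \<open>Li\<close>
   cancels its left factor.\<close>
 have "C2 * J = Li * (A * J) - Li * (E * J)"
  by (simp add: A(1) distrib_right distrib_left mult.assoc assoc_eq[OF Li(1)] assoc_eq[OF A(4)])
 then have C2J: "norm (C2 * J) <= e * l + e * 1 * l"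
 proof (simp only:, intro norm_diff_le)
  have e0: "0 <= e" using E by simp
  show "norm (Li * (A * J)) <= e * l"
   using opbD_left[OF AJ, of Li] mult_left_mono[OF Li(2) e0] by linarith
  show "norm (Li * (E * J)) <= e * 1 * l"
   using opbD_left[OF opb_mult[OF E(1) J1], of Li] mult_left_mono[OF Li(2) e0] by simp
 qed
 have C: "norm (C1 * (C2 * J)) < 3 * (l' * l) * e"
 proof -
  have "norm (C1 * (C2 * J)) <= l' * (e * l + e * 1 * l)" by (intro norm_mult_le Li C2J)
  also have "... = 2 * (l' * l * e)" by (simp add: algebra_simps)
  also have "... < 3 * (l' * l) * e" using Li E by simp
  finally show ?thesis .
 qed
 define S where "S = {B. norm (idm t * B * idm r) < 2 * sqrt (real r)
   & norm ((idm t - (idm t * B * idm r) * tp (idm t * B * idm r)) * (tp A * (A * (idm t * B * idm r)))) < 1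
   & norm (tp (idm t * B * idm r) * (idm t * B * idm r) - idm r) < \<eta>
   & norm (C1 * (C2 * (idm t - (idm t * B * idm r) * tp (idm t * B * idm r)))) < 3 * (l' * l) * e
   & norm (P * (idm t * B * idm r)) < z}"
 \<comment> \<open>All conditions are strict, and the exact singular vectors satisfy them with room
   to spare: the factor 3 in place of 2, and 2 * sqrt r in place of sqrt r. They hold on a
   neighbourhood, which meets the dense set.\<close>
 have "open S" unfolding S_def
  by (intro open_Collect_conj open_Collect_less continuous_intros)
 moreover have "V : S"
  using RJ r \<eta> C P[OF R] by (simp add: S_def V J_def)
 ultimately obtain \<epsilon> where \<epsilon>: "\<epsilon> > 0" "ball V \<epsilon> <= S" using openE by blast
 obtain B where B: "B : D" "norm (V - B) < \<epsilon>" using D[OF \<epsilon>(1)] by blast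
 then have "B : S" using \<epsilon>(2) by (auto simp: dist_norm)
 then show ?thesis using B(1) unfolding S_def Let_def by blast
qed

section \<open>Translation of the matrices of the statement\<close>

lift_definition fm :: "real mat => fmat" is
 "%A i j. if i < dim_row A & j < dim_col A then A $$ (i, j) else 0"
proof -
 fix A :: "real mat"
 show "EX n. ALL i j. n <= i | n <= j --> (if i < dim_row A & j < dim_col A then A $$ (i, j) else 0) = 0"
  by (intro exI[of _ "max (dim_row A) (dim_col A)"]) auto
qed

lemma entry_fm: "entry (fm A) i j = (if i < dim_row A & j < dim_col A then A $$ (i, j) else 0)"
 by (simp add: fm.rep_eq)

definition fv :: "real vec => fmat" where "fv v = fm (mat_of_cols (dim_vec v) [v])"

lemma entry_fv: "entry (fv v) i j = (if i < dim_vec v & j = 0 then v $ i else 0)"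
 by (auto simp: fv_def entry_fm mat_of_cols_def)

lemma fm_inject: "dim_row A = dim_row B ==> dim_col A = dim_col B ==> fm A = fm B ==> A = B"
 by (rule eq_matI) (auto simp: fmat_eq_iff entry_fm split: if_splits)

lemma fm_idm: "A : carrier_mat n m ==> idm n * fm A = fm A" "A : carrier_mat n m ==> fm A * idm m = fm A"
 by (auto simp: fmat_eq_iff entry_dg_mult entry_mult_dg entry_fm)

lemma fm_mult: assumes "A : carrier_mat n k" "B : carrier_mat k m" shows "fm (A * B) = fm A * fm B"
proof (rule entry_eqI)
 fix i j
 have "entry (fm A * fm B) i j = (\<Sum>l<k. entry (fm A) i l * entry (fm B) l j)"
  by (rule entry_mult_gen) (use assms in "auto simp: entry_fm")
 also have "... = entry (fm (A * B)) i j"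
  using assms by (auto simp: entry_fm scalar_prod_def lessThan_atLeast0)
 finally show "entry (fm (A * B)) i j = entry (fm A * fm B) i j" ..
qed

lemma fm_transpose: "fm (A\<^sup>T) = tp (fm A)"
 by (auto simp: fmat_eq_iff entry_fm)

lemma fm_add: "A : carrier_mat n m ==> B : carrier_mat n m ==> fm (A + B) = fm A + fm B"
 by (auto simp: fmat_eq_iff entry_fm)

lemma fm_minus: "A : carrier_mat n m ==> B : carrier_mat n m ==> fm (A - B) = fm A - fm B"
 by (auto simp: fmat_eq_iff entry_fm)

lemma fm_smult: "fm (c \<cdot>\<^sub>m A) = c *\<^sub>R fm A"
 by (auto simp: fmat_eq_iff entry_fm)

lemma fm_one: "fm (1\<^sub>m n) = idm n"
 by (auto simp: fmat_eq_iff entry_fm)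

lemma fm_diag: "fm (mat_diag n f) = dg n f"
 by (auto simp: fmat_eq_iff entry_fm mat_diag_def)

lemma norm_fm: "norm (fm A) = frobenius_norm A"
proof -
 have "inner (fm A) (fm A) = (\<Sum>i<dim_row A. \<Sum>j<dim_col A. entry (fm A) i j * entry (fm A) i j)"
  by (rule inner_fmat_gen) (auto simp: entry_fm)
 also have "... = (\<Sum>i<dim_row A. \<Sum>j<dim_col A. (A $$ (i, j))^2)"
  by (intro sum.cong refl) (auto simp: entry_fm power2_eq_square)
 finally show ?thesis by (simp add: norm_eq_sqrt_inner frobenius_norm_def)
qed

lemma inner_fv: assumes "v : carrier_vec n" "w : carrier_vec n" shows "inner (fv v) (fv w) = v \<bullet> w"
proof -
 have "inner (fv v) (fv w) = (\<Sum>i<n. \<Sum>j<Suc 0. entry (fv v) i j * entry (fv w) i j)"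
  by (rule inner_fmat_gen) (use assms in "auto simp: entry_fv")
 then show ?thesis using assms by (simp add: entry_fv scalar_prod_def lessThan_atLeast0)
qed

lemma norm_fv: "norm (fv v) = vec_l2_norm v"
 by (simp add: norm_eq_sqrt_inner vec_l2_norm_def inner_fv[OF carrier_vec_dim_vec carrier_vec_dim_vec])

lemma fv_mult: assumes "A : carrier_mat n m" "v : carrier_vec m" shows "fv (A *\<^sub>v v) = fm A * fv v"
proof (rule entry_eqI)
 fix i j
 have "entry (fm A * fv v) i j = (\<Sum>l<m. entry (fm A) i l * entry (fv v) l j)"
  by (rule entry_mult_gen) (use assms in "auto simp: entry_fm")
 also have "... = entry (fv (A *\<^sub>v v)) i j"
  using assms by (auto simp: entry_fm entry_fv scalar_prod_def lessThan_atLeast0)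
 finally show "entry (fv (A *\<^sub>v v)) i j = entry (fm A * fv v) i j" ..
qed

lemma fv_minus: "v : carrier_vec n ==> w : carrier_vec n ==> fv (v - w) = fv v - fv w"
 by (auto simp: fmat_eq_iff entry_fv)

lemma fv_row: assumes "A : carrier_mat n m" "i < n" shows "fv (row A i) = tp (fm A) * un i 0"
 using assms by (auto simp: fmat_eq_iff entry_fv entry_mult_un entry_fm)

lemma fv_surj: assumes "idm n * w = w" "w * un 0 0 = w" shows "EX v:carrier_vec n. fv v = w"
proof
 have z: "entry w i j = 0" if "~ (i < n & j = 0)" for i j
  using that arg_cong[OF assms(1), of "%A. entry A i j"] arg_cong[OF assms(2), of "%A. entry A i j"]
  by (auto simp: entry_dg_mult entry_mult_un split: if_splits)
 show "fv (vec n (%i. entry w i 0)) = w" using z by (auto simp: fmat_eq_iff entry_fv)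
qed simp

lemma fm_surj: assumes "idm n * A = A" "A * idm m = A" shows "EX B:carrier_mat n m. fm B = A"
proof
 have z: "entry A i j = 0" if "~ (i < n & j < m)" for i j
  using that arg_cong[OF assms(1), of "%A. entry A i j"] arg_cong[OF assms(2), of "%A. entry A i j"]
  by (auto simp: entry_dg_mult entry_mult_dg split: if_splits)
 show "fm (Matrix.mat n m (%(i, j). entry A i j)) = A" using z by (auto simp: fmat_eq_iff entry_fm)
qed simp

text \<open>A nonzero column is scaled to length one to be compared with the supremum;
  \<open>idm m\<close> discards the rows of a test matrix that \<open>A\<close> cannot see.\<close>

lemma spectral_norm_opb:
 assumes A: "A : carrier_mat n m"
 shows "opb (fm A) (spectral_norm A)" "spectral_norm A <= a \<longleftrightarrow> opb (fm A) a" "0 <= spectral_norm A"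
proof -
 let ?S = "{v : carrier_vec (dim_col A). vec_l2_norm v <= 1}"
 have Sne: "0\<^sub>v m : ?S" using A by (simp add: vec_l2_norm_def)
 have n: "vec_l2_norm (A *\<^sub>v v) = norm (fm A * fv v)" if "v : carrier_vec m" for v
  using fv_mult[OF A that] norm_fv[of "A *\<^sub>v v"] by simp
 have bdd: "bdd_above ((%v. vec_l2_norm (A *\<^sub>v v)) ` ?S)"
 proof (rule bdd_aboveI2)
  fix v assume v: "v : ?S"
  have "norm (fm A * fv v) <= norm (fm A) * norm (fv v)" by (rule norm_mult_ineq)
  also have "... <= norm (fm A) * 1" using v by (intro mult_left_mono) (simp_all add: norm_fv)
  finally show "vec_l2_norm (A *\<^sub>v v) <= norm (fm A)" using n v A by simp
 qed
 show nn: "0 <= spectral_norm A"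
  unfolding spectral_norm_def by (rule cSUP_upper2[OF bdd Sne]) (use n[of "0\<^sub>v m"] in simp)
 have imp: "opb (fm A) a" if a: "spectral_norm A <= a" for a
 proof -
  have "norm (fm A * (idm m * W)) <= a * norm (idm m * (idm m * W))" for W
  proof (rule col_bound)
   fix W assume W: "W * un 0 0 = W"
   define w where "w = idm m * W"
   have w: "idm m * w = w" "w * un 0 0 = w" by (simp_all add: w_def dg_mult_assoc mult.assoc W)
   have "norm (fm A * w) <= a * norm w"
   proof (cases "w = 0")
   case False
   have "EX v:carrier_vec m. fv v = (1 / norm w) *\<^sub>R w" by (rule fv_surj) (simp_all add: w)
   then obtain v where v: "v : carrier_vec m" "fv v = (1 / norm w) *\<^sub>R w" by blast
   have "v : ?S" using v A False norm_fv[of v] by simp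
   then have "vec_l2_norm (A *\<^sub>v v) <= spectral_norm A" unfolding spectral_norm_def by (rule cSUP_upper[OF _ bdd])
   then have "norm (fm A * ((1 / norm w) *\<^sub>R w)) <= a" using n[OF v(1)] v(2) a by simp
   then show ?thesis using False by (simp add: field_simps)
   qed simp
   then show "norm (fm A * (idm m * W)) <= a * norm (idm m * (idm m * W))"
   by (simp add: w_def dg_mult_assoc)
  qed (use nn a in simp)
  moreover have "fm A * (idm m * W) = fm A * W" for W using assoc_eq[OF fm_idm(2)[OF A]] .
  moreover have "norm (idm m * (idm m * W)) <= 1 * norm W" for W
   unfolding dg_mult_assoc by (intro opbD opb_proj) (simp_all add: dg_mult)
  moreover have "0 <= a" using nn a by simp
  ultimately show ?thesis
   unfolding opb_def by (metis mult_1 mult_left_mono order_trans)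
 qed
 show "opb (fm A) (spectral_norm A)" by (rule imp) simp
 show "spectral_norm A <= a \<longleftrightarrow> opb (fm A) a"
 proof
  assume o: "opb (fm A) a"
  show "spectral_norm A <= a" unfolding spectral_norm_def
  proof (rule cSUP_least)
   fix v assume v: "v : ?S"
   have "norm (fm A * fv v) <= a * norm (fv v)" by (rule opbD[OF o])
   also have "... <= a * 1" using v opb_nonneg[OF o] by (intro mult_left_mono) (simp_all add: norm_fv)
   finally show "vec_l2_norm (A *\<^sub>v v) <= a" using n v A by simp
  qed (use Sne in blast)
 qed (rule imp)
qed

text \<open>Stacking two matrices becomes adding the shifted lower one.\<close>
definition shift :: "nat => nat => fmat" where "shift n t = (\<Sum>i<t. un (n + i) i)"

lemma entry_shift: "entry (shift n t) i j = (if i = n + j & j < t then 1 else 0)"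
proof -
 have "entry (shift n t) i j = (\<Sum>k<t. if k = j then (if i = n + j then 1 else 0) else 0)"
  unfolding shift_def entry_sum entry_un by (intro sum.cong) auto
 also have "... = (if i = n + j & j < t then 1 else 0)" by (subst sum.delta) auto
 finally show ?thesis .
qed

lemma entry_shift_mult: "entry (shift n t * A) i j = (if n <= i & i < n + t then entry A (i - n) j else 0)"
proof -
 have "entry (shift n t * A) i j = (\<Sum>k<t. entry (shift n t) i k * entry A k j)"
  by (rule entry_mult_gen) (simp add: entry_shift)
 also have "... = (\<Sum>k<t. if k = i - n then (if n <= i then entry A (i - n) j else 0) else 0)"
  by (intro sum.cong refl) (auto simp: entry_shift)
 also have "... = (if n <= i & i < n + t then entry A (i - n) j else 0)" by (subst sum.delta) auto
 finally show ?thesis .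
qed

lemma shift_isometry: "tp (shift n t) * shift n t = idm t"
proof (rule entry_eqI)
 fix i j
 have "entry (tp (shift n t) * shift n t) i j = (\<Sum>k<n + t. entry (shift n t) k i * entry (shift n t) k j)"
  by (subst entry_mult_gen[of "n + t"]) (auto simp: entry_shift)
 also have "... = (\<Sum>k<n + t. if k = n + i then (if i = j & i < t then 1 else 0) else 0)"
  by (intro sum.cong refl) (auto simp: entry_shift)
 also have "... = entry (idm t) i j" by (subst sum.delta) auto
 finally show "entry (tp (shift n t) * shift n t) i j = entry (idm t) i j" .
qed

lemma shift_tp_mult: assumes "idm n * A = A" shows "tp (shift n t) * A = 0"
proof (rule entry_eqI)
 fix i j
 have z: "entry A k j = 0" if "n <= k" for k
  using that arg_cong[OF assms, of "%A. entry A k j"] by (simp add: entry_dg_mult)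
 have "entry (tp (shift n t) * A) i j = (\<Sum>k<n. entry (shift n t) k i * entry A k j)"
  by (subst entry_mult_gen[of n]) (auto simp: z)
 then show "entry (tp (shift n t) * A) i j = entry 0 i j" by (simp add: entry_shift)
qed

lemma fm_append_rows:
 assumes "A : carrier_mat n m" "B : carrier_mat t m"
 shows "fm (A @\<^sub>r B) = fm A + shift n t * fm B"
 using assms by (auto simp: fmat_eq_iff entry_fm entry_shift_mult append_rows_def)

text \<open>A left inverse is a right inverse only at equal sizes; both factors are confined to
  \<open>n\<close> rows and columns, so the result for square matrices applies.\<close>

lemma right_inverse_square:
 assumes "idm n * V = V" "V * idm n = V" "W * V = idm n" "idm n * W = W" "W * idm n = W"
 shows "V * W = idm n"
proof -
 obtain A B where AB: "A : carrier_mat n n" "fm A = V" "B : carrier_mat n n" "fm B = W"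
  using fm_surj[OF assms(1,2)] fm_surj[OF assms(4,5)] by blast
 have "B * A = 1\<^sub>m n"
  by (rule fm_inject) (use AB assms(3) in "simp_all add: fm_mult[of _ n n _ n] fm_one")
 then have "A * B = 1\<^sub>m n" by (rule mat_mult_left_right_inverse[OF AB(3,1)])
 then have "fm (A * B) = idm n" by (simp add: fm_one)
 then show ?thesis using AB by (simp add: fm_mult[of _ n n _ n])
qed

lemma mat_inverse_SomeI:
 assumes "(A :: real mat) : carrier_mat n n" "B : carrier_mat n n" "A * B = 1\<^sub>m n"
 shows "mat_inverse A = Some B"
proof -
 have BA: "B * A = 1\<^sub>m n" by (rule mat_mult_left_right_inverse[OF assms])
 show ?thesis
 proof (cases "mat_inverse A")
  case None
  have "A : Units (ring_mat TYPE(real) n ())"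
   using assms BA by (auto simp: Units_def ring_mat_def)
  then show ?thesis using mat_inverse(1)[OF assms(1) None, of "()"] by simp
 next
  case (Some C)
  then have C: "A * C = 1\<^sub>m n" "C : carrier_mat n n" using mat_inverse(2)[OF assms(1)] by auto
  have "B * (A * C) = (B * A) * C" using assms C by (simp add: assoc_mult_mat)
  then have "B = C" using C BA assms by simp
  then show ?thesis using Some by simp
 qed
qed

lemma mat_inverse_SomeD:
 assumes "mat_inverse (A :: real mat) = Some B" "A : carrier_mat n n"
 shows "B : carrier_mat n n" "fm A * fm B = idm n" "fm B * fm A = idm n"
 using mat_inverse(2)[OF assms(2,1)] assms(2) by (auto simp: fm_one fm_mult[of _ n n _ n, symmetric])

text \<open>The pseudoinverse, built from a right singular basis. \<open>A * B\<close> is then the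
  orthogonal projection onto the range of \<open>A\<close>, which yields the operator bound 1 / c
  and from it the Frobenius bound.\<close>

lemma left_inverse_exists:
 assumes A: "A * idm r = A" and low: "!!W. c * norm (idm r * W) <= norm (A * W)" and c: "0 < c"
 shows "EX B. B * A = idm r & idm r * B = B & norm B <= sqrt (real r) / c & tp (A * B) = A * B & (A * B) * (A * B) = A * B"
proof -
 obtain V y where R: "rsvd r r A V y" using rsvd_exists[OF A order_refl] by blast
 then have V: "idm r * V = V" "tp V * V = idm r" "tp A * (A * V) = V * dg r (%j. (y j)^2)"
  by (auto simp: rsvd_def)
 have Vr: "V * idm r = V" by (rule norm_orthonormal(2)[OF V(2)])
 have tV: "idm r * tp V = tp V" "tp V * idm r = tp V"
  using arg_cong[OF Vr, of tp] arg_cong[OF V(1), of tp] by (simp_all add: tp_mult)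
 have VV: "V * tp V = idm r" by (rule right_inverse_square) (use V Vr tV in simp_all)
 have y: "c <= y j" if "j < r" for j
 proof -
  have "c - 0 <= y j"
  proof (rule rsvd_lower[OF R, where M = A and E = 0 and B = "idm r"])
   fix W assume "idm r * W = W"
   then show "c * norm (idm r * W) <= norm (A * (idm r * W))" using low[of W] by simp
  qed (use that in "simp_all add: opb_def dg_mult")
  then show ?thesis by simp
 qed
 define D where "D = dg r (%j. 1 / (y j)^2)"
 have DD: "dg r (%j. (y j)^2) * D = idm r" "D * dg r (%j. (y j)^2) = idm r"
  unfolding D_def dg_mult using y c by (auto intro!: dg_cong) (metis less_le_not_le not_less)+
 define B where "B = V * (D * (tp V * tp A))"
 have AA: "tp A * A = V * (dg r (%j. (y j)^2) * tp V)"
 proof -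
  have "tp A * A = tp A * (A * (V * tp V))" by (simp add: VV A)
  then show ?thesis by (metis V(3) mult.assoc)
 qed
 have BA: "B * A = idm r"
 proof -
  have "B * A = V * (D * (tp V * (V * (dg r (%j. (y j)^2) * tp V))))" by (simp add: B_def mult.assoc AA)
  also have "... = V * tp V"
   by (simp add: assoc_eq[OF V(2)] assoc_eq[OF DD(2)] dg_mult_assoc tV)
  finally show ?thesis by (simp add: VV)
 qed
 have IB: "idm r * B = B" by (simp add: B_def assoc_eq[OF V(1)])
 have sym: "tp (A * B) = A * B" by (simp add: B_def tp_mult mult.assoc D_def)
 have idem: "(A * B) * (A * B) = A * B" by (simp add: mult.assoc assoc_eq[OF BA] IB)
 have "opb B (1 / c)" unfolding opb_def
 proof
  fix W
  have "c * norm (idm r * (B * W)) <= norm (A * (B * W))" by (rule low)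
  also have "... <= 1 * norm W" using opbD[OF opb_proj[OF sym idem], of W] by (simp add: mult.assoc)
  finally show "norm (B * W) <= 1 / c * norm W" using c by (simp add: assoc_eq[OF IB] field_simps)
 qed
 then have "norm (idm r * B) <= 1 / c * norm (idm r)" by (rule opbD_left)
 then have "norm B <= sqrt (real r) / c" by (simp add: IB norm_idm)
 then show ?thesis using BA IB sym idem by blast
qed

section \<open>Deterministic analysis of one outcome\<close>

lemma is_top_svd_fm:
 assumes "is_top_svd r A U d V" "A : carrier_mat n t"
 shows "U : carrier_mat n r" "V : carrier_mat t r" "tp (fm U) * fm U = idm r" "tp (fm V) * fm V = idm r"
  and "fm A * fm V = fm U * dg r d" "tp (fm A) * fm U = fm V * dg r d" "rsvd t r (fm A) (fm V) d"
  and "r <= min n t"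
proof -
 define k where "k = min n t"
 obtain U' s V' where rk: "r <= k" and svd: "is_svd k A U' s V'"
  and UV: "U = first_cols r U'" "V = first_cols r V'" and ds: "!!j. j < r ==> d j = s j"
  using assms unfolding is_top_svd_def k_def by auto
 show "r <= min n t" using rk by (simp add: k_def)
 have c: "U' : carrier_mat n k" "V' : carrier_mat t k" "U'\<^sup>T * U' = 1\<^sub>m k" "V'\<^sup>T * V' = 1\<^sub>m k"
  and s: "!!j. j < k ==> 0 <= s j" "!!i j. i <= j ==> j < k ==> s j <= s i" and A: "A = U' * mat_diag k s * V'\<^sup>T"
  using svd assms(2) unfolding is_svd_def by auto
 show UVc: "U : carrier_mat n r" "V : carrier_mat t r" using c by (simp_all add: UV first_cols_def)
 have fU: "fm U = fm U' * idm r" "fm V = fm V' * idm r"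
  using c rk by (auto simp: UV first_cols_def fmat_eq_iff entry_fm entry_mult_dg)
 have cU: "tp (fm U') * fm U' = idm k" "tp (fm V') * fm V' = idm k"
  using c(1,2) arg_cong[OF c(3), of fm] arg_cong[OF c(4), of fm]
  by (simp_all add: fm_mult[of _ k n _ k] fm_mult[of _ k t _ k] fm_transpose fm_one)
 have fA: "fm A = fm U' * (dg k s * tp (fm V'))"
  unfolding A using c
  by (simp add: fm_mult[of _ n k _ t] fm_mult[of _ n k _ k] fm_transpose fm_diag mult.assoc)
 have kr: "idm k * idm r = idm r" "idm r * idm k = idm r" "idm r * idm r = idm r" using rk by (simp_all add: idm_mult_idm)
 have ks: "dg k s * idm r = dg r s" "idm r * dg r d = dg r d" "dg r s = dg r d"
  using rk ds by (auto simp: fmat_eq_iff entry_mult_dg)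
 note ass = assoc_eq[OF cU(1)] assoc_eq[OF cU(2)] assoc_eq[OF kr(1)] assoc_eq[OF kr(2)] assoc_eq[OF kr(3)]
 show orth: "tp (fm U) * fm U = idm r" "tp (fm V) * fm V = idm r"
  by (simp_all add: fU tp_mult mult.assoc ass kr)
 show AV: "fm A * fm V = fm U * dg r d" and AU: "tp (fm A) * fm U = fm V * dg r d"
  by (simp_all add: fU fA tp_mult mult.assoc ass kr ks)
 show "rsvd t r (fm A) (fm V) d" unfolding rsvd_def
 proof (intro conjI allI impI)
  show "idm t * fm V = fm V" by (rule fm_idm(1)[OF UVc(2)])
  show "tp (fm A) * (fm A * fm V) = fm V * dg r (%j. (d j)^2)"
   unfolding AV by (simp add: mult.assoc[symmetric] AU) (simp add: mult.assoc dg_mult power2_eq_square)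
  fix j assume "j < r" then show "0 <= d j" using s(1) ds rk by auto
 next
  fix i j :: nat assume "i <= j" "j < r" then show "d j <= d i" using s(2)[of i j] ds rk by auto
 next
  fix j W assume j: "j < r" and W: "idm t * W = W" "W * un 0 0 = W" "idm j * (tp (fm V) * W) = 0"
  \<comment> \<open>On a vector orthogonal to the first \<open>j\<close> singular vectors the first
    \<open>j\<close> diagonal entries may be set to zero; all others are at most
    \<open>d j\<close>.\<close>
  define s' where "s' = (%i. if i < j then 0 else s i)"
  have z: "idm j * (tp (fm V') * W) = 0"
   using W(3) j by (simp add: fU tp_mult mult.assoc assoc_eq[OF idm_mult_idm] min_def)
  have e: "dg k s = dg k s' + dg k s * idm j"
   by (auto simp: fmat_eq_iff entry_mult_dg s'_def)
  have "dg k s * (tp (fm V') * W) = dg k s' * (tp (fm V') * W)"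
   using arg_cong[OF e, of "%B. B * (tp (fm V') * W)"] by (simp add: distrib_right mult.assoc z)
  then have 1: "fm A * W = fm U' * (dg k s' * (tp (fm V') * W))" by (simp add: fA mult.assoc)
  have opU: "opb (fm U') 1" "opb (fm V') 1"
  proof -
   have "norm (A * W) <= 1 * norm W" if "tp A * A = idm k" for A W
   proof -
   have "inner (A * W) (A * W) = inner (idm k * W) (idm k * W)"
   using that by (simp add: inner_mult_left mult.assoc[symmetric] dg_mult)
   then have "norm (A * W) = norm (idm k * W)" by (simp add: norm_eq_sqrt_inner)
   also have "... <= 1 * norm W" by (intro opbD opb_proj) (simp_all add: dg_mult)
   finally show ?thesis .
   qed
   then show "opb (fm U') 1" "opb (fm V') 1" using cU by (auto simp: opb_def)
  qed
  have "norm (fm A * W) <= 1 * (d j * (1 * norm W))"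
   unfolding 1
  proof (rule norm_opb_le[OF opU(1) norm_opb_le])
   show "opb (dg k s') (d j)"
   by (rule opb_dg) (use s ds j rk in "auto simp: s'_def")
   show "norm (tp (fm V') * W) <= 1 * norm W" by (rule opbD[OF opb_tp[OF opU(2)]])
  qed
  then show "norm (fm A * W) <= d j * norm W" by simp
 qed (use orth in auto)
qed

text \<open>One outcome on which all random bounds hold. \<open>p\<close> and \<open>q\<close> are
  the sizes of loadings and factors, \<open>sqrt m\<close> is that of the noise, and
  \<open>K\<close> collects all constants. The factor \<open>2048 * K^16\<close> in
  \<open>small\<close> is dictated by the absorption step of the leave-out bound, see
  \<open>leave_out_numeric\<close>.\<close>

locale pc_outcome =
 fixes N T r :: nat and L F E U V :: "real mat" and d :: "nat => real" and p q m K :: real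
 assumes dims: "L : carrier_mat N r" "F : carrier_mat T r" "E : carrier_mat N T"
  and PC: "is_top_svd r (L * F\<^sup>T + E) U d V"
  and r1: "1 <= r" and k1: "1 <= K" and rk: "sqrt (real r) <= K"
  and p1: "1 <= p" and qT: "q = sqrt (real T)" and q1: "1 <= q" and qm: "q^2 <= m"
  and L_low: "!!W. p / K * norm (idm r * W) <= norm (fm L * W)" and L_up: "opb (fm L) (K * p)"
  and F_low: "!!W. q / K * norm (idm r * W) <= norm (fm F * W)" and F_up: "opb (fm F) (K * q)"
  and E_up: "opb (fm E) (K * sqrt m)"
  and small: "2048 * K^16 * m <= (p * q)^2"
begin

abbreviation "s \<equiv> p * q"
abbreviation "X \<equiv> fm L * tp (fm F) + fm E"

lemma pos: "0 < K" "0 < p" "0 < q" "0 < s" "0 < m" "1 <= s" "1 <= m"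
proof -
 show "0 < K" "0 < p" "0 < q" "0 < s" using k1 p1 q1 by simp_all
 have "1 * 1 <= q * q" using q1 by (intro mult_mono) auto
 then show "1 <= m" using qm by (simp add: power2_eq_square)
 then show "0 < m" by simp
 have "1 * 1 <= p * q" using p1 q1 by (intro mult_mono) auto
 then show "1 <= s" by simp
qed

lemma sqrt_m: "sqrt m <= s" "q <= sqrt m" "45 * K^8 * sqrt m <= s"
proof -
 have k: "1 <= K^8" "1 <= K^16" using k1 by simp_all
 \<comment> \<open>45^2 = 2025 is the largest square below 2048.\<close>
 have "(45 * K^8 * sqrt m)^2 = 2025 * K^16 * m" using pos by (simp add: power_mult_distrib flip: power_mult)
 also have "... <= 2048 * K^16 * m" using pos by simp
 also note small
 finally show 1: "45 * K^8 * sqrt m <= s" by (rule power2_le_imp_le) (use pos in simp)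
 have "1 * sqrt m <= 45 * K^8 * sqrt m" using k by (intro mult_right_mono) (use pos in auto)
 then show "sqrt m <= s" using 1 by simp
 show "q <= sqrt m" using qm pos by (simp add: real_le_rsqrt)
qed

lemma X_fm: "fm (L * F\<^sup>T + E) = X" "L * F\<^sup>T + E : carrier_mat N T"
 using dims by (simp_all add: fm_add[of _ N T] fm_mult[of _ N r _ T] fm_transpose)

lemmas svd = is_top_svd_fm[OF PC X_fm(2), unfolded X_fm(1)]

lemma LF_idm: "fm L * idm r = fm L" "idm N * fm L = fm L" "fm F * idm r = fm F" "idm T * fm F = fm F"
 "idm N * fm E = fm E" "fm E * idm T = fm E"
 using fm_idm[OF dims(1)] fm_idm[OF dims(2)] fm_idm[OF dims(3)] by simp_all

lemma LF_tp_idm: "idm r * tp (fm L) = tp (fm L)" "tp (fm L) * idm N = tp (fm L)"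
 "idm r * tp (fm F) = tp (fm F)" "tp (fm F) * idm T = tp (fm F)"
 using LF_idm[THEN arg_cong[where f = tp]] by (simp_all add: tp_mult)

lemma UV_norm: "norm (fm U) <= K" "norm (fm V) <= K" "norm (tp (fm U)) <= K" "norm (tp (fm V)) <= K"
 using norm_orthonormal(1)[OF svd(3)] norm_orthonormal(1)[OF svd(4)] rk by simp_all

lemma UV_idm: "fm U * idm r = fm U" "fm V * idm r = fm V" "idm N * fm U = fm U" "idm T * fm V = fm V"
 using norm_orthonormal(2)[OF svd(3)] norm_orthonormal(2)[OF svd(4)] fm_idm(1)[OF svd(1)] fm_idm(1)[OF svd(2)] by simp_all

lemma LF_norm: "norm (fm L) <= K^2 * p" "norm (fm F) <= K^2 * q"
proof -
 have "norm (fm L * idm r) <= K * p * K" "norm (fm F * idm r) <= K * q * K"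
  by (intro norm_opb_le L_up F_up, simp add: norm_idm rk)+
 then show "norm (fm L) <= K^2 * p" "norm (fm F) <= K^2 * q"
  by (simp_all add: LF_idm power2_eq_square mult_ac)
qed

text \<open>The square of \<open>norm (A * W)\<close> is at most
  \<open>norm W * norm (tp A * (A * W))\<close>, and \<open>norm W\<close> is at most
  \<open>norm (A * W) / c\<close>.\<close>

lemma gram_lower:
 assumes low: "!!W. c * norm (idm r * W) <= norm (A * W)" and A: "A * idm r = A" and c: "0 < c" and W: "idm r * W = W"
 shows "c * norm (A * W) <= norm (tp A * (A * W))"
proof (cases "W = 0")
 case False
 have "(norm (A * W))^2 = inner W (tp A * (A * W))" by (simp add: power2_norm_eq_inner inner_mult_left)
 also have "... <= norm W * norm (tp A * (A * W))" by (rule norm_cauchy_schwarz)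
 finally have 1: "norm (A * W) * norm (A * W) <= norm W * norm (tp A * (A * W))" by (simp add: power2_eq_square)
 have 2: "c * norm W <= norm (A * W)" using low[of W] W by simp
 have "(c * norm W) * norm (A * W) <= norm (A * W) * norm (A * W)" using 2 by (rule mult_right_mono) simp
 then have "norm W * (c * norm (A * W)) <= norm W * norm (tp A * (A * W))" using 1 by (simp add: mult_ac)
 then show ?thesis using False by simp
qed simp

lemma M_low: "idm r * W = W ==> s / K^2 * norm (fm F * W) <= norm (fm L * tp (fm F) * (fm F * W))"
 "idm r * W = W ==> s / K^2 * norm (fm L * W) <= norm (fm F * tp (fm L) * (fm L * W))"
proof -
 assume W: "idm r * W = W"
 have "q / K * norm (fm F * W) <= norm (tp (fm F) * (fm F * W))"
  by (rule gram_lower[OF F_low LF_idm(3) _ W]) (use pos in simp)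
 then have "p / K * (q / K * norm (fm F * W)) <= p / K * norm (idm r * (tp (fm F) * (fm F * W)))"
  using pos by (intro mult_left_mono) (simp_all add: assoc_eq[OF LF_tp_idm(3)])
 also have "... <= norm (fm L * (tp (fm F) * (fm F * W)))" by (rule L_low)
 finally show "s / K^2 * norm (fm F * W) <= norm (fm L * tp (fm F) * (fm F * W))"
  by (simp add: power2_eq_square mult.assoc)
 have "p / K * norm (fm L * W) <= norm (tp (fm L) * (fm L * W))"
  by (rule gram_lower[OF L_low LF_idm(1) _ W]) (use pos in simp)
 then have "q / K * (p / K * norm (fm L * W)) <= q / K * norm (idm r * (tp (fm L) * (fm L * W)))"
  using pos by (intro mult_left_mono) (simp_all add: assoc_eq[OF LF_tp_idm(1)])
 also have "... <= norm (fm F * (tp (fm L) * (fm L * W)))" by (rule F_low)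
 finally show "s / K^2 * norm (fm L * W) <= norm (fm F * tp (fm L) * (fm L * W))"
  by (simp add: power2_eq_square mult.assoc mult.commute[of p])
qed

lemma inj: "idm r * W = W ==> fm F * W = 0 ==> W = 0" "idm r * W = W ==> fm L * W = 0 ==> W = 0"
 using F_low[of W] L_low[of W] pos by (simp_all add: divide_le_0_iff mult_le_0_iff)

lemma M_up: "opb (fm L * tp (fm F)) (K^2 * s)"
 using opb_mult[OF L_up opb_tp[OF F_up]] by (simp add: power2_eq_square mult_ac)

text \<open>Weyl's inequality: the singular values of the signal lie between s / K^2 and K^2 * s,
  and the noise is at most half of the lower bound.\<close>

lemma d_bounds: assumes "j < r" shows "s / (2 * K^2) <= d j" "d j <= 2 * K^2 * s"
proof -
 have e: "K * sqrt m <= s / (2 * K^2)"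
 proof -
  have "2 * K^3 * sqrt m <= 45 * K^8 * sqrt m"
   using pos k1 by (intro mult_right_mono mult_mono power_increasing) auto
  then have "2 * K^3 * sqrt m <= s" using sqrt_m(3) by linarith
  then show ?thesis using pos by (simp add: field_simps power_numeral_reduce)
 qed
 have "s / K^2 - K * sqrt m <= d j"
  by (rule rsvd_lower[OF svd(7) refl E_up LF_idm(4,3) M_low(1) inj(1) assms])
 then show "s / (2 * K^2) <= d j" using e by (simp add: field_simps)
 have "s / (2 * K^2) <= K^2 * s"
 proof -
  have "1 <= K^4" using k1 by simp
  then have "s * 1 <= s * (2 * K^4)" using pos by (intro mult_left_mono) auto
  then show ?thesis using pos by (simp add: field_simps power_numeral_reduce)
 qed
 moreover have "d j <= K^2 * s + K * sqrt m"
  by (rule rsvd_upper[OF svd(7) opb_plus[OF M_up E_up] assms])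
 ultimately show "d j <= 2 * K^2 * s" using e by simp
qed

lemma d_pos: "j < r ==> 0 < d j"
 using d_bounds(1)[of j] pos by (meson divide_pos_pos less_le_trans mult_pos_pos zero_less_numeral zero_less_power)

text \<open>The matrix \<open>H\<close> is constrained only where some matching matrix exists, so
  existence has to be proved on the good outcomes before anything can be said about the given
  \<open>H\<close>.\<close>

lemma matching_exists: "EX H. is_matching_matrix r T L F U d V H"
proof -
 define M0 where "M0 = fm L * tp (fm F)"
 have tM: "tp M0 = fm F * tp (fm L)" by (simp add: M0_def tp_mult)
 have rT: "r <= T" using svd(8) by simp
 have MT: "M0 * idm T = M0" by (simp add: M0_def mult.assoc LF_tp_idm)
 obtain V0 y where R: "rsvd T r M0 V0 y" using rsvd_exists[OF MT rT] by blast
 then have V0: "idm T * V0 = V0" "tp V0 * V0 = idm r" "tp M0 * (M0 * V0) = V0 * dg r (%j. (y j)^2)"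
  and dec: "!!i j. i <= j ==> j < r ==> y j <= y i"
  by (auto simp: rsvd_def)
 have opb0: "opb 0 0" by (simp add: opb_def)
 have "s / K^2 <= y j" if "j < r" for j
 proof -
  have "s / K^2 - 0 <= y j"
   by (rule rsvd_lower[OF R _ opb0 LF_idm(4,3) M_low(1) inj(1) that]) (simp_all only: M0_def add_0_right)
  then show ?thesis by simp
 qed
 then have y: "0 < y j" if "j < r" for j
  using that pos by (meson divide_pos_pos less_le_trans zero_less_power)
 \<comment> \<open>The remainder bound with zero noise: the signal has rank at most
   \<open>r\<close>, so \<open>V0\<close> captures all of it.\<close>
 have "opb (M0 * (idm T - V0 * tp V0)) 0"
  by (rule rsvd_remainder[OF R _ MT LF_tp_idm(3) opb0]) (simp add: M0_def)
 then have rem: "M0 * V0 * tp V0 = M0"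
 proof -
  assume "opb (M0 * (idm T - V0 * tp V0)) 0"
  then have "norm (M0 * (idm T - V0 * tp V0) * idm T) <= 0 * norm (idm T)" by (rule opbD)
  then have "M0 * (idm T - V0 * tp V0) * idm T = 0" by simp
  moreover have "tp V0 * idm T = tp V0" using arg_cong[OF V0(1), of tp] by (simp add: tp_mult)
  ultimately show ?thesis by (simp add: right_diff_distrib left_diff_distrib mult.assoc dg_mult MT)
 qed
 have V0r: "V0 * idm r = V0" by (rule norm_orthonormal(2)[OF V0(2)])
 define U0 where "U0 = M0 * V0 * dg r (%j. 1 / y j)"
 have D1: "dg r (%j. 1 / y j) * dg r y = idm r" "dg r y * dg r (%j. 1 / y j) = idm r"
  "dg r (%j. 1 / y j) * (dg r (%j. (y j)^2) * dg r (%j. 1 / y j)) = idm r"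
  unfolding dg_mult by (auto intro!: dg_cong simp: power2_eq_square dest: y)
 have MV: "M0 * V0 = U0 * dg r y" by (simp add: U0_def mult.assoc D1 V0r)
 have M: "M0 = U0 * (dg r y * tp V0)" using rem by (simp add: MV mult.assoc)
 have U0: "tp U0 * U0 = idm r"
 proof -
  have "tp U0 * U0 = dg r (%j. 1 / y j) * (tp V0 * ((tp M0 * (M0 * V0)) * dg r (%j. 1 / y j)))"
   by (simp add: U0_def tp_mult mult.assoc)
  also have "... = dg r (%j. 1 / y j) * (dg r (%j. (y j)^2) * dg r (%j. 1 / y j))"
   by (simp only: V0(3) mult.assoc assoc_eq[OF V0(2)] dg_mult dg_mult_assoc mult_1)
  finally show ?thesis by (simp only: D1)
 qed
 have NM: "idm N * M0 = M0" by (simp add: M0_def mult.assoc[symmetric] LF_idm)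
 have U0n: "idm N * U0 = U0" "U0 * idm r = U0" using norm_orthonormal(2)[OF U0]
  by (simp_all add: U0_def assoc_eq[OF NM] mult.assoc)
 have tU0: "tp U0 * idm N = tp U0" "idm r * tp U0 = tp U0" "tp V0 * idm T = tp V0" "idm r * tp V0 = tp V0"
  using arg_cong[OF U0n(1), of tp] arg_cong[OF U0n(2), of tp] arg_cong[OF V0(1), of tp] arg_cong[OF V0r, of tp]
  by (simp_all add: tp_mult)
 obtain U1 where U1: "U1 : carrier_mat N r" "fm U1 = U0" using fm_surj[OF U0n] by blast
 obtain V1 where V1: "V1 : carrier_mat T r" "fm V1 = V0" using fm_surj[OF V0(1) V0r] by blast
 have LFc: "L * F\<^sup>T : carrier_mat N T" "fm (L * F\<^sup>T) = M0"
  using dims by (simp_all add: M0_def fm_mult[of _ N r _ T] fm_transpose)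
 have red: "is_reduced_svd r (L * F\<^sup>T) U1 y V1"
  unfolding is_reduced_svd_def is_svd_def
 proof (intro conjI allI impI)
  show "U1 : carrier_mat (dim_row (L * F\<^sup>T)) r" "V1 : carrier_mat (dim_col (L * F\<^sup>T)) r" using U1 V1 dims by auto
  show "U1\<^sup>T * U1 = 1\<^sub>m r" "V1\<^sup>T * V1 = 1\<^sub>m r"
   by (rule fm_inject; use U1 V1 U0 V0 in "simp add: fm_mult[of _ r N _ r] fm_mult[of _ r T _ r] fm_transpose fm_one")+
  show "L * F\<^sup>T = U1 * mat_diag r y * V1\<^sup>T"
  proof (rule fm_inject)
   show "fm (L * F\<^sup>T) = fm (U1 * mat_diag r y * V1\<^sup>T)"
   using U1 V1 by (simp add: LFc M fm_mult[of _ N r _ T] fm_mult[of _ N r _ r] fm_transpose fm_diag mult.assoc)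
  qed (use U1 V1 dims in auto)
 next
  fix j assume "j < r" then show "0 <= y j" "0 < y j" using y[of j] by auto
 next
  fix i j assume "i <= j & j < r" then show "y j <= y i" using dec by auto
 qed
 define R0 where "R0 = dg r (%j. sqrt (y j))"
 define Ri0 where "Ri0 = dg r (%j. 1 / sqrt (y j))"
 have RR: "R0 * Ri0 = idm r" "Ri0 * R0 = idm r" "Ri0 * dg r y = R0" "idm r * R0 = R0" "idm r * Ri0 = Ri0" "Ri0 * idm r = Ri0"
  "dg r y * Ri0 = R0"
  unfolding R0_def Ri0_def dg_mult using y by (auto intro!: dg_cong simp: real_div_sqrt less_imp_le dest: y)
 have tRi0: "tp Ri0 = Ri0" by (simp add: Ri0_def)
 \<comment> \<open>\<open>h0\<close> solves the equation between the factors and their singular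
   vectors, \<open>h0i\<close> the one for the loadings; that they are inverse to each other is the
   reduced decomposition of the signal.\<close>
 define h0 where "h0 = (1 / q) *\<^sub>R (Ri0 * (tp V0 * fm F))"
 define h0i where "h0i = q *\<^sub>R (tp (fm L) * (U0 * Ri0))"
 have hh: "h0 * h0i = idm r"
 proof -
  have "h0 * h0i = Ri0 * (tp V0 * (tp M0 * (U0 * Ri0)))"
   using pos by (simp add: h0_def h0i_def tM mult.assoc)
  also have "... = Ri0 * (dg r y * Ri0)"
   unfolding M by (simp add: tp_mult mult.assoc assoc_eq[OF V0(2)] assoc_eq[OF U0] dg_mult_assoc RR)
  finally show ?thesis by (simp add: RR)
 qed
 have hc: "idm r * h0 = h0" "h0 * idm r = h0" "idm r * h0i = h0i" "h0i * idm r = h0i"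
  by (simp_all add: h0_def h0i_def assoc_eq[OF RR(5)] mult.assoc LF_idm assoc_eq[OF LF_tp_idm(1)] RR)
 have hh': "h0i * h0 = idm r" by (rule right_inverse_square[OF hc(3,4) hh hc(1,2)])
 obtain H0 where H0: "H0 : carrier_mat r r" "fm H0 = h0" using fm_surj[OF hc(1,2)] by blast
 obtain H0i where H0i: "H0i : carrier_mat r r" "fm H0i = h0i" using fm_surj[OF hc(3,4)] by blast
 have inv0: "mat_inverse H0 = Some H0i"
 proof (rule mat_inverse_SomeI[OF H0(1) H0i(1)])
  show "H0 * H0i = 1\<^sub>m r"
   by (rule fm_inject) (use H0 H0i hh in "simp_all add: fm_mult[of _ r r _ r] fm_one")
 qed
 obtain Li where Li: "Li * fm L = idm r"
  using left_inverse_exists[OF LF_idm(1) L_low] pos by (metis divide_pos_pos)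
 \<comment> \<open>Cancelling the loadings by a left inverse transfers the invariance under
   \<open>V0 * tp V0\<close> from the signal to the factors.\<close>
 have Fdec: "fm F = V0 * (tp V0 * fm F)"
 proof -
  have "M0 * (V0 * tp V0) = M0" using rem by (simp add: mult.assoc)
  from arg_cong[OF this, of "%A. Li * A"] have "tp (fm F) * (V0 * tp V0) = tp (fm F)"
   by (simp add: M0_def mult.assoc assoc_eq[OF Li] assoc_eq[OF LF_tp_idm(3)] LF_tp_idm)
  from arg_cong[OF this, of tp] show ?thesis by (simp add: tp_mult mult.assoc)
 qed
 have Ldec: "fm L = U0 * (tp U0 * fm L)"
 proof -
  obtain Fi where Fi: "Fi * fm F = idm r"
   using left_inverse_exists[OF LF_idm(3) F_low] pos by (metis divide_pos_pos)
  have "tp M0 = V0 * (dg r y * tp U0)" using arg_cong[OF M, of tp] by (simp add: tp_mult mult.assoc)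
  then have "tp M0 * (U0 * tp U0) = tp M0" by (simp add: mult.assoc assoc_eq[OF U0] dg_mult_assoc)
  from arg_cong[OF this, of "%A. Fi * A"] have "tp (fm L) * (U0 * tp U0) = tp (fm L)"
   by (simp add: tM mult.assoc assoc_eq[OF Fi] assoc_eq[OF LF_tp_idm(1)] LF_tp_idm)
  from arg_cong[OF this, of tp] show ?thesis by (simp add: tp_mult mult.assoc)
 qed
 define D12 where "D12 = mat_diag r (%j. sqrt (d j))"
 define D012 where "D012 = mat_diag r (%j. sqrt (y j))"
 have Dc: "D12 : carrier_mat r r" "D012 : carrier_mat r r" by (simp_all add: D12_def D012_def)
 define W where "W = (U * D12) @\<^sub>r (V * D12)"
 define W0 where "W0 = (U1 * D012) @\<^sub>r (V1 * D012)"
 have Wc: "W : carrier_mat (N + T) r" "W0 : carrier_mat (N + T) r"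
  unfolding W_def W0_def using U1 V1 svd(1,2) Dc by (auto intro!: carrier_append_rows)
 obtain Q where Q: "orth r Q" "!!R. orth r R ==> norm (fm W * Q - fm W0) <= norm (fm W * R - fm W0)"
  using procrustes_exists by metis
 have orthI: "orth r (fm R)" if "R : orthogonal_matrices r" for R
 proof -
  have R: "R : carrier_mat r r" "R\<^sup>T * R = 1\<^sub>m r" "R * R\<^sup>T = 1\<^sub>m r" using that by (auto simp: orthogonal_matrices_def)
  show ?thesis unfolding orth_def
   using arg_cong[OF R(2), of fm] arg_cong[OF R(3), of fm] R(1) fm_idm[OF R(1)]
   by (simp add: fm_mult[of _ r r _ r] fm_transpose fm_one)
 qed
 obtain O1 where O1: "O1 : carrier_mat r r" "fm O1 = Q" using fm_surj[of r Q r] Q(1) by (auto simp: orth_def)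
 have O1o: "O1 : orthogonal_matrices r"
 proof -
  have "O1\<^sup>T * O1 = 1\<^sub>m r" "O1 * O1\<^sup>T = 1\<^sub>m r"
   by (rule fm_inject; use O1 Q(1) in "simp add: fm_mult[of _ r r _ r] fm_transpose fm_one orth_def")+
  then show ?thesis using O1 by (simp add: orthogonal_matrices_def)
 qed
 have arg: "is_arg_min (%R. (frobenius_norm (W * R - W0))^2) (%R. R : orthogonal_matrices r) O1"
  unfolding is_arg_min_def
 proof (intro conjI O1o notI, elim exE conjE)
  fix R assume R: "R : orthogonal_matrices r" "(frobenius_norm (W * R - W0))^2 < (frobenius_norm (W * O1 - W0))^2"
  have f: "frobenius_norm (W * R - W0) = norm (fm W * fm R - fm W0)" if "R : carrier_mat r r" for R
   using Wc that unfolding norm_fm[symmetric] by (simp add: fm_minus[of _ "N + T" r] fm_mult[of _ "N + T" r _ r])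
  have Rc: "R : carrier_mat r r" using R(1) by (simp add: orthogonal_matrices_def)
  have "norm (fm W * Q - fm W0) <= norm (fm W * fm R - fm W0)" by (rule Q(2)[OF orthI[OF R(1)]])
  then have "(norm (fm W * Q - fm W0))^2 <= (norm (fm W * fm R - fm W0))^2" by (rule power_mono) simp
  then show False using R(2) unfolding f[OF Rc] f[OF O1(1)] O1(2) by linarith
 qed
 \<comment> \<open>The explicit inverse of \<open>D12 * O1 * H0\<close>, taken factor by
   factor.\<close>
 define h where "h = h0i * (tp Q * dg r (%j. 1 / sqrt (d j)))"
 have hcc: "idm r * h = h" "h * idm r = h"
  by (simp_all add: h_def assoc_eq[OF hc(3)] mult.assoc dg_mult)
 obtain H where Hm: "H : carrier_mat r r" "fm H = h" using fm_surj[OF hcc] by blast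
 have "mat_inverse (D12 * O1 * H0) = Some H"
 proof (rule mat_inverse_SomeI)
  show "D12 * O1 * H0 * H = 1\<^sub>m r"
  proof (rule fm_inject)
   have "Q * tp Q = idm r" "tp Q * Q = idm r" using Q(1) by (auto simp: orth_def)
   moreover have "idm r * (tp Q * x) = tp Q * x" for x
   using Q(1) arg_cong[of "Q * idm r" Q tp] unfolding orth_def tp_mult tp_dg by (metis mult.assoc)
   moreover have "dg r (%j. sqrt (d j)) * dg r (%j. 1 / sqrt (d j)) = idm r"
   unfolding dg_mult by (rule dg_cong) (use d_pos in force)
   ultimately show "fm (D12 * O1 * H0 * H) = fm (1\<^sub>m r)"
   using Dc O1 H0 Hm
   by (simp add: fm_mult[of _ r r _ r] fm_one h_def mult.assoc assoc_eq[OF hh])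
   (simp add: D12_def fm_diag dg_mult dg_mult_assoc assoc_eq[of Q "tp Q"])
  qed (use Dc O1 H0 Hm in auto)
 qed (use Dc O1 H0 Hm in auto)
 moreover have "F = sqrt (real T) \<cdot>\<^sub>m (V1 * D012 * H0)"
 proof (rule fm_inject)
  show "fm F = fm (sqrt (real T) \<cdot>\<^sub>m (V1 * D012 * H0))"
   using V1 H0 Dc pos
   by (simp add: fm_smult fm_mult[of _ T r _ r] h0_def qT[symmetric] mult.assoc D012_def fm_diag R0_def[symmetric] assoc_eq[OF RR(1)])
   (simp add: assoc_eq[OF tU0(4)] Fdec[symmetric])
 qed (use V1 H0 Dc dims in auto)
 moreover have "L = (1 / sqrt (real T)) \<cdot>\<^sub>m (U1 * D012 * H0i\<^sup>T)"
 proof (rule fm_inject)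
  show "fm L = fm ((1 / sqrt (real T)) \<cdot>\<^sub>m (U1 * D012 * H0i\<^sup>T))"
   using U1 H0i Dc pos
   by (simp add: fm_smult fm_mult[of _ N r _ r] h0i_def qT[symmetric] mult.assoc D012_def fm_diag R0_def[symmetric] fm_transpose tp_simps
   tRi0 assoc_eq[OF RR(1)])
   (simp add: assoc_eq[OF tU0(2)] Ldec[symmetric])
 qed (use U1 H0i Dc dims in auto)
 ultimately show ?thesis
  unfolding is_matching_matrix_def Let_def
  using red H0(1) inv0 arg
  unfolding W_def W0_def D12_def D012_def by blast
qed

end

lemma dg_scale: "c *\<^sub>R dg n f = dg n (%j. c * f j)"
 by (auto simp: fmat_eq_iff)

context pc_outcome
begin

text \<open>A matching matrix comes with some reduced decomposition of the signal that cannot be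
  chosen. The bounds are therefore derived from its own singular pairs.\<close>

lemma U0V0_d0_bounds:
 assumes U0: "tp U0 * U0 = idm r" and V0: "tp V0 * V0 = idm r"
  and M: "fm L * tp (fm F) = U0 * (dg r d0 * tp V0)" and d0: "!!j. j < r ==> 0 < d0 j" and j: "j < r"
 shows "s / K^2 <= d0 j" "d0 j <= K^2 * s"
proof -
 define v where "v = V0 * un j 0"
 define u where "u = U0 * un j 0"
 have nuv: "norm v = 1" "norm u = 1"
 proof -
  have "inner (A * un j 0) (A * un j 0) = 1" if "tp A * A = idm r" for A
   using j norm_un[of j 0, unfolded norm_eq_1] by (simp add: inner_mult_left assoc_eq[OF that] un_idm)
  then show "norm v = 1" "norm u = 1" using U0 V0 by (simp_all add: v_def u_def norm_eq_1)
 qed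
 have dj: "dg r d0 * un j 0 = d0 j *\<^sub>R un j 0" using j by (simp add: un_idm)
 have Mv: "fm L * (tp (fm F) * v) = d0 j *\<^sub>R u"
 proof -
  have "fm L * tp (fm F) * v = U0 * (dg r d0 * ((tp V0 * V0) * un j 0))" by (simp add: M v_def mult.assoc)
  also have "... = U0 * (dg r d0 * un j 0)" using j by (simp add: V0 un_idm)
  finally show ?thesis using dj by (simp add: u_def mult.assoc)
 qed
 have Mu: "fm F * (tp (fm L) * u) = d0 j *\<^sub>R v"
 proof -
  have "tp (fm L * tp (fm F)) * u = V0 * (dg r d0 * ((tp U0 * U0) * un j 0))" by (simp add: M u_def mult.assoc tp_mult)
  also have "... = V0 * (dg r d0 * un j 0)" using j by (simp add: U0 un_idm)
  finally show ?thesis using dj by (simp add: v_def mult.assoc tp_mult)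
 qed
 have dn: "d0 j = norm (fm L * (tp (fm F) * v))" using Mv nuv d0[OF j] by simp
 show "d0 j <= K^2 * s" using dn opbD[OF M_up, of v] nuv by (simp add: mult.assoc)
 \<comment> \<open>The singular vector \<open>v\<close> lies in the range of \<open>F\<close>, as
   \<open>F * w\<close> with \<open>norm w\<close> at most K / q. As \<open>v\<close> has length
   one, \<open>tp F * v\<close> must have norm at least q / K.\<close>
 define w where "w = (1 / d0 j) *\<^sub>R (tp (fm L) * u)"
 have w: "idm r * w = w" "fm F * w = v" using Mu d0[OF j] by (simp_all add: w_def assoc_eq[OF LF_tp_idm(1)])
 have "q / K * norm w <= 1" using F_low[of w] w nuv by simp
 then have nw: "norm w <= K / q" using pos by (simp add: field_simps)
 have "1 = inner v v" using nuv by (simp add: norm_eq_1)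
 also have "... = inner w (tp (fm F) * v)" by (subst (1) w(2)[symmetric]) (simp add: inner_mult_left)
 also have "... <= norm w * norm (tp (fm F) * v)" by (rule norm_cauchy_schwarz)
 also have "... <= K / q * norm (tp (fm F) * v)" using nw by (intro mult_right_mono) auto
 finally have "q / K <= norm (tp (fm F) * v)" using pos by (simp add: field_simps)
 then have "p / K * (q / K) <= p / K * norm (idm r * (tp (fm F) * v))"
  using pos by (intro mult_left_mono) (simp_all add: assoc_eq[OF LF_tp_idm(3)])
 also have "... <= d0 j" unfolding dn by (rule L_low)
 finally show "s / K^2 <= d0 j" by (simp add: power2_eq_square)
qed

text \<open>\<open>4 * K^3\<close> dominates at once the rescaled singular values and their
  inverses, the rescaled loadings and factors, and \<open>sqrt r\<close>.\<close>

definition "cc = core_const (4 * K^3)"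

text \<open>\<open>pc_core\<close> in the original scale: loadings are divided by \<open>p\<close>,
  factors by \<open>q\<close>, and the singular values and the noise by \<open>s\<close>. The noise
  level becomes \<open>K * sqrt m / s\<close>, whose square is the first term of the bound.\<close>

lemma matching_bounds:
 assumes H: "is_matching_matrix r T L F U d V H" and g: "norm (tp (fm L) * (fm E * fm F)) <= g"
 shows "H : carrier_mat r r" "the (mat_inverse H) : carrier_mat r r"
  and "fm (the (mat_inverse H)) * fm H = idm r"
  and "norm ((1 / q) *\<^sub>R (tp (fm V) * fm F) - fm (the (mat_inverse H))) <= cc * (K^2 * m / s^2 + g / s^2)"
  and "norm (q *\<^sub>R (dg r (%j. 1 / d j) * (tp (fm U) * fm L)) - tp (fm H)) <= cc * (K^2 * m / s^2 + g / s^2)"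
  and "norm (fm (the (mat_inverse H))) <= cc" "norm (fm H) <= cc"
proof -
 define St where "St = shift N T"
 obtain U1 d0 V1 H0 H0inv Q1 where
  red: "is_reduced_svd r (L * F\<^sup>T) U1 d0 V1" and H0: "H0 : carrier_mat r r" "mat_inverse H0 = Some H0inv"
  and Feq: "F = sqrt (real T) \<cdot>\<^sub>m (V1 * mat_diag r (%j. sqrt (d0 j)) * H0)"
  and Leq: "L = (1 / sqrt (real T)) \<cdot>\<^sub>m (U1 * mat_diag r (%j. sqrt (d0 j)) * H0inv\<^sup>T)"
  and arg: "is_arg_min (%R. (frobenius_norm (((U * mat_diag r (%j. sqrt (d j))) @\<^sub>r (V * mat_diag r (%j. sqrt (d j)))) * R
   - ((U1 * mat_diag r (%j. sqrt (d0 j))) @\<^sub>r (V1 * mat_diag r (%j. sqrt (d0 j))))))^2) (%R. R : orthogonal_matrices r) Q1"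
  and Hinv: "mat_inverse (mat_diag r (%j. sqrt (d j)) * Q1 * H0) = Some H"
  using H unfolding is_matching_matrix_def Let_def by blast
 have LFc: "L * F\<^sup>T : carrier_mat N T" using dims by simp
 have c1: "U1 : carrier_mat N r" "V1 : carrier_mat T r" "U1\<^sup>T * U1 = 1\<^sub>m r" "V1\<^sup>T * V1 = 1\<^sub>m r"
  and d0: "!!j. j < r ==> 0 < d0 j" and Meq: "L * F\<^sup>T = U1 * mat_diag r d0 * V1\<^sup>T"
  using red LFc unfolding is_reduced_svd_def is_svd_def by auto
 define U0 where "U0 = fm U1"
 define V0 where "V0 = fm V1"
 have U0: "tp U0 * U0 = idm r" and V0: "tp V0 * V0 = idm r"
  using c1(1,2) arg_cong[OF c1(3), of fm] arg_cong[OF c1(4), of fm]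
  by (simp_all add: U0_def V0_def fm_mult[of _ r N _ r] fm_mult[of _ r T _ r] fm_transpose fm_one)
 have M: "fm L * tp (fm F) = U0 * (dg r d0 * tp V0)"
  using arg_cong[OF Meq, of fm] dims c1
  by (simp add: U0_def V0_def fm_mult[of _ N r _ T] fm_mult[of _ N r _ r] fm_transpose fm_diag mult.assoc)
 note d0b = U0V0_d0_bounds[OF U0 V0 M d0, rotated]
 have Q1: "Q1 : orthogonal_matrices r" using arg by (simp add: is_arg_min_def)
 then have Q1c: "Q1 : carrier_mat r r" by (simp add: orthogonal_matrices_def)
 define Q where "Q = fm Q1"
 have Qo: "orth r Q"
 proof -
  have R: "Q1\<^sup>T * Q1 = 1\<^sub>m r" "Q1 * Q1\<^sup>T = 1\<^sub>m r" using Q1 by (auto simp: orthogonal_matrices_def)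
  show ?thesis unfolding orth_def Q_def
   using arg_cong[OF R(1), of fm] arg_cong[OF R(2), of fm] fm_idm[OF Q1c] Q1c
   by (simp add: fm_mult[of _ r r _ r] fm_transpose fm_one)
 qed
 have H0i: "H0inv : carrier_mat r r" "fm H0 * fm H0inv = idm r" "fm H0inv * fm H0 = idm r"
  using mat_inverse_SomeD[OF H0(2,1)] by auto
 define ss where "ss = sqrt s"
 have ss: "0 < ss" "ss * ss = s" using pos by (simp_all add: ss_def)
 define d' where "d' = (%j. d j / s)"
 define d0' where "d0' = (%j. d0 j / s)"
 \<comment> \<open>Dividing the singular values by \<open>s\<close> takes a factor
   \<open>sqrt s\<close> out of their square roots; \<open>h0\<close> absorbs it and
   \<open>h0i\<close> compensates.\<close>
 define h0 where "h0 = ss *\<^sub>R fm H0"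
 define h0i where "h0i = (1 / ss) *\<^sub>R fm H0inv"
 have sd: "dg r (%j. sqrt (d j)) = ss *\<^sub>R dg r (%j. sqrt (d' j))" "dg r (%j. sqrt (d0 j)) = ss *\<^sub>R dg r (%j. sqrt (d0' j))"
  using pos by (simp_all add: dg_scale d'_def d0'_def ss_def real_sqrt_divide)
 have isd: "dg r (%j. 1 / sqrt (d' j)) = ss *\<^sub>R dg r (%j. 1 / sqrt (d j))" "dg r (%j. 1 / d' j) = s *\<^sub>R dg r (%j. 1 / d j)"
  using pos by (simp_all add: dg_scale d'_def ss_def real_sqrt_divide)
 define L' where "L' = (1 / p) *\<^sub>R fm L"
 define F' where "F' = (1 / q) *\<^sub>R fm F"
 define E' where "E' = (1 / s) *\<^sub>R fm E"
 have X': "L' * tp F' + E' = (1 / s) *\<^sub>R X"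
  by (simp add: L'_def F'_def E'_def tp_simps scaleR_add_right mult.commute)
 define W where "W = (%D1 D2. fm U * D1 + St * (fm V * D1) :: fmat)"
 have Dc: "mat_diag r (%j. sqrt (d j)) : carrier_mat r r" "mat_diag r (%j. sqrt (d0 j)) : carrier_mat r r" by simp_all
 define WJ where "WJ = (U * mat_diag r (%j. sqrt (d j))) @\<^sub>r (V * mat_diag r (%j. sqrt (d j)))"
 define W0J where "W0J = (U1 * mat_diag r (%j. sqrt (d0 j))) @\<^sub>r (V1 * mat_diag r (%j. sqrt (d0 j)))"
 have WJc: "WJ : carrier_mat (N + T) r" "W0J : carrier_mat (N + T) r"
  unfolding WJ_def W0J_def using svd(1,2) c1 Dc by (auto intro!: carrier_append_rows)
 have fW: "fm WJ = ss *\<^sub>R (fm U * dg r (%j. sqrt (d' j)) + St * (fm V * dg r (%j. sqrt (d' j))))"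
  "fm W0J = ss *\<^sub>R (U0 * dg r (%j. sqrt (d0' j)) + St * (V0 * dg r (%j. sqrt (d0' j))))"
  unfolding WJ_def W0J_def using svd(1,2) c1 Dc
  by (simp_all add: fm_append_rows[of _ N r _ T] fm_mult[of _ N r _ r] fm_mult[of _ T r _ r] fm_diag sd U0_def V0_def
   scaleR_add_right St_def)
 have opt: "norm ((fm U * dg r (%j. sqrt (d' j)) + St * (fm V * dg r (%j. sqrt (d' j)))) * Q
   - (U0 * dg r (%j. sqrt (d0' j)) + St * (V0 * dg r (%j. sqrt (d0' j)))))
   <= norm ((fm U * dg r (%j. sqrt (d' j)) + St * (fm V * dg r (%j. sqrt (d' j)))) * R
   - (U0 * dg r (%j. sqrt (d0' j)) + St * (V0 * dg r (%j. sqrt (d0' j)))))" if R: "orth r R" for R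
 proof -
  obtain R1 where R1: "R1 : carrier_mat r r" "fm R1 = R" using fm_surj[of r R r] R by (auto simp: orth_def)
  have R1o: "R1 : orthogonal_matrices r"
  proof -
   have "R1\<^sup>T * R1 = 1\<^sub>m r" "R1 * R1\<^sup>T = 1\<^sub>m r"
   by (rule fm_inject; use R1 R in "simp add: fm_mult[of _ r r _ r] fm_transpose fm_one orth_def")+
   then show ?thesis using R1 by (simp add: orthogonal_matrices_def)
  qed
  have f: "frobenius_norm (WJ * R - W0J) = norm (fm WJ * fm R - fm W0J)" if "R : carrier_mat r r" for R
   using WJc that unfolding norm_fm[symmetric] by (simp add: fm_minus[of _ "N + T" r] fm_mult[of _ "N + T" r _ r])
  have "(norm (fm WJ * Q - fm W0J))^2 <= (norm (fm WJ * R - fm W0J))^2"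
   using arg R1o unfolding is_arg_min_def WJ_def[symmetric] W0J_def[symmetric]
   by (auto simp: f R1 Q1c Q_def not_less)
  then have "norm (fm WJ * Q - fm W0J) <= norm (fm WJ * R - fm W0J)" by (rule power2_le_imp_le) simp
  then show ?thesis
   using ss(1) unfolding fW mult_scaleR_left scaleR_diff_right[symmetric] norm_scaleR by simp
 qed
 have k': "1 <= 4 * K^3" and kk: "K^2 * K = K^3" "K^2 <= K^3" "K <= K^3" "1 <= K^3"
  using k1 self_le_power[OF k1, of 3] power_increasing[of 2 3 K] one_le_power[OF k1, of 3]
  by (simp_all add: power_numeral_reduce)
 have rk': "sqrt (real r) <= 4 * K^3" using rk kk by simp
 have db: "1 / (4 * K^3) <= d' j & d' j <= 4 * K^3" if "j < r" for j
 proof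
  have "1 / (4 * K^3) <= 1 / (2 * K^2)" using kk pos by (intro divide_left_mono) auto
  also have "... <= d' j" using d_bounds(1)[OF that] pos by (simp add: d'_def field_simps)
  finally show "1 / (4 * K^3) <= d' j" .
  have "d' j <= 2 * K^2" using d_bounds(2)[OF that] pos by (simp add: d'_def field_simps)
  then show "d' j <= 4 * K^3" using kk by simp
 qed
 have d0b': "1 / (4 * K^3) <= d0' j & d0' j <= 4 * K^3" if "j < r" for j
 proof
  have "1 / (4 * K^3) <= 1 / K^2" using kk pos by (intro divide_left_mono) auto
  also have "... <= d0' j" using d0b(1)[OF that] pos by (simp add: d0'_def field_simps)
  finally show "1 / (4 * K^3) <= d0' j" .
  have "d0' j <= K^2" using d0b(2)[OF that] pos by (simp add: d0'_def field_simps)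
  then show "d0' j <= 4 * K^3" using kk by simp
 qed
 define e where "e = K * sqrt m / s"
 have Eo: "opb E' e" using opb_scaleR[OF E_up, of "1 / s"] pos by (simp add: E'_def e_def)
 have nL': "norm L' <= 4 * K^3" "norm F' <= 4 * K^3"
 proof -
  have "norm L' <= K^2" "norm F' <= K^2" using LF_norm pos by (simp_all add: L'_def F'_def field_simps)
  then show "norm L' <= 4 * K^3" "norm F' <= 4 * K^3" using kk by simp_all
 qed
 have g': "norm (tp L' * (E' * F')) <= g / s^2"
 proof -
  have "tp L' * (E' * F') = (1 / s^2) *\<^sub>R (tp (fm L) * (fm E * fm F))"
   by (simp add: L'_def F'_def E'_def tp_simps power2_eq_square mult_ac)
  then show ?thesis using g pos by (simp add: divide_right_mono)
 qed
 have St: "tp St * St = idm T" "idm T * fm V = fm V" "idm T * V0 = V0" "tp St * fm U = 0" "tp St * U0 = 0"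
  unfolding St_def V0_def U0_def
  using shift_isometry UV_idm fm_idm(1)[OF c1(2)] shift_tp_mult[OF UV_idm(3)] shift_tp_mult[OF fm_idm(1)[OF c1(1)]] by auto
 have dgs: "dg r d' = (1 / s) *\<^sub>R dg r d" "dg r d0' = (1 / s) *\<^sub>R dg r d0" by (simp_all add: dg_scale d'_def d0'_def)
 have XV: "(L' * tp F' + E') * fm V = fm U * dg r d'" "tp (L' * tp F' + E') * fm U = fm V * dg r d'"
  unfolding X' dgs tp_scaleR using svd(5,6) by simp_all
 have M': "L' * tp F' = U0 * (dg r d0' * tp V0)"
  using M by (simp add: L'_def F'_def dgs tp_simps mult.commute)
 have F'eq: "F' = V0 * (dg r (%j. sqrt (d0' j)) * h0)"
 proof -
  have "fm F = q *\<^sub>R (V0 * (dg r (%j. sqrt (d0 j)) * fm H0))"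
   using arg_cong[OF Feq, of fm] c1 H0
   by (simp add: fm_smult fm_mult[of _ T r _ r] fm_diag qT V0_def mult.assoc)
  then show ?thesis using pos by (simp add: F'_def sd h0_def)
 qed
 have L'eq: "L' = U0 * (dg r (%j. sqrt (d0' j)) * tp h0i)"
 proof -
  have "fm L = (1 / q) *\<^sub>R (U0 * (dg r (%j. sqrt (d0 j)) * tp (fm H0inv)))"
   using arg_cong[OF Leq, of fm] c1 H0i
   by (simp add: fm_smult fm_mult[of _ N r _ r] fm_diag qT U0_def mult.assoc fm_transpose)
  then show ?thesis using pos ss by (simp add: L'_def sd h0i_def tp_simps field_simps)
 qed
 have hh: "h0 * h0i = idm r" "h0i * h0 = idm r" "idm r * h0 = h0" "h0i * idm r = h0i"
  using H0i ss fm_idm[OF H0(1)] fm_idm[OF H0i(1)] by (simp_all add: h0_def h0i_def)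
 note core = pc_core[OF k' rk' svd(3) svd(4) U0 V0 XV M' db d0b' Eo St Qo opt F'eq L'eq hh nL'(2,1) g']
 have e2: "e^2 = K^2 * m / s^2" using pos by (simp add: e_def power_mult_distrib power_divide)
 define HI where "HI = mat_diag r (%j. sqrt (d j)) * Q1 * H0"
 have HIc: "HI : carrier_mat r r" unfolding HI_def by (rule mult_carrier_mat[OF mult_carrier_mat[OF Dc(1) Q1c] H0(1)])
 have HIf: "fm HI = dg r (%j. sqrt (d' j)) * (Q * h0)"
  unfolding HI_def fm_mult[OF mult_carrier_mat[OF Dc(1) Q1c] H0(1)] fm_mult[OF Dc(1) Q1c]
  by (simp add: fm_diag sd Q_def h0_def mult.assoc)
 have Hc: "H : carrier_mat r r" "fm HI * fm H = idm r" "fm H * fm HI = idm r"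
  using mat_inverse_SomeD[OF Hinv[folded HI_def] HIc] by auto
 have "H * HI = 1\<^sub>m r" by (rule fm_inject) (use Hc HIc in "simp_all add: fm_mult[of _ r r _ r] fm_one")
 then have HI: "the (mat_inverse H) = HI" using mat_inverse_SomeI[OF Hc(1) HIc] by simp
 show "H : carrier_mat r r" "the (mat_inverse H) : carrier_mat r r" "fm (the (mat_inverse H)) * fm H = idm r"
  using Hc HIc HI by auto
 have Hf: "tp (fm H) = dg r (%j. 1 / sqrt (d' j)) * (Q * tp h0i)"
 proof -
  define G where "G = h0i * (tp Q * dg r (%j. 1 / sqrt (d' j)))"
  have Q': "Q * tp Q = idm r" "idm r * Q = Q" "Q * idm r = Q" using Qo by (auto simp: orth_def)
  have tQ: "idm r * tp Q = tp Q" using arg_cong[OF Q'(3), of tp] by (simp add: tp_mult)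
  have dd: "dg r (%j. sqrt (d' j)) * dg r (%j. 1 / sqrt (d' j)) = idm r"
   unfolding dg_mult by (rule dg_cong) (use d_pos pos in "force simp: d'_def")
  have "fm HI * G = idm r"
   by (simp add: HIf G_def mult.assoc assoc_eq[OF hh(1)] assoc_eq[OF tQ] assoc_eq[OF Q'(1)] dg_mult_assoc dd)
  then have "fm H * (fm HI * G) = fm H * idm r" by simp
  moreover have "idm r * G = G"
  proof -
   have "idm r * h0i = h0i" using fm_idm(1)[OF H0i(1)] by (simp add: h0i_def)
   then show ?thesis by (simp add: G_def assoc_eq)
  qed
  ultimately have "G = fm H" using fm_idm(2)[OF Hc(1)] by (simp add: assoc_eq[OF Hc(3)])
  then have "tp (fm H) = tp G" by simp
  then show ?thesis by (simp add: G_def tp_mult mult.assoc)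
 qed
 show "norm ((1 / q) *\<^sub>R (tp (fm V) * fm F) - fm (the (mat_inverse H))) <= cc * (K^2 * m / s^2 + g / s^2)"
  using core(1) by (simp add: HI HIf F'_def e2 cc_def)
 have "dg r (%j. 1 / d' j) * (tp (fm U) * L') = q *\<^sub>R (dg r (%j. 1 / d j) * (tp (fm U) * fm L))"
  using pos by (simp add: isd L'_def)
 then show "norm (q *\<^sub>R (dg r (%j. 1 / d j) * (tp (fm U) * fm L)) - tp (fm H)) <= cc * (K^2 * m / s^2 + g / s^2)"
  using core(2) by (simp add: Hf e2 cc_def)
 show "norm (fm (the (mat_inverse H))) <= cc" using core(3) by (simp add: HI HIf cc_def)
 have "norm (tp (fm H)) <= cc" using core(4) by (simp add: Hf cc_def)
 then show "norm (fm H) <= cc" by simp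
qed

end

section \<open>Leave-out estimates for a row and for a window of periods\<close>

lemma opb_one_minus: assumes "norm Vh <= 2 * K" "1 <= K" shows "opb (idm t - Vh * tp Vh) (5 * K^2)"
proof -
 have "opb (idm t) 1" by (rule opb_proj) (simp_all add: dg_mult)
 moreover have "opb (Vh * tp Vh) (2 * K * (2 * K))"
  by (rule opb_mono[OF opb_norm norm_mult_le]) (use assms in simp_all)
 ultimately have "opb (idm t - Vh * tp Vh) (1 + 2 * K * (2 * K))" by (rule opb_minus)
 moreover have "1 + 2 * K * (2 * K) <= 5 * K^2"
  using one_le_power[OF assms(2), of 2] by (simp add: power2_eq_square)
 ultimately show ?thesis by (rule opb_mono)
qed

lemma compl_proj: assumes "tp P = P" "P * P = P" "idm n * P = P" "P * idm n = P"
 shows "opb (idm n - P) 1"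
 by (rule opb_proj) (simp_all add: tp_simps assms left_diff_distrib right_diff_distrib dg_mult)

context pc_outcome
begin

lemma X_up: "opb X (2 * K^2 * s)"
proof (rule opb_mono[OF opb_plus[OF M_up E_up]])
 have "K * sqrt m <= K^2 * s"
  using sqrt_m(1) pos k1 by (intro mult_mono) (simp_all add: power2_eq_square)
 then show "K^2 * s + K * sqrt m <= 2 * K^2 * s" by (simp add: algebra_simps)
qed

lemma d_sq: "j < r ==> s^2 / (4 * K^4) <= (d j)^2"
proof -
 assume "j < r"
 then have "(s / (2 * K^2))^2 <= (d j)^2" by (intro power_mono d_bounds) (use pos in auto)
 then show ?thesis by (simp add: power_divide power_mult_distrib flip: power_mult)
qed

lemma XX: "tp X * X * fm V = fm V * dg r (%j. (d j)^2)" "X * tp X * fm U = fm U * dg r (%j. (d j)^2)"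
proof -
 have "tp X * (X * fm V) = (tp X * fm U) * dg r d" using svd(5) by (simp add: mult.assoc)
 then show "tp X * X * fm V = fm V * dg r (%j. (d j)^2)"
  using svd(6) by (simp add: mult.assoc dg_mult power2_eq_square)
 have "X * (tp X * fm U) = (X * fm V) * dg r d" using svd(6) by (simp add: mult.assoc)
 then show "X * tp X * fm U = fm U * dg r (%j. (d j)^2)"
  using svd(5) by (simp add: mult.assoc dg_mult power2_eq_square)
qed

text \<open>Origin of two constants. The first inequality is the absorption condition
  \<open>2 * c^2 <= \<mu>\<close> and fixes 2048 = 2 * 16^2 * 4. The second fixes the tolerance for
  orthonormality: with 96 the defect term equals 8/3 * K^2, below the 4 * K^2 that are
  allowed.\<close>

lemma leave_out_numeric:
 assumes Dd: "1 <= Dd" and small: "2048 * K^16 * m * Dd <= s^2"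
 shows "2 * (16 * K^6 * sqrt (m * Dd))^2 <= s^2 / (4 * K^4)"
  and "16 * K^6 * sqrt (m * Dd) * (2 * K^2 * s * (2 * K * (1 / (96 * K^9 * sqrt (m * Dd) * s) * (2 * K * (2 * K))))) <= (2 * K)^2"
proof -
 have mD: "0 < m * Dd" using pos Dd by simp
 have "(16 * K^6 * sqrt (m * Dd))^2 = 256 * K^12 * (m * Dd)"
  using mD by (simp add: power_mult_distrib flip: power_mult)
 then have eq: "2 * (16 * K^6 * sqrt (m * Dd))^2 * (4 * K^4) = 2048 * K^16 * m * Dd"
  by (simp add: power_numeral_reduce)
 have k4: "0 < 4 * K^4" using pos by simp
 show "2 * (16 * K^6 * sqrt (m * Dd))^2 <= s^2 / (4 * K^4)"
  unfolding pos_le_divide_eq[OF k4] eq by (rule small)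
 define S where "S = sqrt (m * Dd)"
 define a where "a = K^6"
 define z where "z = s"
 have nz: "S ~= 0" "a ~= 0" "z ~= 0" "K ~= 0" using mD pos by (auto simp: S_def a_def z_def)
 have k9: "K^9 = a * K * K * K" by (simp add: a_def power_numeral_reduce)
 have "16 * a * S * (2 * K^2 * z * (2 * K * (1 / (96 * K^9 * S * z) * (2 * K * (2 * K))))) = 8 / 3 * K^2"
  using nz by (simp add: k9 field_simps power2_eq_square)
 then show "16 * K^6 * sqrt (m * Dd) * (2 * K^2 * s * (2 * K * (1 / (96 * K^9 * sqrt (m * Dd) * s) * (2 * K * (2 * K))))) <= (2 * K)^2"
  unfolding S_def[symmetric] a_def[symmetric] z_def[symmetric] by (simp only:) (simp add: power_mult_distrib)
qed

text \<open>Shared by rows, with \<open>Dd = 1\<close>, and by windows, where \<open>Dd\<close> is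
  the number of removed periods. The 16 is 6 from the leakage of the signal plus 2 * 5 from the
  modified noise.\<close>

lemma leave_out_J:
 assumes W: "idm t * W = W" "W * idm r = W" "norm W <= K"
  and ev: "(tp A * A + x * tp x) * W = W * dg r (%j. (d j)^2)"
  and Vh: "norm Vh <= 2 * K" "Vh * idm r = Vh" "idm t * Vh = Vh"
  and inv: "norm ((idm t - Vh * tp Vh) * (tp A * (A * Vh))) <= 1"
  and Dd: "1 <= Dd" and small: "2048 * K^16 * m * Dd <= s^2"
  and on: "norm (tp Vh * Vh - idm r) <= 1 / (96 * K^9 * sqrt (m * Dd) * s)"
  and A: "A = C + E2" "opb A (2 * K^2 * s)" "A * idm t = A"
  and CJ: "norm (C * (idm t - Vh * tp Vh)) <= 6 * K^6 * sqrt (m * Dd)" and E2: "opb E2 (2 * K^2 * sqrt (m * Dd))"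
  and y: "norm ((idm t - Vh * tp Vh) * (x * (tp x * W))) <= y"
 shows "norm ((idm t - Vh * tp Vh) * W) <= 8 * K^4 / s^2 * (8 * K^2 + y)"
proof -
 define J where "J = idm t - Vh * tp Vh"
 have "opb (C * J + E2 * J) (6 * K^6 * sqrt (m * Dd) + 2 * K^2 * sqrt (m * Dd) * (5 * K^2))"
  unfolding J_def by (intro opb_plus opb_mult[OF E2] opb_one_minus[OF Vh(1) k1] opb_mono[OF opb_norm CJ])
 moreover have "6 * K^6 * sqrt (m * Dd) + 2 * K^2 * sqrt (m * Dd) * (5 * K^2) <= 16 * K^6 * sqrt (m * Dd)"
 proof -
  have "K^4 * sqrt (m * Dd) <= K^6 * sqrt (m * Dd)"
   using k1 pos Dd by (intro mult_right_mono power_increasing) auto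
  moreover have "2 * K^2 * sqrt (m * Dd) * (5 * K^2) = 10 * (K^4 * sqrt (m * Dd))"
   by (simp add: power_numeral_reduce)
  ultimately show ?thesis by linarith
 qed
 ultimately have AJ: "opb (A * J) (16 * K^6 * sqrt (m * Dd))"
  unfolding A(1) distrib_right by (rule opb_mono)
 have W2: "norm W <= 2 * K" using W(3) pos by simp
 have "norm (J * W) <= 2 / (s^2 / (4 * K^4)) * ((2 * K)^2 * (1 + 1) + y)"
  by (rule leave_out_bound[OF W(1,2) W2 ev d_sq _ Vh J_def inv[folded J_def] on AJ A(2,3)
   leave_out_numeric(1)[OF Dd small] y[folded J_def] leave_out_numeric(2)[OF Dd small]])
   (use pos in simp_all)
 then show ?thesis using pos by (simp add: J_def power_mult_distrib)
qed

text \<open>\<open>h\<close> is the size of loading \<open>i\<close>. \<open>Vh\<close> plays the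
  part of the singular vectors without row \<open>i\<close>: along its span \<open>tp V * ei\<close>
  is bounded through \<open>k2\<close>, and off its span through the leave-out comparison, whose
  perturbation is the row \<open>x\<close> itself.\<close>

lemma row_bound:
 fixes lam ei Vh :: fmat
 assumes H: "is_matching_matrix r T L F U d V H" and g: "norm (tp (fm L) * (fm E * fm F)) <= K * s"
  and i: "i < N" and h: "0 <= h" "h <= 1"
  and lam: "lam = tp (fm L) * un i 0" "norm lam <= K * h"
  and ei: "ei = tp (fm E) * un i 0" "norm ei <= K * q"
  and Vh: "norm Vh <= 2 * K" "Vh * idm r = Vh" "idm T * Vh = Vh"
  and A: "A = (idm N - un i i) * X"
  and inv: "norm ((idm T - Vh * tp Vh) * (tp A * (A * Vh))) <= 1"
  and on: "norm (tp Vh * Vh - idm r) <= 1 / (96 * K^9 * sqrt m * s)"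
  and CJ: "norm (fm L * (tp (fm F) * (idm T - Vh * tp Vh))) <= 6 * K^6 * sqrt m"
  and k2: "norm (tp Vh * ei) <= k2"
 shows "norm ((1 / q) *\<^sub>R (dg r d * (tp (fm U) * un i 0)) - fm (the (mat_inverse H)) * lam)
  <= (cc * K^3 + cc * K^2 + 4 * K^2 * k2 + 128 * K^7 + 160 * K^12) * (1 / q + h * (m / s^2))"
proof -
 define x where "x = tp X * un i 0"
 define v where "v = norm (tp (fm V) * ei)"
 have k20: "0 <= k2" using k2 norm_ge_zero order_trans by blast
 have xe: "x = fm F * lam + ei" by (simp add: x_def lam ei tp_simps distrib_right mult.assoc)
 have iN: "idm N * un i i = un i i" "un i i * idm N = un i i" using i by (simp_all add: un_idm)
 have Pi: "opb (idm N - un i i) 1" by (rule compl_proj) (simp_all add: iN un_mult_un)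
 \<comment> \<open>Rank-one update: deleting row \<open>i\<close> changes the Gram matrix by
   \<open>x * tp x\<close> only, so \<open>V\<close> is an eigenbasis in the form required by the
   leave-out comparison.\<close>
 have dec: "tp A * A + x * tp x = tp X * X"
 proof -
  have PP: "(idm N - un i i) * (idm N - un i i) = idm N - un i i"
   by (simp add: left_diff_distrib right_diff_distrib iN un_mult_un dg_mult)
  have "tp A * A = tp X * (((idm N - un i i) * (idm N - un i i)) * X)"
   by (simp add: A tp_mult tp_minus mult.assoc)
  also have "... = tp X * X - tp X * (un i i * X)"
   unfolding PP by (simp add: left_diff_distrib right_diff_distrib distrib_left
   assoc_eq[OF LF_idm(2)] assoc_eq[OF LF_idm(5)] LF_idm)
  also have "tp X * (un i i * X) = x * tp x"
   unfolding x_def by (simp add: tp_mult mult.assoc un_un_assoc)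
  finally show ?thesis by simp
 qed
 \<comment> \<open>The reduced data is still compared with the full signal; the deleted signal row
   is counted as noise, which is harmless because its norm is of order
   \<open>q <= sqrt m\<close>.\<close>
 define E2 where "E2 = (idm N - un i i) * fm E - un i 0 * (tp lam * tp (fm F))"
 have AC: "A = fm L * tp (fm F) + E2"
  by (simp add: A E2_def lam left_diff_distrib right_diff_distrib distrib_left assoc_eq[OF LF_idm(2)] LF_idm
   tp_mult mult.assoc un_un_assoc)
 have nFl: "norm (fm F * lam) <= K * q * (K * h)" by (rule norm_opb_le[OF F_up lam(2)])
 have nFl1: "norm (fm F * lam) <= K^2 * q"
 proof (rule order_trans[OF nFl])
  have "K^2 * q * h <= K^2 * q * 1" using h pos by (intro mult_left_mono) auto
  then show "K * q * (K * h) <= K^2 * q" by (simp add: power2_eq_square mult_ac)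
 qed
 have E2o: "opb E2 (2 * K^2 * sqrt (m * 1))"
 proof -
  have "norm (un i 0 * (tp lam * tp (fm F))) <= 1 * (K^2 * q)"
  proof (rule norm_mult_le)
   have "norm (tp lam * tp (fm F)) = norm (fm F * lam)" by (metis norm_tp tp_mult)
   then show "norm (tp lam * tp (fm F)) <= K^2 * q" using nFl1 by simp
  qed simp
  then have "opb (un i 0 * (tp lam * tp (fm F))) (K^2 * q)" by (intro opb_mono[OF opb_norm]) simp
  then have "opb E2 (1 * (K * sqrt m) + K^2 * q)"
   unfolding E2_def by (intro opb_minus opb_mult[OF Pi E_up])
  moreover have "K * sqrt m <= K^2 * sqrt m" "K^2 * q <= K^2 * sqrt m"
   using k1 pos sqrt_m(2) by (auto intro!: mult_right_mono mult_left_mono simp: power2_eq_square)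
  ultimately show ?thesis by (auto elim!: opb_mono)
 qed
 have Ao: "opb A (2 * K^2 * s)" using opb_mult[OF Pi X_up] by (simp add: A)
 have AT: "A * idm T = A" by (simp add: A mult.assoc distrib_right LF_idm LF_tp_idm)
 have nx: "norm x <= 2 * K^2 * q"
 proof -
  have "norm x <= K^2 * q + K * q" unfolding xe by (intro norm_add_le nFl1 ei)
  also have "K * q <= K^2 * q" using k1 pos by (intro mult_right_mono) (auto simp: power2_eq_square)
  finally show ?thesis by (simp add: algebra_simps)
 qed
 have nxV: "norm (tp x * fm V) <= K^3 * q * h + v"
 proof -
  have "norm (tp x * fm V) = norm (tp (fm V) * x)" by (metis norm_tp tp_mult tp_tp)
  also have "... <= K * (K * q * (K * h)) + v"
   unfolding xe distrib_left by (intro norm_add_le norm_mult_le UV_norm nFl) (simp add: v_def)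
  finally show ?thesis by (simp add: power_numeral_reduce mult_ac)
 qed
 have y: "norm ((idm T - Vh * tp Vh) * (x * (tp x * fm V))) <= 5 * K^2 * (2 * K^2 * q * (K^3 * q * h + v))"
  by (intro norm_opb_le[OF opb_one_minus[OF Vh(1) k1]] norm_mult_le nx nxV)
 have small1: "2048 * K^16 * m * 1 <= s^2" using small by simp
 have JV: "norm ((idm T - Vh * tp Vh) * fm V)
   <= 8 * K^4 / s^2 * (8 * K^2 + 5 * K^2 * (2 * K^2 * q * (K^3 * q * h + v)))"
 proof (rule leave_out_J[OF UV_idm(4,2) UV_norm(2) _ Vh inv order_refl small1 _ AC Ao AT _ E2o y])
  show "(tp A * A + x * tp x) * fm V = fm V * dg r (%j. (d j)^2)" unfolding dec by (rule XX(1))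
 qed (use on CJ in "simp_all add: mult.assoc")
 have v0: "0 <= v" by (simp add: v_def)
 \<comment> \<open>The leave-out comparison returns \<open>v\<close> with the factor
   \<open>80 * K^9 * q^2 / s^2\<close>, at most 1/2 by \<open>small\<close>. Moving it to the left
   doubles the remaining constants.\<close>
 have vb: "v <= 4 * K^2 * k2 + 128 * K^7 + 160 * K^12 * (q * (h * (m / s^2)))"
 proof -
  have "fm V = Vh * (tp Vh * fm V) + (idm T - Vh * tp Vh) * fm V"
   by (simp add: left_diff_distrib UV_idm mult.assoc)
  then have dec: "tp (fm V) * ei = tp (tp Vh * fm V) * (tp Vh * ei) + tp ((idm T - Vh * tp Vh) * fm V) * ei"
   by (metis distrib_right mult.assoc tp_mult tp_plus)
  have "v = norm (tp (tp Vh * fm V) * (tp Vh * ei) + tp ((idm T - Vh * tp Vh) * fm V) * ei)"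
   unfolding v_def dec ..
  also have "... <= 2 * K * K * k2 + 8 * K^4 / s^2 * (8 * K^2 + 5 * K^2 * (2 * K^2 * q * (K^3 * q * h + v))) * (K * q)"
  proof (rule norm_add_le[OF norm_mult_le[OF _ k2] norm_mult_le[OF _ ei(2)]])
   show "norm (tp (tp Vh * fm V)) <= 2 * K * K" unfolding norm_tp by (intro norm_mult_le UV_norm) (use Vh in simp)
   show "norm (tp ((idm T - Vh * tp Vh) * fm V)) <= 8 * K^4 / s^2 * (8 * K^2 + 5 * K^2 * (2 * K^2 * q * (K^3 * q * h + v)))"
   unfolding norm_tp by (rule JV)
  qed
  also have "... = 2 * K^2 * k2 + 64 * K^7 * (q / s^2) + 80 * K^12 * (q * (h * (q^2 / s^2))) + (80 * K^9 * q^2 / s^2) * v"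
  proof -
   have "2 * K * K * k2 + 8 * K^4 / z * (8 * K^2 + 5 * K^2 * (2 * K^2 * q * (K^3 * q * h + v))) * (K * q)
   = 2 * K^2 * k2 + 64 * K^7 * (q / z) + 80 * K^12 * (q * (h * (q^2 / z))) + (80 * K^9 * q^2 / z) * v" if "z ~= 0" for z
   using that by (simp add: field_simps power_numeral_reduce)
   then show ?thesis using pos by simp
  qed
  also have "... <= 2 * K^2 * k2 + 64 * K^7 * 1 + 80 * K^12 * (q * (h * (m / s^2))) + (1 / 2) * v"
  proof (intro add_mono mult_left_mono mult_right_mono order_refl)
   have "q <= q^2" using q1 by (simp add: power2_eq_square)
   also have "... <= m" by (rule qm)
   also have "m <= s^2" using sqrt_m(1) pos by (metis less_imp_le real_le_lsqrt real_sqrt_le_iff real_sqrt_abs abs_of_pos)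
   finally show "q / s^2 <= 1" using pos by simp
   show "q^2 / s^2 <= m / s^2" using qm by (intro divide_right_mono) auto
   have "160 * K^9 * q^2 <= 2048 * K^16 * m"
   using k1 qm pos by (intro mult_mono power_increasing) auto
   then have a: "80 * K^9 * q^2 <= 1 / 2 * s^2" using small by linarith
   have "0 < s^2" using pos by simp
   show "80 * K^9 * q^2 / s^2 <= 1 / 2" unfolding pos_divide_le_eq[OF \<open>0 < s^2\<close>] by (rule a)
  qed (use pos h v0 in auto)
  finally show ?thesis by simp
 qed
 have "dg r d * (tp (fm U) * un i 0) = tp (fm V) * x"
 proof -
  have "dg r d * tp (fm U) = tp (fm V) * tp X" using arg_cong[OF svd(5), of tp] by (simp add: tp_mult)
  then show ?thesis by (simp add: x_def mult.assoc[symmetric])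
 qed
 \<comment> \<open>The signal part of row \<open>i\<close> meets only the mismatch of the matching
   matrix; the rest is \<open>tp V * ei\<close>, scaled by 1 / q.\<close>
 then have eq: "(1 / q) *\<^sub>R (dg r d * (tp (fm U) * un i 0)) - fm (the (mat_inverse H)) * lam
   = ((1 / q) *\<^sub>R (tp (fm V) * fm F) - fm (the (mat_inverse H))) * lam + (1 / q) *\<^sub>R (tp (fm V) * ei)"
  by (simp add: xe distrib_left left_diff_distrib mult.assoc scaleR_add_right)
 have cc0: "0 <= cc" using matching_bounds(6)[OF H g] norm_ge_zero order_trans by blast
 have "norm ((1 / q) *\<^sub>R (dg r d * (tp (fm U) * un i 0)) - fm (the (mat_inverse H)) * lam)
   <= cc * (K^2 * m / s^2 + K * s / s^2) * (K * h) + (1 / q) * v"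
  unfolding eq by (intro norm_add_le norm_mult_le matching_bounds(4)[OF H g] lam) (use pos in "simp add: v_def")
 also have "... = cc * K^3 * (h * (m / s^2)) + cc * K^2 * (h / s) + (1 / q) * v"
  using pos by (simp add: field_simps power_numeral_reduce power2_eq_square)
 also have "... <= cc * K^3 * (h * (m / s^2)) + cc * K^2 * (1 / q)
   + (1 / q) * (4 * K^2 * k2 + 128 * K^7 + 160 * K^12 * (q * (h * (m / s^2))))"
 proof (intro add_mono mult_left_mono order_refl vb)
  have "h / s <= 1 / s" using h pos by (intro divide_right_mono) auto
  also have "... <= 1 / q" using p1 pos by (intro divide_left_mono) auto
  finally show "h / s <= 1 / q" .
 qed (use cc0 pos h in auto)
 also have "... = (cc * K^2 + 4 * K^2 * k2 + 128 * K^7) * (1 / q) + (cc * K^3 + 160 * K^12) * (h * (m / s^2))"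
 proof -
  have "cc * K^3 * Y + cc * K^2 * (1 / q) + (1 / q) * (4 * K^2 * k2 + 128 * K^7 + 160 * K^12 * (q * Y))
   = (cc * K^2 + 4 * K^2 * k2 + 128 * K^7) * (1 / q) + (cc * K^3 + 160 * K^12) * Y" for Y
   using pos by (simp add: field_simps)
  then show ?thesis .
 qed
 also have "... <= (cc * K^3 + cc * K^2 + 4 * K^2 * k2 + 128 * K^7 + 160 * K^12) * (1 / q)
   + (cc * K^3 + cc * K^2 + 4 * K^2 * k2 + 128 * K^7 + 160 * K^12) * (h * (m / s^2))"
 proof -
  have "0 <= cc * K^3" "0 <= cc * K^2" "0 <= 4 * K^2 * k2" "0 <= 128 * K^7" "0 <= 160 * K^12"
   using cc0 pos k20 by simp_all
  moreover have "0 <= h * (m / s^2)" "0 <= 1 / q" using pos h by simp_all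
  ultimately show ?thesis by (intro add_mono[OF mult_right_mono mult_right_mono]) linarith+
 qed
 finally show ?thesis by (simp add: distrib_left)
qed

text \<open>The complement of the loading space annihilates the signal, so there
  \<open>U = X * V\<close> times the inverse singular values consists of noise alone.\<close>

lemma noise_part:
 assumes P: "opb (idm N - fm L * Li) 1" and Li: "Li * fm L = idm r"
 shows "norm ((idm N - fm L * Li) * fm U) <= 2 * K^4 * sqrt m / s"
proof -
 have "(idm N - fm L * Li) * fm L = 0"
  by (simp add: left_diff_distrib LF_idm mult.assoc Li)
 then have "(idm N - fm L * Li) * X = (idm N - fm L * Li) * fm E"
  by (simp add: distrib_left mult.assoc[symmetric])
 moreover have "fm U = X * fm V * dg r (%j. 1 / d j)"
 proof -
  have "dg r d * dg r (%j. 1 / d j) = idm r" unfolding dg_mult by (rule dg_cong) (use d_pos in force)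
  then show ?thesis by (simp add: svd(5) mult.assoc UV_idm)
 qed
 ultimately have "(idm N - fm L * Li) * fm U = (idm N - fm L * Li) * (fm E * (fm V * dg r (%j. 1 / d j)))"
  by (metis mult.assoc)
 also have "norm ... <= 1 * (K * sqrt m * (2 * K^2 / s * K))"
 proof (intro norm_opb_le[OF P] norm_opb_le[OF E_up])
  have "opb (dg r (%j. 1 / d j)) (2 * K^2 / s)"
  proof (rule opb_dg)
   fix j assume j: "j < r"
   have "1 / d j <= 2 * K^2 / s" using d_bounds(1)[OF j] d_pos[OF j] pos by (simp add: field_simps)
   then show "\<bar>1 / d j\<bar> <= 2 * K^2 / s" using d_pos[OF j] by simp
  qed (use pos in simp)
  from opbD_left[OF this, of "fm V"] show "norm (fm V * dg r (%j. 1 / d j)) <= 2 * K^2 / s * K"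
   using UV_norm(2) pos by (meson divide_nonneg_pos less_imp_le mult_left_mono mult_nonneg_nonneg order_trans zero_le_numeral zero_le_power2)
 qed
 finally show ?thesis by (simp add: power_numeral_reduce mult_ac)
qed

end

context pc_outcome
begin

text \<open>Counterpart of \<open>row_bound\<close> with the roles of \<open>U\<close> and
  \<open>V\<close> exchanged and a whole window \<open>Pc\<close> of periods removed. The noise
  \<open>e\<close> of the period is split into its projection on the loadings, small by
  \<open>Le\<close>, and the rest, which the candidate \<open>Uh\<close> sees only through
  \<open>k2\<close>.\<close>

lemma col_bound:
 fixes f e Uh Pc Li Fi :: fmat and Dd n2 N6 k2 :: real
 assumes H: "is_matching_matrix r T L F U d V H" and g: "norm (tp (fm L) * (fm E * fm F)) <= K * s"
  and f: "f = tp (fm F) * un t 0" "norm f <= K"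
  and e: "e = fm E * un t 0" "norm e <= K * n2" and n2: "p <= n2" "n2 <= sqrt m"
  and Pc: "tp Pc = Pc" "Pc * Pc = Pc" "idm T * Pc = Pc" "Pc * idm T = Pc"
  and Dd: "1 <= Dd" "Dd <= q" and N6: "sqrt Dd <= N6" "1 <= N6"
  and PF: "norm (Pc * fm F) <= K * sqrt Dd" and PEL: "norm (Pc * (tp (fm E) * fm L)) <= K * sqrt Dd * p"
  and Le: "norm (tp (fm L) * e) <= K * p"
  and small: "2048 * K^16 * m * Dd <= s^2"
  and Uh: "norm Uh <= 2 * K" "Uh * idm r = Uh" "idm N * Uh = Uh"
  and A: "A = (idm T - Pc) * tp X"
  and inv: "norm ((idm N - Uh * tp Uh) * (tp A * (A * Uh))) <= 1"
  and on: "norm (tp Uh * Uh - idm r) <= 1 / (96 * K^9 * sqrt (m * Dd) * s)"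
  and CJ: "norm (fm F * (tp (fm L) * (idm N - Uh * tp Uh))) <= 6 * K^6 * sqrt (m * Dd)"
  and Li: "Li * fm L = idm r" "norm Li <= K^2 / p" "tp (fm L * Li) = fm L * Li" "fm L * Li * (fm L * Li) = fm L * Li"
  and k2: "norm (tp Uh * ((idm N - fm L * Li) * e)) <= k2 * (sqrt m / s * N6)"
 shows "norm (q *\<^sub>R (tp (fm V) * un t 0) - tp (fm H) * f)
  <= (cc * K^3 + cc * K^2 + 8 * K^8 + 4 * K^4 * k2 + 128 * K^9 + 704 * K^21)
   * (1 / p + m * N6 / s^2 + n2 * (m * sqrt m) * sqrt Dd / (s^3 * p))"
proof -
 define J where "J = idm N - Uh * tp Uh"
 define x where "x = X * Pc"
 define S where "S = sqrt m"
 define Sd where "Sd = sqrt Dd"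
 have S: "0 < S" "S * S = m" "S <= m" "1 <= S"
 proof -
  show "0 < S" "S * S = m" using pos by (simp_all add: S_def)
  show "1 <= S" using pos by (simp add: S_def)
  then have "S * 1 <= S * S" by (intro mult_left_mono) auto
  then show "S <= m" using \<open>S * S = m\<close> by simp
 qed
 have Sd: "1 <= Sd" "Sd * Sd = Dd" using Dd by (simp_all add: Sd_def)
 have SSd: "sqrt (m * Dd) = S * Sd" by (simp add: S_def Sd_def real_sqrt_mult)
 have k20: "0 <= k2"
 proof -
  have "0 < sqrt m / s * N6" using pos N6 by simp
  moreover have "0 <= k2 * (sqrt m / s * N6)" using k2 norm_ge_zero order_trans by blast
  ultimately show ?thesis unfolding zero_le_mult_iff by linarith
 qed
 have n20: "1 <= n2" using n2 p1 by simp
 have Pi: "opb (idm T - Pc) 1" by (rule compl_proj[OF Pc])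
 have Pc1: "opb Pc 1" by (rule opb_proj[OF Pc(1,2)])
 have tX: "tp X = fm F * tp (fm L) + tp (fm E)" by (simp add: tp_simps)
 have TX: "idm T * tp X = tp X"
  unfolding tX using arg_cong[OF LF_idm(6), of tp] by (simp add: distrib_left assoc_eq[OF LF_idm(4)] tp_mult)
 have dec: "tp A * A + x * tp x = X * tp X"
 proof -
  have PP: "(idm T - Pc) * (idm T - Pc) = idm T - Pc"
   by (simp add: left_diff_distrib right_diff_distrib Pc dg_mult)
  have "tp A * A = X * (((idm T - Pc) * (idm T - Pc)) * tp X)"
   by (simp only: A tp_mult tp_minus tp_tp tp_dg Pc mult.assoc)
  also have "... = X * tp X - X * (Pc * tp X)"
   unfolding PP by (simp only: left_diff_distrib right_diff_distrib TX)
  also have "X * (Pc * tp X) = x * tp x"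
   unfolding x_def tp_mult Pc(1) mult.assoc assoc_eq[OF Pc(2)] ..
  finally show ?thesis by simp
 qed
 define E2 where "E2 = (idm T - Pc) * tp (fm E) - Pc * fm F * tp (fm L)"
 have AC: "A = fm F * tp (fm L) + E2"
  unfolding A tX E2_def by (simp add: left_diff_distrib distrib_left assoc_eq[OF LF_idm(4)] mult.assoc)
 have E2o: "opb E2 (2 * K^2 * sqrt (m * Dd))"
 proof -
  have "opb E2 (1 * (K * sqrt m) + K * sqrt Dd * (K * p))"
   unfolding E2_def
   by (intro opb_minus opb_mult[OF Pi opb_tp[OF E_up]] opb_mult[OF opb_mono[OF opb_norm PF] opb_tp[OF L_up]])
  moreover have "1 * (K * sqrt m) + K * sqrt Dd * (K * p) <= 2 * K^2 * sqrt (m * Dd)"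
  proof -
   have "K * S * 1 <= K^2 * S * Sd" using k1 S Sd by (intro mult_mono) (auto simp: power2_eq_square)
   moreover have "K^2 * Sd * p <= K^2 * Sd * S" using n2 pos Sd by (intro mult_left_mono) (auto simp: S_def)
   ultimately show ?thesis unfolding SSd S_def[symmetric] Sd_def[symmetric] by (simp add: power2_eq_square mult_ac)
  qed
  ultimately show ?thesis by (rule opb_mono)
 qed
 have Ao: "opb A (2 * K^2 * s)" using opb_mult[OF Pi opb_tp[OF X_up]] by (simp add: A)
 have AN: "A * idm N = A"
 proof -
  have "tp X * idm N = tp X" unfolding tX using arg_cong[OF LF_idm(5), of tp]
   by (simp add: distrib_right mult.assoc LF_tp_idm tp_mult)
  then show ?thesis by (simp only: A mult.assoc)
 qed
 have P1: "opb (idm N - fm L * Li) 1"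
 proof (rule compl_proj[OF Li(3,4)])
  show N: "idm N * (fm L * Li) = fm L * Li" by (rule assoc_eq[OF LF_idm(2)])
  show "fm L * Li * idm N = fm L * Li" using arg_cong[OF N, of tp] by (simp only: tp_mult[of "idm N"] Li(3) tp_dg)
 qed
 define W where "W = tp x * fm U"
 \<comment> \<open>Norm bounds alone would leave the order \<open>sqrt m\<close> in the noise part
   of \<open>W\<close>. Splitting \<open>U\<close> along the loading space leaves window terms of
   order \<open>p * sqrt Dd\<close> and a rest of order \<open>m / s\<close>.\<close>
 have nW: "norm W <= 2 * K^4 * p * Sd + 2 * K^5 * m / s"
 proof -
  have Udec: "fm U = fm L * (Li * fm U) + (idm N - fm L * Li) * fm U"
   by (simp add: left_diff_distrib UV_idm mult.assoc)
  have "W = Pc * fm F * (tp (fm L) * fm U) + Pc * (tp (fm E) * fm U)"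
   unfolding W_def x_def tp_mult[of X] Pc(1) tX by (simp only: mult.assoc distrib_left distrib_right)
  also have "Pc * (tp (fm E) * fm U) = Pc * (tp (fm E) * fm L) * (Li * fm U) + Pc * (tp (fm E) * ((idm N - fm L * Li) * fm U))"
   by (subst (1) Udec) (simp only: distrib_left mult.assoc)
  finally have "W = Pc * fm F * (tp (fm L) * fm U) + (Pc * (tp (fm E) * fm L) * (Li * fm U) + Pc * (tp (fm E) * ((idm N - fm L * Li) * fm U)))" .
  then have "norm W <= K * sqrt Dd * (K * p * K) + (K * sqrt Dd * p * (K^2 / p * K) + 1 * (K * sqrt m * (2 * K^4 * sqrt m / s)))"
   by (simp only:) (intro norm_add_le norm_mult_le[OF PF] norm_mult_le[OF PEL] norm_mult_le[OF Li(2)] norm_opb_le[OF Pc1]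
   norm_opb_le[OF opb_tp[OF L_up]] norm_opb_le[OF opb_tp[OF E_up]] noise_part[OF P1 Li(1)] UV_norm)
  also have "... = K^3 * p * Sd + K^4 * 1 * Sd + 2 * K^5 * (S * S) / s"
   using pos by (simp add: S_def[symmetric] Sd_def[symmetric] power_numeral_reduce mult_ac)
  also have "... <= K^4 * p * Sd + K^4 * p * Sd + 2 * K^5 * (S * S) / s"
   using k1 pos p1 Sd by (intro add_mono mult_mono power_increasing order_refl) auto
  finally show ?thesis by (simp add: S mult_ac)
 qed
 obtain Fi where Fi: "Fi * fm F = idm r" "norm Fi <= sqrt (real r) / (q / K)"
  using left_inverse_exists[OF LF_idm(3) F_low] pos by (metis divide_pos_pos)
 have nFi: "norm Fi <= K^2 / q"
 proof (rule order_trans[OF Fi(2)])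
  have "sqrt (real r) * K <= K * K" using rk pos by (intro mult_right_mono) auto
  then show "sqrt (real r) / (q / K) <= K^2 / q" using pos by (simp add: power2_eq_square divide_right_mono)
 qed
 \<comment> \<open>\<open>CJ\<close> bounds \<open>J\<close> against the whole signal; a left
   inverse of the factors reduces this to the loadings.\<close>
 have nJL: "norm (J * fm L) <= K^2 / q * (6 * K^6 * sqrt (m * Dd))"
 proof -
  have tJ: "tp J = J" by (simp add: J_def tp_simps)
  have "tp (fm L) * J = Fi * (fm F * (tp (fm L) * J))" by (simp add: assoc_eq[OF Fi(1)] assoc_eq[OF LF_tp_idm(1)])
  also have "norm ... <= K^2 / q * (6 * K^6 * sqrt (m * Dd))"
   by (rule norm_mult_le[OF nFi CJ[folded J_def]])
  finally show ?thesis by (metis norm_tp tJ tp_mult tp_tp)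
 qed
 have nJE: "opb J (5 * K^2)" unfolding J_def by (rule opb_one_minus[OF Uh(1) k1])
 \<comment> \<open>The window acts through loadings and through noise. The loading part is damped by
   \<open>J * fm L\<close>, and \<open>Dd <= q\<close> keeps it at the noise level
   \<open>sqrt m\<close>.\<close>
 have y: "norm (J * (x * (tp x * fm U))) <= 11 * K^9 * S * (2 * K^4 * p * Sd + 2 * K^5 * m / s)"
 proof -
  have "J * (x * W) = J * fm L * (tp (Pc * fm F) * W) + J * (fm E * (Pc * W))"
   by (simp only: x_def tp_mult Pc mult.assoc distrib_left distrib_right)
  then have "norm (J * (x * W)) <= K^2 / q * (6 * K^6 * sqrt (m * Dd)) * (K * sqrt Dd * norm W) + 5 * K^2 * (K * sqrt m * (1 * norm W))"
   by (simp only:)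
   (rule norm_add_le[OF norm_mult_le[OF nJL norm_mult_le[OF _ order_refl]]
   norm_opb_le[OF nJE norm_opb_le[OF E_up norm_opb_le[OF Pc1 order_refl]]]], simp only: norm_tp PF)
  also have "... = (6 * K^9 * S * (Dd / q) + 5 * K^3 * S) * norm W"
  proof -
   have "K^2 / q * (6 * K^6 * (S * Sd)) * (K * Sd * w) = 6 * K^9 * S * ((Sd * Sd) / q) * w" for w
   by (simp add: power_numeral_reduce mult_ac)
   then show ?thesis unfolding SSd by (simp add: S_def[symmetric] Sd_def[symmetric] Sd power_numeral_reduce algebra_simps)
  qed
  also have "... <= (6 * K^9 * S * 1 + 5 * K^9 * S) * norm W"
   using k1 pos S Dd by (intro mult_right_mono add_mono mult_left_mono mult_mono power_increasing order_refl) auto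
  also have "... = 11 * K^9 * S * norm W" by (simp add: algebra_simps)
  also have "... <= 11 * K^9 * S * (2 * K^4 * p * Sd + 2 * K^5 * m / s)"
   using nW pos S by (intro mult_left_mono) auto
  finally show ?thesis by (simp add: W_def)
 qed
 have JU: "norm (J * fm U) <= 8 * K^4 / s^2 * (8 * K^2 + 11 * K^9 * S * (2 * K^4 * p * Sd + 2 * K^5 * m / s))"
  unfolding J_def
 proof (rule leave_out_J[OF UV_idm(3,1) UV_norm(1) _ Uh inv Dd(1) small on AC Ao AN _ E2o y[unfolded J_def]])
  show "(tp A * A + x * tp x) * fm U = fm U * dg r (%j. (d j)^2)" unfolding dec by (rule XX(2))
 qed (use CJ in "simp add: mult.assoc")
 \<comment> \<open>The projection on the loadings is symmetric, so it can be evaluated at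
   \<open>e\<close> through \<open>tp L * e\<close>, which is of order \<open>p\<close> only;
   \<open>Li\<close> contributes the factor 1 / p.\<close>
 have PE: "norm (fm L * Li * e) <= K^3"
 proof -
  have "fm L * Li * e = tp Li * (tp (fm L) * e)"
   by (subst Li(3)[symmetric]) (simp only: tp_mult mult.assoc)
  also have "norm ... <= norm (tp Li) * norm (tp (fm L) * e)" by (rule norm_mult_ineq)
  also have "... <= K^2 / p * (K * p)" using Li(2) Le pos by (intro mult_mono) auto
  finally show ?thesis using pos by (simp add: power_numeral_reduce power2_eq_square)
 qed
 have UhE: "norm (tp Uh * e) <= 2 * K * K^3 + k2 * (S / s * N6)"
 proof -
  have "fm E * un t 0 = idm N * (fm E * un t 0)" by (simp add: assoc_eq[OF LF_idm(5)])
  then have "tp Uh * e = tp Uh * (fm L * Li * e) + tp Uh * ((idm N - fm L * Li) * e)"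
   by (simp add: e(1) left_diff_distrib right_diff_distrib)
  then show ?thesis
   unfolding S_def by (simp only:) (rule norm_add_le[OF norm_mult_le[OF _ PE] k2], simp only: norm_tp Uh)
 qed
 define u where "u = norm (tp (fm U) * e)"
 have u: "u <= 2 * K * K * (2 * K * K^3 + k2 * (S / s * N6))
   + 8 * K^4 / s^2 * (8 * K^2 + 11 * K^9 * S * (2 * K^4 * p * Sd + 2 * K^5 * m / s)) * (K * n2)"
 proof -
  have "fm U = Uh * (tp Uh * fm U) + J * fm U"
   by (simp add: J_def left_diff_distrib UV_idm mult.assoc)
  then have "tp (fm U) * e = tp (tp Uh * fm U) * (tp Uh * e) + tp (J * fm U) * e"
   by (metis distrib_right mult.assoc tp_mult tp_plus)
  moreover have "norm (tp (tp Uh * fm U)) <= 2 * K * K" unfolding norm_tp by (intro norm_mult_le UV_norm) (use Uh in simp)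
  ultimately show ?thesis
   unfolding u_def using JU by (simp only:) (intro norm_add_le[OF norm_mult_le[OF _ UhE] norm_mult_le[OF _ e(2)]], simp_all)
 qed
 define Di where "Di = dg r (%j. 1 / d j)"
 have Dio: "opb Di (2 * K^2 / s)" unfolding Di_def
 proof (rule opb_dg)
  fix j assume j: "j < r"
  have "1 / d j <= 2 * K^2 / s" using d_bounds(1)[OF j] d_pos[OF j] pos by (simp add: field_simps)
  then show "\<bar>1 / d j\<bar> <= 2 * K^2 / s" using d_pos[OF j] by simp
 qed (use pos in simp)
 \<comment> \<open>Row \<open>t\<close> of \<open>V\<close> is read off from column \<open>t\<close>
   of \<open>X\<close> through the left singular vectors, which is why the leave-out is carried out
   on \<open>U\<close>.\<close>
 have "tp (fm V) = Di * (tp (fm U) * X)"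
 proof -
  have "tp (fm U) * X = dg r d * tp (fm V)" using arg_cong[OF svd(6), of tp] by (simp only: tp_mult tp_tp tp_dg)
  moreover have "Di * dg r d = idm r" unfolding Di_def dg_mult by (rule dg_cong) (use d_pos in force)
  moreover have "idm r * tp (fm V) = tp (fm V)" using arg_cong[OF UV_idm(2), of tp] by (simp only: tp_mult tp_dg)
  ultimately show ?thesis by (simp only: assoc_eq)
 qed
 moreover have "X * un t 0 = fm L * f + e" by (simp add: f e distrib_right mult.assoc)
 ultimately have "tp (fm V) * un t 0 = Di * (tp (fm U) * (fm L * f + e))"
  by (metis mult.assoc)
 then have "tp (fm V) * un t 0 = Di * (tp (fm U) * (fm L * f)) + Di * (tp (fm U) * e)"
  by (simp only: distrib_left)
 then have eq: "q *\<^sub>R (tp (fm V) * un t 0) - tp (fm H) * f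
   = (q *\<^sub>R (Di * (tp (fm U) * fm L)) - tp (fm H)) * f + q *\<^sub>R (Di * (tp (fm U) * e))"
  by (simp add: left_diff_distrib scaleR_add_right mult.assoc)
 have cc0: "0 <= cc" using matching_bounds(6)[OF H g] norm_ge_zero order_trans by blast
 have "norm (q *\<^sub>R (tp (fm V) * un t 0) - tp (fm H) * f)
   <= cc * (K^2 * m / s^2 + K * s / s^2) * K + q * (2 * K^2 / s * u)"
  unfolding eq
 proof (rule norm_add_le[OF norm_mult_le[OF matching_bounds(5)[OF H g, folded Di_def] f(2)]])
  have "norm (Di * (tp (fm U) * e)) <= 2 * K^2 / s * u" by (rule norm_opb_le[OF Dio]) (simp add: u_def)
  then have "q * norm (Di * (tp (fm U) * e)) <= q * (2 * K^2 / s * u)"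
   by (rule mult_left_mono) (use pos in simp)
  moreover have "norm (q *\<^sub>R (Di * (tp (fm U) * e))) = q * norm (Di * (tp (fm U) * e))" using pos by simp
  ultimately show "norm (q *\<^sub>R (Di * (tp (fm U) * e))) <= q * (2 * K^2 / s * u)" by (simp only:)
 qed
 also have "... = cc * K^3 * (m / s^2) + cc * K^2 * (1 / s) + 2 * K^2 / p * u"
  using pos by (simp add: field_simps power_numeral_reduce power2_eq_square)
 also have "... <= cc * K^3 * (m / s^2) + cc * K^2 * (1 / s) + 2 * K^2 / p * (2 * K * K * (2 * K * K^3 + k2 * (S / s * N6))
   + 8 * K^4 / s^2 * (8 * K^2 + 11 * K^9 * S * (2 * K^4 * p * Sd + 2 * K^5 * m / s)) * (K * n2))"
  using pos by (intro add_left_mono mult_left_mono u) auto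
 also have "... = cc * K^3 * (m / s^2) + cc * K^2 * (1 / s) + 8 * K^8 * (1 / p) + 4 * K^4 * k2 * (S / (s * p) * N6)
   + 128 * K^9 * (n2 / (s^2 * p)) + 352 * K^20 * (n2 * S * Sd / s^2) + 352 * K^21 * (n2 * (m * S) / (s^3 * p))"
 proof -
  have "2 * K^2 / p * (2 * K * K * (2 * K * K^3 + k2 * (S / z * N6))
   + 8 * K^4 / z^2 * (8 * K^2 + 11 * K^9 * S * (2 * K^4 * p * Sd + 2 * K^5 * m / z)) * (K * n2))
   = 8 * K^8 * (1 / p) + 4 * K^4 * k2 * (S / (z * p) * N6)
   + 128 * K^9 * (n2 / (z^2 * p)) + 352 * K^20 * (n2 * S * Sd / z^2) + 352 * K^21 * (n2 * (m * S) / (z^3 * p))" if "0 < z" for z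
   using that pos by (simp add: field_simps power_numeral_reduce)
  then show ?thesis using pos by simp
 qed
 \<comment> \<open>Seven rates collapse to three. The mixed one, \<open>n2 * S * Sd / s^2\<close>,
   falls under \<open>m * N6 / s^2\<close> by \<open>n2 <= S\<close> and \<open>Sd <= N6\<close>;
   704 later covers both terms with 352.\<close>
 also have "... <= cc * K^3 * (m * N6 / s^2) + cc * K^2 * (1 / p) + 8 * K^8 * (1 / p) + 4 * K^4 * k2 * (m * N6 / s^2)
   + 128 * K^9 * (m * N6 / s^2) + 352 * K^21 * (m * N6 / s^2) + 352 * K^21 * (n2 * (m * S) * Sd / (s^3 * p))"
 proof (intro add_mono mult_left_mono)
  have mN: "m / s^2 * 1 <= m / s^2 * N6" using N6 pos by (intro mult_left_mono) auto
  then show mN6: "m / s^2 <= m * N6 / s^2" by simp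
  show "1 / s <= 1 / p" using q1 pos by (intro divide_left_mono) auto
  show "1 / p <= 1 / p" ..
  have "S / (s * p) = S * q / s^2" using pos by (simp add: field_simps power2_eq_square)
  also have "... <= S * S / s^2" using sqrt_m(2) S by (intro divide_right_mono mult_left_mono) (auto simp: S_def)
  finally have "S / (s * p) * N6 <= m / s^2 * N6" using N6 S by (intro mult_right_mono) auto
  then show "S / (s * p) * N6 <= m * N6 / s^2" by simp
  have "n2 / (s^2 * p) <= n2 / (s^2 * 1)" using p1 pos n20 by (intro divide_left_mono mult_left_mono) auto
  also have "... <= m / s^2" using n2(2) S by (simp add: S_def[symmetric] divide_right_mono)
  also note mN6
  finally show "n2 / (s^2 * p) <= m * N6 / s^2" .
  show "352 * K^20 * (n2 * S * Sd / s^2) <= 352 * K^21 * (m * N6 / s^2)"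
  proof (intro mult_mono)
   have "n2 * S * Sd <= S * S * N6" using n2 N6 S Sd n20 by (intro mult_mono) (auto simp: S_def Sd_def)
   then show "n2 * S * Sd / s^2 <= m * N6 / s^2" unfolding S(2) by (intro divide_right_mono) auto
  qed (use k1 S Sd n20 pos in "auto intro!: power_increasing")
  have "n2 * (m * S) * 1 / (s^3 * p) <= n2 * (m * S) * Sd / (s^3 * p)"
   using Sd S pos n20 by (intro divide_right_mono mult_left_mono) auto
  then show "n2 * (m * S) / (s^3 * p) <= n2 * (m * S) * Sd / (s^3 * p)" by simp
 qed (use cc0 pos k20 in auto)
 also have "... = (cc * K^2 + 8 * K^8) * (1 / p) + (cc * K^3 + 4 * K^4 * k2 + 128 * K^9 + 352 * K^21) * (m * N6 / s^2)
   + 352 * K^21 * (n2 * (m * S) * Sd / (s^3 * p))"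
 proof -
  have "cc * K^3 * b + cc * K^2 * a + 8 * K^8 * a + 4 * K^4 * k2 * b + 128 * K^9 * b + 352 * K^21 * b + c
   = (cc * K^2 + 8 * K^8) * a + (cc * K^3 + 4 * K^4 * k2 + 128 * K^9 + 352 * K^21) * b + c" for a b c
   by (simp add: algebra_simps)
  then show ?thesis .
 qed
 also have "... <= (cc * K^3 + cc * K^2 + 8 * K^8 + 4 * K^4 * k2 + 128 * K^9 + 704 * K^21) * (1 / p)
   + (cc * K^3 + cc * K^2 + 8 * K^8 + 4 * K^4 * k2 + 128 * K^9 + 704 * K^21) * (m * N6 / s^2)
   + (cc * K^3 + cc * K^2 + 8 * K^8 + 4 * K^4 * k2 + 128 * K^9 + 704 * K^21) * (n2 * (m * S) * Sd / (s^3 * p))"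
 proof -
  have "0 <= cc * K^3" "0 <= cc * K^2" "0 <= 8 * K^8" "0 <= 4 * K^4 * k2" "0 <= 128 * K^9" "0 <= 352 * K^21"
   using cc0 pos k20 by simp_all
  moreover have "0 <= 1 / p" "0 <= m * N6 / s^2" "0 <= n2 * (m * S) * Sd / (s^3 * p)"
   using pos S Sd n20 N6 by simp_all
  ultimately show ?thesis
   by (intro add_mono[OF add_mono[OF mult_right_mono mult_right_mono] mult_right_mono]) linarith+
 qed
 finally show ?thesis by (simp add: distrib_left S_def Sd_def)
qed

end

section \<open>Probabilistic tools\<close>

context prob_space
begin

text \<open>The sigma-algebras generated by the two functions are contained in the given independent
  ones, so the functions are independent.\<close>

lemma indep_sigma_integral:
 fixes X Y :: "'a => real"
 assumes ind: "indep_set (sets A) (sets B)" and sp: "space A = space M" "space B = space M"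
  and X: "X : borel_measurable A" "integrable M X" and Y: "Y : borel_measurable B" "integrable M Y"
 shows "integrable M (%u. X u * Y u)" "(\<integral>u. X u * Y u \<partial>M) = (\<integral>u. X u \<partial>M) * (\<integral>u. Y u \<partial>M)"
proof -
 have sub: "sigma_sets (space M) {f -` C \<inter> space M | C. C : sets borel} <= sets D"
  if "f : borel_measurable D" "space D = space M" for f :: "'a => real" and D
 proof -
  have "{f -` C \<inter> space M | C. C : sets borel} <= sets D"
   using measurable_sets[OF that(1)] that(2) by auto
  from sets.sigma_sets_subset[OF this] show ?thesis by (simp only: that(2))
 qed
 have "indep_var borel X borel Y"
  unfolding indep_var_eq
 proof (intro conjI)
  show "random_variable borel X" "random_variable borel Y" using X Y by auto
  show "indep_set (sigma_sets (space M) {X -` C \<inter> space M | C. C : sets borel})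
   (sigma_sets (space M) {Y -` C \<inter> space M | C. C : sets borel})"
   using ind sub[OF X(1) sp(1)] sub[OF Y(1) sp(2)] unfolding indep_set_def
   by (elim indep_sets_mono_sets) (auto split: bool.split)
 qed
 then show "integrable M (%u. X u * Y u)" "(\<integral>u. X u * Y u \<partial>M) = (\<integral>u. X u \<partial>M) * (\<integral>u. Y u \<partial>M)"
  using indep_var_integrable indep_var_lebesgue_integral X(2) Y(2) by blast+
qed

lemma sigma_finite_subalgebraI: "subalgebra M G ==> sigma_finite_subalgebra M G"
 by (rule finite_measure_subalgebra_is_sigma_finite)
  (simp add: finite_measure_subalgebra_def finite_measure_subalgebra_axioms_def finite_measure_axioms)

text \<open>Information independent of \<open>Y\<close> together with \<open>G\<close> does not
  change the conditional expectation. On intersections \<open>B \<inter> C\<close> the probability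
  of the independent set \<open>C\<close> splits off from both integrals; these sets generate
  \<open>K\<close> and are stable under intersection, so Dynkin's argument extends the
  equality.\<close>

lemma real_cond_exp_enlarge:
 assumes G: "subalgebra M G" and G1: "subalgebra M G1" "sets G <= sets G1" and Hh: "subalgebra M Hh"
  and ind: "indep_set (sets G1) (sets Hh)" and Y: "Y : borel_measurable G1" "integrable M Y"
 defines "K \<equiv> sigma (space M) (sets G \<union> sets Hh)"
 shows "AE u in M. real_cond_exp M K Y u = real_cond_exp M G Y u"
  and "subalgebra M K" "sets G <= sets K" "sets Hh <= sets K"
proof -
 have sp: "space G = space M" "space G1 = space M" "space Hh = space M"
  and se: "sets G <= sets M" "sets Hh <= sets M"
  using G G1 Hh by (auto simp: subalgebra_def)
 have pow: "sets G \<union> sets Hh <= Pow (space M)" using se sets.sets_into_space by blast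
 have sK: "sets K = sigma_sets (space M) (sets G \<union> sets Hh)" "space K = space M"
  using pow by (simp_all add: K_def)
 show KM: "subalgebra M K"
  unfolding subalgebra_def sK using sets.sigma_sets_subset[of "sets G \<union> sets Hh" M] se by simp
 show GK: "sets G <= sets K" and HK: "sets Hh <= sets K" unfolding sK by auto
 interpret K: sigma_finite_subalgebra M K by (rule sigma_finite_subalgebraI[OF KM])
 interpret G: sigma_finite_subalgebra M G by (rule sigma_finite_subalgebraI[OF G])
 define \<mu> where "\<mu> = real_cond_exp M G Y"
 have \<mu>: "integrable M \<mu>" "\<mu> : borel_measurable G" using Y by (auto simp: \<mu>_def G.real_cond_exp_int)
 have \<mu>1: "\<mu> : borel_measurable G1"
  by (rule borel_measurable_subalgebra[OF G1(2) _ \<mu>(2)]) (simp add: sp)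
 define P where "P = {B \<inter> C | B C. B : sets G & C : sets Hh}"
 have sKP: "sets K = sigma_sets (space M) P"
 proof (rule antisym)
  have "sets G \<union> sets Hh <= P"
  proof
   fix A assume "A : sets G \<union> sets Hh"
   then show "A : P"
   proof
   assume a: "A : sets G"
   have "A = A \<inter> space Hh" using sets.sets_into_space[OF a] sp by auto
   then show ?thesis using a sets.top[of Hh] unfolding P_def by blast
   next
   assume a: "A : sets Hh"
   have "A = space G \<inter> A" using sets.sets_into_space[OF a] sp by auto
   then show ?thesis using a sets.top[of G] unfolding P_def by blast
   qed
  qed
  then show "sets K <= sigma_sets (space M) P" unfolding sK by (rule sigma_sets_mono')
  have "P <= sets K" unfolding P_def using GK HK by auto
  then show "sigma_sets (space M) P <= sets K" using sets.sigma_sets_subset[of P K] sK by simp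
 qed
 have eq: "set_lebesgue_integral M A Y = set_lebesgue_integral M A \<mu>" if "A : sets K" for A
 proof -
  have "Int_stable P"
  proof (rule Int_stableI)
   fix a b assume "a : P" "b : P"
   then obtain B C B' C' where *: "a = B \<inter> C" "b = B' \<inter> C'" "B : sets G" "C : sets Hh" "B' : sets G" "C' : sets Hh"
   unfolding P_def by blast
   then have "a \<inter> b = (B \<inter> B') \<inter> (C \<inter> C')" by auto
   then show "a \<inter> b : P" unfolding P_def using * by blast
  qed
  moreover have "P <= Pow (space M)" unfolding P_def using pow by blast
  moreover have "A : sigma_sets (space M) P" using that sKP by simp
  ultimately show ?thesis
  proof (induction rule: sigma_sets_induct_disjoint)
   case (basic A)
   then obtain B C where A: "A = B \<inter> C" "B : sets G" "C : sets Hh" unfolding P_def by blast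
   have BM: "B : sets M" "C : sets M" using A se by auto
   have C: "(indicator C :: 'a => real) : borel_measurable Hh" "integrable M (indicator C :: 'a => real)"
   using A(3) BM by (auto intro: integrable_real_indicator simp: emeasure_eq_measure)
   have B1: "(indicator B :: 'a => real) : borel_measurable G1" using A(2) G1(2) by auto
   have f: "set_lebesgue_integral M A f = set_lebesgue_integral M B f * prob C"
   if "f : borel_measurable G1" "integrable M f" for f :: "'a => real"
   proof -
   have "integrable M (%u. indicator B u * f u)"
   using integrable_mult_indicator[OF BM(1) that(2)] by simp
   moreover have "(%u. indicator B u * f u) : borel_measurable G1" using B1 that(1) by simp
   ultimately have "(\<integral>u. (indicator B u * f u) * indicator C u \<partial>M) = (\<integral>u. indicator B u * f u \<partial>M) * (\<integral>u. indicator C u \<partial>M)"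
   using indep_sigma_integral(2)[OF ind sp(2,3)] C by blast
   moreover have "(%u. (indicator B u * f u) * indicator C u) = (%u. indicator A u *\<^sub>R f u)"
   by (auto simp: A(1) fun_eq_iff split: split_indicator)
   ultimately show ?thesis using BM by (simp add: set_lebesgue_integral_def)
   qed
   show ?case
   using f[OF Y] f[OF \<mu>1 \<mu>(1)] G.real_cond_exp_intA[OF Y(2) A(2)] by (simp add: \<mu>_def)
  next
   case empty then show ?case by (simp add: set_lebesgue_integral_def)
  next
   case (compl A)
   have AM: "A : sets M" using compl(1) sKP KM by (auto simp: subalgebra_def)
   have f: "set_lebesgue_integral M (space M - A) f = (\<integral>u. f u \<partial>M) - set_lebesgue_integral M A f" if "integrable M f" for f :: "'a => real"
   proof -
   have "(\<integral>u. f u \<partial>M) - set_lebesgue_integral M A f = (\<integral>u. f u - indicator A u *\<^sub>R f u \<partial>M)"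
   unfolding set_lebesgue_integral_def
   using that integrable_mult_indicator[OF AM that] by simp
   also have "... = set_lebesgue_integral M (space M - A) f"
   unfolding set_lebesgue_integral_def
   by (rule Bochner_Integration.integral_cong) (auto split: split_indicator)
   finally show ?thesis ..
   qed
   have "(\<integral>u. Y u \<partial>M) = (\<integral>u. \<mu> u \<partial>M)" unfolding \<mu>_def by (rule G.real_cond_exp_int(2)[OF Y(2), symmetric])
   then show ?case using f[OF Y(2)] f[OF \<mu>(1)] compl(2) by simp
  next
   case (union A)
   have AM: "A i : sets M" for i using union(2) sKP KM by (auto simp: subalgebra_def)
   have "set_lebesgue_integral M (\<Union>i. A i) f = (\<Sum>i. set_lebesgue_integral M (A i) f)" if "integrable M f" for f :: "'a => real"
   proof (rule lebesgue_integral_countable_add[OF AM])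
   show "A i \<inter> A j = {}" if "i ~= j" for i j using union(1) that by (auto simp: disjoint_family_on_def)
   show "set_integrable M (\<Union>i. A i) f"
   unfolding set_integrable_def using that AM by (intro integrable_mult_indicator) auto
   qed
   then show ?case using Y(2) \<mu>(1) union(3) by simp
  qed
 qed
 show "AE u in M. real_cond_exp M K Y u = real_cond_exp M G Y u"
 proof (rule K.real_cond_exp_charact)
  show "real_cond_exp M G Y : borel_measurable K"
   using borel_measurable_subalgebra[OF GK _ \<mu>(2)] sp sK(2) by (simp add: \<mu>_def)
 qed (use eq Y \<mu> in "auto simp: \<mu>_def")
qed

text \<open>The first admissible index is a measurable choice, so that a conditional second moment
 bound holds for the chosen function.\<close>

lemma selection_bound:
 fixes g :: "nat => 'a => real"
 assumes G: "subalgebra M G" and A: "!!k. A k : sets G"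
  and g: "!!k. g k : borel_measurable M" "!!k u. 0 <= g k u"
  and int: "!!k B. B : sets G ==> B <= A k ==> integrable M (%u. indicator B u * g k u)"
  and bd: "!!k B. B : sets G ==> B <= A k ==> (\<integral>u. indicator B u * g k u \<partial>M) <= c * prob B"
  and K: "0 < K" "0 <= c"
 shows "EX C:sets M. prob C >= prob (\<Union>k. A k) - c / K & (ALL u:C. EX k. u : A k & g k u <= K)"
proof -
 have GM: "sets G <= sets M" using G by (simp add: subalgebra_def)
 define B where "B = disjointed A"
 have B: "B k : sets G" "B k <= A k" for k
  using A sets.range_disjointed_sets[of A G] disjointed_subset[of A k] by (auto simp: B_def)
 have BU: "(\<Union>k. B k) = (\<Union>k. A k)" "disjoint_family B"
  unfolding B_def by (simp_all add: UN_disjointed_eq disjoint_family_disjointed)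
 define bad where "bad = (%k. {u : B k. K < g k u})"
 have BM: "B k : sets M" for k using B GM by auto
 have badM: "bad k : sets M" for k
 proof -
  have "bad k = B k \<inter> {u : space M. K < g k u}"
   using sets.sets_into_space[OF BM[of k]] by (auto simp: bad_def)
  moreover have "{u : space M. K < g k u} : sets M" using g(1)[of k] by measurable
  ultimately show ?thesis using BM by auto
 qed
 \<comment> \<open>Markov's inequality on the piece where index \<open>k\<close> is chosen. The
   pieces are disjoint, so the failure probabilities add up to at most c / K.\<close>
 have pb: "prob (bad k) <= c / K * prob (B k)" for k
 proof -
  have "K * prob (bad k) = (\<integral>u. K * indicator (bad k) u \<partial>M)" using badM by simp
  also have "... <= (\<integral>u. indicator (B k) u * g k u \<partial>M)"
  proof (rule integral_mono)
   show "integrable M (%u. K * indicator (bad k) u)"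
   using badM by (auto intro!: integrable_real_indicator simp: emeasure_eq_measure)
   show "integrable M (%u. indicator (B k) u * g k u)" by (rule int[OF B])
   fix u show "K * indicator (bad k) u <= indicator (B k) u * g k u"
   using g(2)[of k u] by (auto simp: bad_def split: split_indicator)
  qed
  also have "... <= c * prob (B k)" by (rule bd[OF B])
  finally show ?thesis using K by (simp add: field_simps)
 qed
 have dB: "summable (%k. prob (B k))" and sB: "(\<Sum>k. prob (B k)) = prob (\<Union>k. A k)"
  using finite_measure_UNION[OF _ BU(2)] BM BU(1) by (auto simp: sums_iff)
 have "prob (\<Union>k. bad k) <= (\<Sum>k. prob (bad k))"
  using pb dB badM by (intro finite_measure_subadditive_countably)
   (auto intro: summable_comparison_test'[OF summable_mult[OF dB, of "c / K"], of 0])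
 also have "... <= (\<Sum>k. c / K * prob (B k))"
  using pb dB by (intro suminf_le summable_mult) (auto intro: summable_comparison_test'[OF summable_mult[OF dB, of "c / K"], of 0])
 also have "... = c / K * prob (\<Union>k. A k)" by (simp only: suminf_mult[OF dB] sB)
 also have "... <= c / K * 1" using K by (intro mult_left_mono) auto
 finally have pbad: "prob (\<Union>k. bad k) <= c / K" by simp
 define C where "C = (\<Union>k. A k) - (\<Union>k. bad k)"
 have AM: "(\<Union>k. A k) : sets M" using A GM by blast
 have "(\<Union>k. bad k) <= (\<Union>k. A k)" using BU by (auto simp: bad_def)
 then have "prob C = prob (\<Union>k. A k) - prob (\<Union>k. bad k)"
  unfolding C_def using AM badM by (intro finite_measure_Diff) auto
 moreover have "C : sets M" unfolding C_def using AM badM by auto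
 moreover have "EX k. u : A k & g k u <= K" if "u : C" for u
 proof -
  have "u : (\<Union>k. B k)" using that unfolding C_def BU(1) by (rule DiffD1)
  then obtain k where "u : B k" by (rule UN_E)
  moreover have "u \<notin> bad k" using that unfolding C_def by blast
  ultimately show ?thesis using B(2)[of k] by (auto simp: bad_def not_less)
 qed
 ultimately show ?thesis using pbad by (intro bexI[of _ C]) auto
qed

end

section \<open>Stochastic boundedness of predicates\<close>

definition tight :: "'a measure => (real => nat => 'a => bool) => bool" where
 "tight M Q \<longleftrightarrow> (ALL e>0. EX K>0. EV n. EX A:sets M. measure M A >= 1 - e & (ALL u:A. Q K n u))"

text \<open>Replacing the inequality by a predicate in the constant puts orders in probability, good
  events and the existence of candidates on the same footing.\<close>

lemma bounded_in_prob_tight: "bounded_in_prob M Z a \<longleftrightarrow> tight M (%K n u. \<bar>Z n u\<bar> <= K * a n)"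
 by (simp add: bounded_in_prob_def tight_def)

text \<open>Monotonicity in the constant lets two tight predicates be combined with the larger of
  their constants.\<close>

definition mono_pred :: "(real => nat => 'a => bool) => bool" where
 "mono_pred Q \<longleftrightarrow> (ALL K K' n u. 0 < K --> K <= K' --> Q K n u --> Q K' n u)"

lemma mono_predI: "(!!K K' n u. 0 < K ==> K <= K' ==> Q K n u ==> Q K' n u) ==> mono_pred Q"
 by (auto simp: mono_pred_def)

lemma mono_pred_conj: "mono_pred P ==> mono_pred Q ==> mono_pred (%K n u. P K n u & Q K n u)"
 unfolding mono_pred_def by blast

lemma mono_pred_le: assumes "!!n u. 0 <= Z n u" shows "mono_pred (%K n u. Z n u <= K * a n)"
proof (rule mono_predI)
 fix K K' :: real and n and u :: 'a assume *: "0 < K" "K <= K'" "Z n u <= K * a n"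
 then have "0 <= K * a n" using assms order_trans by blast
 then have "0 <= a n" using *(1) by (simp add: zero_le_mult_iff)
 then show "Z n u <= K' * a n" using * by (meson mult_right_mono order_trans)
qed

lemma (in prob_space) tight_conj:
 assumes "tight M P" "mono_pred P" "tight M Q" "mono_pred Q"
 shows "tight M (%K n u. P K n u & Q K n u)"
 unfolding tight_def
proof (intro allI impI)
 fix e :: real assume "e > 0"
 then obtain K1 K2 where K: "0 < K1" "0 < K2"
  and 1: "EV n. EX A:sets M. prob A >= 1 - e / 2 & (ALL u:A. P K1 n u)"
  and 2: "EV n. EX A:sets M. prob A >= 1 - e / 2 & (ALL u:A. Q K2 n u)"
  using assms(1,3) unfolding tight_def by (meson half_gt_zero)
 have "EV n. EX A:sets M. prob A >= 1 - e & (ALL u:A. P (max K1 K2) n u & Q (max K1 K2) n u)"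
  using 1 2
 proof eventually_elim
  case (elim n)
  then obtain A B where AB: "A : sets M" "prob A >= 1 - e / 2" "ALL u:A. P K1 n u"
   "B : sets M" "prob B >= 1 - e / 2" "ALL u:B. Q K2 n u" by blast
  have "prob (A \<union> B) = prob A + prob (B - A)" using AB by (simp add: finite_measure_Union')
  moreover have "prob (B - A) = prob B - prob (A \<inter> B)" using AB by (simp add: finite_measure_Diff' Int_commute)
  moreover have "prob (A \<union> B) <= 1" by simp
  ultimately have "prob (A \<inter> B) >= 1 - e" using AB by linarith
  then show ?case using AB assms(2,4) K unfolding mono_pred_def
   by (intro bexI[of _ "A \<inter> B"]) (auto intro: max.cobounded1 max.cobounded2)
 qed
 then show "EX K>0. EV n. EX A:sets M. prob A >= 1 - e & (ALL u:A. P K n u & Q K n u)"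
  using K by (intro exI[of _ "max K1 K2"]) auto
qed

text \<open>Bridge from single outcomes to probability: the events that witness \<open>P\<close>
  serve for \<open>Q\<close> as well, so \<open>Q\<close> itself may be nonmeasurable, as it is for
  chosen singular vectors.\<close>

lemma tight_imp:
 assumes "tight M P"
  and "!!K. 0 < K ==> EX K'>0. EV n. ALL u:space M. P K n u --> Q K' n u"
 shows "tight M Q"
 unfolding tight_def
proof (intro allI impI)
 fix e :: real assume "e > 0"
 then obtain K where K: "K > 0" "EV n. EX A:sets M. measure M A >= 1 - e & (ALL u:A. P K n u)"
  using assms(1) unfolding tight_def by blast
 obtain K' where K': "K' > 0" "EV n. ALL u:space M. P K n u --> Q K' n u"
  using assms(2)[OF K(1)] by blast
 have "EV n. EX A:sets M. measure M A >= 1 - e & (ALL u:A. Q K' n u)"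
  using K(2) K'(2)
 proof eventually_elim
  case (elim n)
  then obtain A where A: "A : sets M" "measure M A >= 1 - e" "ALL u:A. P K n u" by blast
  then show ?case using elim(2) sets.sets_into_space[OF A(1)] by (intro bexI[of _ A]) auto
 qed
 then show "EX K>0. EV n. EX A:sets M. measure M A >= 1 - e & (ALL u:A. Q K n u)"
  using K'(1) by blast
qed

lemma (in prob_space) tight_markov:
 assumes C: "0 < C" and ev: "EV n. 0 <= a n & integrable M (%u. (Z n u)^2) & (\<integral>u. (Z n u)^2 \<partial>M) <= C * (a n)^2
   & Z n : borel_measurable M"
 shows "tight M (%K n u. \<bar>Z n u\<bar> <= K * a n)"
 unfolding tight_def
proof (intro allI impI)
 fix e :: real assume e: "e > 0"
 define K where "K = sqrt (C / e)"
 have K: "K > 0" "K^2 = C / e" using C e by (simp_all add: K_def)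
 have "EV n. EX A:sets M. prob A >= 1 - e & (ALL u:A. \<bar>Z n u\<bar> <= K * a n)"
  using ev
 proof eventually_elim
  case (elim n)
  then have [measurable]: "Z n : borel_measurable M" and a: "0 <= a n" by auto
  show ?case
  proof (cases "a n = 0")
   \<comment> \<open>Markov's inequality would divide by zero; here \<open>Z n\<close> vanishes
     almost surely.\<close>
   case True
   then have "(\<integral>u. (Z n u)^2 \<partial>M) = 0" using elim by (simp add: antisym)
   then have "AE u in M. (Z n u)^2 = 0" using elim by (subst (asm) integral_nonneg_eq_0_iff_AE) auto
   then have ae: "AE u in M. u : {u : space M. \<bar>Z n u\<bar> <= K * a n}" using True by (auto elim!: AE_mp)
   have "prob {u : space M. \<bar>Z n u\<bar> <= K * a n} = 1"
   by (subst prob_eq_1) (use ae in auto)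
   then show ?thesis using e by (intro bexI[of _ "{u : space M. \<bar>Z n u\<bar> <= K * a n}"]) auto
  next
   case False
   then have ap: "0 < (K * a n)^2" using a K by simp
   define B where "B = {u : space M. (Z n u)^2 >= (K * a n)^2}"
   have "prob B <= (\<integral>u. (Z n u)^2 \<partial>M) / (K * a n)^2"
   unfolding B_def by (rule integral_Markov_inequality_measure[where A = "{}"]) (use elim ap in auto)
   also have "... <= (C * (a n)^2) / (K * a n)^2" using elim ap by (intro divide_right_mono) auto
   also have "... = e" using False K C e by (simp add: power_mult_distrib)
   finally have "prob B <= e" .
   have BM: "B : sets M" unfolding B_def by measurable
   have "prob (space M - B) = 1 - prob B" using BM by (rule prob_compl)
   moreover have "\<bar>Z n u\<bar> <= K * a n" if "u : space M - B" for u
   proof -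
   have "(Z n u)^2 < (K * a n)^2" using that by (simp add: B_def not_le)
   then have "\<bar>Z n u\<bar> < \<bar>K * a n\<bar>" using abs_le_square_iff[of "K * a n" "Z n u"] by linarith
   then show ?thesis using a K by simp
   qed
   ultimately show ?thesis using \<open>prob B <= e\<close> BM by (intro bexI[of _ "space M - B"]) auto
  qed
 qed
 then show "EX K>0. EV n. EX A:sets M. prob A >= 1 - e & (ALL u:A. \<bar>Z n u\<bar> <= K * a n)"
  using K(1) by blast
qed

lemma (in prob_space) tight_prob_1:
 assumes "(%n. prob (B n)) \<longlonglongrightarrow> 1" "!!n u. u : B n ==> Q n u"
 shows "tight M (%K n u. Q n u)"
 unfolding tight_def
proof (intro allI impI, rule exI[of _ 1], rule conjI)
 fix e :: real assume e: "e > 0"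
 \<comment> \<open>The 0 in the maximum makes the probability positive; sets outside the
   sigma-algebra have measure 0, so this yields measurability of \<open>B n\<close>.\<close>
 have "EV n. prob (B n) > max 0 (1 - e)"
  using order_tendstoD(1)[OF assms(1), of "max 0 (1 - e)"] e by simp
 then show "EV n. EX A:sets M. prob A >= 1 - e & (ALL u:A. Q n u)"
 proof eventually_elim
  case (elim n)
  then have "B n : sets M" using measure_notin_sets[of "B n" M] by (cases "B n : sets M") auto
  then show ?case using elim assms(2) by (intro bexI[of _ "B n"]) auto
 qed
qed simp

section \<open>Sigma-algebras generated by matrix entries\<close>

lemma space_entries_sigma [simp]: "space (entries_sigma M I A) = space M"
 by (simp add: entries_sigma_def)

lemma entries_space: "entries I A : space M \<rightarrow> space (PiM I (%_. borel))"
 by (auto simp: entries_def space_PiM)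

lemma sets_entries_sigma: "sets (entries_sigma M I A) = {entries I A -` B \<inter> space M | B. B : sets (PiM I (%_. borel))}"
 unfolding entries_sigma_def by (rule sets_vimage_algebra2[OF entries_space])

lemma entry_measurable_sigma: assumes "x : I" shows "(%u. A u $$ x) : borel_measurable (entries_sigma M I A)"
proof -
 have "(%u. entries I A u x) : borel_measurable (entries_sigma M I A)"
  using measurable_compose[OF measurable_vimage_algebra1[OF entries_space] measurable_component_singleton[OF assms]]
  unfolding entries_sigma_def .
 then show ?thesis using assms by (simp add: entries_def)
qed

lemma entries_sigma_subset:
 assumes "space G = space M" "!!x. x : I ==> (%u. A u $$ x) : borel_measurable G"
 shows "sets (entries_sigma M I A) <= sets G"
proof -
 have "entries I A : measurable G (PiM I (%_. borel))"
  unfolding entries_def using assms(2) by (intro measurable_restrict) auto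
 then show ?thesis
  unfolding sets_entries_sigma using assms(1) measurable_sets[of "entries I A" G] by auto
qed

text \<open>Schur's test: after the arithmetic mean bound on \<open>m s t\<close>, symmetry of
  \<open>c\<close> makes the two halves equal, and each is controlled by absolute row sums.\<close>

lemma quadratic_form_bound:
 fixes c m :: "nat => nat => real"
 assumes sym: "!!s t. c s t = c t s" and c: "!!s. s < n ==> (\<Sum>t<n. \<bar>c s t\<bar>) <= C"
  and m: "!!s t. s < n ==> t < n ==> \<bar>m s t\<bar> <= (a s + a t) / 2" and a: "!!s. 0 <= a s"
 shows "(\<Sum>s<n. \<Sum>t<n. c s t * m s t) <= C * (\<Sum>s<n. a s)"
proof -
 have "(\<Sum>s<n. \<Sum>t<n. c s t * m s t) <= (\<Sum>s<n. \<Sum>t<n. \<bar>c s t\<bar> * ((a s + a t) / 2))"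
 proof (intro sum_mono)
  fix s t assume "s : {..<n}" "t : {..<n}"
  then have "\<bar>c s t * m s t\<bar> <= \<bar>c s t\<bar> * ((a s + a t) / 2)"
   unfolding abs_mult by (intro mult_left_mono m) auto
  then show "c s t * m s t <= \<bar>c s t\<bar> * ((a s + a t) / 2)" by linarith
 qed
 also have "... = (\<Sum>s<n. \<Sum>t<n. \<bar>c s t\<bar> * a s / 2) + (\<Sum>s<n. \<Sum>t<n. \<bar>c s t\<bar> * a t / 2)"
  by (simp add: add_divide_distrib distrib_left sum.distrib)
 also have "(\<Sum>s<n. \<Sum>t<n. \<bar>c s t\<bar> * a t / 2) = (\<Sum>s<n. \<Sum>t<n. \<bar>c s t\<bar> * a s / 2)"
  by (subst sum.swap) (simp add: sym)
 also have "(\<Sum>s<n. \<Sum>t<n. \<bar>c s t\<bar> * a s / 2) + (\<Sum>s<n. \<Sum>t<n. \<bar>c s t\<bar> * a s / 2) = (\<Sum>s<n. (\<Sum>t<n. \<bar>c s t\<bar>) * a s)"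
  by (simp add: sum_distrib_left sum.distrib[symmetric] mult.commute)
 also have "... <= (\<Sum>s<n. C * a s)"
  by (intro sum_mono mult_right_mono c a) auto
 finally show ?thesis by (simp add: sum_distrib_left)
qed

lemma integral_sum2:
 fixes f :: "nat => nat => 'a => real"
 assumes "!!i j. i < n ==> j < m ==> integrable M (f i j)"
 shows "(\<integral>u. (\<Sum>i<n. \<Sum>j<m. f i j u) \<partial>M) = (\<Sum>i<n. \<Sum>j<m. \<integral>u. f i j u \<partial>M)"
proof -
 have "(\<integral>u. (\<Sum>i<n. \<Sum>j<m. f i j u) \<partial>M) = (\<Sum>i<n. \<integral>u. (\<Sum>j<m. f i j u) \<partial>M)"
  by (rule Bochner_Integration.integral_sum, rule Bochner_Integration.integrable_sum, rule assms) auto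
 also have "... = (\<Sum>i<n. \<Sum>j<m. \<integral>u. f i j u \<partial>M)"
  by (rule sum.cong[OF refl], rule Bochner_Integration.integral_sum, rule assms) auto
 finally show ?thesis .
qed

section \<open>Second moments of linear and bilinear forms in the noise\<close>

locale factor_noise = prob_space M for M :: "'a measure" +
 fixes N T :: nat and E M0 :: "'a => real mat" and C :: real
 assumes E_rv: "!!i t. i < N ==> t < T ==> (%u. E u $$ (i, t)) : borel_measurable M"
  and M0_rv: "!!i t. i < N ==> t < T ==> (%u. M0 u $$ (i, t)) : borel_measurable M"
  and E_mean: "!!i t. i < N ==> t < T ==> (\<integral>u. E u $$ (i, t) \<partial>M) = 0"
  and E6: "!!i t. i < N ==> t < T ==> integrable M (%u. (E u $$ (i, t)) ^ 6)"
   "!!i t. i < N ==> t < T ==> (\<integral>u. (E u $$ (i, t)) ^ 6 \<partial>M) <= C" and C1: "1 <= C"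
  and E_M0: "indep_var (PiM ({..<N} \<times> {..<T}) (%_. borel)) (entries ({..<N} \<times> {..<T}) E)
   (PiM ({..<N} \<times> {..<T}) (%_. borel)) (entries ({..<N} \<times> {..<T}) M0)"
  and E_rows: "indep_vars (%i. PiM ({i} \<times> {..<T}) (%_. borel)) (%i. entries ({i} \<times> {..<T}) E) {..<N}"
  and E_cov: "!!i t. i < N ==> t < T ==>
   (\<Sum>s<T. \<bar>covariance M (%u. E u $$ (i, t)) (%u. E u $$ (i, s))\<bar>) <= C"
begin

abbreviation "RowS j \<equiv> entries_sigma M ({j} \<times> {..<T}) E"
abbreviation "AllS \<equiv> entries_sigma M ({..<N} \<times> {..<T}) E"
abbreviation "MeanS \<equiv> entries_sigma M ({..<N} \<times> {..<T}) M0"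

text \<open>Index \<open>N\<close> stands for the signal, so that the rows of the noise and the
  signal form one independent family; \<open>Oth j\<close> is everything but row
  \<open>j\<close>.\<close>

definition "S j = (if j < N then sets (RowS j) else sets MeanS)"
definition "Oth j = sigma (space M) (\<Union>l\<in>{..N} - {j}. S l)"

lemma subs: "j < N ==> subalgebra M (RowS j)" "subalgebra M AllS" "subalgebra M MeanS" "j < N ==> sets (RowS j) <= sets AllS"
proof -
 show "j < N ==> subalgebra M (RowS j)" "subalgebra M AllS" "subalgebra M MeanS"
  unfolding subalgebra_def by (intro conjI space_entries_sigma entries_sigma_subset refl; auto intro: E_rv M0_rv)+
 show "sets (RowS j) <= sets AllS" if "j < N"
  by (rule entries_sigma_subset) (use that in "auto intro: entry_measurable_sigma")
qed

lemma S_sub: "j <= N ==> S j <= sets M"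
 using subs by (auto simp: S_def subalgebra_def)

lemma indep_all_mean: "indep_set (sets AllS) (sets MeanS)"
proof -
 have "sigma_sets (space M) {entries I A -` B \<inter> space M |B. B : sets (PiM I (%_. borel))} = sets (entries_sigma M I A)" for I A
  using sets.sigma_sets_eq[of "entries_sigma M I A"] by (simp add: sets_entries_sigma)
 then show ?thesis using E_M0 unfolding indep_var_eq by simp
qed

text \<open>Independence of the whole noise from the signal splits off the factor with index
  \<open>N\<close>, and independence of the rows splits the rest.\<close>

lemma indep_S: "indep_sets S {..N}"
proof (rule indep_setsI)
 fix A J assume J: "J ~= {}" "J <= {..N}" "finite J" "ALL j:J. A j : S j"
 have rows: "indep_sets (%j. sets (RowS j)) {..<N}"
  using E_rows unfolding indep_vars_def2 sets_entries_sigma by simp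
 have r: "prob (\<Inter>j\<in>K. A j) = (\<Prod>j\<in>K. prob (A j))" if K: "K <= J - {N}" "K ~= {}" for K
 proof (rule indep_setsD[OF rows])
  show "K <= {..<N}"  using K(1) J(2) by fastforce
  show "finite K" using finite_subset[OF K(1)] J(3) by simp
  show "ALL j:K. A j : sets (RowS j)"
  proof
   fix j assume "j : K"
   then have "j : J" "j ~= N" "j <= N" using K(1) J(2) by auto
   then show "A j : sets (RowS j)" using J(4) unfolding S_def by (metis le_neq_implies_less)
  qed
 qed (use K in auto)
 show "prob (\<Inter>j\<in>J. A j) = (\<Prod>j\<in>J. prob (A j))"
 proof (cases "N : J")
  case False
  then show ?thesis using r[of J] J by auto
 next
  case True
  then have AN: "A N : sets MeanS" using J by (auto simp: S_def)
  show ?thesis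
  proof (cases "J = {N}")
   case False
   define K where "K = J - {N}"
   have K: "K ~= {}" "finite K" "J = insert N K" "N \<notin> K" using False True J(3) by (auto simp: K_def)
   have "A j : sets AllS" if "j : K" for j
   proof -
   have j: "j : J" "j < N" using that J(2) unfolding K_def by fastforce+
   then show ?thesis using J(4) subs(4)[of j] unfolding S_def by (metis subsetD)
   qed
   then have "(\<Inter>j\<in>K. A j) : sets AllS" using K by (intro sets.finite_INT) auto
   then have "prob ((\<Inter>j\<in>K. A j) \<inter> A N) = prob (\<Inter>j\<in>K. A j) * prob (A N)"
   using indep_setD[OF indep_all_mean] AN by blast
   then show ?thesis using K r[of K] by (simp add: K_def[symmetric] Int_commute mult.commute)
  qed simp
 qed
qed (use S_sub in auto)

lemma Oth_pow: "(\<Union>l\<in>{..N} - {j}. S l) <= Pow (space M)"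
 using S_sub sets.sets_into_space[of _ M] by blast

lemma Oth_sets: "sets (Oth j) = sigma_sets (space M) (\<Union>l\<in>{..N} - {j}. S l)" "space (Oth j) = space M"
 using Oth_pow[of j] by (simp_all add: Oth_def)

lemma Oth_sub: "subalgebra M (Oth j)"
 unfolding subalgebra_def Oth_sets using sets.sigma_sets_subset[of "\<Union>l\<in>{..N} - {j}. S l" M] S_sub by auto

lemma S_Oth: "l <= N ==> l ~= j ==> S l <= sets (Oth j)"
 unfolding Oth_sets by auto

lemma indep_row_Oth: assumes j: "j < N" shows "indep_set (sets (RowS j)) (sets (Oth j))"
proof -
 define I where "I = (%b. if b then {j} else {..N} - {j})"
 have "indep_sets (%b. sigma_sets (space M) (\<Union>i\<in>I b. S i)) (UNIV :: bool set)"
 proof (rule indep_sets_collect_sigma)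
  have "(\<Union>b. I b) = {..N}" using j by (auto simp: I_def UNIV_bool)
  then show "indep_sets S (\<Union>b. I b)" using indep_S by simp
  show "Int_stable (S i)" for i unfolding S_def by (auto intro!: Int_stableI)
  show "disjoint_family_on I UNIV" by (auto simp: disjoint_family_on_def I_def)
 qed
 moreover have "sigma_sets (space M) (\<Union>i\<in>I b. S i) = (case b of True => sets (RowS j) | False => sets (Oth j))" for b
  using j sets.sigma_sets_eq[of "RowS j"] by (cases b) (simp_all add: I_def S_def Oth_sets)
 ultimately show ?thesis unfolding indep_set_def by simp
qed

lemma E_row_meas: "j < N ==> t < T ==> (%u. E u $$ (j, t)) : borel_measurable (RowS j)"
 by (rule entry_measurable_sigma) simp

lemma E_Oth_meas: "l < N ==> l ~= j ==> t < T ==> (%u. E u $$ (l, t)) : borel_measurable (Oth j)"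
 using S_Oth[of l j] borel_measurable_subalgebra[OF _ _ E_row_meas[of l t], of "Oth j"] by (simp add: S_def Oth_sets)

lemma M0_Oth_meas: "l < N ==> t < T ==> j < N ==> (%u. M0 u $$ (l, t)) : borel_measurable (Oth j)"
 using S_Oth[of N j] borel_measurable_subalgebra[OF _ _ entry_measurable_sigma[of "(l, t)" "{..<N} \<times> {..<T}" M0 M], of "Oth j"]
 by (simp add: S_def Oth_sets)

lemma E2_int: assumes "i < N" "t < T" shows "integrable M (%u. (E u $$ (i, t))^2)" "(\<integral>u. (E u $$ (i, t))^2 \<partial>M) <= 2 * C"
 "integrable M (%u. E u $$ (i, t))"
proof -
 have [measurable]: "(%u. E u $$ (i, t)) : borel_measurable M" by (rule E_rv[OF assms])
 have b: "x^2 <= 1 + x^6" "\<bar>x\<bar> <= 1 + x^6" for x :: real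
 proof -
  have "x^2 <= 1 + (x^2)^3"
  proof (cases "x^2 <= 1")
   case False
   then have "(x^2)^1 <= (x^2)^3" by (intro power_increasing) auto
   then show ?thesis by simp
  qed (simp add: add_increasing2)
  then show 1: "x^2 <= 1 + x^6" by (simp flip: power_mult)
  have "\<bar>x\<bar> <= 1 + (\<bar>x\<bar>)^6"
  proof (cases "\<bar>x\<bar> <= 1")
   case False
   then have "\<bar>x\<bar>^1 <= \<bar>x\<bar>^6" by (intro power_increasing) auto
   then show ?thesis by simp
  qed (simp add: add_increasing2)
  then show "\<bar>x\<bar> <= 1 + x^6" by simp
 qed
 have i: "integrable M (%u. 1 + (E u $$ (i, t))^6)" using E6(1)[OF assms] by simp
 have b': "norm (x^2) <= norm (1 + x^6)" "norm x <= norm (1 + x^6)" for x :: real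
  using b[of x] by simp_all
 show 1: "integrable M (%u. (E u $$ (i, t))^2)"
  by (rule Bochner_Integration.integrable_bound[OF i]) (use b' in auto)
 show "integrable M (%u. E u $$ (i, t))"
  by (rule Bochner_Integration.integrable_bound[OF i]) (use b' in auto)
 have "(\<integral>u. (E u $$ (i, t))^2 \<partial>M) <= (\<integral>u. 1 + (E u $$ (i, t))^6 \<partial>M)"
  by (rule integral_mono[OF 1 i]) (rule b)
 also have "... <= 1 + C" using E6[OF assms] by (simp add: prob_space)
 finally show "(\<integral>u. (E u $$ (i, t))^2 \<partial>M) <= 2 * C" using C1 by simp
qed

lemma integrable_L2_mult:
 fixes f g :: "'a => real"
 assumes "f : borel_measurable M" "g : borel_measurable M" "integrable M (%u. (f u)^2)" "integrable M (%u. (g u)^2)"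
 shows "integrable M (%u. f u * g u)"
proof (rule Bochner_Integration.integrable_bound)
 show "integrable M (%u. (f u)^2 + (g u)^2)" using assms by simp
 have "\<bar>x * y\<bar> <= x^2 + y^2" for x y :: real
 proof -
  have "2 * (\<bar>x\<bar> * \<bar>y\<bar>) <= x^2 + y^2" using sum_squares_bound[of "\<bar>x\<bar>" "\<bar>y\<bar>"] by simp
  moreover have "0 <= \<bar>x\<bar> * \<bar>y\<bar>" by simp
  ultimately show ?thesis unfolding abs_mult by linarith
 qed
 then show "AE u in M. norm (f u * g u) <= norm ((f u)^2 + (g u)^2)" by auto
qed (use assms in simp)

lemma EE_int: assumes "i < N" "t < T" "j < N" "s < T" shows "integrable M (%u. E u $$ (i, t) * E u $$ (j, s))"
 using assms by (intro integrable_L2_mult E_rv E2_int)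

lemma EE_rows: assumes "i < N" "t < T" "j < N" "s < T" "i ~= j" shows "(\<integral>u. E u $$ (i, t) * E u $$ (j, s) \<partial>M) = 0"
 using indep_sigma_integral(2)[OF indep_row_Oth[OF assms(1)] _ _ E_row_meas[OF assms(1,2)] E2_int(3)[OF assms(1,2)]
   E_Oth_meas[of j i s] E2_int(3)[OF assms(3,4)]] assms E_mean by (simp add: Oth_sets)

lemma EE_sum: assumes "i < N" "t < T" shows "(\<Sum>s<T. \<bar>\<integral>u. E u $$ (i, t) * E u $$ (i, s) \<partial>M\<bar>) <= C"
 using E_cov[OF assms] assms by (simp add: covariance_def E_mean)

text \<open>Schur's test with the summable covariances within a row.\<close>

lemma row_form: assumes i: "i < N"
 shows "integrable M (%u. (\<Sum>t<T. w t * E u $$ (i, t))^2)" "(\<integral>u. (\<Sum>t<T. w t * E u $$ (i, t))^2 \<partial>M) <= C * (\<Sum>t<T. (w t)^2)"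
proof -
 have eq: "(\<Sum>t<T. w t * E u $$ (i, t))^2 = (\<Sum>t<T. \<Sum>s<T. (E u $$ (i, t) * E u $$ (i, s)) * (w t * w s))" for u
  by (simp add: power2_eq_square sum_product mult_ac)
 show "integrable M (%u. (\<Sum>t<T. w t * E u $$ (i, t))^2)"
  unfolding eq using i by (intro Bochner_Integration.integrable_sum integrable_mult_left EE_int) auto
 have "(\<integral>u. (\<Sum>t<T. w t * E u $$ (i, t))^2 \<partial>M)
   = (\<Sum>t<T. \<Sum>s<T. (\<integral>u. E u $$ (i, t) * E u $$ (i, s) \<partial>M) * (w t * w s))"
  unfolding eq using i by (subst integral_sum2) (auto intro!: EE_int)
 also have "... <= C * (\<Sum>t<T. (w t)^2)"
 proof (rule quadratic_form_bound)
  show "\<bar>w s * w t\<bar> <= ((w s)^2 + (w t)^2) / 2" for s t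
   using sum_squares_bound[of "\<bar>w s\<bar>" "\<bar>w t\<bar>"] by (simp add: abs_mult)
 qed (use EE_sum[OF i] in "auto simp: mult.commute")
 finally show "(\<integral>u. (\<Sum>t<T. w t * E u $$ (i, t))^2 \<partial>M) <= C * (\<Sum>t<T. (w t)^2)" .
qed

text \<open>Different rows are independent and centred, so only the diagonal of the expanded square
  survives.\<close>

lemma col_form: assumes t: "t < T"
 shows "integrable M (%u. (\<Sum>j<N. w j * E u $$ (j, t))^2)" "(\<integral>u. (\<Sum>j<N. w j * E u $$ (j, t))^2 \<partial>M) <= 2 * C * (\<Sum>j<N. (w j)^2)"
proof -
 have eq: "(\<Sum>j<N. w j * E u $$ (j, t))^2 = (\<Sum>j<N. \<Sum>l<N. (E u $$ (j, t) * E u $$ (l, t)) * (w j * w l))" for u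
  by (simp add: power2_eq_square sum_product mult_ac)
 show "integrable M (%u. (\<Sum>j<N. w j * E u $$ (j, t))^2)"
  unfolding eq using t by (intro Bochner_Integration.integrable_sum integrable_mult_left EE_int) auto
 have "(\<integral>u. (\<Sum>j<N. w j * E u $$ (j, t))^2 \<partial>M)
   = (\<Sum>j<N. \<Sum>l<N. (\<integral>u. E u $$ (j, t) * E u $$ (l, t) \<partial>M) * (w j * w l))"
  unfolding eq using t by (subst integral_sum2) (auto intro!: EE_int)
 also have "... = (\<Sum>j<N. \<Sum>l<N. if l = j then (\<integral>u. (E u $$ (j, t))^2 \<partial>M) * (w j)^2 else 0)"
  using t by (intro sum.cong refl) (auto simp: EE_rows power2_eq_square)
 also have "... = (\<Sum>j<N. (\<integral>u. (E u $$ (j, t))^2 \<partial>M) * (w j)^2)"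
  by (simp add: sum.delta)
 also have "... <= (\<Sum>j<N. 2 * C * (w j)^2)"
  using t by (intro sum_mono mult_right_mono E2_int) auto
 finally show "(\<integral>u. (\<Sum>j<N. w j * E u $$ (j, t))^2 \<partial>M) <= 2 * C * (\<Sum>j<N. (w j)^2)" by (simp add: sum_distrib_left)
qed

text \<open>Independence of noise and signal factors every fourth-order expectation; independence of
  the rows leaves only equal rows, and there Schur's test applies, with the second moments of
  \<open>w\<close> as weights.\<close>

lemma bilinear_form:
 assumes w: "!!s. s < T ==> w s : borel_measurable MeanS" "!!s. s < T ==> integrable M (%u. (w s u)^2)"
 shows "integrable M (%u. (\<Sum>j<N. \<Sum>s<T. l j * E u $$ (j, s) * w s u)^2)"
  "(\<integral>u. (\<Sum>j<N. \<Sum>s<T. l j * E u $$ (j, s) * w s u)^2 \<partial>M) <= C * (\<Sum>j<N. (l j)^2) * (\<Sum>s<T. \<integral>u. (w s u)^2 \<partial>M)"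
proof -
 have wM: "w s : borel_measurable M" if "s < T" for s
  using w(1)[OF that] subs(3) measurable_from_subalg by blast
 have ww: "integrable M (%u. w s u * w t u)" if "s < T" "t < T" for s t
  using that by (intro integrable_L2_mult wM w)
 have EA: "(%u. E u $$ (j, s) * E u $$ (k, t)) : borel_measurable AllS" if "j < N" "k < N" "s < T" "t < T" for j k s t
  using that by (intro borel_measurable_times entry_measurable_sigma) auto
 have four: "integrable M (%u. (E u $$ (j, s) * E u $$ (k, t)) * (w s u * w t u))"
  "(\<integral>u. (E u $$ (j, s) * E u $$ (k, t)) * (w s u * w t u) \<partial>M)
   = (\<integral>u. E u $$ (j, s) * E u $$ (k, t) \<partial>M) * (\<integral>u. w s u * w t u \<partial>M)"
  if "j < N" "k < N" "s < T" "t < T" for j k s t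
  using indep_sigma_integral[OF indep_all_mean _ _ EA[OF that] EE_int[of j s k t] _ ww[of s t]] that w(1) by auto
 have eq: "(\<Sum>j<N. \<Sum>s<T. l j * E u $$ (j, s) * w s u)^2
   = (\<Sum>j<N. \<Sum>k<N. \<Sum>s<T. \<Sum>t<T. (E u $$ (j, s) * E u $$ (k, t)) * (w s u * w t u) * (l j * l k))" for u
  unfolding power2_eq_square sum_product by (intro sum.cong refl) (simp add: mult_ac)
 show "integrable M (%u. (\<Sum>j<N. \<Sum>s<T. l j * E u $$ (j, s) * w s u)^2)"
  unfolding eq by (intro Bochner_Integration.integrable_sum integrable_mult_left four) auto
 have "(\<integral>u. (\<Sum>j<N. \<Sum>s<T. l j * E u $$ (j, s) * w s u)^2 \<partial>M)
   = (\<Sum>j<N. \<Sum>k<N. \<Sum>s<T. \<Sum>t<T. (\<integral>u. E u $$ (j, s) * E u $$ (k, t) \<partial>M) * (\<integral>u. w s u * w t u \<partial>M) * (l j * l k))"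
 proof -
  have i1: "integrable M (%u. \<Sum>s<T. \<Sum>t<T. (E u $$ (j, s) * E u $$ (k, t)) * (w s u * w t u) * (l j * l k))"
   if "j < N" "k < N" for j k
   using that by (intro Bochner_Integration.integrable_sum integrable_mult_left four) auto
  show ?thesis unfolding eq
  proof (subst integral_sum2[OF i1], assumption, assumption, intro sum.cong refl)
   fix j k assume "j : {..<N}" "k : {..<N}"
   then have jk: "j < N" "k < N" by auto
   show "(\<integral>u. (\<Sum>s<T. \<Sum>t<T. (E u $$ (j, s) * E u $$ (k, t)) * (w s u * w t u) * (l j * l k)) \<partial>M)
   = (\<Sum>s<T. \<Sum>t<T. (\<integral>u. E u $$ (j, s) * E u $$ (k, t) \<partial>M) * (\<integral>u. w s u * w t u \<partial>M) * (l j * l k))"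
   by (subst integral_sum2) (auto simp: four[OF jk] simp del: integral_mult_left_zero intro!: integrable_mult_left four jk sum.cong)
  qed
 qed
 also have "... = (\<Sum>j<N. \<Sum>k<N. if k = j then (\<Sum>s<T. \<Sum>t<T. (\<integral>u. E u $$ (j, s) * E u $$ (j, t) \<partial>M) * (\<integral>u. w s u * w t u \<partial>M) * (l j * l j)) else 0)"
  by (intro sum.cong refl) (auto simp: EE_rows)
 also have "... = (\<Sum>j<N. (l j)^2 * (\<Sum>s<T. \<Sum>t<T. (\<integral>u. E u $$ (j, s) * E u $$ (j, t) \<partial>M) * (\<integral>u. w s u * w t u \<partial>M)))"
  by (simp add: sum.delta sum_distrib_left power2_eq_square mult_ac)
 also have "... <= (\<Sum>j<N. (l j)^2 * (C * (\<Sum>s<T. \<integral>u. (w s u)^2 \<partial>M)))"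
 proof (intro sum_mono mult_left_mono quadratic_form_bound)
  fix j s t assume j: "j : {..<N}" and st: "s < T" "t < T"
  have "\<bar>\<integral>u. w s u * w t u \<partial>M\<bar> <= (\<integral>u. \<bar>w s u * w t u\<bar> \<partial>M)" by (rule integral_abs_bound)
  also have "... <= (\<integral>u. ((w s u)^2 + (w t u)^2) / 2 \<partial>M)"
  proof (rule integral_mono)
   show "\<bar>w s u * w t u\<bar> <= ((w s u)^2 + (w t u)^2) / 2" for u
   using sum_squares_bound[of "\<bar>w s u\<bar>" "\<bar>w t u\<bar>"] by (simp add: abs_mult)
  qed (use st ww w(2) in auto)
  also have "... = ((\<integral>u. (w s u)^2 \<partial>M) + (\<integral>u. (w t u)^2 \<partial>M)) / 2"
   using w(2) st by simp
  finally show "\<bar>\<integral>u. w s u * w t u \<partial>M\<bar> <= ((\<integral>u. (w s u)^2 \<partial>M) + (\<integral>u. (w t u)^2 \<partial>M)) / 2" .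
 qed (use EE_sum in "auto simp: mult.commute")
 finally show "(\<integral>u. (\<Sum>j<N. \<Sum>s<T. l j * E u $$ (j, s) * w s u)^2 \<partial>M) <= C * (\<Sum>j<N. (l j)^2) * (\<Sum>s<T. \<integral>u. (w s u)^2 \<partial>M)"
  by (simp add: sum_distrib_left sum_distrib_right mult.assoc mult.left_commute) (simp add: sum.swap[of _ "{..<T}" "{..<N}"])
qed

text \<open>For a fixed matrix, restricting to an event of the other data multiplies the second
  moment by the probability of the event. This is exactly what the countable selection
  requires.\<close>

lemma row_form_event: assumes i: "i < N" and A: "A : sets (Oth i)"
 shows "integrable M (%u. indicator A u * (\<Sum>t<T. w t * E u $$ (i, t))^2)"
  "(\<integral>u. indicator A u * (\<Sum>t<T. w t * E u $$ (i, t))^2 \<partial>M) <= C * (\<Sum>t<T. (w t)^2) * prob A"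
proof -
 have AM: "A : sets M" using A Oth_sub by (auto simp: subalgebra_def)
 have X: "(%u. (\<Sum>t<T. w t * E u $$ (i, t))^2) : borel_measurable (RowS i)"
  using i by (intro borel_measurable_power borel_measurable_sum borel_measurable_times borel_measurable_const E_row_meas) auto
 have Y: "(indicator A :: 'a => real) : borel_measurable (Oth i)" "integrable M (indicator A :: 'a => real)"
  using A AM by (auto intro!: integrable_real_indicator simp: emeasure_eq_measure)
 note I = indep_sigma_integral[OF indep_row_Oth[OF i] _ _ X row_form(1)[OF i] Y]
 show "integrable M (%u. indicator A u * (\<Sum>t<T. w t * E u $$ (i, t))^2)"
  using I(1) by (simp add: Oth_sets mult.commute)
 have "(\<integral>u. indicator A u * (\<Sum>t<T. w t * E u $$ (i, t))^2 \<partial>M) = (\<integral>u. (\<Sum>t<T. w t * E u $$ (i, t))^2 \<partial>M) * prob A"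
  using I(2) AM by (simp add: Oth_sets mult.commute)
 also have "... <= C * (\<Sum>t<T. (w t)^2) * prob A" by (intro mult_right_mono row_form(2)[OF i]) simp
 finally show "(\<integral>u. indicator A u * (\<Sum>t<T. w t * E u $$ (i, t))^2 \<partial>M) <= C * (\<Sum>t<T. (w t)^2) * prob A" .
qed

end

section \<open>Conditional moments given distant periods\<close>

context factor_noise
begin

definition "Gs d t j = entries_sigma M ({j} \<times> nbhd_compl T d t) E"
definition "mu d t j = real_cond_exp M (Gs d t j) (%u. E u $$ (j, t))"
text \<open>The summand 1 keeps the argument in the open half-line on which the cube is convex, so
  that Jensen's inequality applies.\<close>

definition "vv d t j = real_cond_exp M (Gs d t j) (%u. 1 + (E u $$ (j, t))^2)"
text \<open>What remains visible when the periods near \<open>t\<close> are removed: the distant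
  noise of all rows, and the signal.\<close>

definition "Kc d t = sigma (space M) ((\<Union>j<N. sets (Gs d t j)) \<union> sets MeanS)"
text \<open>Adds to the distant noise of row \<open>j\<close> everything about the other rows and
  the signal. Only the near part of row \<open>j\<close> is averaged under it, so the rows can be
  treated one at a time.\<close>

definition "Kj d t j = sigma (space M) (sets (Gs d t j) \<union> sets (Oth j))"

lemma Gs_sub: assumes "j < N" shows "subalgebra M (Gs d t j)" "sets (Gs d t j) <= sets (RowS j)"
proof -
 show 1: "sets (Gs d t j) <= sets (RowS j)"
  unfolding Gs_def by (rule entries_sigma_subset) (auto simp: nbhd_compl_def intro: entry_measurable_sigma)
 show "subalgebra M (Gs d t j)"
  using 1 subs(1)[OF assms] by (auto simp: subalgebra_def Gs_def)
qed

lemma Kj_facts: assumes j: "j < N"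
 shows "subalgebra M (Kj d t j)" "sets (Gs d t j) <= sets (Kj d t j)" "sets (Oth j) <= sets (Kj d t j)"
  "Y : borel_measurable (RowS j) ==> integrable M Y ==>
   AE u in M. real_cond_exp M (Kj d t j) Y u = real_cond_exp M (Gs d t j) Y u"
proof -
 note * = real_cond_exp_enlarge[OF Gs_sub(1)[OF j] subs(1)[OF j] Gs_sub(2)[OF j] Oth_sub indep_row_Oth[OF j], folded Kj_def]
 have Y0: "(%_. 0::real) : borel_measurable (RowS j)" "integrable M (%_. 0::real)" by simp_all
 show "subalgebra M (Kj d t j)" "sets (Gs d t j) <= sets (Kj d t j)" "sets (Oth j) <= sets (Kj d t j)"
  using *(2-4)[OF Y0] by blast+
 show "AE u in M. real_cond_exp M (Kj d t j) Y u = real_cond_exp M (Gs d t j) Y u"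
  if "Y : borel_measurable (RowS j)" "integrable M Y" using *(1)[OF that] .
qed

lemma Kc_facts: "space (Kc d t) = space M" "subalgebra M (Kc d t)" "j < N ==> sets (Kc d t) <= sets (Kj d t j)"
 "j < N ==> sets (Gs d t j) <= sets (Kc d t)" "sets MeanS <= sets (Kc d t)"
proof -
 have M: "(\<Union>j<N. sets (Gs d t j)) \<union> sets MeanS <= sets M"
  using Gs_sub(1)[of _ d t] subs(3) unfolding subalgebra_def by blast
 then have pow: "(\<Union>j<N. sets (Gs d t j)) \<union> sets MeanS <= Pow (space M)"
  using sets.sets_into_space[of _ M] by blast
 show sp: "space (Kc d t) = space M" using pow by (simp add: Kc_def)
 have s: "sets (Kc d t) = sigma_sets (space M) ((\<Union>j<N. sets (Gs d t j)) \<union> sets MeanS)" using pow by (simp add: Kc_def)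
 show "subalgebra M (Kc d t)" unfolding subalgebra_def sp s using sets.sigma_sets_subset[OF M] by simp
 show "sets (Gs d t j) <= sets (Kc d t)" if "j < N" unfolding s using that by auto
 show "sets MeanS <= sets (Kc d t)" unfolding s by auto
 show "sets (Kc d t) <= sets (Kj d t j)" if j: "j < N"
 proof -
  have "sets (Gs d t l) <= sets (Kj d t j)" if l: "l < N" for l
  proof (cases "l = j")
   case False
   have "sets (Gs d t l) <= S l" using Gs_sub(2)[OF l] l by (simp add: S_def)
   also have "... <= sets (Oth j)" using l False by (intro S_Oth) auto
   finally show ?thesis using Kj_facts(3)[OF j] by blast
  qed (use Kj_facts(2)[OF j] in simp)
  moreover have "sets MeanS <= sets (Kj d t j)" using S_Oth[of N j] j Kj_facts(3)[OF j] by (auto simp: S_def)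
  ultimately have "(\<Union>j<N. sets (Gs d t j)) \<union> sets MeanS <= sets (Kj d t j)" by auto
  moreover have "space (Kj d t j) = space M" using Kj_facts(1)[OF j] by (simp add: subalgebra_def)
  ultimately show ?thesis unfolding s using sets.sigma_sets_subset[of _ "Kj d t j"] by metis
 qed
qed

text \<open>Conditioning row \<open>j\<close> on all of \<open>Kj\<close> amounts to conditioning on
  its own distant noise, because the other data is independent of the row. Against a
  \<open>Kj\<close>-measurable factor, \<open>Y\<close> may therefore be replaced by this smaller
  conditional expectation.\<close>

lemma rce_swap: assumes j: "j < N" and f: "f : borel_measurable (Kj d t j)"
  and Y: "Y : borel_measurable (RowS j)" "integrable M Y" and fY: "integrable M (%u. f u * Y u)"
 shows "integrable M (%u. f u * real_cond_exp M (Gs d t j) Y u)"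
  "(\<integral>u. f u * real_cond_exp M (Gs d t j) Y u \<partial>M) = (\<integral>u. f u * Y u \<partial>M)"
proof -
 interpret K: sigma_finite_subalgebra M "Kj d t j" by (rule sigma_finite_subalgebraI[OF Kj_facts(1)[OF j]])
 have YM: "Y : borel_measurable M" using Y(2) by simp
 have fM: "f : borel_measurable M" by (rule measurable_from_subalg[OF Kj_facts(1)[OF j] f])
 note I = K.real_cond_exp_intg[OF fY f YM]
 have ae: "AE u in M. f u * real_cond_exp M (Kj d t j) Y u = f u * real_cond_exp M (Gs d t j) Y u"
  using Kj_facts(4)[OF j Y, of d t] by (rule eventually_mono) simp
 have m: "(%u. f u * real_cond_exp M (Gs d t j) Y u) : borel_measurable M" using fM by simp
 have m': "(%u. f u * real_cond_exp M (Kj d t j) Y u) : borel_measurable M" using fM by simp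
 show "integrable M (%u. f u * real_cond_exp M (Gs d t j) Y u)"
  using I(1) integrable_cong_AE[OF m' m ae] by blast
 show "(\<integral>u. f u * real_cond_exp M (Gs d t j) Y u \<partial>M) = (\<integral>u. f u * Y u \<partial>M)"
  using I(2) integral_cong_AE[OF m' m ae] by metis
qed

lemma Gs_meas_Kj: assumes "j < N" "l < N" "f : borel_measurable (Gs d t l)" shows "f : borel_measurable (Kj d t j)"
proof (rule borel_measurable_subalgebra[OF _ _ assms(3)])
 show "sets (Gs d t l) <= sets (Kj d t j)" using Kc_facts(4)[OF assms(2)] Kc_facts(3)[OF assms(1)] by blast
 show "space (Gs d t l) = space (Kj d t j)" using Kj_facts(1)[OF assms(1)] by (simp add: subalgebra_def Gs_def)
qed

text \<open>Off the diagonal, two successive swaps replace both factors by their conditional means;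
  on the diagonal the conditional second moment is at most \<open>b\<close>. Cauchy-Schwarz bounds
  the square of the summed means by another \<open>b\<close>, whence the factor 2.\<close>

lemma col_form_event:
 assumes t: "t < T" and A: "A : sets (Kc d t)" and b: "0 <= b"
  and sel: "!!u. u : A ==> (\<Sum>j<N. (mu d t j u)^2) <= b & (ALL j<N. vv d t j u <= b)"
 shows "integrable M (%u. indicator A u * (\<Sum>j<N. w j * E u $$ (j, t))^2)"
  "(\<integral>u. indicator A u * (\<Sum>j<N. w j * E u $$ (j, t))^2 \<partial>M) <= 2 * b * (\<Sum>j<N. (w j)^2) * prob A"
proof -
 have AM: "A : sets M" using A Kc_facts(2) by (auto simp: subalgebra_def)
 have AK: "(indicator A :: 'a => real) : borel_measurable (Kj d t j)" if "j < N" for j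
  using A Kc_facts(3)[OF that, of d t] by auto
 have ind: "integrable M (%u. indicator A u * f u)" if "integrable M f" for f :: "'a => real"
  using integrable_mult_indicator[OF AM that] by simp
 have muG: "mu d t j : borel_measurable (Gs d t j)" for j unfolding mu_def by simp
 have muM: "mu d t j : borel_measurable M" if "j < N" for j
  using measurable_from_subalg[OF Gs_sub(1)[OF that] muG] .
 have EM: "(%u. E u $$ (j, t)) : borel_measurable (RowS j)" "integrable M (%u. E u $$ (j, t))" if "j < N" for j
  using E_row_meas[OF that t] E2_int(3)[OF that t] by auto
 have EK: "(%u. E u $$ (l, t)) : borel_measurable (Kj d t j)" if "j < N" "l < N" "l ~= j" for j l
  using borel_measurable_subalgebra[OF Kj_facts(3)[OF that(1)] _ E_Oth_meas[OF that(2,3) t]] Kj_facts(1)[OF that(1)]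
  by (simp add: subalgebra_def Oth_sets)
 have off: "(\<integral>u. indicator A u * (E u $$ (j, t) * E u $$ (l, t)) \<partial>M) = (\<integral>u. indicator A u * (mu d t j u * mu d t l u) \<partial>M)"
  if jl: "j < N" "l < N" "l ~= j" for j l
 proof -
  have i1: "integrable M (%u. (indicator A u * E u $$ (l, t)) * E u $$ (j, t))"
   using ind[OF EE_int[OF jl(2) t jl(1) t]] by (simp add: mult.assoc)
  have f1: "(%u. indicator A u * E u $$ (l, t)) : borel_measurable (Kj d t j)"
   using AK[OF jl(1)] EK[OF jl] by simp
  note s1 = rce_swap[OF jl(1) f1 EM[OF jl(1)] i1, folded mu_def]
  have i2: "integrable M (%u. (indicator A u * mu d t j u) * E u $$ (l, t))" using s1(1) by (simp add: mult_ac)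
  have f2: "(%u. indicator A u * mu d t j u) : borel_measurable (Kj d t l)"
   using AK[OF jl(2)] Gs_meas_Kj[OF jl(2,1) muG] by simp
  note s2 = rce_swap[OF jl(2) f2 EM[OF jl(2)] i2, folded mu_def]
  show ?thesis using s1(2) s2(2) by (simp add: mult_ac)
 qed
 have diag: "(\<integral>u. indicator A u * (E u $$ (j, t))^2 \<partial>M) <= b * prob A" if j: "j < N" for j
 proof -
  have Y: "(%u. 1 + (E u $$ (j, t))^2) : borel_measurable (RowS j)" "integrable M (%u. 1 + (E u $$ (j, t))^2)"
   using EM(1)[OF j] E2_int(1)[OF j t] by simp_all
  note s = rce_swap[OF j AK[OF j] Y ind[OF Y(2)], folded vv_def]
  have "(\<integral>u. indicator A u * (E u $$ (j, t))^2 \<partial>M) <= (\<integral>u. indicator A u * (1 + (E u $$ (j, t))^2) \<partial>M)"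
   by (rule integral_mono[OF ind[OF E2_int(1)[OF j t]] ind[OF Y(2)]]) (auto simp: indicator_def)
  also have "... = (\<integral>u. indicator A u * vv d t j u \<partial>M)" by (rule s(2)[symmetric])
  also have "... <= (\<integral>u. indicator A u * b \<partial>M)"
   by (rule integral_mono[OF s(1) ind]) (use sel j in "auto simp: indicator_def")
  also have "... = b * prob A" using AM by simp
  finally show ?thesis .
 qed
 have mumu: "integrable M (%u. indicator A u * (mu d t j u * mu d t l u))" if jl: "j < N" "l < N" for j l
 proof (rule Bochner_Integration.integrable_bound)
  show "integrable M (%u. b)" by simp
  have sq: "(mu d t j u)^2 <= b" if "j < N" "u : A" for j u
   using member_le_sum[of j "{..<N}" "%j. (mu d t j u)^2"] that sel[OF that(2)] by auto
  have "\<bar>mu d t j u * mu d t l u\<bar> <= b" if "u : A" for u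
   using sum_squares_bound[of "\<bar>mu d t j u\<bar>" "\<bar>mu d t l u\<bar>"] sq[OF jl(1) that] sq[OF jl(2) that] unfolding abs_mult power2_abs by linarith
  then show "AE u in M. norm (indicator A u * (mu d t j u * mu d t l u)) <= norm b"
   using b by (auto simp: indicator_def)
  show "(%u. indicator A u * (mu d t j u * mu d t l u)) : borel_measurable M"
   using AM muM jl by simp
 qed
 have eq: "indicator A u * (\<Sum>j<N. w j * f j)^2 = (\<Sum>j<N. \<Sum>l<N. (indicator A u * (f j * f l)) * (w j * w l))" for u and f :: "nat => real"
  by (simp add: power2_eq_square sum_product sum_distrib_left mult_ac)
 show "integrable M (%u. indicator A u * (\<Sum>j<N. w j * E u $$ (j, t))^2)"
  by (rule ind[OF col_form(1)[OF t]])
 have mi: "integrable M (%u. indicator A u * (\<Sum>j<N. w j * mu d t j u)^2)"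
  unfolding eq by (intro Bochner_Integration.integrable_sum integrable_mult_left mumu) auto
 have "(\<integral>u. indicator A u * (\<Sum>j<N. w j * E u $$ (j, t))^2 \<partial>M)
   = (\<Sum>j<N. \<Sum>l<N. (\<integral>u. indicator A u * (E u $$ (j, t) * E u $$ (l, t)) \<partial>M) * (w j * w l))"
  unfolding eq using t by (subst integral_sum2) (auto intro!: ind EE_int integrable_mult_left)
 \<comment> \<open>The diagonal also receives the nonnegative products of conditional means that
   complete the double sum to a square.\<close>
 also have "... <= (\<Sum>j<N. \<Sum>l<N. (\<integral>u. indicator A u * (mu d t j u * mu d t l u) \<partial>M) * (w j * w l) + (if l = j then b * prob A * (w j)^2 else 0))"
 proof (intro sum_mono)
  fix j l assume "j : {..<N}" "l : {..<N}"
  then have jl: "j < N" "l < N" by auto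
  show "(\<integral>u. indicator A u * (E u $$ (j, t) * E u $$ (l, t)) \<partial>M) * (w j * w l)
   <= (\<integral>u. indicator A u * (mu d t j u * mu d t l u) \<partial>M) * (w j * w l) + (if l = j then b * prob A * (w j)^2 else 0)"
  proof (cases "l = j")
   case True
   have "(\<integral>u. indicator A u * (E u $$ (j, t))^2 \<partial>M) * (w j)^2 <= b * prob A * (w j)^2"
   by (rule mult_right_mono[OF diag[OF jl(1)]]) simp
   moreover have "0 <= (\<integral>u. indicator A u * (mu d t j u)^2 \<partial>M) * (w j)^2" by simp
   ultimately show ?thesis by (simp only: True simp_thms if_True power2_eq_square[symmetric])
  qed (use off[OF jl] in simp)
 qed
 also have "... = (\<Sum>j<N. \<Sum>l<N. (\<integral>u. indicator A u * (mu d t j u * mu d t l u) \<partial>M) * (w j * w l)) + b * prob A * (\<Sum>j<N. (w j)^2)"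
  by (simp add: sum.distrib sum_distrib_left)
 also have "(\<Sum>j<N. \<Sum>l<N. (\<integral>u. indicator A u * (mu d t j u * mu d t l u) \<partial>M) * (w j * w l))
   = (\<integral>u. indicator A u * (\<Sum>j<N. w j * mu d t j u)^2 \<partial>M)"
  unfolding eq using t by (subst integral_sum2) (auto intro!: mumu integrable_mult_left)
 also have "... <= (\<integral>u. indicator A u * (b * (\<Sum>j<N. (w j)^2)) \<partial>M)"
 proof (rule integral_mono[OF mi ind])
  fix u
  show "indicator A u * (\<Sum>j<N. w j * mu d t j u)^2 <= indicator A u * (b * (\<Sum>j<N. (w j)^2))"
  proof (cases "u : A")
   case True
   have "(\<Sum>j<N. w j * mu d t j u)^2 <= (\<Sum>j<N. (w j)^2) * (\<Sum>j<N. (mu d t j u)^2)"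
   by (rule Cauchy_Schwarz_ineq_sum)
   also have "... <= (\<Sum>j<N. (w j)^2) * b" using sel[OF True] by (intro mult_left_mono sum_nonneg) auto
   finally show ?thesis using True by (simp add: mult.commute)
  qed simp
 qed simp
 also have "... = b * (\<Sum>j<N. (w j)^2) * prob A" using AM by simp
 finally show "(\<integral>u. indicator A u * (\<Sum>j<N. w j * E u $$ (j, t))^2 \<partial>M) <= 2 * b * (\<Sum>j<N. (w j)^2) * prob A"
  by (simp add: algebra_simps)
qed

text \<open>Jensen with the cube turns sixth moments into a tail of order \<open>b\<close> to the
  power -3 for each row. The union over \<open>N\<close> rows is then under control for
  \<open>b\<close> of order N^(1/3), the same order as in (B'(iv)).\<close>

lemma vv_tail:
 assumes t: "t < T" and b: "0 < b"
 shows "prob {u : space M. EX j<N. b < vv d t j u} <= 8 * C * N / b^3"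
proof -
 have one: "prob {u : space M. b < vv d t j u} <= 8 * C / b^3" "{u : space M. b < vv d t j u} : sets M" if j: "j < N" for j
 proof -
  interpret G: sigma_finite_subalgebra M "Gs d t j" by (rule sigma_finite_subalgebraI[OF Gs_sub(1)[OF j]])
  define q where "q = (%x::real. x^3)"
  have [measurable]: "(%u. E u $$ (j, t)) : borel_measurable M" by (rule E_rv[OF j t])
  have cube: "(1 + x^2)^3 <= 4 * (1 + x^6)" for x :: real
  proof -
   have "(1 + y)^3 <= 4 * (1 + y^3)" if "0 <= y" for y :: real
   proof -
   have "4 * (1 + y^3) - (1 + y)^3 = 3 * ((1 + y) * (1 - y)^2)" by (simp add: power2_eq_square power3_eq_cube algebra_simps)
   moreover have "0 <= 3 * ((1 + y) * (1 - y)^2)" using that by simp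
   ultimately show ?thesis by linarith
   qed
   from this[of "x^2"] show ?thesis by (simp flip: power_mult)
  qed
  have i6: "integrable M (%u. 4 * (1 + (E u $$ (j, t))^6))" using E6(1)[OF j t] by simp
  have n: "norm (q (1 + x^2)) <= norm (4 * (1 + x^6))" for x :: real
   using cube[of x] by (simp add: q_def)
  have iq: "integrable M (%u. q (1 + (E u $$ (j, t))^2))"
   by (rule Bochner_Integration.integrable_bound[OF i6]) (use n in "auto simp: q_def")
  have "(\<integral>u. q (1 + (E u $$ (j, t))^2) \<partial>M) <= (\<integral>u. 4 * (1 + (E u $$ (j, t))^6) \<partial>M)"
   by (rule integral_mono[OF iq i6]) (use cube in "simp add: q_def")
  also have "... <= 8 * C" using E6[OF j t] C1 by (simp add: prob_space)
  finally have q8: "(\<integral>u. q (1 + (E u $$ (j, t))^2) \<partial>M) <= 8 * C" .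
  have cv: "convex_on {0<..} q"
   unfolding q_def by (rule convex_on_subset[OF convex_power_odd[of 3]]) (auto simp: convex_real_interval)
  have pos: "AE u in M. 1 + (E u $$ (j, t))^2 : {0<..}" by (auto intro!: AE_I2 add_pos_nonneg)
  have i2: "integrable M (%u. 1 + (E u $$ (j, t))^2)" using E2_int(1)[OF j t] by simp
  have qb: "q : borel_measurable borel" unfolding q_def by simp
  define g where "g = real_cond_exp M (Gs d t j) (%u. q (1 + (E u $$ (j, t))^2))"
  have J: "AE u in M. q (vv d t j u) <= g u"
   unfolding vv_def g_def using G.real_cond_exp_jensens_inequality(2)[OF i2 pos _ iq cv qb, of 0 0] by simp
  have g: "integrable M g" "(\<integral>u. g u \<partial>M) <= 8 * C" unfolding g_def using G.real_cond_exp_int[OF iq] q8 by auto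
  have g0: "AE u in M. 0 <= g u" unfolding g_def using iq
   by (intro G.real_cond_exp_pos) (auto simp: q_def)
  have [measurable]: "g : borel_measurable M" "vv d t j : borel_measurable M" using g(1) unfolding vv_def by auto
  show "{u : space M. b < vv d t j u} : sets M" by measurable
  have "prob {u : space M. b < vv d t j u} <= prob {u : space M. b^3 <= g u}"
  proof (rule finite_measure_mono_AE)
   show "AE u in M. u : {u : space M. b < vv d t j u} --> u : {u : space M. b^3 <= g u}"
   using J
   proof (rule eventually_mono, intro impI CollectI conjI)
   fix u assume a: "q (vv d t j u) <= g u" "u : {u : space M. b < vv d t j u}"
   then have "b^3 <= (vv d t j u)^3" using b by (intro power_mono) auto
   then show "b^3 <= g u" using a by (simp add: q_def)
   qed auto
  qed measurable
  also have "... <= (\<integral>u. g u \<partial>M) / b^3"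
   using b by (intro integral_Markov_inequality_measure[OF g(1) sets.empty_sets g0]) simp
  also have "... <= 8 * C / b^3" using b g(2) by (intro divide_right_mono) auto
  finally show "prob {u : space M. b < vv d t j u} <= 8 * C / b^3" .
 qed
 have "{u : space M. EX j<N. b < vv d t j u} = (\<Union>j<N. {u : space M. b < vv d t j u})" by auto
 also have "prob ... <= (\<Sum>j<N. prob {u : space M. b < vv d t j u})"
  using one(2) by (intro finite_measure_subadditive_finite) auto
 also have "... <= (\<Sum>j<N. 8 * C / b^3)" using one(1) by (intro sum_mono) auto
 finally show ?thesis by (simp add: mult_ac)
qed

lemma sel_event: "{u : space M. (\<Sum>j<N. (mu d t j u)^2) <= b & (ALL j<N. vv d t j u <= b)} : sets (Kc d t)"
proof -
 have G: "f : borel_measurable (Gs d t j) ==> j < N ==> f : borel_measurable (Kc d t)" for f :: "'a => real" and j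
  by (rule borel_measurable_subalgebra[OF Kc_facts(4)]) (simp_all add: Kc_facts Gs_def)
 have m: "(%u. \<Sum>j<N. (mu d t j u)^2) : borel_measurable (Kc d t)"
  by (intro borel_measurable_sum borel_measurable_power G) (auto simp: mu_def)
 have v: "vv d t j : borel_measurable (Kc d t)" if "j < N" for j
  by (rule G[OF _ that]) (simp add: vv_def)
 have 1: "{u : space (Kc d t). (\<Sum>j<N. (mu d t j u)^2) <= b} : sets (Kc d t)" using m by measurable
 have "{u : space (Kc d t). vv d t j u <= b} : sets (Kc d t)" if "j < N" for j using v[OF that] by measurable
 then have 2: "{u : space (Kc d t). ALL j:{..<N}. vv d t j u <= b} : sets (Kc d t)"
  by (intro sets.sets_Collect_finite_All) auto
 have "{u : space M. (\<Sum>j<N. (mu d t j u)^2) <= b & (ALL j<N. vv d t j u <= b)}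
  = {u : space M. (\<Sum>j<N. (mu d t j u)^2) <= b} \<inter> {u : space M. ALL j:{..<N}. vv d t j u <= b}"
  by blast
 then show ?thesis using sets.Int[OF 1 2] unfolding Kc_facts(1) by argo
qed

end

section \<open>Measurable choice of leave-out singular vectors\<close>

text \<open>Leave-one-out singular vectors, replaced by elements of a countable dense set so that they can be
 chosen measurably with respect to the remaining data.\<close>

lemma (in prob_space) leave_out_select:
 fixes A Mm Y :: "'a => fmat" and P :: fmat
 assumes G: "subalgebra M G" and A: "A : borel_measurable G" and Mm: "Mm : borel_measurable G"
  and Y: "Y : borel_measurable M" and Sel: "Sel : sets G" and Om: "\<Omega> : sets M"
  and ex: "!!u. u : \<Omega> ==> EX C1 C2 E Li. Mm u = C1 * C2 & A u = C1 * C2 + E & C2 * idm t = C2 & E * idm t = E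
   & idm r * C2 = C2 & opb E e & Li * C1 = idm r & norm Li <= l & norm C1 <= l'"
  and e: "0 < e" "0 < l" "0 < l'" and r: "1 <= r" "r <= t" and \<eta>: "0 < \<eta>"
  and P: "!!u V \<sigma>. u : \<Omega> ==> rsvd t r (A u) V \<sigma> ==> norm (P * V) < z"
  and bd: "!!W B. idm t * W = W ==> W * idm r = W ==> norm W < 2 * sqrt (real r) ==> norm (P * W) < z ==> B : sets G ==> B <= Sel
   ==> integrable M (%u. indicator B u * (norm (tp W * Y u))^2)
   & (\<integral>u. indicator B u * (norm (tp W * Y u))^2 \<partial>M) <= c * prob B"
  and K: "0 < K" "0 <= c"
 shows "EX C:sets M. prob C >= prob (\<Omega> \<inter> Sel) - c / K^2 & (ALL u:C. EX Vh. norm Vh < 2 * sqrt (real r) & Vh * idm r = Vh & idm t * Vh = Vh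
   & norm ((idm t - Vh * tp Vh) * (tp (A u) * (A u * Vh))) < 1 & norm (tp Vh * Vh - idm r) < \<eta>
   & norm (Mm u * (idm t - Vh * tp Vh)) < 3 * (l' * l) * e & norm (P * Vh) < z & norm (tp Vh * Y u) <= K)"
proof -
 obtain D :: "fmat set" where D: "countable D" "!!A e. e > 0 ==> EX B:D. norm (A - B) < (e::real)"
  using countable_dense_fmat by blast
 have Dne: "D ~= {}" using D(2)[of 1 0] by auto
 define f where "f = from_nat_into D"
 have rf: "range f = D" unfolding f_def by (rule range_from_nat_into[OF Dne D(1)])
 define W where "W = (%k. idm t * f k * idm r)"
 define J where "J = (%k. idm t - W k * tp (W k))"
 \<comment> \<open>\<open>ok\<close> collects the conditions on the candidate alone,
   \<open>Ev\<close> those that involve the data; a candidate that is not \<open>ok\<close> gets the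
   empty event, so the moment bound is needed only for the others.\<close>
 define ok where "ok = (%k. norm (W k) < 2 * sqrt (real r) & norm (tp (W k) * W k - idm r) < \<eta> & norm (P * W k) < z)"
 define Ev where "Ev = (%k. {u : space G. norm (J k * (tp (A u) * (A u * W k))) < 1} \<inter> {u : space G. norm (Mm u * J k) < 3 * (l' * l) * e} \<inter> Sel)"
 define Ak where "Ak = (%k. if ok k then Ev k else {})"
 have Ws: "idm t * W k = W k" "W k * idm r = W k" for k
  by (simp_all add: W_def mult.assoc dg_mult) (simp add: mult.assoc[symmetric] dg_mult)
 have spG: "space G = space M" and sG: "sets G <= sets M" using G by (auto simp: subalgebra_def)
 have EvG: "Ev k : sets G" for k
 proof -
  have tA: "(%u. tp (A u)) : borel_measurable G" using measurable_compose[OF A borel_measurable_tp] .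
  have 1: "(%u. norm (J k * (tp (A u) * (A u * W k)))) : borel_measurable G"
   by (intro borel_measurable_norm[THEN measurable_compose[rotated]] borel_measurable_times borel_measurable_const tA A)
  have 2: "(%u. norm (Mm u * J k)) : borel_measurable G"
   by (intro borel_measurable_norm[THEN measurable_compose[rotated]] borel_measurable_times borel_measurable_const Mm)
  have "{u : space G. norm (J k * (tp (A u) * (A u * W k))) < 1} : sets G" using 1 by measurable
  moreover have "{u : space G. norm (Mm u * J k) < 3 * (l' * l) * e} : sets G" using 2 by measurable
  ultimately show ?thesis unfolding Ev_def using Sel by (intro sets.Int)
 qed
 have AkG: "Ak k : sets G" for k using EvG by (simp add: Ak_def)
 have sub: "\<Omega> \<inter> Sel <= (\<Union>k. Ak k)"
 proof
  fix u assume w: "u : \<Omega> \<inter> Sel"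
  then have wM: "u : space G" using Om sets.sets_into_space spG by auto
  obtain C1 C2 E Li where *: "Mm u = C1 * C2" "A u = C1 * C2 + E" "C2 * idm t = C2" "E * idm t = E"
   "idm r * C2 = C2" "opb E e" "Li * C1 = idm r" "norm Li <= l" "norm C1 <= l'" using ex[of u] w by blast
  have "EX B:D. let Vh = idm t * B * idm r; J = idm t - Vh * tp Vh in
   norm Vh < 2 * sqrt (real r) & norm (J * (tp (A u) * (A u * Vh))) < 1 & norm (tp Vh * Vh - idm r) < \<eta> &
   norm (C1 * (C2 * J)) < 3 * (l' * l) * e & norm (P * Vh) < z"
  proof (rule leave_out_exists[OF _ *(2-6) e(1) *(7-9) e(2,3) r \<eta>])
   show "EX B:D. norm (A - B) < e" if "e > 0" for A e by (rule D(2)[OF that])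
   show "norm (P * V) < z" if "rsvd t r (A u) V \<sigma>" for V \<sigma> using P[OF _ that] w by blast
  qed
  then obtain B where B: "B : D" and ex: "let Vh = idm t * B * idm r; J = idm t - Vh * tp Vh in
   norm Vh < 2 * sqrt (real r) & norm (J * (tp (A u) * (A u * Vh))) < 1 & norm (tp Vh * Vh - idm r) < \<eta> &
   norm (C1 * (C2 * J)) < 3 * (l' * l) * e & norm (P * Vh) < z" ..
  obtain k where k: "f k = B" using B rf by blast
  have "ok k" "u : Ev k" using ex w wM *(1) unfolding ok_def Ev_def J_def W_def k Let_def by (simp_all add: mult.assoc)
  then show "u : (\<Union>k. Ak k)" by (auto simp: Ak_def)
 qed
 have K2: "0 < K^2" using K by simp
 have cb: "integrable M (%u. indicator B u * (norm (tp (W k) * Y u))^2)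
   & (\<integral>u. indicator B u * (norm (tp (W k) * Y u))^2 \<partial>M) <= c * prob B" if B: "B : sets G" "B <= Ak k" for k B
 proof (cases "ok k")
  case True
  then have "B <= Sel" using B by (auto simp: Ak_def Ev_def)
  then show ?thesis using True bd[OF Ws _ _ B(1)] by (auto simp: ok_def)
 next
  case False
  then have "B = {}" using B by (simp add: Ak_def)
  then show ?thesis by simp
 qed
 have gm: "(%u. (norm (tp (W k) * Y u))^2) : borel_measurable M" for k
  by (intro borel_measurable_power borel_measurable_norm[THEN measurable_compose[rotated]] borel_measurable_times borel_measurable_const Y)
 obtain C where C: "C : sets M" "prob C >= prob (\<Union>k. Ak k) - c / K^2"
  "!!u. u : C ==> EX k. u : Ak k & (norm (tp (W k) * Y u))^2 <= K^2"
  using selection_bound[where A = Ak and g = "%k u. (norm (tp (W k) * Y u))^2" and c = c and K = "K^2", OF G AkG gm _ _ _ K2 K(2)] cb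
  by auto
 have "prob (\<Omega> \<inter> Sel) <= prob (\<Union>k. Ak k)"
  using AkG sG by (intro finite_measure_mono sub) blast
 moreover have "EX Vh. norm Vh < 2 * sqrt (real r) & Vh * idm r = Vh & idm t * Vh = Vh
   & norm ((idm t - Vh * tp Vh) * (tp (A u) * (A u * Vh))) < 1 & norm (tp Vh * Vh - idm r) < \<eta>
   & norm (Mm u * (idm t - Vh * tp Vh)) < 3 * (l' * l) * e & norm (P * Vh) < z & norm (tp Vh * Y u) <= K" if w: "u : C" for u
 proof -
  obtain k where k: "u : Ak k" "(norm (tp (W k) * Y u))^2 <= K^2" using C(3)[OF w] by blast
  have "norm (tp (W k) * Y u) <= K" by (rule power2_le_imp_le[OF k(2)]) (use K in simp)
  moreover have "ok k" "u : Ev k" using k(1) by (auto simp: Ak_def split: if_splits)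
  ultimately show ?thesis unfolding ok_def Ev_def J_def by (intro exI[of _ "W k"]) (simp add: Ws)
 qed
 ultimately show ?thesis using C(1,2) by (intro bexI[of _ C]) auto
qed

section \<open>Candidates for deleted rows and deleted windows\<close>

lemma norm_tp_mult_sq:
 assumes W: "idm t * W = W" "W * idm r = W" and Y: "Y * un 0 0 = Y"
 shows "(norm (tp W * Y))^2 = (\<Sum>c<r. (\<Sum>s<t. entry W s c * entry Y s 0)^2)"
proof -
 define n where "n = max 1 r"
 have e0: "entry Y s j = 0" if "j ~= 0" for s j using arg_cong[OF Y, of "%X. entry X s j"] that by (simp add: entry_mult_un)
 have Ws: "entry W s c = 0" if "t <= s | r <= c" for s c
  using arg_cong[OF W(1), of "%X. entry X s c"] arg_cong[OF W(2), of "%X. entry X s c"] that by (auto simp: entry_dg_mult entry_mult_dg)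
 have en: "entry (tp W * Y) c j = (\<Sum>s<t. entry W s c * entry Y s j)" for c j
  by (subst entry_mult_gen[where n = t and A = "tp W" and B = Y]) (auto simp: Ws)
 have sp: "supp_in n (tp W * Y)"
  unfolding supp_in_def en n_def using e0 Ws by (auto intro!: sum.neutral)
 have "(norm (tp W * Y))^2 = (\<Sum>c<n. \<Sum>j<n. (entry (tp W * Y) c j)^2)" by (rule norm_fmat_sq[OF sp])
 also have "... = (\<Sum>c<n. (entry (tp W * Y) c 0)^2)"
 proof (rule sum.cong[OF refl])
  fix c
  have "(\<Sum>j<n. (entry (tp W * Y) c j)^2) = (\<Sum>j<n. if j = 0 then (entry (tp W * Y) c 0)^2 else 0)"
   by (intro sum.cong refl) (auto simp: en e0)
  then show "(\<Sum>j<n. (entry (tp W * Y) c j)^2) = (entry (tp W * Y) c 0)^2" by (simp add: n_def)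
 qed
 also have "... = (\<Sum>c<r. (entry (tp W * Y) c 0)^2)"
  by (rule sum.mono_neutral_right) (auto simp: n_def en Ws)
 finally show ?thesis by (simp add: en)
qed

lemma norm_sq_rect:
 assumes W: "idm t * W = W" "W * idm r = W"
 shows "(norm W)^2 = (\<Sum>c<r. \<Sum>s<t. (entry W s c)^2)"
proof -
 define n where "n = max t r"
 have Ws: "entry W s c = 0" if "t <= s | r <= c" for s c
  using arg_cong[OF W(1), of "%X. entry X s c"] arg_cong[OF W(2), of "%X. entry X s c"] that by (auto simp: entry_dg_mult entry_mult_dg)
 have "(norm W)^2 = (\<Sum>s<n. \<Sum>c<n. (entry W s c)^2)"
  by (rule norm_fmat_sq) (auto simp: supp_in_def n_def intro: Ws)
 also have "... = (\<Sum>s<t. \<Sum>c<n. (entry W s c)^2)"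
  by (rule sum.mono_neutral_right) (auto simp: n_def Ws)
 also have "... = (\<Sum>s<t. \<Sum>c<r. (entry W s c)^2)"
  by (intro sum.cong[OF refl] sum.mono_neutral_right) (auto simp: n_def Ws)
 also have "... = (\<Sum>c<r. \<Sum>s<t. (entry W s c)^2)" by (rule sum.swap)
 finally show ?thesis .
qed

lemma borel_measurable_fm:
 assumes "!!u. u : space G ==> A u : carrier_mat n m"
  and "!!i j. i < n ==> j < m ==> (%u. A u $$ (i, j)) : borel_measurable G"
 shows "(%u. fm (A u)) : borel_measurable G"
proof -
 have eq: "fm (A u) = (\<Sum>i<n. \<Sum>j<m. A u $$ (i, j) *\<^sub>R un i j)" if "u : space G" for u
 proof -
  have d: "dim_row (A u) = n" "dim_col (A u) = m" using assms(1)[OF that] by auto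
  have "entry (\<Sum>i<n. \<Sum>j<m. A u $$ (i, j) *\<^sub>R un i j) k l = entry (fm (A u)) k l" for k l
  proof -
   have "(\<Sum>j<m. A u $$ (i, j) * (if k = i & l = j then 1 else 0)) = (if k = i & l < m then A u $$ (i, l) else 0)" for i
   by (cases "k = i") (auto simp: if_distrib[of "%x. _ * x"] cong: if_cong)
   then show ?thesis by (auto simp: entry_fm d)
  qed
  then show ?thesis by (intro entry_eqI) simp
 qed
 have "(%u. \<Sum>i<n. \<Sum>j<m. A u $$ (i, j) *\<^sub>R un i j) : borel_measurable G"
  using assms(2) by (intro borel_measurable_sum borel_measurable_scaleR borel_measurable_const) auto
 then show ?thesis by (subst measurable_cong[OF eq]) auto
qed

text \<open>The loadings are deterministic, so their bounds are assumed outright; the bounds for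
  factors and noise are asked only on the event \<open>\<Omega>\<close> of the lemmas below.\<close>

locale pc_noise = factor_noise M N T E "%u. L * (F u)\<^sup>T" C
 for M :: "'a measure" and N T :: nat and E F :: "'a => real mat" and L :: "real mat" and C :: real +
 fixes r :: nat and k p m :: real
 assumes L_dim: "L : carrier_mat N r" and F_dim: "!!u. u : space M ==> F u : carrier_mat T r"
  and E_dim: "!!u. u : space M ==> E u : carrier_mat N T"
  and r1: "1 <= r" and rN: "r <= N" and rT: "r <= T" and k1: "1 <= k" and rk: "sqrt (real r) <= k"
  and p1: "1 <= p" and Tm: "real T <= m"
  and L_low: "!!W. p / k * norm (idm r * W) <= norm (fm L * W)" and L_up: "opb (fm L) (k * p)"
begin

abbreviation "q \<equiv> sqrt (real T)"
abbreviation "s \<equiv> p * q"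
abbreviation "X u \<equiv> fm L * tp (fm (F u)) + fm (E u)"

lemma pos: "0 < k" "0 < p" "1 <= q" "0 < q" "1 <= m" "q <= sqrt m" "1 <= sqrt m" "0 < s"
proof -
 have T1: "1 <= real T" using r1 rT by simp
 show "0 < k" "0 < p" using k1 p1 by simp_all
 show q: "1 <= q" "0 < q" using T1 by simp_all
 show "1 <= m" using T1 Tm by simp
 then show "1 <= sqrt m" by simp
 show "q <= sqrt m" using Tm by simp
 show "0 < s" using q p1 by simp
qed

lemma L_idm: "idm N * fm L = fm L" "fm L * idm r = fm L"
 using fm_idm[OF L_dim] by auto

lemma F_idm: assumes "u : space M" shows "idm T * fm (F u) = fm (F u)" "fm (F u) * idm r = fm (F u)"
  "tp (fm (F u)) * idm T = tp (fm (F u))" "idm r * tp (fm (F u)) = tp (fm (F u))"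
 using fm_idm[OF F_dim[OF assms]] fm_idm[of "(F u)\<^sup>T" r T] F_dim[OF assms] by (auto simp: fm_transpose)

lemma E_idm: assumes "u : space M" shows "idm N * fm (E u) = fm (E u)" "fm (E u) * idm T = fm (E u)"
 using fm_idm[OF E_dim[OF assms]] by auto

lemma M0_fm: assumes "u : space M" shows "fm (L * (F u)\<^sup>T) = fm L * tp (fm (F u))"
 using fm_mult[OF L_dim, of "(F u)\<^sup>T" T] F_dim[OF assms] by (simp add: fm_transpose)

lemma M0_dim: "u : space M ==> L * (F u)\<^sup>T : carrier_mat N T"
 using L_dim F_dim by auto

lemma M0_measurable:
 assumes "space G = space M" "!!i t. i < N ==> t < T ==> (%u. (L * (F u)\<^sup>T) $$ (i, t)) : borel_measurable G"
 shows "(%u. fm L * tp (fm (F u))) : borel_measurable G"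
 using borel_measurable_fm[of G "%u. L * (F u)\<^sup>T" N T, OF M0_dim assms(2)] assms(1)
 by (subst measurable_cong[OF M0_fm[symmetric]]) auto

lemma E_fm_measurable: "(%u. fm (E u)) : borel_measurable M"
 by (rule borel_measurable_fm[OF E_dim E_rv])

lemma L_inverse: "EX Li. Li * fm L = idm r & norm Li <= k^2 / p & tp (fm L * Li) = fm L * Li & fm L * Li * (fm L * Li) = fm L * Li"
proof -
 have c: "0 < p / k" using pos by simp
 obtain B where "B * fm L = idm r" "norm B <= sqrt (real r) / (p / k)" "tp (fm L * B) = fm L * B" "fm L * B * (fm L * B) = fm L * B"
  using left_inverse_exists[OF L_idm(2) L_low c] by blast
 moreover have "sqrt (real r) / (p / k) <= k^2 / p"
  using rk pos by (simp add: divide_right_mono power2_eq_square)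
 ultimately show ?thesis by (meson order_trans)
qed

lemma norm_opb_idm: assumes "opb A (k * c)" "A * idm r = A" "0 <= c" shows "norm A <= k^2 * c"
proof -
 have "norm (A * idm r) <= (k * c) * norm (idm r)" by (rule opbD[OF assms(1)])
 also have "... <= (k * c) * k" using assms(3) pos rk by (intro mult_left_mono) (simp_all add: norm_idm)
 finally show ?thesis using assms(2) by (simp add: power2_eq_square mult_ac)
qed

text \<open>Without row \<open>i\<close> the data is independent of \<open>e_i\<close>, so for each
  fixed candidate \<open>W\<close> the second moment of \<open>tp W * e_i\<close> is at most
  \<open>C\<close> times the squared norm of \<open>W\<close>, below 4 * r.\<close>

lemma row_select:
 assumes i: "i < N" and lam: "norm (tp (fm L) * un i 0) <= k" and Om: "\<Omega> : sets M"
  and F_up: "!!u. u : \<Omega> ==> opb (fm (F u)) (k * q)" and E_up: "!!u. u : \<Omega> ==> opb (fm (E u)) (k * sqrt m)"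
  and \<eta>: "0 < \<eta>" and K: "0 < K"
 shows "EX Cc:sets M. prob Cc >= prob \<Omega> - 4 * C * r / K^2 & (ALL u:Cc. EX Vh. norm Vh < 2 * sqrt (real r) & Vh * idm r = Vh & idm T * Vh = Vh
   & norm ((idm T - Vh * tp Vh) * (tp ((idm N - un i i) * X u) * ((idm N - un i i) * X u * Vh))) < 1
   & norm (tp Vh * Vh - idm r) < \<eta>
   & norm (fm L * (tp (fm (F u)) * (idm T - Vh * tp Vh))) < 6 * k^6 * sqrt m & norm (tp Vh * (tp (fm (E u)) * un i 0)) <= K)"
proof -
 define Pi where "Pi = idm N - un i i"
 define A where "A = (%u. Pi * X u)"
 define Y where "Y = (%u. tp (fm (E u)) * un i 0)"
 have iN: "idm N * un i i = un i i" "un i i * idm N = un i i" using i by (simp_all add: un_idm)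
 have sM: "\<Omega> <= space M" using Om sets.sets_into_space by blast
 have Mm: "(%u. fm L * tp (fm (F u))) : borel_measurable (Oth i)"
  by (rule M0_measurable) (use M0_Oth_meas i in "auto simp: Oth_sets")
 have A_meas: "A : borel_measurable (Oth i)"
 proof -
  \<comment> \<open>Row \<open>i\<close> is overwritten by zeros, so that only entries measurable
    for \<open>Oth i\<close> occur.\<close>
  define E' where "E' = (%u. mat N T (%(l, t). if l = i then 0 else E u $$ (l, t)))"
  have eq: "A u = Pi * (fm L * tp (fm (F u))) + fm (E' u)" if "u : space (Oth i)" for u
  proof -
   have "u : space M" using that by (simp add: Oth_sets)
   then have d: "dim_row (E u) = N" "dim_col (E u) = T" using E_dim by auto
   have "Pi * fm (E u) = fm (E' u)"
   by (auto simp: fmat_eq_iff Pi_def left_diff_distrib entry_dg_mult entry_un_mult entry_fm E'_def d)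
   then show ?thesis by (simp add: A_def distrib_left)
  qed
  have "(%u. fm (E' u)) : borel_measurable (Oth i)"
  proof (rule borel_measurable_fm[where n = N and m = T])
   show "(%u. E' u $$ (l, t)) : borel_measurable (Oth i)" if "l < N" "t < T" for l t
   using that E_Oth_meas[of l i t] by (cases "l = i") (simp_all add: E'_def)
  qed (simp add: E'_def)
  then have "(%u. Pi * (fm L * tp (fm (F u))) + fm (E' u)) : borel_measurable (Oth i)"
   by (intro borel_measurable_add borel_measurable_times[OF borel_measurable_const Mm])
  then show ?thesis by (subst measurable_cong[OF eq]) auto
 qed
 have Y_meas: "Y : borel_measurable M" unfolding Y_def
  by (rule borel_measurable_times[OF measurable_compose[OF E_fm_measurable borel_measurable_tp] borel_measurable_const])
 obtain Li where Li: "Li * fm L = idm r" "norm Li <= k^2 / p" using L_inverse by blast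
 have nL: "norm (fm L) <= k^2 * p" by (rule norm_opb_idm[OF L_up L_idm(2)]) (use pos in simp)
 have ex: "EX C1 C2 E' Li. fm L * tp (fm (F u)) = C1 * C2 & A u = C1 * C2 + E' & C2 * idm T = C2 & E' * idm T = E'
   & idm r * C2 = C2 & opb E' (2 * k^2 * sqrt m) & Li * C1 = idm r & norm Li <= k^2 / p & norm C1 <= k^2 * p"
  if w: "u : \<Omega>" for u
 proof -
  have wM: "u : space M" using w sM by blast
  define E' where "E' = Pi * fm (E u) - un i i * (fm L * tp (fm (F u)))"
  have "A u = fm L * tp (fm (F u)) + E'"
   by (simp add: A_def E'_def Pi_def distrib_left left_diff_distrib assoc_eq[OF L_idm(1)] E_idm[OF wM])
  moreover have "E' * idm T = E'"
   by (simp add: E'_def left_diff_distrib mult.assoc E_idm[OF wM] F_idm[OF wM])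
  moreover have "opb E' (2 * k^2 * sqrt m)"
  proof (rule opb_mono)
   have P1: "opb Pi 1" unfolding Pi_def by (rule compl_proj) (simp_all add: iN un_mult_un)
   have "norm (un i i * (fm L * tp (fm (F u)))) <= k * (k * q)"
   proof -
   have "un i i * (fm L * tp (fm (F u))) = un i 0 * (tp (tp (fm L) * un i 0) * tp (fm (F u)))"
   by (simp add: tp_mult un_un_assoc mult.assoc)
   also have "norm ... <= norm (un i 0) * norm (tp (tp (fm L) * un i 0) * tp (fm (F u)))" by (rule norm_mult_ineq)
   also have "... <= k * (k * q)"
   proof -
   have "norm (tp (tp (fm L) * un i 0) * tp (fm (F u))) <= (k * q) * norm (tp (tp (fm L) * un i 0))"
   by (rule opbD_left[OF opb_tp[OF F_up[OF w]]])
   also have "... <= (k * q) * k" using lam pos by (intro mult_left_mono) simp_all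
   finally show ?thesis by (simp add: mult_ac)
   qed
   finally show ?thesis .
   qed
   note b = opb_mono[OF opb_norm this]
   show "opb E' (1 * (k * sqrt m) + k * (k * q))"
   unfolding E'_def by (rule opb_minus[OF opb_mult[OF P1 E_up[OF w]] b])
   have "k * (k * q) <= k * (k * sqrt m)" using pos by (intro mult_left_mono) auto
   moreover have "k * sqrt m <= k * (k * sqrt m)" using pos k1 by (intro mult_left_mono) auto
   ultimately show "1 * (k * sqrt m) + k * (k * q) <= 2 * k^2 * sqrt m" by (simp add: power2_eq_square)
  qed
  ultimately show ?thesis using Li nL F_idm[OF wM] by blast
 qed
 have bd: "integrable M (%u. indicator B u * (norm (tp W * Y u))^2)
   & (\<integral>u. indicator B u * (norm (tp W * Y u))^2 \<partial>M) <= 4 * C * r * prob B"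
  if W: "idm T * W = W" "W * idm r = W" "norm W < 2 * sqrt (real r)" and B: "B : sets (Oth i)" for W B
 proof -
  have BM: "B <= space M" using sets.sets_into_space[OF B] by (simp add: Oth_sets)
  have eq: "indicator B u * (norm (tp W * Y u))^2 = (\<Sum>c<r. indicator B u * (\<Sum>s<T. entry W s c * E u $$ (i, s))^2)" for u
  proof (cases "u : B")
   case True
   then have d: "dim_row (E u) = N" "dim_col (E u) = T" using E_dim BM by auto
   have "entry (Y u) s 0 = E u $$ (i, s)" if "s < T" for s
   using that i by (simp add: Y_def entry_mult_un entry_fm d)
   then show ?thesis using norm_tp_mult_sq[OF W(1,2), of "Y u"] True by (simp add: Y_def mult.assoc un_mult_un)
  qed simp
  note R = row_form_event[OF i B]
  have "(\<integral>u. indicator B u * (norm (tp W * Y u))^2 \<partial>M)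
   = (\<Sum>c<r. \<integral>u. indicator B u * (\<Sum>s<T. entry W s c * E u $$ (i, s))^2 \<partial>M)"
   unfolding eq by (rule Bochner_Integration.integral_sum) (rule R(1))
  also have "... <= (\<Sum>c<r. C * (\<Sum>s<T. (entry W s c)^2) * prob B)" by (intro sum_mono R(2))
  also have "... = C * (norm W)^2 * prob B"
   unfolding norm_sq_rect[OF W(1,2)] by (simp add: sum_distrib_left sum_distrib_right)
  also have "... <= C * (4 * r) * prob B"
  proof -
   have "(norm W)^2 <= (2 * sqrt (real r))^2" using W(3) by (intro power_mono) auto
   then show ?thesis using C1 by (intro mult_right_mono mult_left_mono) (auto simp: power_mult_distrib)
  qed
  finally have "(\<integral>u. indicator B u * (norm (tp W * Y u))^2 \<partial>M) <= 4 * C * r * prob B" by (simp add: mult_ac)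
  moreover have "integrable M (%u. indicator B u * (norm (tp W * Y u))^2)"
   unfolding eq by (rule Bochner_Integration.integrable_sum) (rule R(1))
  ultimately show ?thesis by blast
 qed
 have top: "space M : sets (Oth i)" using sets.top[of "Oth i"] by (simp add: Oth_sets)
 have e: "0 < 2 * k^2 * sqrt m" "0 < k^2 / p" "0 < k^2 * p" using pos by simp_all
 \<comment> \<open>Default instance of the residual condition on candidates: \<open>P = 0\<close>
   and \<open>z = 1\<close> make it trivial for rows.\<close>
 have z: "norm (0 * V) < (1::real)" for V :: fmat by simp
 have c0: "0 <= 4 * C * real r" using C1 by simp
 have "EX Cc:sets M. prob Cc >= prob (\<Omega> \<inter> space M) - 4 * C * r / K^2 & (ALL u:Cc. EX Vh. norm Vh < 2 * sqrt (real r) & Vh * idm r = Vh & idm T * Vh = Vh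
   & norm ((idm T - Vh * tp Vh) * (tp (A u) * (A u * Vh))) < 1 & norm (tp Vh * Vh - idm r) < \<eta>
   & norm (fm L * tp (fm (F u)) * (idm T - Vh * tp Vh)) < 3 * ((k^2 * p) * (k^2 / p)) * (2 * k^2 * sqrt m) & norm (0 * Vh) < (1::real) & norm (tp Vh * Y u) <= K)"
  by (rule leave_out_select[where P = 0 and z = 1, OF Oth_sub A_meas Mm Y_meas top Om ex e r1 rT \<eta> z bd K c0])
 moreover have "3 * ((k^2 * p) * (k^2 / p)) * (2 * k^2 * sqrt m) = 6 * k^6 * sqrt m"
  using pos by (simp add: eval_nat_numeral)
 moreover have "\<Omega> \<inter> space M = \<Omega>" using sM by blast
 ultimately show ?thesis unfolding A_def Y_def Pi_def by (simp only: mult.assoc) blast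
qed

end

context pc_noise
begin

definition "Pn \<delta> t = dg T (%s. if s : nbhd_compl T \<delta> t then 0 else 1)"

lemma Pn: "tp (Pn \<delta> t) = Pn \<delta> t" "Pn \<delta> t * Pn \<delta> t = Pn \<delta> t" "idm T * Pn \<delta> t = Pn \<delta> t" "Pn \<delta> t * idm T = Pn \<delta> t"
 by (auto simp: Pn_def dg_mult intro!: dg_cong)

text \<open>The singular vectors of the reduced data lie in the range of \<open>X * Q\<close>, and
  \<open>P\<close> removes the loadings, so only noise of size \<open>sqrt m\<close> is left,
  divided by singular values of order \<open>s\<close>.\<close>

lemma col_residual_small:
 assumes w: "x : space M" and F_low: "!!W. q / k * norm (idm r * W) <= norm (fm (F x) * W)"
  and E_up: "opb (fm (E x)) (k * sqrt m)" and Q: "opb Q 1" and P: "opb P 1" "P * fm L = 0"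
  and A: "A = Q * tp (X x)" "tp Q = Q" "Q * Q = Q" "A = fm (F x) * tp (fm L) + E2" "opb E2 e"
  and e: "4 * k^2 * e <= s" and R: "rsvd N r A V \<sigma>"
 shows "norm (P * V) < 3 * k^4 * sqrt m / s"
proof -
 define Fm where "Fm = fm (F x)"
 from R have V: "idm N * V = V" "tp V * V = idm r" "tp A * (A * V) = V * dg r (%j. (\<sigma> j)^2)"
  by (auto simp: rsvd_def)
 have nV: "V * idm r = V" by (rule norm_orthonormal(2)[OF V(2)])
 have \<sigma>: "s / (2 * k^2) <= \<sigma> j" if j: "j < r" for j
 proof -
  have "s / k^2 - e <= \<sigma> j"
  proof (rule rsvd_lower[OF R A(4,5) L_idm _ _ j])
   fix W assume W: "idm r * W = W"
   show "s / k^2 * norm (fm L * W) <= norm (fm (F x) * tp (fm L) * (fm L * W))"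
   proof (cases "norm (fm L * W) = 0")
   case False
   define LW where "LW = fm L * W"
   define G where "G = tp (fm L) * LW"
   have "(norm LW)^2 = inner W G" by (simp add: power2_norm_eq_inner LW_def G_def inner_mult_left)
   also have "... <= norm W * norm G" by (rule norm_cauchy_schwarz)
   also have "... <= (k / p * norm LW) * norm G"
   proof (rule mult_right_mono)
   have "p / k * norm W <= norm LW" using L_low[of W] W by (simp add: LW_def)
   then show "norm W <= k / p * norm LW" using pos by (simp add: field_simps)
   qed simp
   finally have "norm LW * norm LW <= norm LW * (k / p * norm G)" by (simp add: power2_eq_square mult_ac)
   then have 1: "norm LW <= k / p * norm G"
   by (rule mult_left_le_imp_le) (use False in "simp add: LW_def")
   have "idm r * tp (fm L) = tp (fm L)" using arg_cong[OF L_idm(2), of tp] by (simp add: tp_mult)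
   then have "idm r * G = G" unfolding G_def by (rule assoc_eq)
   then have "q / k * norm G <= norm (fm (F x) * G)" using F_low[of G] by simp
   moreover have "s / k^2 * norm LW <= q / k * norm G"
   using mult_left_mono[OF 1, of "s / k^2"] pos by (simp add: power2_eq_square mult_ac)
   ultimately show ?thesis by (simp add: LW_def[symmetric] G_def mult.assoc)
   qed simp
   show "W = 0" if "fm L * W = 0"
   proof -
   have "p / k * norm W <= 0" "0 < p / k" using L_low[of W] that W pos by simp_all
   then have "norm W <= 0" by (metis mult_le_0_iff not_le)
   then show ?thesis by simp
   qed
  qed
  moreover define h where "h = s / (2 * k^2)"
  moreover have "e <= h"
  proof -
   have "0 <= k^2 * e" using opb_nonneg[OF A(5)] by simp
   then have "2 * k^2 * e <= s" using e by linarith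
   then show ?thesis using pos by (simp add: h_def field_simps)
  qed
  moreover have "s / k^2 = h + h" using pos by (simp add: h_def field_simps)
  ultimately show ?thesis unfolding h_def[symmetric] by linarith
 qed
 have s2: "0 < s / (2 * k^2)" using pos by simp
 have \<sigma>0: "0 < \<sigma> j" if "j < r" for j using \<sigma>[OF that] s2 by linarith
 define Dm where "Dm = dg r (%j. 1 / \<sigma> j)"
 define B where "B = A * (V * Dm)"
 have "tp B * B = idm r"
 proof -
  have "tp B * B = Dm * (tp V * ((tp A * (A * V)) * Dm))" by (simp add: B_def Dm_def tp_mult mult.assoc)
  also have "... = Dm * (dg r (%j. (\<sigma> j)^2) * Dm)"
   unfolding V(3) by (simp add: mult.assoc assoc_eq[OF V(2)]) (simp add: Dm_def dg_mult)
  also have "... = idm r" unfolding Dm_def dg_mult by (rule dg_cong) (use \<sigma>0 in "auto simp: power2_eq_square field_simps less_le")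
  finally show ?thesis .
 qed
 then have nB: "norm B = sqrt (real r)" by (rule norm_orthonormal(1))
 have tA: "tp A = X x * Q" by (simp add: A(1) A(2) tp_mult)
 have PX: "P * (X x * W) = P * (fm (E x) * W)" for W
  by (simp add: distrib_left distrib_right mult.assoc assoc_eq[OF P(2)])
 have "P * V = P * (fm (E x) * (Q * (B * Dm)))"
 proof -
  \<comment> \<open>The eigenvalue equation writes \<open>V\<close> as an image under
    \<open>tp A\<close>; \<open>B\<close> is the corresponding orthonormal left basis.\<close>
  have "V = (V * dg r (%j. (\<sigma> j)^2)) * (Dm * Dm)"
  proof -
   have "dg r (%j. (\<sigma> j)^2) * (Dm * Dm) = idm r"
   unfolding Dm_def dg_mult by (rule dg_cong) (use \<sigma>0 in "auto simp: power2_eq_square field_simps less_le")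
   then show ?thesis by (simp add: mult.assoc nV)
  qed
  also have "... = tp A * (B * Dm)" by (simp add: V(3)[symmetric] B_def mult.assoc)
  finally have "P * V = P * (tp A * (B * Dm))" by simp
  then show ?thesis by (simp add: tA mult.assoc PX)
 qed
 then have "norm (P * V) = norm (P * (fm (E x) * (Q * (B * Dm))))" by simp
 also have "... <= 1 * norm (fm (E x) * (Q * (B * Dm)))" by (rule opbD[OF P(1)])
 also have "... <= 1 * ((k * sqrt m) * norm (Q * (B * Dm)))" by (intro mult_left_mono opbD[OF E_up]) simp
 also have "... <= 1 * ((k * sqrt m) * (1 * norm (B * Dm)))" using pos by (intro mult_left_mono opbD[OF Q]) auto
 also have "norm (B * Dm) <= (2 * k^2 / s) * norm B"
 proof (rule opbD_left)
  show "opb Dm (2 * k^2 / s)" unfolding Dm_def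
  proof (rule opb_dg)
   fix j assume j: "j < r"
   have "1 / \<sigma> j <= 1 / (s / (2 * k^2))" using \<sigma>[OF j] s2 by (intro divide_left_mono mult_pos_pos \<sigma>0[OF j]) auto
   then show "\<bar>1 / \<sigma> j\<bar> <= 2 * k^2 / s" using \<sigma>0[OF j] by simp
  qed (use pos in simp)
 qed
 also have "(2 * k^2 / s) * norm B <= (2 * k^2 / s) * k" unfolding nB using rk pos by (intro mult_left_mono) auto
 finally have "norm (P * V) <= (k * sqrt m) * ((2 * k^2 / s) * k)" using pos by simp
 also have "... = 2 * k^4 * sqrt m / s" by (simp add: eval_nat_numeral)
 also have "... < 3 * k^4 * sqrt m / s"
 proof -
  define y where "y = k^4 * sqrt m / s"
  have "0 < y" using pos by (simp add: y_def)
  moreover have e: "2 * k^4 * sqrt m / s = 2 * y" "3 * k^4 * sqrt m / s = 3 * y" by (simp_all add: y_def)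
  ultimately show ?thesis unfolding e by simp
 qed
 finally show ?thesis .
qed

text \<open>The noise of period \<open>t\<close> is not independent of the distant periods, so the
  candidate is chosen on the event where its conditional moments are at most \<open>\<tau>\<close>.
  Off the loading space the candidate has norm below \<open>3 * k^4 * sqrt m / s\<close>, and the
  square of this factor enters the second moment.\<close>

lemma col_select:
 assumes t: "t < T" and Om: "\<Omega> : sets M"
  and F_low: "!!x W. x : \<Omega> ==> q / k * norm (idm r * W) <= norm (fm (F x) * W)"
  and F_up: "!!x. x : \<Omega> ==> opb (fm (F x)) (k * q)" and E_up: "!!x. x : \<Omega> ==> opb (fm (E x)) (k * sqrt m)"
  and PF: "!!x. x : \<Omega> ==> norm (Pn \<delta> t * fm (F x)) <= k * sqrt Dd" and Dd: "1 <= Dd" and pm: "p <= sqrt m"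
  and small: "8 * k^4 * sqrt (m * Dd) <= s"
  and Li: "Li * fm L = idm r" "tp (fm L * Li) = fm L * Li" "fm L * Li * (fm L * Li) = fm L * Li"
  and \<tau>: "0 <= \<tau>" and \<eta>: "0 < \<eta>" and K: "0 < K"
 shows "EX Cc:sets M. prob Cc >= prob (\<Omega> \<inter> {x : space M. (\<Sum>j<N. (mu \<delta> t j x)^2) <= \<tau> & (ALL j<N. vv \<delta> t j x <= \<tau>)}) - 2 * \<tau> * (3 * k^4 * sqrt m / s)^2 / K^2
   & (ALL x:Cc. EX Uh. norm Uh < 2 * sqrt (real r) & Uh * idm r = Uh & idm N * Uh = Uh
   & norm ((idm N - Uh * tp Uh) * (tp ((idm T - Pn \<delta> t) * tp (X x)) * ((idm T - Pn \<delta> t) * tp (X x) * Uh))) < 1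
   & norm (tp Uh * Uh - idm r) < \<eta>
   & norm (fm (F x) * (tp (fm L) * (idm N - Uh * tp Uh))) < 6 * k^6 * sqrt (m * Dd)
   & norm (tp Uh * ((idm N - fm L * Li) * (fm (E x) * un t 0))) <= K)"
proof -
 define Q where "Q = idm T - Pn \<delta> t"
 define P where "P = idm N - fm L * Li"
 define A where "A = (%x. Q * tp (X x))"
 define Y where "Y = (%x. P * (fm (E x) * un t 0))"
 define Sel where "Sel = {x : space M. (\<Sum>j<N. (mu \<delta> t j x)^2) <= \<tau> & (ALL j<N. vv \<delta> t j x <= \<tau>)}"
 define z where "z = 3 * k^4 * sqrt m / s"
 define e where "e = 2 * k^2 * sqrt (m * Dd)"
 have sM: "\<Omega> <= space M" using Om sets.sets_into_space by blast
 have LLi: "idm N * (fm L * Li) = fm L * Li" "fm L * Li * idm N = fm L * Li"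
 proof -
  show 1: "idm N * (fm L * Li) = fm L * Li" by (rule assoc_eq[OF L_idm(1)])
  show "fm L * Li * idm N = fm L * Li" using arg_cong[OF 1, of tp] unfolding tp_mult[of "idm N"] Li(2) by simp
 qed
 have tP: "tp P = P" by (simp add: P_def tp_minus Li(2))
 have PN: "idm N * P = P" by (simp add: P_def right_diff_distrib LLi dg_mult)
 have P1: "opb P 1" unfolding P_def by (rule compl_proj[OF Li(2,3) LLi])
 have PL: "P * fm L = 0" by (simp add: P_def left_diff_distrib mult.assoc L_idm Li(1))
 have Q: "opb Q 1" "tp Q = Q" "Q * Q = Q"
 proof -
  show "opb Q 1" unfolding Q_def by (rule compl_proj[OF Pn])
  show "tp Q = Q" by (simp add: Q_def tp_minus Pn)
  show "Q * Q = Q" by (simp add: Q_def left_diff_distrib right_diff_distrib Pn dg_mult)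
 qed
 have spK: "space (Kc \<delta> t) = space M" by (rule Kc_facts(1))
 have Mm0: "(%x. fm L * tp (fm (F x))) : borel_measurable (Kc \<delta> t)"
 proof (rule M0_measurable[OF spK])
  show "(%x. (L * (F x)\<^sup>T) $$ (i, u)) : borel_measurable (Kc \<delta> t)" if "i < N" "u < T" for i u
   by (rule borel_measurable_subalgebra[OF Kc_facts(5) _ entry_measurable_sigma]) (use that spK in auto)
 qed
 have Mm: "(%x. fm (F x) * tp (fm L)) : borel_measurable (Kc \<delta> t)"
  using measurable_compose[OF Mm0 borel_measurable_tp] by (simp add: tp_mult)
 have A_meas: "A : borel_measurable (Kc \<delta> t)"
 proof -
  define E' where "E' = (%x. mat N T (%(j, s). if s : nbhd_compl T \<delta> t then E x $$ (j, s) else 0))"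
  have eq: "A x = Q * (fm (F x) * tp (fm L)) + tp (fm (E' x))" if "x : space (Kc \<delta> t)" for x
  proof -
   have "x : space M" using that spK by simp
   then have d: "dim_row (E x) = N" "dim_col (E x) = T" using E_dim by auto
   have "Q * tp (fm (E x)) = tp (fm (E' x))"
   by (auto simp: fmat_eq_iff Q_def Pn_def left_diff_distrib entry_dg_mult entry_fm E'_def d nbhd_compl_def)
   then show ?thesis by (simp add: A_def distrib_left tp_simps)
  qed
  have "(%x. fm (E' x)) : borel_measurable (Kc \<delta> t)"
  proof (rule borel_measurable_fm[where n = N and m = T])
   show "(%x. E' x $$ (j, u)) : borel_measurable (Kc \<delta> t)" if "j < N" "u < T" for j u
   proof (cases "u : nbhd_compl T \<delta> t")
   case True
   have "(%x. E x $$ (j, u)) : borel_measurable (Gs \<delta> t j)"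
   unfolding Gs_def by (rule entry_measurable_sigma) (use True in simp)
   then have "(%x. E x $$ (j, u)) : borel_measurable (Kc \<delta> t)"
   by (rule borel_measurable_subalgebra[OF Kc_facts(4)[OF that(1)], rotated]) (simp add: Gs_def spK)
   then show ?thesis using True that by (simp add: E'_def)
   qed (use that in "simp add: E'_def")
  qed (simp add: E'_def)
  then have "(%x. Q * (fm (F x) * tp (fm L)) + tp (fm (E' x))) : borel_measurable (Kc \<delta> t)"
   by (intro borel_measurable_add borel_measurable_times[OF borel_measurable_const Mm] measurable_compose[OF _ borel_measurable_tp])
  then show ?thesis by (subst measurable_cong[OF eq]) auto
 qed
 have Y_meas: "Y : borel_measurable M" unfolding Y_def
  by (intro borel_measurable_times borel_measurable_const E_fm_measurable)
 have Sel: "Sel : sets (Kc \<delta> t)" unfolding Sel_def by (rule sel_event)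
 have S: "sqrt (m * Dd) = sqrt m * sqrt Dd" "1 <= sqrt Dd" using Dd by (simp_all add: real_sqrt_mult)
 have mD: "sqrt m <= sqrt (m * Dd)" using pos Dd by (simp add: mult_le_cancel_left1)
 have E2: "A x = fm (F x) * tp (fm L) + (Q * tp (fm (E x)) - Pn \<delta> t * fm (F x) * tp (fm L))
   & opb (Q * tp (fm (E x)) - Pn \<delta> t * fm (F x) * tp (fm L)) e" if w: "x : \<Omega>" for x
 proof
  have wM: "x : space M" using w sM by blast
  show "A x = fm (F x) * tp (fm L) + (Q * tp (fm (E x)) - Pn \<delta> t * fm (F x) * tp (fm L))"
   by (simp add: A_def Q_def tp_simps distrib_left left_diff_distrib mult.assoc assoc_eq[OF F_idm(1)[OF wM]])
  show "opb (Q * tp (fm (E x)) - Pn \<delta> t * fm (F x) * tp (fm L)) e"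
  proof (rule opb_mono)
   show "opb (Q * tp (fm (E x)) - Pn \<delta> t * fm (F x) * tp (fm L)) (1 * (k * sqrt m) + (k * sqrt Dd) * (k * p))"
   by (rule opb_minus[OF opb_mult[OF Q(1) opb_tp[OF E_up[OF w]]] opb_mult[OF opb_mono[OF opb_norm PF[OF w]] opb_tp[OF L_up]]])
   have "k * sqrt m <= k^2 * sqrt (m * Dd)"
   using k1 mD pos by (intro mult_mono) (auto simp: power2_eq_square)
   moreover have "(k * sqrt Dd) * (k * p) <= k^2 * sqrt (m * Dd)"
   proof -
   have "p * sqrt Dd <= sqrt m * sqrt Dd" using pm S by (intro mult_right_mono) auto
   then have "k^2 * (p * sqrt Dd) <= k^2 * (sqrt m * sqrt Dd)" by (intro mult_left_mono) auto
   then show ?thesis unfolding S(1) by (simp add: power2_eq_square mult_ac)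
   qed
   ultimately show "1 * (k * sqrt m) + (k * sqrt Dd) * (k * p) <= e" by (simp add: e_def)
  qed
 qed
 have ex: "EX C1 C2 E' Li. fm (F x) * tp (fm L) = C1 * C2 & A x = C1 * C2 + E' & C2 * idm N = C2 & E' * idm N = E'
   & idm r * C2 = C2 & opb E' e & Li * C1 = idm r & norm Li <= k^2 / q & norm C1 <= k^2 * q"
  if w: "x : \<Omega>" for x
 proof -
  have wM: "x : space M" using w sM by blast
  have c: "0 < q / k" using pos by simp
  obtain B where B: "B * fm (F x) = idm r" "norm B <= sqrt (real r) / (q / k)"
   using left_inverse_exists[OF F_idm(2)[OF wM] F_low[OF w] c] by blast
  have "sqrt (real r) / (q / k) <= k^2 / q"
   using rk pos by (simp add: divide_right_mono power2_eq_square)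
  then have nB: "norm B <= k^2 / q" using B(2) by linarith
  have nF: "norm (fm (F x)) <= k^2 * q" by (rule norm_opb_idm[OF F_up[OF w] F_idm(2)[OF wM]]) (use pos in simp)
  have tL: "tp (fm L) * idm N = tp (fm L)" "idm r * tp (fm L) = tp (fm L)"
   using arg_cong[OF L_idm(1), of tp] arg_cong[OF L_idm(2), of tp] by (simp_all add: tp_mult)
  have "(Q * tp (fm (E x)) - Pn \<delta> t * fm (F x) * tp (fm L)) * idm N = Q * tp (fm (E x)) - Pn \<delta> t * fm (F x) * tp (fm L)"
   using arg_cong[OF E_idm(1)[OF wM], of tp] tL by (simp add: left_diff_distrib mult.assoc tp_mult)
  then show ?thesis using E2[OF w] B(1) nB nF tL by blast
 qed
 have Pz: "norm (P * V) < z" if w: "x : \<Omega>" and R: "rsvd N r (A x) V \<sigma>" for x V \<sigma>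
  unfolding z_def
 proof (rule col_residual_small[OF _ F_low[OF w] E_up[OF w] Q(1) P1 PL A_def[THEN fun_cong] Q(2,3) _ _ _ R])
  show "x : space M" using w sM by blast
  show "A x = fm (F x) * tp (fm L) + (Q * tp (fm (E x)) - Pn \<delta> t * fm (F x) * tp (fm L))"
   "opb (Q * tp (fm (E x)) - Pn \<delta> t * fm (F x) * tp (fm L)) e" using E2[OF w] by auto
  show "4 * k^2 * e <= s" using small by (simp add: e_def eval_nat_numeral mult_ac)
 qed
 have bd: "integrable M (%x. indicator B x * (norm (tp W * Y x))^2)
   & (\<integral>x. indicator B x * (norm (tp W * Y x))^2 \<partial>M) <= 2 * \<tau> * z^2 * prob B"
  if W: "idm N * W = W" "W * idm r = W" "norm W < 2 * sqrt (real r)" "norm (P * W) < z" and B: "B : sets (Kc \<delta> t)" "B <= Sel" for W B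
 proof -
  have BM: "B <= space M" using sets.sets_into_space[OF B(1)] by (simp add: spK)
  \<comment> \<open>\<open>P\<close> is symmetric and is moved from the noise to the candidate,
    where the residual condition bounds it.\<close>
  define W' where "W' = P * W"
  have W': "idm N * W' = W'" "W' * idm r = W'" unfolding W'_def using W(2) by (simp_all add: mult.assoc assoc_eq[OF PN])
  have eq: "indicator B x * (norm (tp W * Y x))^2 = (\<Sum>c<r. indicator B x * (\<Sum>j<N. entry W' j c * E x $$ (j, t))^2)" for x
  proof (cases "x : B")
   case True
   then have d: "dim_row (E x) = N" "dim_col (E x) = T" using E_dim BM by auto
   have "entry (fm (E x) * un t 0) j 0 = E x $$ (j, t)" if "j < N" for j
   using that t by (simp add: entry_mult_un entry_fm d)
   moreover have "tp W * Y x = tp W' * (fm (E x) * un t 0)" by (simp add: W'_def Y_def tp_mult tP mult.assoc)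
   ultimately show ?thesis using norm_tp_mult_sq[OF W', of "fm (E x) * un t 0"] True by (simp add: mult.assoc un_mult_un)
  qed simp
  note R = col_form_event[OF t B(1) \<tau>]
  have sel: "(\<Sum>j<N. (mu \<delta> t j x)^2) <= \<tau> & (ALL j<N. vv \<delta> t j x <= \<tau>)" if "x : B" for x
   using that B(2) by (auto simp: Sel_def)
  have "(\<integral>x. indicator B x * (norm (tp W * Y x))^2 \<partial>M)
   = (\<Sum>c<r. \<integral>x. indicator B x * (\<Sum>j<N. entry W' j c * E x $$ (j, t))^2 \<partial>M)"
   unfolding eq by (rule Bochner_Integration.integral_sum) (rule R(1)[OF sel])
  also have "... <= (\<Sum>c<r. 2 * \<tau> * (\<Sum>j<N. (entry W' j c)^2) * prob B)" by (intro sum_mono R(2)[OF sel])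
  also have "... = 2 * \<tau> * (norm W')^2 * prob B"
   unfolding norm_sq_rect[OF W'] by (simp add: sum_distrib_left sum_distrib_right)
  also have "... <= 2 * \<tau> * z^2 * prob B"
  proof -
   have "(norm W')^2 <= z^2" using W(4) by (intro power_mono) (auto simp: W'_def)
   then show ?thesis using \<tau> by (intro mult_right_mono mult_left_mono) auto
  qed
  finally have "(\<integral>x. indicator B x * (norm (tp W * Y x))^2 \<partial>M) <= 2 * \<tau> * z^2 * prob B" .
  moreover have "integrable M (%x. indicator B x * (norm (tp W * Y x))^2)"
   unfolding eq by (rule Bochner_Integration.integrable_sum) (rule R(1)[OF sel])
  ultimately show ?thesis by blast
 qed
 have e0: "0 < e" "0 < k^2 / q" "0 < k^2 * q" unfolding e_def using pos Dd by simp_all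
 have c0: "0 <= 2 * \<tau> * z^2" using \<tau> by simp
 have "EX Cc:sets M. prob Cc >= prob (\<Omega> \<inter> Sel) - 2 * \<tau> * z^2 / K^2 & (ALL x:Cc. EX Vh. norm Vh < 2 * sqrt (real r) & Vh * idm r = Vh & idm N * Vh = Vh
   & norm ((idm N - Vh * tp Vh) * (tp (A x) * (A x * Vh))) < 1 & norm (tp Vh * Vh - idm r) < \<eta>
   & norm (fm (F x) * tp (fm L) * (idm N - Vh * tp Vh)) < 3 * ((k^2 * q) * (k^2 / q)) * e & norm (P * Vh) < z & norm (tp Vh * Y x) <= K)"
  by (rule leave_out_select[OF Kc_facts(2) A_meas Mm Y_meas Sel Om ex e0 r1 rN \<eta> Pz bd K c0])
 moreover have "3 * ((k^2 * q) * (k^2 / q)) * e = 6 * k^6 * sqrt (m * Dd)"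
  using pos by (simp add: e_def eval_nat_numeral)
 ultimately show ?thesis unfolding A_def Y_def Q_def P_def Sel_def z_def by (simp only: mult.assoc) blast
qed

end

section \<open>Gram matrices close to positive definite limits\<close>

lemma pos_def_lower:
 assumes S: "pos_def_mat r S" and r: "1 <= r"
 shows "EX c>0. ALL W. c * (norm (idm r * W))^2 <= inner (idm r * W) (fm S * (idm r * W))"
proof -
 have Sc: "S : carrier_mat r r" using S by (simp add: pos_def_mat_def)
 define f where "f = (%w :: fmat. inner w (fm S * w))"
 define B where "B = {w. idm r * w = w & w * idm 1 = w & norm w = 1}"
 have "closed B"
  unfolding B_def by (intro closed_Collect_conj closed_Collect_eq continuous_intros)
 then have "compact B" by (rule compact_fmat_sub[where n = r and m = 1 and c = 1]) (auto simp: B_def)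
 moreover have "un 0 0 : B" unfolding B_def using r by (auto simp: un_idm)
 moreover have "continuous_on B f" unfolding f_def by (intro continuous_intros)
 ultimately obtain w0 where w0: "w0 : B" "!!w. w : B ==> f w0 <= f w"
  using continuous_attains_inf[of B f] by blast
 have one: "idm (Suc 0) = un 0 0" by (auto simp: fmat_eq_iff)
 obtain v where v: "v : carrier_vec r" "fv v = w0" using fv_surj[of r w0] w0(1) by (auto simp: B_def one)
 have "v ~= 0\<^sub>v r"
 proof
  assume "v = 0\<^sub>v r"
  then have "fv v = 0" by (auto simp: fmat_eq_iff entry_fv)
  then show False using v w0(1) by (simp add: B_def)
 qed
 then have "0 < v \<bullet> (S *\<^sub>v v)" using S v by (simp add: pos_def_mat_def)
 also have "v \<bullet> (S *\<^sub>v v) = f w0" using inner_fv[OF v(1), of "S *\<^sub>v v"] fv_mult[OF Sc v(1)] Sc v by (simp add: f_def)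
 finally have c: "0 < f w0" .
 have col: "f w0 * (norm w)^2 <= f w" if w: "idm r * w = w" "w * idm 1 = w" for w
 proof (cases "w = 0")
  case False
  have "f w0 <= f ((1 / norm w) *\<^sub>R w)" by (rule w0(2)) (use w False in "simp add: B_def")
  also have "... = f w / (norm w)^2" by (simp add: f_def power2_eq_square)
  finally show ?thesis using False by (simp add: field_simps)
 qed (simp add: f_def)
 have "f w0 * (norm (idm r * W))^2 <= inner (idm r * W) (fm S * (idm r * W))" for W
 proof -
  obtain n where "supp_in n W" using supp_in_ex by blast
  then have "W * idm n = W" by (rule idm_supp)
  then have U: "idm r * W * idm n = idm r * W" by (simp add: mult.assoc)
  then have U': "fm S * (idm r * W) * idm n = fm S * (idm r * W)" by (simp add: mult.assoc)
  have "f w0 * (norm (idm r * W))^2 = (\<Sum>j<n. f w0 * (norm (idm r * W * un j 0))^2)"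
   using norm_sq_sum_cols[OF U] by (simp add: sum_distrib_left)
  also have "... <= (\<Sum>j<n. f (idm r * W * un j 0))"
   by (intro sum_mono col) (simp_all add: one un_mult_un mult.assoc dg_mult_assoc)
  also have "... = inner (idm r * W) (fm S * (idm r * W))"
   using inner_sum_cols[OF U', of "idm r * W"] by (simp add: f_def mult.assoc)
  finally show ?thesis .
 qed
 then show ?thesis using c by blast
qed

text \<open>Spectral closeness of the scaled Gram matrix to \<open>S\<close> perturbs the quadratic
  form of \<open>S\<close> by at most 1 / k, which leaves lower and upper bounds for the singular
  values of \<open>A\<close> of order \<open>x\<close>.\<close>

lemma gram_bounds:
 assumes S: "pos_def_mat r S" and r: "1 <= r"
 shows "EX k>=1. ALL A x. 0 < x --> A * idm r = A --> opb ((1 / x^2) *\<^sub>R (tp A * A) - fm S) (1 / k)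
  --> (ALL W. x / k * norm (idm r * W) <= norm (A * W)) & opb A (k * x)"
proof -
 obtain c where c: "0 < c" "!!W. c * (norm (idm r * W))^2 <= inner (idm r * W) (fm S * (idm r * W))"
  using pos_def_lower[OF assms] by blast
 \<comment> \<open>2 / c makes the perturbation 1 / k at most half of the lower bound
   \<open>c\<close>, with the other half left for 1 / k^2; the norm of \<open>S\<close> and the 1
   serve the upper bound.\<close>
 define k where "k = 1 + 2 / c + norm (fm S)"
 have k: "1 <= k" "1 / k <= c / 2" "1 / k^2 <= 1 / k" "norm (fm S) + 1 / k <= k^2"
 proof -
  show k1: "1 <= k" using c by (simp add: k_def)
  have "2 / c <= k" using c by (simp add: k_def)
  then show "1 / k <= c / 2" using c k1 by (simp add: field_simps)
  have "k * 1 <= k * k" using k1 by (intro mult_left_mono) auto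
  then have kk: "k <= k^2" by (simp add: power2_eq_square)
  then show "1 / k^2 <= 1 / k" using k1 by (intro divide_left_mono) auto
  have "1 / k <= 1" using k1 by simp
  moreover have "norm (fm S) + 1 <= k" using c by (simp add: k_def)
  ultimately show "norm (fm S) + 1 / k <= k^2" using kk by linarith
 qed
 have "(ALL W. x / k * norm (idm r * W) <= norm (A * W)) & opb A (k * x)"
  if x: "0 < x" and A: "A * idm r = A" and D: "opb ((1 / x^2) *\<^sub>R (tp A * A) - fm S) (1 / k)" for A x
 proof -
  define D where "D = (1 / x^2) *\<^sub>R (tp A * A) - fm S"
  have eq: "(norm (A * W))^2 = x^2 * (inner (idm r * W) (D * (idm r * W)) + inner (idm r * W) (fm S * (idm r * W)))"
   and Db: "\<bar>inner (idm r * W) (D * (idm r * W))\<bar> <= 1 / k * (norm (idm r * W))^2" for W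
  proof -
   define U where "U = idm r * W"
   have "A * W = A * U" unfolding U_def by (rule assoc_eq[OF A, symmetric])
   then have "(norm (A * W))^2 = inner U (tp A * A * U)" by (simp add: power2_norm_eq_inner inner_mult_left mult.assoc)
   also have "tp A * A = x^2 *\<^sub>R (D + fm S)" using x by (simp add: D_def)
   finally show "(norm (A * W))^2 = x^2 * (inner (idm r * W) (D * (idm r * W)) + inner (idm r * W) (fm S * (idm r * W)))"
   by (simp add: U_def[symmetric] distrib_right inner_add_right)
   have "\<bar>inner U (D * U)\<bar> <= norm U * norm (D * U)" by (rule Cauchy_Schwarz_ineq2)
   also have "... <= norm U * (1 / k * norm U)" using that(3) by (intro mult_left_mono opbD) (simp_all add: D_def)
   finally show "\<bar>inner (idm r * W) (D * (idm r * W))\<bar> <= 1 / k * (norm (idm r * W))^2"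
   by (simp add: U_def[symmetric] power2_eq_square)
  qed
  have "x / k * norm (idm r * W) <= norm (A * W)" for W
  proof (rule power2_le_imp_le)
   define y where "y = (norm (idm r * W))^2"
   have y: "0 <= y" by (simp add: y_def)
   have "(x / k * norm (idm r * W))^2 = x^2 * (1 / k^2 * y)" by (simp add: y_def power_mult_distrib power_divide)
   also have "... <= (norm (A * W))^2"
   unfolding eq
   proof (rule mult_left_mono)
   have "1 / k^2 * y + 1 / k * y <= c / 2 * y + c / 2 * y"
   using k y by (intro add_mono mult_right_mono) auto
   then have "1 / k^2 * y + 1 / k * y <= c * y" by (simp add: field_simps)
   moreover have "\<bar>inner (idm r * W) (D * (idm r * W))\<bar> <= 1 / k * y" unfolding y_def by (rule Db)
   moreover have "c * y <= inner (idm r * W) (fm S * (idm r * W))" unfolding y_def by (rule c(2))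
   ultimately show "1 / k^2 * y <= inner (idm r * W) (D * (idm r * W)) + inner (idm r * W) (fm S * (idm r * W))" by linarith
   qed simp
   finally show "(x / k * norm (idm r * W))^2 <= (norm (A * W))^2" .
  qed simp
  moreover have "norm (A * W) <= k * x * norm W" for W
  proof (rule power2_le_imp_le)
   define y where "y = (norm (idm r * W))^2"
   have y: "0 <= y" by (simp add: y_def)
   have "opb (idm r) 1" by (rule opb_proj) (simp_all add: dg_mult)
   from opbD[OF this, of W] have yW: "y <= (norm W)^2" unfolding y_def by (intro power_mono) auto
   have "inner (idm r * W) (fm S * (idm r * W)) <= norm (idm r * W) * norm (fm S * (idm r * W))" by (rule norm_cauchy_schwarz)
   also have "... <= norm (idm r * W) * (norm (fm S) * norm (idm r * W))" by (intro mult_left_mono norm_mult_ineq) simp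
   finally have 1: "inner (idm r * W) (fm S * (idm r * W)) <= norm (fm S) * y" by (simp add: y_def power2_eq_square mult_ac)
   have "(norm (A * W))^2 <= x^2 * ((norm (fm S) + 1 / k) * y)"
   unfolding eq using 1 Db[of W] by (intro mult_left_mono) (auto simp: y_def algebra_simps abs_le_iff)
   also have "... <= x^2 * (k^2 * (norm W)^2)" using k yW y by (intro mult_left_mono mult_mono) auto
   also have "... = (k * x * norm W)^2" by (simp add: power_mult_distrib mult_ac)
   finally show "(norm (A * W))^2 <= (k * x * norm W)^2" .
  qed (use x k in simp)
  ultimately show ?thesis by (simp add: opb_def)
 qed
 then show ?thesis using k(1) by blast
qed

text \<open>Chebyshev for the Frobenius norm: \<open>b\<close> bounds the second moments entry by
  entry, and their sum is of the order of the squared rate.\<close>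

lemma (in prob_space) tight_norm:
 fixes A :: "nat => 'a => fmat"
 assumes C: "0 < C" and ev: "EV n. 0 <= a n & (\<Sum>c<k n. \<Sum>x<l n. b n c x) <= C * (a n)^2 &
   (ALL u:space M. idm (l n) * A n u = A n u & A n u * idm (k n) = A n u) &
   (ALL c<k n. ALL x<l n. (%u. entry (A n u) x c) : borel_measurable M & integrable M (%u. (entry (A n u) x c)^2)
   & (\<integral>u. (entry (A n u) x c)^2 \<partial>M) <= b n c x)"
 shows "tight M (%K n u. norm (A n u) <= K * a n)"
proof -
 define Z where "Z = (%n u. sqrt (\<Sum>c<k n. \<Sum>x<l n. (entry (A n u) x c)^2))"
 have Z2: "(Z n u)^2 = (\<Sum>c<k n. \<Sum>x<l n. (entry (A n u) x c)^2)" for n u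
  unfolding Z_def by (intro real_sqrt_pow2 sum_nonneg) auto
 have t: "tight M (%K n u. \<bar>Z n u\<bar> <= K * a n)"
 proof (rule tight_markov[OF C], use ev in eventually_elim)
  case (elim n)
  then have a: "0 <= a n" and b: "(\<Sum>c<k n. \<Sum>x<l n. b n c x) <= C * (a n)^2"
   and e: "!!c x. c < k n ==> x < l n ==> (%u. entry (A n u) x c) : borel_measurable M & integrable M (%u. (entry (A n u) x c)^2)
   & (\<integral>u. (entry (A n u) x c)^2 \<partial>M) <= b n c x" by blast+
  have "Z n : borel_measurable M" unfolding Z_def
   by (intro borel_measurable_sqrt borel_measurable_sum borel_measurable_power measurable_compose[OF _ borel_measurable_sqrt]) (use e in auto)
  moreover have "integrable M (%u. (Z n u)^2)"
   unfolding Z2 by (intro Bochner_Integration.integrable_sum) (use e in auto)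
  moreover have "(\<integral>u. (Z n u)^2 \<partial>M) <= C * (a n)^2"
  proof -
   have "(\<integral>u. (Z n u)^2 \<partial>M) = (\<Sum>c<k n. \<Sum>x<l n. \<integral>u. (entry (A n u) x c)^2 \<partial>M)"
   unfolding Z2 by (rule integral_sum2) (use e in auto)
   also have "... <= (\<Sum>c<k n. \<Sum>x<l n. b n c x)" by (intro sum_mono) (use e in auto)
   finally show ?thesis using b by linarith
  qed
  ultimately show ?case using a by blast
 qed
 show ?thesis
 proof (rule tight_imp[OF t], intro exI[of _ "_ :: real"] conjI)
  fix K :: real assume K: "0 < K"
  show "EV n. ALL u:space M. \<bar>Z n u\<bar> <= K * a n --> norm (A n u) <= K * a n"
   using ev
  proof eventually_elim
   case (elim n)
   have "norm (A n u) = Z n u" if "u : space M" for u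
   proof -
   have "(norm (A n u))^2 = (Z n u)^2" unfolding Z2 by (rule norm_sq_rect) (use elim that in auto)
   moreover have "0 <= Z n u" unfolding Z_def by (intro real_sqrt_ge_zero sum_nonneg) auto
   ultimately show ?thesis by (simp add: power2_eq_iff_nonneg)
   qed
   then show ?case by auto
  qed
 qed
qed

section \<open>Asymptotic rates and the width of the window\<close>

locale rates =
 fixes N T :: "nat => nat" and \<alpha> \<nu> :: real
 assumes N_lim: "filterlim N at_top sequentially" and T_lim: "filterlim T at_top sequentially"
  and alpha: "0 < \<alpha>" "\<alpha> <= 1" and nu_pos: "0 < \<nu>"
  and growth: "(%n. real (max (N n) (T n)) * ln (real (N n)) powr (2 * \<nu>)) : o(%n. real (N n) powr \<alpha> * real (T n))"
begin

text \<open>\<open>p\<close> and \<open>q\<close> are the orders of the singular values of loadings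
  and factors, so \<open>s\<close> is that of the signal and \<open>sqrt m\<close> that of the
  noise. In these terms the growth condition says that \<open>m * Lg^2\<close> is negligible against
  \<open>s^2\<close>.\<close>

definition "p n = sqrt (real (N n) powr \<alpha>)"
definition "q n = sqrt (real (T n))"
definition "m n = real (max (N n) (T n))"
definition "s n = p n * q n"
definition "Lg n = ln (real (N n)) powr \<nu>"

lemma real_lim: "filterlim (%n. real (N n)) at_top sequentially" "filterlim (%n. real (T n)) at_top sequentially"
 using N_lim T_lim by (auto intro: filterlim_compose[OF filterlim_real_sequentially])

lemma ev_N: "EV n. c <= real (N n)" and ev_T: "EV n. c <= real (T n)"
 using real_lim unfolding filterlim_at_top by auto

lemma ev_Lg: "EV n. c <= Lg n"
proof -
 have "filterlim (%x::real. ln x powr \<nu>) at_top at_top" using nu_pos by real_asymp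
 from filterlim_compose[OF this real_lim(1)] show ?thesis unfolding filterlim_at_top Lg_def by auto
qed

lemma ev_m: "EV n. c <= m n"
 using ev_N[of c] by eventually_elim (simp add: m_def)

lemma ev_basic: "EV n. 1 <= p n & 1 <= q n & (q n)^2 <= m n & p n <= sqrt (N n) & sqrt (N n) <= sqrt (m n) & 1 <= real (N n)"
 using ev_N[of 1] ev_T[of 1]
proof eventually_elim
 case (elim n)
 have "real (N n) powr 0 <= real (N n) powr \<alpha>" using elim alpha by (intro powr_mono) auto
 moreover have "real (N n) powr \<alpha> <= real (N n) powr 1" using elim alpha by (intro powr_mono) auto
 ultimately show ?case using elim by (auto simp: p_def q_def m_def)
qed

lemma s_sq: "(s n)^2 = real (N n) powr \<alpha> * real (T n)"
 by (simp add: s_def p_def q_def power_mult_distrib)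

lemma ev_small: assumes "0 < c" shows "EV n. c * (m n * (Lg n)^2) <= (s n)^2"
 using landau_o.smallD[OF growth, of "1 / c"] ev_N[of 1] assms
proof (elim eventually_elim2)
 fix n assume a: "norm (real (max (N n) (T n)) * ln (real (N n)) powr (2 * \<nu>)) <= 1 / c * norm (real (N n) powr \<alpha> * real (T n))" "1 <= real (N n)"
 have "(Lg n)^2 = ln (real (N n)) powr (2 * \<nu>)"
  unfolding Lg_def by (metis mult_2 powr_add power2_eq_square)
 then show "c * (m n * (Lg n)^2) <= (s n)^2"
  using a assms unfolding s_sq m_def by (simp add: field_simps abs_mult)
qed auto

lemma ev_small1: assumes "0 < c" shows "EV n. c * m n <= (s n)^2"
 using ev_small[OF assms] ev_Lg[of 1]
proof eventually_elim
 case (elim n)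
 have "1 <= (Lg n)^2" using elim by simp
 then have "c * (m n * 1) <= c * (m n * (Lg n)^2)" using assms by (intro mult_left_mono) (auto simp: m_def)
 then show ?case using elim by simp
qed

text \<open>\<open>Dd\<close> bounds the number of periods within distance \<open>\<delta>\<close>
  of \<open>t\<close>. It is of the order of a power of log N and hence below every positive power
  of \<open>N\<close>; the exponent 1/6 lets \<open>sqrt (Dd n)\<close> disappear in the rate of the
  conditional moments.\<close>

lemma width:
 assumes "(%n. real (\<delta> n)) : \<Theta>(%n. ln (real (N n)) powr \<nu>)"
 defines "Dd \<equiv> %n. 2 * real (\<delta> n) + 1"
 shows "EX c>=1. EV n. Dd n <= c * Lg n"
  and "0 < c ==> EV n. c * (m n * Dd n) <= (s n)^2"
  and "EV n. Dd n <= q n & sqrt (Dd n) <= real (N n) powr (1 / 6)"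
proof -
 have "(%n. real (\<delta> n)) : O(%n. ln (real (N n)) powr \<nu>)" using assms(1) by (rule bigthetaD1)
 then obtain c0 where c0: "c0 > 0" "EV n. norm (real (\<delta> n)) <= c0 * norm (ln (real (N n)) powr \<nu>)"
  by (elim landau_o.bigE) auto
 define c1 where "c1 = 2 * c0 + 1"
 have D1: "EV n. Dd n <= c1 * Lg n"
  using c0(2) ev_Lg[of 1] by eventually_elim (simp add: Dd_def c1_def Lg_def algebra_simps)
 show "EX c>=1. EV n. Dd n <= c * Lg n" using D1 c0(1) by (intro exI[of _ c1]) (simp add: c1_def)
 have c1: "1 <= c1" using c0 by (simp add: c1_def)
 show "EV n. c * (m n * Dd n) <= (s n)^2" if c: "0 < c"
  using D1 ev_Lg[of 1] ev_small[of "c * c1", OF mult_pos_pos[OF c]]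
 proof (rule eventually_elim2[OF eventually_conj eventually_mono])
  fix n assume a: "Dd n <= c1 * Lg n & 1 <= Lg n" "0 < c1 --> c * c1 * (m n * (Lg n)^2) <= (s n)^2"
  have "Lg n * 1 <= Lg n * Lg n" using a by (intro mult_left_mono) auto
  then have "c1 * Lg n <= c1 * (Lg n)^2" using c1 by (intro mult_left_mono) (auto simp: power2_eq_square)
  then have "Dd n <= c1 * (Lg n)^2" using a by linarith
  then have "c * (m n * Dd n) <= c * (m n * (c1 * (Lg n)^2))" using c by (intro mult_left_mono) (auto simp: m_def)
  then show "c * (m n * Dd n) <= (s n)^2" using a c1 by (simp add: mult_ac)
 qed (use c1 in auto)
 have "(%x::real. c1 * ln x powr \<nu>) : o(%x. x powr (1 / 3))" using nu_pos by real_asymp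
 from landau_o.smallD[OF this, of 1] have "\<forall>\<^sub>F x in at_top. norm (c1 * ln x powr \<nu>) <= x powr (1 / 3 :: real)"
  by (auto elim: eventually_mono)
 then have N3: "EV n. norm (c1 * Lg n) <= real (N n) powr (1 / 3)"
  unfolding Lg_def using real_lim(1) by (rule eventually_compose_filterlim)
 have c12: "0 < c1^2" using c1 by simp
 show "EV n. Dd n <= q n & sqrt (Dd n) <= real (N n) powr (1 / 6)"
  using D1 N3 ev_small[OF c12] ev_basic ev_Lg[of 1]
 proof eventually_elim
  case (elim n)
  have "sqrt (Dd n) <= sqrt (real (N n) powr (1 / 3))" using elim by simp
  also have "... = real (N n) powr (1 / 6)" by (simp add: powr_half_sqrt[symmetric] powr_powr)
  finally have 1: "sqrt (Dd n) <= real (N n) powr (1 / 6)" .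
  have "p n <= sqrt (m n)" "0 <= p n" using elim by linarith+
  then have "(p n)^2 <= (sqrt (m n))^2" by (rule power_mono)
  then have pm: "(p n)^2 <= m n" by (simp add: m_def)
  \<comment> \<open>\<open>p^2 <= m\<close>, and the growth condition bounds \<open>m * Lg^2\<close>
    by a multiple of \<open>p^2 * q^2\<close>; cancelling \<open>p^2\<close> bounds the window by
    \<open>q\<close>.\<close>
  have "(p n)^2 * (c1 * Lg n)^2 <= m n * (c1 * Lg n)^2" using pm by (intro mult_right_mono) auto
  also have "... = c1^2 * (m n * (Lg n)^2)" by (simp add: power_mult_distrib)
  also have "... <= (p n)^2 * (q n)^2" using elim by (simp add: s_def power_mult_distrib)
  finally have "(c1 * Lg n)^2 <= (q n)^2" by (rule mult_left_le_imp_le) (use elim in auto)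
  then have "c1 * Lg n <= q n" by (rule power2_le_imp_le) (use elim in auto)
  then show ?case using 1 elim by linarith
 qed
qed

end

section \<open>Stochastic orders of the noise terms\<close>

lemma entry_fm_mult: "A : carrier_mat n k ==> entry (fm A * W) i j = (\<Sum>l<k. entry (fm A) i l * entry W l j)"
 by (rule entry_mult_gen) (auto simp: entry_fm)

lemma entry_tp_fm_mult: "A : carrier_mat n k ==> entry (tp (fm A) * W) i j = (\<Sum>l<n. entry (fm A) l i * entry W l j)"
 using entry_mult_gen[of n "tp (fm A)" i W j] by (auto simp: entry_fm)

lemma card_nbhd: "card {x. x < T & x \<notin> nbhd_compl T g t} <= 2 * g + 1"
proof -
 have "{x. x < T & x \<notin> nbhd_compl T g t} <= {t - g..t + g}" by (auto simp: nbhd_compl_def)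
 then have "card {x. x < T & x \<notin> nbhd_compl T g t} <= card {t - g..t + g}" by (intro card_mono) auto
 also have "... <= 2 * g + 1" by simp
 finally show ?thesis .
qed

locale pc_asymp = prob_space M + rates N T \<alpha> \<nu> for M :: "'a measure" and N T :: "nat => nat" and \<alpha> \<nu> :: real +
 fixes r :: nat and Lam :: "nat => real mat" and F E :: "nat => 'a => real mat" and C k0 :: real
 assumes r1: "1 <= r" and L_dim: "!!n. Lam n : carrier_mat (N n) r"
  and F_dim: "!!n y. y : space M ==> F n y : carrier_mat (T n) r"
  and E_dim: "!!n y. y : space M ==> E n y : carrier_mat (N n) (T n)"
  and F_rv: "!!n t k. t < T n ==> k < r ==> (%y. F n y $$ (t, k)) : borel_measurable M"
  and fn: "!!n. factor_noise M (N n) (T n) (E n) (%y. Lam n * (F n y)\<^sup>T) C"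
  and F2: "!!n t. t < T n ==> integrable M (%y. (vec_l2_norm (row (F n y) t))^2)"
   "!!n t. t < T n ==> (\<integral>y. (vec_l2_norm (row (F n y) t))^2 \<partial>M) <= C"
  and k0: "1 <= k0"
  and L_b: "EV n. (ALL W. p n / k0 * norm (idm r * W) <= norm (fm (Lam n) * W)) & opb (fm (Lam n)) (k0 * p n)"
  and F_b: "tight M (%K n y. (ALL W. q n / K * norm (idm r * W) <= norm (fm (F n y) * W)) & opb (fm (F n y)) (K * q n))"
  and E_b: "tight M (%K n y. opb (fm (E n y)) (K * sqrt (m n)))"
begin

lemma C1: "1 <= C" using factor_noise.C1[OF fn] .

lemma dims [simp]: "dim_row (Lam n) = N n" "dim_col (Lam n) = r"
 "y : space M ==> dim_row (F n y) = T n" "y : space M ==> dim_col (F n y) = r"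
 "y : space M ==> dim_row (E n y) = N n" "y : space M ==> dim_col (E n y) = T n"
 using L_dim[of n] F_dim[of y n] E_dim[of y n] by auto

lemma F_sq: assumes t: "t < T n"
 shows "k < r ==> integrable M (%y. (F n y $$ (t, k))^2)" "(\<Sum>k<r. \<integral>y. (F n y $$ (t, k))^2 \<partial>M) <= C"
proof -
 have eq: "(vec_l2_norm (row (F n y) t))^2 = (\<Sum>k<r. (F n y $$ (t, k))^2)" if "y : space M" for y
 proof -
  have "row (F n y) t \<bullet> row (F n y) t = (\<Sum>k<r. (F n y $$ (t, k))^2)"
   using that t by (simp add: scalar_prod_def lessThan_atLeast0 power2_eq_square)
  then show ?thesis by (simp add: vec_l2_norm_def sum_nonneg)
 qed
 have i: "integrable M (%y. \<Sum>k<r. (F n y $$ (t, k))^2)"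
  using F2(1)[OF t] eq by (simp cong: Bochner_Integration.integrable_cong)
 show ik: "integrable M (%y. (F n y $$ (t, k))^2)" if k: "k < r" for k
 proof (rule Bochner_Integration.integrable_bound[OF i])
  show "(%y. (F n y $$ (t, k))^2) : borel_measurable M" using F_rv[OF t k] by simp
  have "(F n y $$ (t, k))^2 <= (\<Sum>k<r. (F n y $$ (t, k))^2)" for y
   using k by (intro member_le_sum) auto
  then show "AE y in M. norm ((F n y $$ (t, k))^2) <= norm (\<Sum>k<r. (F n y $$ (t, k))^2)"
   by (auto simp: sum_nonneg)
 qed
 have "(\<Sum>k<r. \<integral>y. (F n y $$ (t, k))^2 \<partial>M) = (\<integral>y. (\<Sum>k<r. (F n y $$ (t, k))^2) \<partial>M)"
  by (rule Bochner_Integration.integral_sum[symmetric]) (use ik in auto)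
 also have "... = (\<integral>y. (vec_l2_norm (row (F n y) t))^2 \<partial>M)"
  by (rule Bochner_Integration.integral_cong) (auto simp: eq)
 finally show "(\<Sum>k<r. \<integral>y. (F n y $$ (t, k))^2 \<partial>M) <= C" using F2(2)[OF t] by simp
qed

lemma L_sq: "EV n. (\<Sum>k<r. \<Sum>j<N n. (Lam n $$ (j, k))^2) <= r * k0^2 * (p n)^2"
 using L_b
proof eventually_elim
 case (elim n)
 have "norm (fm (Lam n) * idm r) <= (k0 * p n) * norm (idm r)" using elim by (intro opbD) auto
 then have "norm (fm (Lam n)) <= (k0 * p n) * sqrt r" using fm_idm(2)[OF L_dim] by (simp add: norm_idm)
 then have "(norm (fm (Lam n)))^2 <= ((k0 * p n) * sqrt r)^2" by (intro power_mono) auto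
 moreover have "(norm (fm (Lam n)))^2 = (\<Sum>k<r. \<Sum>j<N n. (Lam n $$ (j, k))^2)"
  using norm_sq_rect[OF fm_idm[OF L_dim]] by (simp add: entry_fm)
 ultimately show ?case by (simp add: power_mult_distrib mult_ac)
qed

lemma T_f: "tight M (%K n y. norm (tp (fm (F n y)) * un t 0) <= K * 1)"
proof (rule tight_norm[where k = "%_. 1" and l = "%_. r" and C = C and b = "%n c x. \<integral>y. (F n y $$ (t, x))^2 \<partial>M"], goal_cases)
 case 1 then show ?case using C1 by simp
next
 case 2
 have "EV n. t < T n" using ev_T[of "real (Suc t)"] by eventually_elim simp
 then show ?case
 proof eventually_elim
  case (elim n)
  have e: "entry (tp (fm (F n y)) * un t 0) x 0 = F n y $$ (t, x)" if "y : space M" "x < r" for y x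
   using that elim by (simp add: entry_mult_un entry_fm)
  show ?case using F_sq(2)[OF elim] F_sq(1)[OF elim] F_rv[OF elim]
   by (auto simp: e elim entry_mult_un entry_fm entry_dg_mult entry_mult_dg fmat_eq_iff cong: measurable_cong Bochner_Integration.integrable_cong Bochner_Integration.integral_cong)
 qed
qed

lemma T_e: "tight M (%K n y. norm (tp (fm (E n y)) * un i 0) <= K * q n)"
proof (rule tight_norm[where k = "%_. 1" and l = T and C = "2 * C" and b = "%n c x. 2 * C"], goal_cases)
 case 1 then show ?case using C1 by simp
next
 case 2
 have "EV n. i < N n" using ev_N[of "real (Suc i)"] by eventually_elim simp
 then show ?case
 proof eventually_elim
  case (elim n)
  interpret fn: factor_noise M "N n" "T n" "E n" "%y. Lam n * (F n y)\<^sup>T" C by (rule fn)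
  have e: "entry (tp (fm (E n y)) * un i 0) x 0 = E n y $$ (i, x)" if "y : space M" "x < T n" for y x
   using that elim by (simp add: entry_mult_un entry_fm)
  show ?case using fn.E2_int[OF elim] fn.E_rv[OF elim]
   by (auto simp: e elim q_def entry_mult_un entry_fm entry_dg_mult entry_mult_dg fmat_eq_iff cong: measurable_cong Bochner_Integration.integrable_cong Bochner_Integration.integral_cong)
 qed
qed

lemma T_eps: "tight M (%K n y. norm (fm (E n y) * un t 0) <= K * sqrt (real (N n)))"
proof (rule tight_norm[where k = "%_. 1" and l = N and C = "2 * C" and b = "%n c x. 2 * C"], goal_cases)
 case 1 then show ?case using C1 by simp
next
 case 2
 have "EV n. t < T n" using ev_T[of "real (Suc t)"] by eventually_elim simp
 then show ?case
 proof eventually_elim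
  case (elim n)
  interpret fn: factor_noise M "N n" "T n" "E n" "%y. Lam n * (F n y)\<^sup>T" C by (rule fn)
  have e: "entry (fm (E n y) * un t 0) x 0 = E n y $$ (x, t)" if "y : space M" "x < N n" for y x
   using that elim by (simp add: entry_mult_un entry_fm)
  show ?case using fn.E2_int[OF _ elim] fn.E_rv[OF _ elim]
   by (auto simp: e elim entry_mult_un entry_fm entry_dg_mult entry_mult_dg fmat_eq_iff cong: measurable_cong Bochner_Integration.integrable_cong Bochner_Integration.integral_cong)
 qed
qed

lemma T_Leps: "tight M (%K n y. norm (tp (fm (Lam n)) * (fm (E n y) * un t 0)) <= K * p n)"
proof (rule tight_norm[where k = "%_. 1" and l = "%_. r" and C = "2 * C * (r * k0^2)" and b = "%n c x. 2 * C * (\<Sum>j<N n. (Lam n $$ (j, x))^2)"], goal_cases)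
 case 1 then show ?case using C1 k0 r1 by simp
next
 case 2
 have "EV n. t < T n" using ev_T[of "real (Suc t)"] by eventually_elim simp
 then show ?case
  using L_sq
 proof eventually_elim
  case (elim n)
  interpret fn: factor_noise M "N n" "T n" "E n" "%y. Lam n * (F n y)\<^sup>T" C by (rule fn)
  have e: "entry (tp (fm (Lam n)) * (fm (E n y) * un t 0)) x 0 = (\<Sum>j<N n. Lam n $$ (j, x) * E n y $$ (j, t))" if "y : space M" "x < r" for y x
   using that elim by (simp add: entry_tp_fm_mult[OF L_dim] entry_mult_un entry_fm)
  have 1: "(%y. \<Sum>j<N n. Lam n $$ (j, x) * E n y $$ (j, t)) : borel_measurable M" for x
   using elim by (intro borel_measurable_sum borel_measurable_times borel_measurable_const fn.E_rv) auto
  have 2: "idm r * (tp (fm (Lam n)) * W) = tp (fm (Lam n)) * W" for W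
   by (rule assoc_eq) (auto simp: fmat_eq_iff entry_dg_mult entry_fm)
  have 3: "(\<Sum>x<r. 2 * C * (\<Sum>j<N n. (Lam n $$ (j, x))^2)) <= 2 * C * (r * k0^2) * (p n)^2"
   using mult_left_mono[OF elim(2), of "2 * C"] C1 by (simp add: sum_distrib_left[symmetric] mult_ac)
  show ?case using fn.col_form[OF elim(1)] 1 3
   by (auto simp: e 2 p_def mult.assoc un_idm cong: measurable_cong Bochner_Integration.integrable_cong Bochner_Integration.integral_cong)
 qed
qed

text \<open>Norm bounds would give \<open>s * sqrt m\<close>. Uncorrelated rows and summable
  covariances reduce the bilinear form to order \<open>s\<close>, so its contribution
  \<open>g / s^2\<close> to the matching matrix is only of order 1 / s.\<close>

lemma T_LEF: "tight M (%K n y. norm (tp (fm (Lam n)) * (fm (E n y) * fm (F n y))) <= K * s n)"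
proof (rule tight_norm[where k = "%_. r" and l = "%_. r" and C = "C * (r * k0^2) * C"
   and b = "%n c x. C * (\<Sum>j<N n. (Lam n $$ (j, x))^2) * (\<Sum>u<T n. \<integral>y. (F n y $$ (u, c))^2 \<partial>M)"], goal_cases)
 case 1 then show ?case using C1 k0 r1 by simp
next
 case 2 show ?case
  using L_sq L_b ev_basic
 proof eventually_elim
  case (elim n)
  interpret fn: factor_noise M "N n" "T n" "E n" "%y. Lam n * (F n y)\<^sup>T" C by (rule fn)
  have e: "entry (tp (fm (Lam n)) * (fm (E n y) * fm (F n y))) x c = (\<Sum>j<N n. \<Sum>u<T n. Lam n $$ (j, x) * E n y $$ (j, u) * F n y $$ (u, c))"
   if "y : space M" "x < r" "c < r" for y x c
   using that by (simp add: entry_tp_fm_mult[OF L_dim] entry_fm_mult[OF E_dim[OF that(1)]] entry_fm sum_distrib_left mult.assoc)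
  have 2: "idm r * (tp (fm (Lam n)) * W) = tp (fm (Lam n)) * W" for W
   by (rule assoc_eq) (auto simp: fmat_eq_iff entry_dg_mult entry_fm)
  have 4: "tp (fm (Lam n)) * (fm (E n y) * fm (F n y)) * idm r = tp (fm (Lam n)) * (fm (E n y) * fm (F n y))" if "y : space M" for y
   using fm_idm(2)[OF F_dim[OF that]] by (simp add: mult.assoc)
  have pk: "0 < p n / k0" using elim k0 by simp
  obtain Li where Li: "Li * fm (Lam n) = idm r"
   using left_inverse_exists[OF fm_idm(2)[OF L_dim], where c = "p n / k0"] elim pk by blast
  \<comment> \<open>Independence is assumed for the signal, not for the factors; a left inverse of
    the loadings recovers the factors from the signal.\<close>
  have FM: "(%y. F n y $$ (u, c)) : borel_measurable fn.MeanS" if "u < T n" "c < r" for u c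
  proof -
   have eq: "F n y $$ (u, c) = (\<Sum>j<N n. entry Li c j * (Lam n * (F n y)\<^sup>T) $$ (j, u))" if w: "y : space fn.MeanS" for y
   proof -
   have w: "y : space M" using w by simp
   have FT: "(F n y)\<^sup>T : carrier_mat r (T n)" using F_dim[OF w] by simp
   have "fm ((F n y)\<^sup>T) = Li * fm (Lam n * (F n y)\<^sup>T)"
   unfolding fm_mult[OF L_dim FT] mult.assoc[symmetric] Li by (rule fm_idm(1)[OF FT, symmetric])
   then have "entry (fm ((F n y)\<^sup>T)) c u = entry (Li * fm (Lam n * (F n y)\<^sup>T)) c u" by simp
   also have "... = (\<Sum>j<N n. entry Li c j * entry (fm (Lam n * (F n y)\<^sup>T)) j u)"
   by (rule entry_mult_gen) (simp add: entry_fm)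
   finally show ?thesis using \<open>u < T n\<close> \<open>c < r\<close> w by (simp add: entry_fm)
   qed
   have "(%y. \<Sum>j<N n. entry Li c j * (Lam n * (F n y)\<^sup>T) $$ (j, u)) : borel_measurable fn.MeanS"
   using that by (intro borel_measurable_sum borel_measurable_times borel_measurable_const entry_measurable_sigma) auto
   then show ?thesis by (subst measurable_cong[OF eq]) auto
  qed
  note bf = fn.bilinear_form[of "%u y. F n y $$ (u, c)" for c, OF FM F_sq(1)]
  have 1: "(%y. \<Sum>j<N n. \<Sum>u<T n. Lam n $$ (j, x) * E n y $$ (j, u) * F n y $$ (u, c)) : borel_measurable M" if "c < r" for x c
   using that by (intro borel_measurable_sum borel_measurable_times borel_measurable_const fn.E_rv F_rv) auto
  have 3: "(\<Sum>c<r. \<Sum>x<r. C * (\<Sum>j<N n. (Lam n $$ (j, x))^2) * (\<Sum>u<T n. \<integral>y. (F n y $$ (u, c))^2 \<partial>M)) <= C * (r * k0^2) * C * (s n)^2"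
  proof -
   have f: "(\<Sum>c<r. \<Sum>u<T n. \<integral>y. (F n y $$ (u, c))^2 \<partial>M) <= real (T n) * C"
   using sum_mono[of "{..<T n}" "%u. \<Sum>c<r. \<integral>y. (F n y $$ (u, c))^2 \<partial>M" "%_. C"] F_sq(2) by (subst sum.swap) auto
   have "(\<Sum>c<r. \<Sum>x<r. C * (\<Sum>j<N n. (Lam n $$ (j, x))^2) * (\<Sum>u<T n. \<integral>y. (F n y $$ (u, c))^2 \<partial>M))
   = C * (\<Sum>x<r. \<Sum>j<N n. (Lam n $$ (j, x))^2) * (\<Sum>c<r. \<Sum>u<T n. \<integral>y. (F n y $$ (u, c))^2 \<partial>M)"
   by (simp only: sum_distrib_left[symmetric] sum_distrib_right[symmetric])
   also have "... <= C * (r * k0^2 * (p n)^2) * (real (T n) * C)"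
   using C1 elim(1) f by (intro mult_mono) (auto intro!: sum_nonneg)
   also have "... = C * (r * k0^2) * C * (s n)^2" by (simp add: s_def q_def power_mult_distrib mult_ac)
   finally show ?thesis .
  qed
  have 5: "0 <= s n" by (simp add: s_def p_def q_def)
  have "(%y. entry (tp (fm (Lam n)) * (fm (E n y) * fm (F n y))) x c) : borel_measurable M
   & integrable M (%y. (entry (tp (fm (Lam n)) * (fm (E n y) * fm (F n y))) x c)^2)
   & (\<integral>y. (entry (tp (fm (Lam n)) * (fm (E n y) * fm (F n y))) x c)^2 \<partial>M)
   <= C * (\<Sum>j<N n. (Lam n $$ (j, x))^2) * (\<Sum>u<T n. \<integral>y. (F n y $$ (u, c))^2 \<partial>M)" if xc: "x < r" "c < r" for x c
   using bf[of c "%j. Lam n $$ (j, x)"] 1[of c x] xc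
   by (simp add: e cong: measurable_cong Bochner_Integration.integrable_cong Bochner_Integration.integral_cong)
  then show ?case using 3 4 5 2 by blast
 qed
qed

lemma sum_nbhd: fixes c :: real assumes "0 <= c" "!!x. x < T' ==> f x <= c"
 shows "(\<Sum>x<T'. if x : nbhd_compl T' d t then 0 else f x) <= (2 * real d + 1) * c"
proof -
 have "(\<Sum>x<T'. if x : nbhd_compl T' d t then 0 else f x) = (\<Sum>x | x < T' & x \<notin> nbhd_compl T' d t. f x)"
  by (rule sum.mono_neutral_cong_right) auto
 also have "... <= (\<Sum>x | x < T' & x \<notin> nbhd_compl T' d t. c)" by (intro sum_mono assms) auto
 also have "... = real (card {x. x < T' & x \<notin> nbhd_compl T' d t}) * c" by simp
 also have "... <= real (2 * d + 1) * c" using card_nbhd[of T' d t] assms(1) by (intro mult_right_mono) linarith+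
 finally show ?thesis by (simp add: add.commute)
qed

definition "Pq d n t = dg (T n) (%s. if s : nbhd_compl (T n) d t then 0 else 1)"

text \<open>The window contains at most \<open>2 * g n + 1\<close> periods, each with bounded second
  moment.\<close>

lemma T_PF: "tight M (%K n y. norm (Pq (g n) n t * fm (F n y)) <= K * sqrt (2 * real (g n) + 1))"
proof (rule tight_norm[where k = "%_. r" and l = T and C = C
   and b = "%n c x. if x : nbhd_compl (T n) (g n) t then 0 else \<integral>y. (F n y $$ (x, c))^2 \<partial>M"], goal_cases)
 case 1 show ?case using C1 by simp
next
 case 2 show ?case
 proof (intro always_eventually conjI ballI allI impI)
  fix n
  have "(\<Sum>c<r. \<Sum>x<T n. if x : nbhd_compl (T n) (g n) t then 0 else \<integral>y. (F n y $$ (x, c))^2 \<partial>M)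
   = (\<Sum>x<T n. if x : nbhd_compl (T n) (g n) t then 0 else (\<Sum>c<r. \<integral>y. (F n y $$ (x, c))^2 \<partial>M))"
   by (subst sum.swap) (intro sum.cong, auto)
  also have "... <= (2 * real (g n) + 1) * C" using C1 F_sq(2) by (intro sum_nbhd) auto
  finally show "(\<Sum>c<r. \<Sum>x<T n. if x : nbhd_compl (T n) (g n) t then 0 else \<integral>y. (F n y $$ (x, c))^2 \<partial>M) <= C * (sqrt (2 * real (g n) + 1))^2"
   by (simp add: mult.commute)
  fix y assume w: "y : space M"
  show "idm (T n) * (Pq (g n) n t * fm (F n y)) = Pq (g n) n t * fm (F n y)" by (simp add: Pq_def dg_mult_assoc)
  show "Pq (g n) n t * fm (F n y) * idm r = Pq (g n) n t * fm (F n y)" using fm_idm(2)[OF F_dim[OF w]] by (simp add: mult.assoc)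
 next
  fix n c x assume cx: "c < r" "x < T n"
  have e: "entry (Pq (g n) n t * fm (F n y)) x c = (if x : nbhd_compl (T n) (g n) t then 0 else F n y $$ (x, c))" if "y : space M" for y
   using that cx by (simp add: Pq_def entry_dg_mult entry_fm)
  show "(%y. entry (Pq (g n) n t * fm (F n y)) x c) : borel_measurable M"
   using F_rv[OF cx(2,1)] by (simp add: e cong: measurable_cong)
  show "integrable M (%y. (entry (Pq (g n) n t * fm (F n y)) x c)^2)"
   using F_sq(1)[OF cx(2,1)] by (cases "x : nbhd_compl (T n) (g n) t") (simp_all add: e cong: Bochner_Integration.integrable_cong)
  show "(\<integral>y. (entry (Pq (g n) n t * fm (F n y)) x c)^2 \<partial>M) <= (if x : nbhd_compl (T n) (g n) t then 0 else \<integral>y. (F n y $$ (x, c))^2 \<partial>M)"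
   by (simp add: e cong: Bochner_Integration.integral_cong)
 qed simp
qed

lemma T_PEL: "tight M (%K n y. norm (Pq (g n) n t * (tp (fm (E n y)) * fm (Lam n))) <= K * (sqrt (2 * real (g n) + 1) * p n))"
proof (rule tight_norm[where k = "%_. r" and l = T and C = "2 * C * (r * k0^2)"
   and b = "%n c x. if x : nbhd_compl (T n) (g n) t then 0 else 2 * C * (\<Sum>j<N n. (Lam n $$ (j, c))^2)"], goal_cases)
 case 1 show ?case using C1 k0 r1 by simp
next
 case 2 show ?case
  using L_sq
 proof eventually_elim
  case (elim n)
  interpret fn: factor_noise M "N n" "T n" "E n" "%y. Lam n * (F n y)\<^sup>T" C by (rule fn)
  show ?case
  proof (intro conjI ballI allI impI)
   show "0 <= sqrt (2 * real (g n) + 1) * p n" by (simp add: p_def)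
   have "(\<Sum>x<T n. if x : nbhd_compl (T n) (g n) t then 0 else 2 * C * (\<Sum>j<N n. (Lam n $$ (j, c))^2))
   <= (2 * real (g n) + 1) * (2 * C * (\<Sum>j<N n. (Lam n $$ (j, c))^2))" for c
   using C1 by (intro sum_nbhd) (auto intro!: sum_nonneg mult_nonneg_nonneg)
   then have "(\<Sum>c<r. \<Sum>x<T n. if x : nbhd_compl (T n) (g n) t then 0 else 2 * C * (\<Sum>j<N n. (Lam n $$ (j, c))^2))
   <= (\<Sum>c<r. (2 * real (g n) + 1) * (2 * C * (\<Sum>j<N n. (Lam n $$ (j, c))^2)))" by (intro sum_mono)
   also have "... = (2 * real (g n) + 1) * (2 * C * (\<Sum>c<r. \<Sum>j<N n. (Lam n $$ (j, c))^2))" by (simp only: sum_distrib_left)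
   also have "... <= (2 * real (g n) + 1) * (2 * C * (r * k0^2 * (p n)^2))" using elim C1 by (intro mult_left_mono) auto
   also have "... = 2 * C * (r * k0^2) * (sqrt (2 * real (g n) + 1) * p n)^2" by (simp add: power_mult_distrib mult_ac)
   finally show "(\<Sum>c<r. \<Sum>x<T n. if x : nbhd_compl (T n) (g n) t then 0 else 2 * C * (\<Sum>j<N n. (Lam n $$ (j, c))^2))
   <= 2 * C * (r * k0^2) * (sqrt (2 * real (g n) + 1) * p n)^2" .
   fix y assume w: "y : space M"
   show "idm (T n) * (Pq (g n) n t * (tp (fm (E n y)) * fm (Lam n))) = Pq (g n) n t * (tp (fm (E n y)) * fm (Lam n))" by (simp add: Pq_def dg_mult_assoc)
   show "Pq (g n) n t * (tp (fm (E n y)) * fm (Lam n)) * idm r = Pq (g n) n t * (tp (fm (E n y)) * fm (Lam n))"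
   using fm_idm(2)[OF L_dim[of n]] by (simp add: mult.assoc)
  next
   fix c x assume cx: "c < r" "x < T n"
   have e: "entry (Pq (g n) n t * (tp (fm (E n y)) * fm (Lam n))) x c = (if x : nbhd_compl (T n) (g n) t then 0 else (\<Sum>j<N n. Lam n $$ (j, c) * E n y $$ (j, x)))" if "y : space M" for y
   using that cx by (simp add: Pq_def entry_dg_mult entry_tp_fm_mult[OF E_dim[OF that]] entry_fm mult.commute)
   have 1: "(%y. \<Sum>j<N n. Lam n $$ (j, c) * E n y $$ (j, x)) : borel_measurable M"
   using cx by (intro borel_measurable_sum borel_measurable_times borel_measurable_const fn.E_rv) auto
   show "(%y. entry (Pq (g n) n t * (tp (fm (E n y)) * fm (Lam n))) x c) : borel_measurable M"
   using 1 by (simp add: e cong: measurable_cong)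
   show "integrable M (%y. (entry (Pq (g n) n t * (tp (fm (E n y)) * fm (Lam n))) x c)^2)"
   using fn.col_form(1)[OF cx(2)] by (cases "x : nbhd_compl (T n) (g n) t") (simp_all add: e cong: Bochner_Integration.integrable_cong)
   show "(\<integral>y. (entry (Pq (g n) n t * (tp (fm (E n y)) * fm (Lam n))) x c)^2 \<partial>M) <= (if x : nbhd_compl (T n) (g n) t then 0 else 2 * C * (\<Sum>j<N n. (Lam n $$ (j, c))^2))"
   using fn.col_form(2)[OF cx(2)] by (simp add: e cong: Bochner_Integration.integral_cong)
  qed
 qed
qed

end

section \<open>Good events and candidates along the asymptotics\<close>

context pc_asymp
begin

abbreviation "Xm n u \<equiv> fm (Lam n) * tp (fm (F n u)) + fm (E n u)"

definition "Bs K n u \<longleftrightarrow> ((ALL W. q n / K * norm (idm r * W) <= norm (fm (F n u) * W)) & opb (fm (F n u)) (K * q n)) & opb (fm (E n u)) (K * sqrt (m n))"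

lemma pqms_nonneg: "0 <= p n" "0 <= q n" "0 <= m n" "0 <= s n"
 by (simp_all add: p_def q_def m_def s_def)

lemma mono_opb: "(!!n. 0 <= a n) ==> mono_pred (%K n u. opb (A n u) (K * a n))"
 by (rule mono_predI) (meson mult_right_mono opb_mono)

lemma mono_low: "mono_pred (%K n u. ALL W. q n / K * norm (idm r * W) <= norm (fm (F n u) * W))"
proof (rule mono_predI, intro allI)
 fix K K' n u W assume a: "0 < K" "K <= K'" "ALL W. q n / K * norm (idm r * W) <= norm (fm (F n u) * W)"
 have "q n / K' <= q n / K" using a pqms_nonneg by (intro divide_left_mono) auto
 then have "q n / K' * norm (idm r * W) <= q n / K * norm (idm r * W)" by (intro mult_right_mono) auto
 then show "q n / K' * norm (idm r * W) <= norm (fm (F n u) * W)" using a(3) order_trans by blast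
qed

lemma Bs: "tight M Bs" "mono_pred Bs"
proof -
 have mE: "mono_pred (%K n u. opb (fm (E n u)) (K * sqrt (m n)))" by (rule mono_opb) (simp add: pqms_nonneg)
 have mF: "mono_pred (%K n u. (ALL W. q n / K * norm (idm r * W) <= norm (fm (F n u) * W)) & opb (fm (F n u)) (K * q n))"
  by (intro mono_pred_conj mono_low mono_opb pqms_nonneg)
 show "tight M Bs" using tight_conj[OF F_b mF E_b mE] unfolding Bs_def .
 show "mono_pred Bs" using mono_pred_conj[OF mF mE] unfolding Bs_def .
qed

definition "kk = max k0 (sqrt (real r))"

lemma kk: "1 <= kk" "k0 <= kk" "sqrt (real r) <= kk"
 using k0 by (auto simp: kk_def)

lemma ev_L: assumes "kk <= h"
 shows "EV n. (ALL W. p n / h * norm (idm r * W) <= norm (fm (Lam n) * W)) & opb (fm (Lam n)) (h * p n)"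
 using L_b
proof eventually_elim
 case (elim n)
 have k: "0 < k0" "k0 <= h" using k0 kk assms by auto
 have "p n / h * norm (idm r * W) <= norm (fm (Lam n) * W)" for W
 proof -
  have "p n / h <= p n / k0" using k pqms_nonneg by (intro divide_left_mono) auto
  then have "p n / h * norm (idm r * W) <= p n / k0 * norm (idm r * W)" by (intro mult_right_mono) auto
  then show ?thesis using elim order_trans by blast
 qed
 moreover have "opb (fm (Lam n)) (h * p n)"
  by (rule opb_mono[OF conjunct2[OF elim]]) (use k pqms_nonneg in "auto intro: mult_right_mono")
 ultimately show ?case by blast
qed

lemma ev_pc_noise: assumes "kk <= h"
 shows "EV n. pc_noise M (N n) (T n) (E n) (F n) (Lam n) C r h (p n) (m n)"
 using ev_L[OF assms] ev_basic ev_N[of "real r"] ev_T[of "real r"]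
proof eventually_elim
 case (elim n)
 show ?case
  unfolding pc_noise_def pc_noise_axioms_def
  using fn L_dim F_dim E_dim r1 elim kk assms by (auto simp: m_def)
qed

text \<open>What \<open>row_bound\<close> asks of a candidate. The tolerance for orthonormality is
  free of \<open>K\<close>, so that the predicate is monotone in \<open>K\<close>; for large
  \<open>n\<close> it is stricter than the one with \<open>96 * K^9\<close>.\<close>

definition "RowSel i K n u \<longleftrightarrow> (EX Vh. norm Vh <= 2 * K & Vh * idm r = Vh & idm (T n) * Vh = Vh
  & norm ((idm (T n) - Vh * tp Vh) * (tp ((idm (N n) - un i i) * Xm n u) * ((idm (N n) - un i i) * Xm n u * Vh))) <= 1
  & norm (tp Vh * Vh - idm r) <= 1 / ((m n)^2 * s n)
  & norm (fm (Lam n) * (tp (fm (F n u)) * (idm (T n) - Vh * tp Vh))) <= 6 * K^6 * sqrt (m n)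
  & norm (tp Vh * (tp (fm (E n u)) * un i 0)) <= K)"

lemma mono_row: "mono_pred (RowSel i)"
proof (rule mono_predI)
 fix K K' :: real and n u assume a: "0 < K" "K <= K'" "RowSel i K n u"
 have "K^6 <= K'^6" using a by (intro power_mono) auto
 then have "6 * K^6 * sqrt (m n) <= 6 * K'^6 * sqrt (m n)" using pqms_nonneg by (intro mult_right_mono) auto
 moreover have "2 * K <= 2 * K'" using a by simp
 ultimately show "RowSel i K' n u" using a(2,3) unfolding RowSel_def by (meson order_trans)
qed

lemma T_row: assumes c: "EV n. norm (tp (fm (Lam n)) * un i 0) <= c"
 shows "tight M (RowSel i)"
 unfolding tight_def
proof (intro allI impI)
 fix e :: real assume e: "e > 0"
 obtain K1 where K1: "K1 > 0" "EV n. EX A:sets M. prob A >= 1 - e / 2 & (ALL u:A. Bs K1 n u)"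
  using Bs(1) e unfolding tight_def by (meson half_gt_zero)
 define h where "h = max K1 (max kk c)"
 \<comment> \<open>The selection fails with probability at most \<open>4 * C * r / K^2\<close>; this
   \<open>K\<close> makes that at most e / 2.\<close>
 define K where "K = max h (sqrt (8 * C * r / e))"
 have h: "K1 <= h" "kk <= h" "c <= h" "1 <= h" using kk by (auto simp: h_def)
 have K: "h <= K" "0 < K" using h by (auto simp: K_def)
 have "(sqrt (8 * C * r / e))^2 <= K^2" unfolding K_def using C1 e by (intro power_mono) auto
 then have "8 * C * r / e <= K^2" using C1 e by simp
 then have Kb: "4 * C * r / K^2 <= e / 2" using e K by (simp add: field_simps)
 have "EV n. EX A:sets M. prob A >= 1 - e & (ALL u:A. RowSel i K n u)"
  using K1(2) c ev_pc_noise[OF h(2)] ev_N[of "real (Suc i)"] ev_basic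
 proof eventually_elim
  case (elim n)
  interpret P: pc_noise M "N n" "T n" "E n" "F n" "Lam n" C r h "p n" "m n" by (rule elim(3))
  obtain A where A: "A : sets M" "prob A >= 1 - e / 2" "!!u. u : A ==> Bs h n u"
   using elim(1) Bs(2) K1(1) h(1) unfolding mono_pred_def by meson
  have s: "0 < s n" "p n * sqrt (real (T n)) = s n" "q n = sqrt (real (T n))" using P.pos by (simp_all add: s_def q_def)
  have \<eta>: "0 < 1 / ((m n)^2 * s n)" using s(1) P.pos(5) by simp
  have i: "i < N n" using elim(4) by simp
  have lam: "norm (tp (fm (Lam n)) * un i 0) <= h" using elim(2) h(3) by linarith
  obtain Cc where Cc: "Cc : sets M" "prob Cc >= prob A - 4 * C * r / K^2"
   and sel: "!!u. u : Cc ==> EX Vh. norm Vh < 2 * sqrt (real r) & Vh * idm r = Vh & idm (T n) * Vh = Vh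
   & norm ((idm (T n) - Vh * tp Vh) * (tp ((idm (N n) - un i i) * Xm n u) * ((idm (N n) - un i i) * Xm n u * Vh))) < 1
   & norm (tp Vh * Vh - idm r) < 1 / ((m n)^2 * s n)
   & norm (fm (Lam n) * (tp (fm (F n u)) * (idm (T n) - Vh * tp Vh))) < 6 * h^6 * sqrt (m n) & norm (tp Vh * (tp (fm (E n u)) * un i 0)) <= K"
   using P.row_select[OF i lam A(1) _ _ \<eta> K(2)] A(3) unfolding Bs_def s(3) by blast
  have "RowSel i K n u" if w: "u : Cc" for u
  proof -
   have "h^6 <= K^6" using K h by (intro power_mono) auto
   then have k6: "6 * h^6 * sqrt (m n) <= 6 * K^6 * sqrt (m n)" using pqms_nonneg by (intro mult_right_mono) auto
   have k2: "2 * sqrt (real r) <= 2 * K" using kk h K by linarith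
   show ?thesis using sel[OF w] k6 k2 unfolding RowSel_def by (meson less_imp_le less_le_trans)
  qed
  then show ?case using Cc A(2) Kb by (intro bexI[of _ Cc]) auto
 qed
 then show "EX K>0. EV n. EX A:sets M. prob A >= 1 - e & (ALL u:A. RowSel i K n u)" using K(2) by blast
qed

text \<open>As for rows, all bounds are weakened when \<open>K\<close> grows. The last rate is the
  residual norm \<open>sqrt m / s\<close> times the root N^(1/6) of the conditional second
  moments.\<close>

definition "ColSel d t K n u \<longleftrightarrow> (EX Uh Li. norm Uh <= 2 * K & Uh * idm r = Uh & idm (N n) * Uh = Uh
  & norm ((idm (N n) - Uh * tp Uh) * (tp ((idm (T n) - Pq (d n) n t) * tp (Xm n u)) * ((idm (T n) - Pq (d n) n t) * tp (Xm n u) * Uh))) <= 1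
  & norm (tp Uh * Uh - idm r) <= 1 / ((m n)^2 * s n)
  & norm (fm (F n u) * (tp (fm (Lam n)) * (idm (N n) - Uh * tp Uh))) <= 6 * K^6 * sqrt (m n * (2 * real (d n) + 1))
  & Li * fm (Lam n) = idm r & norm Li <= K^2 / p n & tp (fm (Lam n) * Li) = fm (Lam n) * Li & fm (Lam n) * Li * (fm (Lam n) * Li) = fm (Lam n) * Li
  & norm (tp Uh * ((idm (N n) - fm (Lam n) * Li) * (fm (E n u) * un t 0))) <= K * (sqrt (m n) / s n * real (N n) powr (1 / 6)))"

lemma mono_col: "mono_pred (ColSel d t)"
proof (rule mono_predI)
 fix K K' :: real and n u assume a: "0 < K" "K <= K'" "ColSel d t K n u"
 have "K^6 <= K'^6" using a by (intro power_mono) auto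
 then have "6 * K^6 * sqrt (m n * (2 * real (d n) + 1)) <= 6 * K'^6 * sqrt (m n * (2 * real (d n) + 1))" using pqms_nonneg by (intro mult_right_mono) auto
 moreover have "2 * K <= 2 * K'" using a by simp
 moreover have "K^2 / p n <= K'^2 / p n" using a pqms_nonneg by (intro divide_right_mono power_mono) auto
 moreover have "K * (sqrt (m n) / s n * real (N n) powr (1 / 6)) <= K' * (sqrt (m n) / s n * real (N n) powr (1 / 6))"
  using a pqms_nonneg by (intro mult_right_mono) auto
 ultimately show "ColSel d t K' n u" using a(3) unfolding ColSel_def by (meson order_trans)
qed

lemma T_col:
 assumes d: "(%n. real (d n)) : \<Theta>(%n. ln (real (N n)) powr \<nu>)"
  and mu: "tight M (%K n u. (\<Sum>j<N n. (real_cond_exp M (entries_sigma M ({j} \<times> nbhd_compl (T n) (d n) t) (E n)) (%u'. E n u' $$ (j, t)) u)^2)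
   <= K * real (N n) powr (1 / 3))"
 shows "tight M (ColSel d t)"
 unfolding tight_def
proof (intro allI impI)
 fix e :: real assume e: "e > 0"
 define Q where "Q = (%K n u. (Bs K n u & norm (Pq (d n) n t * fm (F n u)) <= K * sqrt (2 * real (d n) + 1))
   & (\<Sum>j<N n. (real_cond_exp M (entries_sigma M ({j} \<times> nbhd_compl (T n) (d n) t) (E n)) (%u'. E n u' $$ (j, t)) u)^2)
   <= K * real (N n) powr (1 / 3))"
 have m1: "mono_pred (%K n u. norm (Pq (d n) n t * fm (F n u)) <= K * sqrt (2 * real (d n) + 1))"
  by (rule mono_pred_le) simp
 have m2: "mono_pred (%K n u. (\<Sum>j<N n. (real_cond_exp M (entries_sigma M ({j} \<times> nbhd_compl (T n) (d n) t) (E n)) (%u'. E n u' $$ (j, t)) u)^2)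
   <= K * real (N n) powr (1 / 3))"
  by (rule mono_pred_le) (simp add: sum_nonneg)
 have Q: "tight M Q" "mono_pred Q" unfolding Q_def
  by (intro tight_conj Bs T_PF mu m1 m2 mono_pred_conj)+
 obtain K1 where K1: "K1 > 0" "EV n. EX A:sets M. prob A >= 1 - e / 4 & (ALL u:A. Q K1 n u)"
  using Q(1)[unfolded tight_def, rule_format, of "e / 4"] e by auto
 define h where "h = max K1 kk"
 \<comment> \<open>\<open>K3\<close> scales the threshold for the conditional moments so that the
   tail bound is at most e / 4; \<open>K\<close> then makes the failure of the selection at most e /
   4.\<close>
 define K3 where "K3 = max h (32 * C / e)"
 define K where "K = max h (sqrt (72 * K3 * h^8 / e))"
 have h: "K1 <= h" "kk <= h" "1 <= h" using kk by (auto simp: h_def)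
 have K3: "h <= K3" "1 <= K3" "32 * C / e <= K3" using h by (auto simp: K3_def)
 have K3b: "8 * C / K3^3 <= e / 4"
 proof -
  have "K3^1 <= K3^3" using K3 by (intro power_increasing) auto
  then have "32 * C / e <= K3^3" using K3 by simp
  then show ?thesis using e K3 by (simp add: field_simps)
 qed
 have K: "h <= K" "0 < K" using h by (auto simp: K_def)
 have "(sqrt (72 * K3 * h^8 / e))^2 <= K^2" unfolding K_def using K3 h e by (intro power_mono) auto
 then have "72 * K3 * h^8 / e <= K^2" using K3 h e by simp
 then have Kb: "18 * K3 * h^8 / K^2 <= e / 4" using e K by (simp add: field_simps)
 have c64: "0 < 64 * h^8" using h by simp
 have "EV n. EX A:sets M. prob A >= 1 - e & (ALL u:A. ColSel d t K n u)"
  using K1(2) ev_pc_noise[OF h(2)] ev_T[of "real (Suc t)"] ev_basic width(2)[OF d c64]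
 proof eventually_elim
  case (elim n)
  interpret P: pc_noise M "N n" "T n" "E n" "F n" "Lam n" C r h "p n" "m n" by (rule elim(2))
  obtain A where A: "A : sets M" "prob A >= 1 - e / 4" "!!u. u : A ==> Q h n u"
   using elim(1) Q(2) K1(1) h(1) unfolding mono_pred_def by meson
  have s: "0 < s n" "p n * sqrt (real (T n)) = s n" "q n = sqrt (real (T n))" using P.pos by (simp_all add: s_def q_def)
  have Pn: "P.Pn (d n) t = Pq (d n) n t" by (simp add: P.Pn_def Pq_def)
  have \<eta>: "0 < 1 / ((m n)^2 * s n)" using s(1) P.pos(5) by simp
  have t: "t < T n" using elim(3) by simp
  have N1: "1 <= real (N n)" using elim(4) by blast
  \<comment> \<open>The sum of squared conditional means and every conditional second moment have
    the same order N^(1/3), so one threshold serves both.\<close>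
  define \<tau> where "\<tau> = K3 * real (N n) powr (1 / 3)"
  define N6 where "N6 = real (N n) powr (1 / 6)"
  have N6: "0 < N6" "N6^2 = real (N n) powr (1 / 3)" using N1
   by (simp_all add: N6_def power2_eq_square powr_add[symmetric])
  have \<tau>: "0 < \<tau>" "\<tau>^3 = K3^3 * real (N n)" using K3 N1
   by (simp_all add: \<tau>_def power_mult_distrib powr_power)
  \<comment> \<open>Scaled like the root of the second moment bound: \<open>\<tau>\<close>
    contributes N^(1/6) and the residual norm \<open>sqrt m / s\<close>, so the failure probability
    is free of \<open>n\<close>.\<close>
  define K' where "K' = K * (sqrt (m n) / s n * N6)"
  have K': "0 < K'" using K N6 s P.pos by (simp add: K'_def)
  define Sel where "Sel = {u : space M. (\<Sum>j<N n. (P.mu (d n) t j u)^2) <= \<tau> & (ALL j<N n. P.vv (d n) t j u <= \<tau>)}"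
  define Bad where "Bad = {u : space M. EX j<N n. \<tau> < P.vv (d n) t j u}"
  have SelM: "Sel : sets M" using P.sel_event[of "d n" t \<tau>] P.Kc_facts(2) by (auto simp: Sel_def subalgebra_def)
  have BadM: "Bad : sets M"
  proof -
   have "Bad = (\<Union>j<N n. {u : space M. \<tau> < P.vv (d n) t j u})" by (auto simp: Bad_def)
   moreover have "{u : space M. \<tau> < P.vv (d n) t j u} : sets M" for j
   unfolding P.vv_def by measurable
   ultimately show ?thesis by auto
  qed
  have "prob Bad <= 8 * C * real (N n) / \<tau>^3" unfolding Bad_def by (rule P.vv_tail[OF t \<tau>(1)])
  also have "... = 8 * C / K3^3" using N1 by (simp add: \<tau>(2))
  finally have pBad: "prob Bad <= e / 4" using K3b by linarith
  \<comment> \<open>The bound for the conditional means is part of the event \<open>A\<close>; only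
    the conditional second moments can fail, and that is \<open>Bad\<close>.\<close>
  have "A <= (A \<inter> Sel) \<union> Bad"
  proof
   fix u assume w: "u : A"
   then have wM: "u : space M" using A(1) sets.sets_into_space by blast
   have "(\<Sum>j<N n. (P.mu (d n) t j u)^2) <= h * real (N n) powr (1 / 3)"
   using A(3)[OF w] unfolding Q_def P.mu_def P.Gs_def by blast
   also have "... <= \<tau>" unfolding \<tau>_def using K3 by (intro mult_right_mono) auto
   finally show "u : (A \<inter> Sel) \<union> Bad" using w wM unfolding Sel_def Bad_def by (auto simp: not_le)
  qed
  then have "prob A <= prob ((A \<inter> Sel) \<union> Bad)" using A SelM BadM by (intro finite_measure_mono) auto
  also have "... <= prob (A \<inter> Sel) + prob Bad" using A SelM BadM by (intro measure_Un_le) auto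
  finally have pAS: "prob (A \<inter> Sel) >= 1 - e / 2" using A(2) pBad by linarith
  have D1: "1 <= 2 * real (d n) + 1" by simp
  have pm: "p n <= sqrt (m n)" using elim(4) by linarith
  have small: "8 * h^4 * sqrt (m n * (2 * real (d n) + 1)) <= p n * sqrt (real (T n))"
  proof (rule power2_le_imp_le)
   have "(8 * h^4 * sqrt (m n * (2 * real (d n) + 1)))^2 = 64 * h^8 * (m n * (2 * real (d n) + 1))"
   using pqms_nonneg by (simp add: power_mult_distrib)
   then show "(8 * h^4 * sqrt (m n * (2 * real (d n) + 1)))^2 <= (p n * sqrt (real (T n)))^2" using elim(5) s(2) by simp
  qed (use s in simp)
  obtain Li where Li: "Li * fm (Lam n) = idm r" "norm Li <= h^2 / p n" "tp (fm (Lam n) * Li) = fm (Lam n) * Li"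
   "fm (Lam n) * Li * (fm (Lam n) * Li) = fm (Lam n) * Li" using P.L_inverse by blast
  obtain Cc where Cc: "Cc : sets M" "prob Cc >= prob (A \<inter> Sel) - 2 * \<tau> * (3 * h^4 * sqrt (m n) / s n)^2 / K'^2"
   and sel: "!!u. u : Cc ==> EX Uh. norm Uh < 2 * sqrt (real r) & Uh * idm r = Uh & idm (N n) * Uh = Uh
   & norm ((idm (N n) - Uh * tp Uh) * (tp ((idm (T n) - Pq (d n) n t) * tp (Xm n u)) * ((idm (T n) - Pq (d n) n t) * tp (Xm n u) * Uh))) < 1
   & norm (tp Uh * Uh - idm r) < 1 / ((m n)^2 * s n)
   & norm (fm (F n u) * (tp (fm (Lam n)) * (idm (N n) - Uh * tp Uh))) < 6 * h^6 * sqrt (m n * (2 * real (d n) + 1))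
   & norm (tp Uh * ((idm (N n) - fm (Lam n) * Li) * (fm (E n u) * un t 0))) <= K'"
   using P.col_select[OF t A(1) _ _ _ _ D1 pm small Li(1,3,4) less_imp_le[OF \<tau>(1)] \<eta> K', where \<delta> = "d n", folded Sel_def] A(3)
   unfolding Q_def Bs_def Pn s(2,3) by blast
  have "2 * \<tau> * (3 * h^4 * sqrt (m n) / s n)^2 / K'^2 = 18 * K3 * h^8 / K^2"
  proof -
   define g where "g = sqrt (m n) / s n"
   have g: "0 < g" using s P.pos by (simp add: g_def)
   have "(3 * h^4 * sqrt (m n) / s n)^2 = 9 * h^8 * g^2" by (simp add: g_def power_mult_distrib power_divide)
   moreover have "K'^2 = K^2 * (g^2 * real (N n) powr (1 / 3))" by (simp add: K'_def g_def power_mult_distrib N6(2) power_divide)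
   ultimately show ?thesis using g N1 K by (simp add: \<tau>_def)
  qed
  then have "prob Cc >= 1 - e" using Cc(2) pAS Kb e by linarith
  moreover have "ColSel d t K n u" if w: "u : Cc" for u
  proof -
   have "h^6 <= K^6" using K h by (intro power_mono) auto
   then have k6: "6 * h^6 * sqrt (m n * (2 * real (d n) + 1)) <= 6 * K^6 * sqrt (m n * (2 * real (d n) + 1))" using pqms_nonneg by (intro mult_right_mono) auto
   have k2: "2 * sqrt (real r) <= 2 * K" using kk h K by linarith
   have "h^2 / p n <= K^2 / p n" using K h pqms_nonneg by (intro divide_right_mono power_mono) auto
   then have nLi: "norm Li <= K^2 / p n" using Li(2) by linarith
   show ?thesis using sel[OF w] k6 k2 Li(1,3,4) nLi unfolding ColSel_def K'_def N6_def by (meson less_imp_le less_le_trans)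
  qed
  ultimately show ?case using Cc(1) by blast
 qed
 then show "EX K>0. EV n. EX A:sets M. prob A >= 1 - e & (ALL u:A. ColSel d t K n u)" using K(2) by blast
qed

end

section \<open>Estimation errors expressed by singular vectors\<close>

context pc_outcome
begin

lemma UV_dim: "U : carrier_mat N r" "V : carrier_mat T r"
 using PC dims unfolding is_top_svd_def is_svd_def first_cols_def by auto

lemma fv_loading: assumes "i < N"
 shows "fv (row (pc_loadings T r U d) i) = (1 / q) *\<^sub>R (dg r d * (tp (fm U) * un i 0))" "row (pc_loadings T r U d) i : carrier_vec r"
proof -
 have c: "pc_loadings T r U d : carrier_mat N r" using UV_dim unfolding pc_loadings_def by (auto simp: mat_diag_def)
 have "fm (pc_loadings T r U d) = (1 / q) *\<^sub>R (fm U * dg r d)"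
 proof -
  have "mat_diag r d : carrier_mat r r" by (simp add: mat_diag_def)
  from fm_mult[OF UV_dim(1) this] show ?thesis unfolding pc_loadings_def fm_smult by (simp add: fm_diag qT)
 qed
 then show "fv (row (pc_loadings T r U d) i) = (1 / q) *\<^sub>R (dg r d * (tp (fm U) * un i 0))"
  using fv_row[OF c assms] by (simp add: tp_simps mult.assoc)
 show "row (pc_loadings T r U d) i : carrier_vec r" using c by (intro carrier_vecI) simp
qed

lemma fv_factor: assumes "t < T"
 shows "fv (row (pc_factors T V) t) = q *\<^sub>R (tp (fm V) * un t 0)" "row (pc_factors T V) t : carrier_vec r"
proof -
 have c: "pc_factors T V : carrier_mat T r" using UV_dim unfolding pc_factors_def by auto
 show "fv (row (pc_factors T V) t) = q *\<^sub>R (tp (fm V) * un t 0)"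
  using fv_row[OF c assms] by (simp add: pc_factors_def fm_smult tp_simps qT)
 show "row (pc_factors T V) t : carrier_vec r" using c by (intro carrier_vecI) simp
qed

lemma loading_error: assumes "i < N" "the (mat_inverse H) : carrier_mat r r"
 shows "vec_l2_norm (row (pc_loadings T r U d) i - the (mat_inverse H) *\<^sub>v row L i)
  = norm ((1 / q) *\<^sub>R (dg r d * (tp (fm U) * un i 0)) - fm (the (mat_inverse H)) * (tp (fm L) * un i 0))"
proof -
 have r: "row L i : carrier_vec r" using dims by auto
 show ?thesis unfolding norm_fv[symmetric]
  by (subst fv_minus[of _ r]) (use fv_loading[OF assms(1)] fv_mult[OF assms(2) r] fv_row[OF dims(1) assms(1)] mult_mat_vec_carrier[OF assms(2) r] in auto)
qed

lemma factor_error: assumes "t < T" "H : carrier_mat r r"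
 shows "vec_l2_norm (row (pc_factors T V) t - H\<^sup>T *\<^sub>v row F t)
  = norm (q *\<^sub>R (tp (fm V) * un t 0) - tp (fm H) * (tp (fm F) * un t 0))"
proof -
 have r: "row F t : carrier_vec r" and h: "H\<^sup>T : carrier_mat r r" using dims assms by auto
 show ?thesis unfolding norm_fv[symmetric]
  by (subst fv_minus[of _ r]) (use fv_factor[OF assms(1)] fv_mult[OF h r] fv_row[OF dims(2) assms(1)] mult_mat_vec_carrier[OF h r] in "auto simp: fm_transpose")
qed

text \<open>\<open>H\<close> cancels in the product of loading and factor, so the truth is the inner
  product of the rotated targets; the error is linear in each estimation error, plus their
  product.\<close>

lemma common_error:
 assumes it: "i < N" "t < T" and H: "is_matching_matrix r T L F U d V H" and g: "norm (tp (fm L) * (fm E * fm F)) <= g"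
  and a: "vec_l2_norm (row (pc_loadings T r U d) i - the (mat_inverse H) *\<^sub>v row L i) <= a"
  and b: "vec_l2_norm (row (pc_factors T V) t - H\<^sup>T *\<^sub>v row F t) <= b"
  and lam: "norm (tp (fm L) * un i 0) <= x" and f: "norm (tp (fm F) * un t 0) <= y"
 shows "\<bar>row (pc_loadings T r U d) i \<bullet> row (pc_factors T V) t - (L * F\<^sup>T) $$ (i, t)\<bar> <= cc * x * b + a * (cc * y) + a * b"
proof -
 note mb = matching_bounds[OF H g]
 define G where "G = fm (the (mat_inverse H))"
 define l where "l = tp (fm L) * un i 0"
 define f where "f = tp (fm F) * un t 0"
 define A where "A = (1 / q) *\<^sub>R (dg r d * (tp (fm U) * un i 0)) - G * l"
 define B where "B = q *\<^sub>R (tp (fm V) * un t 0) - tp (fm H) * f"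
 have nA: "norm A <= a" using a loading_error[OF it(1) mb(2)] by (simp add: A_def G_def l_def)
 have nB: "norm B <= b" using b factor_error[OF it(2) mb(1)] by (simp add: B_def f_def)
 have HG: "fm H * G = idm r" unfolding G_def
  by (rule right_inverse_square[OF fm_idm(1)[OF mb(1)] fm_idm(2)[OF mb(1)] mb(3) fm_idm(1)[OF mb(2)] fm_idm(2)[OF mb(2)]])
 have lr: "idm r * f = f" unfolding f_def by (rule assoc_eq) (use fm_idm(1)[of "F\<^sup>T" r T] dims in "simp add: fm_transpose")
 have "row (pc_loadings T r U d) i \<bullet> row (pc_factors T V) t = inner (A + G * l) (B + tp (fm H) * f)"
  using inner_fv[OF fv_loading(2)[OF it(1)] fv_factor(2)[OF it(2)]]
  by (simp add: fv_loading(1)[OF it(1)] fv_factor(1)[OF it(2)] A_def B_def)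
 moreover have "(L * F\<^sup>T) $$ (i, t) = inner (G * l) (tp (fm H) * f)"
 proof -
  have "(L * F\<^sup>T) $$ (i, t) = row L i \<bullet> row F t" using it dims by simp
  also have "... = inner (fv (row L i)) (fv (row F t))" by (rule inner_fv[symmetric, of _ r]) (use dims in auto)
  also have "... = inner l f" by (simp add: fv_row[OF dims(1) it(1)] fv_row[OF dims(2) it(2)] l_def f_def)
  also have "... = inner (fm H * (G * l)) f"
   by (simp add: mult.assoc[symmetric] HG) (simp add: inner_mult_left lr)
  also have "... = inner (G * l) (tp (fm H) * f)" by (rule inner_mult_left)
  finally show ?thesis .
 qed
 ultimately have eq: "row (pc_loadings T r U d) i \<bullet> row (pc_factors T V) t - (L * F\<^sup>T) $$ (i, t)
  = inner (G * l) B + inner A (tp (fm H) * f) + inner A B"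
  by (simp add: inner_add_left inner_add_right)
 have a0: "0 <= a" "0 <= b" using nA nB norm_ge_zero order_trans by blast+
 have cc0: "0 <= cc" using mb(7) norm_ge_zero order_trans by blast
 have Gl: "norm (G * l) <= cc * x"
  by (rule order_trans[OF norm_mult_ineq mult_mono]) (use mb(6) lam cc0 in "auto simp: G_def l_def")
 have Hf: "norm (tp (fm H) * f) <= cc * y"
  by (rule order_trans[OF norm_mult_ineq mult_mono]) (use mb(7) f cc0 in "auto simp: f_def")
 have "\<bar>inner (G * l) B\<bar> <= cc * x * b"
  by (rule order_trans[OF Cauchy_Schwarz_ineq2 mult_mono]) (use Gl nB order_trans[OF norm_ge_zero Gl] in auto)
 moreover have "\<bar>inner A (tp (fm H) * f)\<bar> <= a * (cc * y)"
  by (rule order_trans[OF Cauchy_Schwarz_ineq2 mult_mono]) (use Hf nA a0 in auto)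
 moreover have "\<bar>inner A B\<bar> <= a * b"
  by (rule order_trans[OF Cauchy_Schwarz_ineq2 mult_mono]) (use nB nA a0 in auto)
 ultimately show ?thesis unfolding eq by linarith
qed

end

section \<open>Rates of the estimators\<close>

locale pc_estimator = pc_asymp M N T \<alpha> \<nu> r Lam F E C k0
 for M :: "'a measure" and N T :: "nat => nat" and \<alpha> \<nu> :: real and r :: nat and Lam :: "nat => real mat"
  and F E :: "nat => 'a => real mat" and C k0 :: real +
 fixes U V H :: "nat => 'a => real mat" and d :: "nat => 'a => nat => real"
 assumes PC: "!!n u. u : space M ==> r <= min (N n) (T n) ==> is_top_svd r (Lam n * (F n u)\<^sup>T + E n u) (U n u) (d n u) (V n u)"
  and H: "!!n u. u : space M ==>
   (EX H'. is_matching_matrix r (T n) (Lam n) (F n u) (U n u) (d n u) (V n u) H') ==>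
   is_matching_matrix r (T n) (Lam n) (F n u) (U n u) (d n u) (V n u) (H n u)"
begin

abbreviation "outcome k n u \<equiv> pc_outcome (N n) (T n) r (Lam n) (F n u) (E n u) (U n u) (V n u) (d n u) (p n) (q n) (m n) k"

text \<open>On the basic event the signal has rank \<open>r\<close>, so a matching matrix exists and
  the hypothesis on \<open>H\<close> becomes effective.\<close>

lemma ev_outcome: assumes "kk <= k"
 shows "EV n. ALL u:space M. Bs k n u --> outcome k n u
   & is_matching_matrix r (T n) (Lam n) (F n u) (U n u) (d n u) (V n u) (H n u)"
proof -
 have "0 < 2048 * k^16" using kk assms by simp
 from ev_small1[OF this] show ?thesis using ev_L[OF assms] ev_basic ev_N[of "real r"] ev_T[of "real r"]
 proof eventually_elim
  case (elim n)
  show ?case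
  proof (intro ballI impI)
   fix u assume w: "u : space M" and b: "Bs k n u"
   have "r <= min (N n) (T n)" using elim by simp
   then have o: "outcome k n u"
   unfolding pc_outcome_def
   using L_dim F_dim[OF w] E_dim[OF w] PC[OF w] r1 kk assms elim b
   by (auto simp: Bs_def q_def s_def power_mult_distrib)
   then show "outcome k n u & is_matching_matrix r (T n) (Lam n) (F n u) (U n u) (d n u) (V n u) (H n u)"
   using H[OF w] pc_outcome.matching_exists[OF o] by blast
  qed
 qed
qed

definition "G0 K n u \<longleftrightarrow> Bs K n u & norm (tp (fm (Lam n)) * (fm (E n u) * fm (F n u))) <= K * s n"

lemma G0: "tight M G0" "mono_pred G0"
proof -
 have m1: "mono_pred (%K n u. norm (tp (fm (Lam n)) * (fm (E n u) * fm (F n u))) <= K * s n)" by (rule mono_pred_le) simp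
 show "tight M G0" using tight_conj[OF Bs T_LEF m1] unfolding G0_def .
 show "mono_pred G0" using mono_pred_conj[OF Bs(2) m1] unfolding G0_def .
qed

definition "lerr i n u = vec_l2_norm (row (pc_loadings (T n) r (U n u) (d n u)) i - the (mat_inverse (H n u)) *\<^sub>v row (Lam n) i)"
definition "ferr t n u = vec_l2_norm (row (pc_factors (T n) (V n u)) t - (H n u)\<^sup>T *\<^sub>v row (F n u) t)"

lemma vec_l2_norm_nonneg: "0 <= vec_l2_norm v" by (simp flip: norm_fv)

lemma loading_rate:
 assumes lam: "EV n. norm (tp (fm (Lam n)) * un i 0) <= c * z n & 0 <= z n & z n <= 1" and c: "0 < c"
 shows "tight M (%K n u. lerr i n u <= K * (1 / q n + z n * (m n / (s n)^2)))"
proof -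
 have lc: "EV n. norm (tp (fm (Lam n)) * un i 0) <= c"
  using lam
 proof eventually_elim
  case (elim n)
  then have "c * z n <= c * 1" using c by (intro mult_left_mono) auto
  then show ?case using elim by linarith
 qed
 have m1: "mono_pred (%K n u. norm (tp (fm (E n u)) * un i 0) <= K * q n)" by (rule mono_pred_le) simp
 define Q where "Q = (%K n u. (G0 K n u & norm (tp (fm (E n u)) * un i 0) <= K * q n) & RowSel i K n u)"
 have Q: "tight M Q" "mono_pred Q" unfolding Q_def
  by (intro tight_conj G0 T_e m1 T_row[OF lc] mono_row mono_pred_conj)+
 show ?thesis
 proof (rule tight_imp[OF Q(1)])
  fix K0 :: real assume K0: "0 < K0"
  define k where "k = max K0 (max kk c)"
  have k: "K0 <= k" "kk <= k" "c <= k" "1 <= k" using kk by (auto simp: k_def)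
  define K' where "K' = pc_outcome.cc k * k^3 + pc_outcome.cc k * k^2 + 4 * k^2 * k + 128 * k^7 + 160 * k^12"
  have "EV n. ALL u:space M. Q K0 n u --> lerr i n u <= max 1 K' * (1 / q n + z n * (m n / (s n)^2))"
   using ev_outcome[OF k(2)] lam ev_N[of "real (Suc i)"] ev_m[of "96 * k^9"] ev_m[of 1]
  proof eventually_elim
   case (elim n)
   show ?case
   proof (intro ballI impI)
   fix u assume w: "u : space M" and "Q K0 n u"
   then have Qk: "Q k n u" using Q(2) K0 k(1) unfolding mono_pred_def by blast
   have oc: "outcome k n u" and Hm: "is_matching_matrix r (T n) (Lam n) (F n u) (U n u) (d n u) (V n u) (H n u)"
   using elim(1) w Qk unfolding Q_def G0_def by auto
   interpret P: pc_outcome "N n" "T n" r "Lam n" "F n u" "E n u" "U n u" "V n u" "d n u" "p n" "q n" "m n" k by (rule oc)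
   have sn: "p n * q n = s n" by (simp add: s_def)
   have i: "i < N n" using elim(3) by simp
   have g: "norm (tp (fm (Lam n)) * (fm (E n u) * fm (F n u))) <= k * (p n * q n)" using Qk by (simp add: Q_def G0_def sn)
   have ei: "norm (tp (fm (E n u)) * un i 0) <= k * q n" using Qk by (simp add: Q_def)
   have "c * z n <= k * z n" using k(3) elim(2) by (intro mult_right_mono) auto
   then have lam: "norm (tp (fm (Lam n)) * un i 0) <= k * z n" and z: "0 <= z n" "z n <= 1" using elim(2) by linarith+
   obtain Vh where Vh: "norm Vh <= 2 * k" "Vh * idm r = Vh" "idm (T n) * Vh = Vh"
   "norm ((idm (T n) - Vh * tp Vh) * (tp ((idm (N n) - un i i) * Xm n u) * ((idm (N n) - un i i) * Xm n u * Vh))) <= 1"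
   "norm (tp Vh * Vh - idm r) <= 1 / ((m n)^2 * s n)"
   "norm (fm (Lam n) * (tp (fm (F n u)) * (idm (T n) - Vh * tp Vh))) <= 6 * k^6 * sqrt (m n)"
   "norm (tp Vh * (tp (fm (E n u)) * un i 0)) <= k"
   using Qk unfolding Q_def RowSel_def by blast
   have on: "norm (tp Vh * Vh - idm r) <= 1 / (96 * k^9 * sqrt (m n) * (p n * q n))"
   proof (rule order_trans[OF Vh(5)])
   have "sqrt (m n) <= m n" using elim(5) by (intro real_le_lsqrt) (auto simp: power2_eq_square mult_le_cancel_left1)
   then have "96 * k^9 * sqrt (m n) <= m n * m n" using elim(4,5) k by (intro mult_mono) auto
   then have "96 * k^9 * sqrt (m n) * s n <= (m n)^2 * s n" using pqms_nonneg by (intro mult_right_mono) (auto simp: power2_eq_square)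
   then show "1 / ((m n)^2 * s n) <= 1 / (96 * k^9 * sqrt (m n) * (p n * q n))"
   unfolding sn using k P.pos sn by (intro divide_left_mono) auto
   qed
   have "norm ((1 / q n) *\<^sub>R (dg r (d n u) * (tp (fm (U n u)) * un i 0)) - fm (the (mat_inverse (H n u))) * (tp (fm (Lam n)) * un i 0))
   <= K' * (1 / q n + z n * (m n / (p n * q n)^2))"
   unfolding K'_def by (rule P.row_bound[OF Hm g i z refl lam refl ei Vh(1-3) refl Vh(4) on Vh(6) Vh(7)])
   then have "lerr i n u <= K' * (1 / q n + z n * (m n / (s n)^2))"
   unfolding lerr_def P.loading_error[OF i P.matching_bounds(2)[OF Hm g]] sn .
   also have "... <= max 1 K' * (1 / q n + z n * (m n / (s n)^2))"
   using z pqms_nonneg by (intro mult_right_mono add_nonneg_nonneg) auto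
   finally show "lerr i n u <= max 1 K' * (1 / q n + z n * (m n / (s n)^2))" .
   qed
  qed
  then show "EX K'>0. EV n. ALL u:space M. Q K0 n u --> lerr i n u <= K' * (1 / q n + z n * (m n / (s n)^2))"
   by (intro exI[of _ "max 1 K'"]) auto
 qed
qed

definition "N6 n = real (N n) powr (1 / 6)"
text \<open>Third rate of the factor error: \<open>s^3 * p\<close> equals N^(2 * \<alpha>) *
  T^(3/2), and \<open>m * sqrt m\<close> is the maximum of N and T to the power 3/2.\<close>

definition "Gr n = sqrt (real (N n)) * (m n * sqrt (m n)) * sqrt (Lg n) / ((s n)^3 * p n)"

lemma factor_rate:
 assumes dl: "(%n. real (\<delta> n)) : \<Theta>(%n. ln (real (N n)) powr \<nu>)"
  and mu: "tight M (%K n u. (\<Sum>j<N n. (real_cond_exp M (entries_sigma M ({j} \<times> nbhd_compl (T n) (\<delta> n) t) (E n)) (%u'. E n u' $$ (j, t)) u)^2)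
   <= K * real (N n) powr (1 / 3))"
 shows "tight M (%K n u. ferr t n u <= K * (1 / p n + m n * N6 n / (s n)^2 + Gr n))"
proof -
 define Dd where "Dd = (%n. 2 * real (\<delta> n) + 1)"
 have Dd: "2 * real (\<delta> n) + 1 = Dd n" for n by (simp add: Dd_def)
 note wd = width[OF dl, unfolded Dd]
 obtain cD where cD: "1 <= cD" "EV n. Dd n <= cD * Lg n" using wd(1) by blast
 define Q where "Q = (%K n u. (((((G0 K n u & norm (fm (E n u) * un t 0) <= K * sqrt (real (N n))) & norm (tp (fm (F n u)) * un t 0) <= K * 1)
   & norm (tp (fm (Lam n)) * (fm (E n u) * un t 0)) <= K * p n) & norm (Pq (\<delta> n) n t * fm (F n u)) <= K * sqrt (2 * real (\<delta> n) + 1))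
   & norm (Pq (\<delta> n) n t * (tp (fm (E n u)) * fm (Lam n))) <= K * (sqrt (2 * real (\<delta> n) + 1) * p n)) & ColSel \<delta> t K n u)"
 have Q: "tight M Q" "mono_pred Q" unfolding Q_def
  by (intro tight_conj G0 T_eps T_f T_Leps T_PF T_PEL T_col[OF dl mu] mono_col mono_pred_conj mono_pred_le norm_ge_zero)+
 show ?thesis
 proof (rule tight_imp[OF Q(1)])
  fix K0 :: real assume K0: "0 < K0"
  define k where "k = max K0 kk"
  have k: "K0 <= k" "kk <= k" "1 <= k" using kk by (auto simp: k_def)
  define K' where "K' = pc_outcome.cc k * k^3 + pc_outcome.cc k * k^2 + 8 * k^8 + 4 * k^4 * k + 128 * k^9 + 704 * k^21"
  have c2: "0 < 2048 * k^16" using k by simp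
  have "EV n. ALL u:space M. Q K0 n u --> ferr t n u <= (max 1 K' * sqrt cD) * (1 / p n + m n * N6 n / (s n)^2 + Gr n)"
   using ev_outcome[OF k(2)] cD(2) ev_T[of "real (Suc t)"] ev_m[of "96 * k^9"] ev_m[of 1] ev_basic wd(2)[OF c2] wd(3)
  proof eventually_elim
   case (elim n)
   show ?case
   proof (intro ballI impI)
   fix u assume w: "u : space M" and "Q K0 n u"
   then have Qk: "Q k n u" using Q(2) K0 k(1) unfolding mono_pred_def by blast
   have oc: "outcome k n u" and Hm: "is_matching_matrix r (T n) (Lam n) (F n u) (U n u) (d n u) (V n u) (H n u)"
   using elim(1) w Qk unfolding Q_def G0_def by auto
   interpret P: pc_outcome "N n" "T n" r "Lam n" "F n u" "E n u" "U n u" "V n u" "d n u" "p n" "q n" "m n" k by (rule oc)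
   have sn: "p n * q n = s n" by (simp add: s_def)
   have t: "t < T n" using elim(3) by simp
   have D1: "1 <= Dd n" by (simp add: Dd_def)
   have g: "norm (tp (fm (Lam n)) * (fm (E n u) * fm (F n u))) <= k * (p n * q n)" using Qk by (simp add: Q_def G0_def sn)
   have f: "norm (tp (fm (F n u)) * un t 0) <= k" and \<epsilon>: "norm (fm (E n u) * un t 0) <= k * sqrt (real (N n))"
   and L\<epsilon>: "norm (tp (fm (Lam n)) * (fm (E n u) * un t 0)) <= k * p n"
   and PF: "norm (Pq (\<delta> n) n t * fm (F n u)) <= k * sqrt (Dd n)"
   and PEL: "norm (Pq (\<delta> n) n t * (tp (fm (E n u)) * fm (Lam n))) <= k * sqrt (Dd n) * p n"
   using Qk by (simp_all add: Q_def Dd_def mult.assoc)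
   have Pc: "tp (Pq (\<delta> n) n t) = Pq (\<delta> n) n t" "Pq (\<delta> n) n t * Pq (\<delta> n) n t = Pq (\<delta> n) n t"
   "idm (T n) * Pq (\<delta> n) n t = Pq (\<delta> n) n t" "Pq (\<delta> n) n t * idm (T n) = Pq (\<delta> n) n t"
   by (auto simp: Pq_def dg_mult intro!: dg_cong)
   obtain Uh Li where Uh: "norm Uh <= 2 * k" "Uh * idm r = Uh" "idm (N n) * Uh = Uh"
   "norm ((idm (N n) - Uh * tp Uh) * (tp ((idm (T n) - Pq (\<delta> n) n t) * tp (Xm n u)) * ((idm (T n) - Pq (\<delta> n) n t) * tp (Xm n u) * Uh))) <= 1"
   "norm (tp Uh * Uh - idm r) <= 1 / ((m n)^2 * s n)"
   "norm (fm (F n u) * (tp (fm (Lam n)) * (idm (N n) - Uh * tp Uh))) <= 6 * k^6 * sqrt (m n * Dd n)"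
   and Li: "Li * fm (Lam n) = idm r" "norm Li <= k^2 / p n" "tp (fm (Lam n) * Li) = fm (Lam n) * Li" "fm (Lam n) * Li * (fm (Lam n) * Li) = fm (Lam n) * Li"
   and k2: "norm (tp Uh * ((idm (N n) - fm (Lam n) * Li) * (fm (E n u) * un t 0))) <= k * (sqrt (m n) / s n * N6 n)"
   using Qk unfolding Q_def ColSel_def N6_def Dd_def by blast
   have sm: "sqrt (m n) <= m n" using elim(5) by (intro real_le_lsqrt) (auto simp: power2_eq_square mult_le_cancel_left1)
   have qm: "q n <= sqrt (m n)" using elim(6) pqms_nonneg by (auto intro: real_le_rsqrt)
   have on: "norm (tp Uh * Uh - idm r) <= 1 / (96 * k^9 * sqrt (m n * Dd n) * (p n * q n))"
   proof (rule order_trans[OF Uh(5)])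
   have "Dd n <= m n" using elim(8) qm sm by linarith
   then have "m n * Dd n <= m n * m n" using pqms_nonneg by (intro mult_left_mono) auto
   then have "sqrt (m n * Dd n) <= m n" using pqms_nonneg by (intro real_le_lsqrt) (auto simp: power2_eq_square)
   then have "96 * k^9 * sqrt (m n * Dd n) <= m n * m n" using elim(4,5) k D1 by (intro mult_mono) auto
   then have "96 * k^9 * sqrt (m n * Dd n) * s n <= (m n)^2 * s n" using pqms_nonneg by (intro mult_right_mono) (auto simp: power2_eq_square)
   then show "1 / ((m n)^2 * s n) <= 1 / (96 * k^9 * sqrt (m n * Dd n) * (p n * q n))"
   unfolding sn using k P.pos sn D1 by (intro divide_left_mono) auto
   qed
   have "1 <= real (N n)" using elim(6) by blast
   then have N6: "1 <= N6 n" unfolding N6_def by (intro ge_one_powr_ge_zero) auto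
   have small: "2048 * k^16 * m n * Dd n <= (p n * q n)^2" using elim(7) by (simp add: sn mult.assoc)
   have pn: "p n <= sqrt (real (N n))" "sqrt (real (N n)) <= sqrt (m n)" "Dd n <= q n" "sqrt (Dd n) <= N6 n" using elim(6,8) by (auto simp: N6_def)
   have k2': "norm (tp Uh * ((idm (N n) - fm (Lam n) * Li) * (fm (E n u) * un t 0))) <= k * (sqrt (m n) / (p n * q n) * N6 n)" using k2 by (simp add: sn)
   have "norm (q n *\<^sub>R (tp (fm (V n u)) * un t 0) - tp (fm (H n u)) * (tp (fm (F n u)) * un t 0))
   <= K' * (1 / p n + m n * N6 n / (p n * q n)^2 + sqrt (real (N n)) * (m n * sqrt (m n)) * sqrt (Dd n) / ((p n * q n)^3 * p n))"
   unfolding K'_def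
   by (rule P.col_bound[OF Hm g refl f refl \<epsilon> pn(1,2) Pc D1 pn(3,4) N6 PF PEL L\<epsilon> small Uh(1-3) refl Uh(4) on Uh(6) Li k2'])
   then have 1: "ferr t n u <= K' * (1 / p n + m n * N6 n / (s n)^2 + sqrt (real (N n)) * (m n * sqrt (m n)) * sqrt (Dd n) / ((s n)^3 * p n))"
   unfolding ferr_def P.factor_error[OF t P.matching_bounds(1)[OF Hm g]] sn .
   have c1: "1 <= sqrt cD" using cD(1) by simp
   have sp: "0 < s n" "0 < p n" using P.pos sn by auto
   have n1: "0 <= 1 / p n + m n * N6 n / (s n)^2" using pqms_nonneg N6 by simp
   \<comment> \<open>The window width is traded for its logarithmic order only here; the
     proportionality constant \<open>cD\<close> enters under the root.\<close>
   have G1: "sqrt (real (N n)) * (m n * sqrt (m n)) * sqrt (Dd n) / ((s n)^3 * p n) <= sqrt cD * Gr n"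
   proof -
   have "sqrt (Dd n) <= sqrt cD * sqrt (Lg n)" using elim(2) by (simp add: real_sqrt_mult[symmetric])
   then have "sqrt (real (N n)) * (m n * sqrt (m n)) * sqrt (Dd n) <= sqrt (real (N n)) * (m n * sqrt (m n)) * (sqrt cD * sqrt (Lg n))"
   using pqms_nonneg by (intro mult_left_mono) auto
   then have "sqrt (real (N n)) * (m n * sqrt (m n)) * sqrt (Dd n) / ((s n)^3 * p n) <= sqrt (real (N n)) * (m n * sqrt (m n)) * (sqrt cD * sqrt (Lg n)) / ((s n)^3 * p n)"
   using sp by (intro divide_right_mono) auto
   then show ?thesis by (simp add: Gr_def mult_ac)
   qed
   have n2: "0 <= sqrt (real (N n)) * (m n * sqrt (m n)) * sqrt (Dd n) / ((s n)^3 * p n)" using sp pqms_nonneg D1 by simp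
   have "ferr t n u <= max 1 K' * (1 / p n + m n * N6 n / (s n)^2 + sqrt (real (N n)) * (m n * sqrt (m n)) * sqrt (Dd n) / ((s n)^3 * p n))"
   by (rule order_trans[OF 1 mult_right_mono]) (use n1 n2 in auto)
   also have "... <= max 1 K' * (sqrt cD * (1 / p n + m n * N6 n / (s n)^2) + sqrt cD * Gr n)"
   proof (rule mult_left_mono)
   show "1 / p n + m n * N6 n / (s n)^2 + sqrt (real (N n)) * (m n * sqrt (m n)) * sqrt (Dd n) / ((s n)^3 * p n)
   <= sqrt cD * (1 / p n + m n * N6 n / (s n)^2) + sqrt cD * Gr n"
   by (rule add_mono[OF mult_right_mono[OF c1 n1, unfolded mult_1] G1])
   qed simp
   finally show "ferr t n u <= (max 1 K' * sqrt cD) * (1 / p n + m n * N6 n / (s n)^2 + Gr n)"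
   by (simp only: distrib_left mult.assoc)
   qed
  qed
  then show "EX K'>0. EV n. ALL u:space M. Q K0 n u --> ferr t n u <= K' * (1 / p n + m n * N6 n / (s n)^2 + Gr n)"
   using cD(1) by (intro exI[of _ "max 1 K' * sqrt cD"]) auto
 qed
qed

lemma common_rate:
 assumes lam: "EV n. norm (tp (fm (Lam n)) * un i 0) <= c * z n & 0 <= z n & z n <= 1" and c: "0 < c"
  and fr: "tight M (%K n u. ferr t n u <= K * (1 / p n + m n * N6 n / (s n)^2 + Gr n))"
 shows "tight M (%K n u. \<bar>row (pc_loadings (T n) r (U n u) (d n u)) i \<bullet> row (pc_factors (T n) (V n u)) t - (Lam n * (F n u)\<^sup>T) $$ (i, t)\<bar>
   <= K * (1 / q n + z n * (1 / p n) + z n * (m n * N6 n / (s n)^2) + z n * Gr n + m n * N6 n / ((s n)^2 * q n) + Gr n / q n))"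
proof -
 define Q where "Q = (%K n u. ((G0 K n u & lerr i n u <= K * (1 / q n + z n * (m n / (s n)^2))) & ferr t n u <= K * (1 / p n + m n * N6 n / (s n)^2 + Gr n))
   & norm (tp (fm (F n u)) * un t 0) <= K * 1)"
 have Q: "tight M Q" "mono_pred Q" unfolding Q_def
  by (intro tight_conj G0 loading_rate[OF lam c] fr T_f mono_pred_conj mono_pred_le norm_ge_zero; simp add: lerr_def ferr_def vec_l2_norm_nonneg)+
 show ?thesis
 proof (rule tight_imp[OF Q(1)])
  fix K0 :: real assume K0: "0 < K0"
  define k where "k = max K0 kk"
  have k: "K0 <= k" "kk <= k" "1 <= k" using kk by (auto simp: k_def)
  define cc where "cc = pc_outcome.cc k"
  define K' where "K' = cc * c * k + k * (cc * k) + k * k"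
  define R where "R = (%n. 1 / q n + z n * (1 / p n) + z n * (m n * N6 n / (s n)^2) + z n * Gr n + m n * N6 n / ((s n)^2 * q n) + Gr n / q n)"
  have "EV n. ALL u:space M. Q K0 n u -->
   \<bar>row (pc_loadings (T n) r (U n u) (d n u)) i \<bullet> row (pc_factors (T n) (V n u)) t - (Lam n * (F n u)\<^sup>T) $$ (i, t)\<bar> <= max 1 K' * R n"
   using ev_outcome[OF k(2)] lam ev_N[of "real (Suc i)"] ev_T[of "real (Suc t)"] ev_basic ev_small1[of 1, simplified] ev_Lg[of 0]
  proof eventually_elim
   case (elim n)
   show ?case
   proof (intro ballI impI)
   fix u assume w: "u : space M" and "Q K0 n u"
   then have Qk: "Q k n u" using Q(2) K0 k(1) unfolding mono_pred_def by blast
   have oc: "outcome k n u" and Hm: "is_matching_matrix r (T n) (Lam n) (F n u) (U n u) (d n u) (V n u) (H n u)"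
   using elim(1) w Qk unfolding Q_def G0_def by auto
   interpret P: pc_outcome "N n" "T n" r "Lam n" "F n u" "E n u" "U n u" "V n u" "d n u" "p n" "q n" "m n" k by (rule oc)
   have sn: "p n * q n = s n" by (simp add: s_def)
   have g: "norm (tp (fm (Lam n)) * (fm (E n u) * fm (F n u))) <= k * (p n * q n)" using Qk by (simp add: Q_def G0_def sn)
   define a0 where "a0 = 1 / q n + z n * (m n / (s n)^2)"
   define b0 where "b0 = 1 / p n + m n * N6 n / (s n)^2 + Gr n"
   have cc0: "0 <= cc" using P.matching_bounds(7)[OF Hm g] norm_ge_zero order_trans unfolding cc_def by blast
   have "1 <= real (N n)" using elim(5) by blast
   then have N6: "1 <= N6 n" unfolding N6_def by (intro ge_one_powr_ge_zero) auto
   have sp: "0 < s n" "1 <= p n" "1 <= q n" "0 < m n" "0 <= z n" "z n <= 1" using P.pos sn P.p1 P.q1 elim(2) by auto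
   have Gr0: "0 <= Gr n" unfolding Gr_def using sp elim(7) by simp
   have ms: "m n / (s n)^2 <= 1" using elim(6) sp by (simp add: divide_le_eq_1)
   have x1: "0 <= m n / (s n)^2" "m n / (s n)^2 <= m n * N6 n / (s n)^2"
   proof -
   show "0 <= m n / (s n)^2" using sp by simp
   have "m n * 1 <= m n * N6 n" using N6 sp by (intro mult_left_mono) auto
   then show "m n / (s n)^2 <= m n * N6 n / (s n)^2" by (intro divide_right_mono) auto
   qed
   have b0: "0 <= b0" unfolding b0_def using sp Gr0 N6 by simp
   have a0: "0 <= a0" unfolding a0_def using sp x1 by simp
   have Req: "R n = 1 / q n + z n * b0 + m n * N6 n / ((s n)^2 * q n) + Gr n / q n"
   by (simp add: R_def b0_def distrib_left)
   have t0: "0 <= m n * N6 n / ((s n)^2 * q n)" "0 <= Gr n / q n" "0 <= 1 / q n" "0 <= z n * b0" using sp Gr0 N6 b0 by simp_all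
   have rb: "z n * b0 <= R n" unfolding Req using t0 by linarith
   \<comment> \<open>The second part of the loading rate is dominated by \<open>z n * b0\<close>,
     because \<open>m / s^2\<close> is already one of the terms below \<open>b0\<close>.\<close>
   have ra: "a0 <= R n"
   proof -
   have "m n / (s n)^2 <= b0" unfolding b0_def using x1 sp Gr0 by (simp add: add_increasing add_increasing2)
   then have "z n * (m n / (s n)^2) <= z n * b0" using sp by (intro mult_left_mono) auto
   then show ?thesis unfolding Req a0_def using t0 by linarith
   qed
   \<comment> \<open>The part 1 / q of the loading rate produces the terms divided by
     \<open>q\<close>; the other part is at most \<open>z n * b0\<close>, since
     \<open>m <= s^2\<close>.\<close>
   have rab: "a0 * b0 <= R n"
   proof -
   have "a0 * b0 = b0 * (1 / q n) + z n * b0 * (m n / (s n)^2)" by (simp only: a0_def distrib_right distrib_left mult_ac)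
   also have "... <= b0 * (1 / q n) + z n * b0 * 1" using ms t0 by (intro add_left_mono mult_left_mono) auto
   also have "b0 * (1 / q n) = 1 / p n * (1 / q n) + m n * N6 n / ((s n)^2 * q n) + Gr n / q n"
   by (simp add: b0_def add_divide_distrib)
   also have "1 / p n * (1 / q n) <= 1 * (1 / q n)" using sp by (intro mult_right_mono) auto
   finally show ?thesis unfolding Req by simp
   qed
   have la: "lerr i n u <= k * a0" and fb: "ferr t n u <= k * b0" and fy: "norm (tp (fm (F n u)) * un t 0) <= k"
   using Qk by (simp_all add: Q_def a0_def b0_def)
   have it: "i < N n" "t < T n" using elim(3,4) by auto
   have lx: "norm (tp (fm (Lam n)) * un i 0) <= c * z n" using elim(2) by blast
   have "\<bar>row (pc_loadings (T n) r (U n u) (d n u)) i \<bullet> row (pc_factors (T n) (V n u)) t - (Lam n * (F n u)\<^sup>T) $$ (i, t)\<bar>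
   <= cc * (c * z n) * (k * b0) + (k * a0) * (cc * k) + (k * a0) * (k * b0)"
   unfolding cc_def by (rule P.common_error[OF it Hm g la[unfolded lerr_def] fb[unfolded ferr_def] lx fy])
   also have "... = (cc * c * k) * (z n * b0) + (k * (cc * k)) * a0 + (k * k) * (a0 * b0)" by (simp add: mult_ac)
   also have "... <= (cc * c * k) * R n + (k * (cc * k)) * R n + (k * k) * R n"
   using cc0 c k rb ra rab by (intro add_mono mult_left_mono) auto
   also have "... = K' * R n" by (simp add: K'_def distrib_right)
   also have "... <= max 1 K' * R n" using ra a0 by (intro mult_right_mono) auto
   finally show "\<bar>row (pc_loadings (T n) r (U n u) (d n u)) i \<bullet> row (pc_factors (T n) (V n u)) t - (Lam n * (F n u)\<^sup>T) $$ (i, t)\<bar> <= max 1 K' * R n" .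
   qed
  qed
  then show "EX K'>0. EV n. ALL u:space M. Q K0 n u -->
   \<bar>row (pc_loadings (T n) r (U n u) (d n u)) i \<bullet> row (pc_factors (T n) (V n u)) t - (Lam n * (F n u)\<^sup>T) $$ (i, t)\<bar>
   <= K' * (1 / q n + z n * (1 / p n) + z n * (m n * N6 n / (s n)^2) + z n * Gr n + m n * N6 n / ((s n)^2 * q n) + Gr n / q n)"
   unfolding R_def by (intro exI[of _ "max 1 K'"]) auto
 qed
qed

end

section \<open>From the stated assumptions to the abstract setting\<close>

theorem theorem4p2:
  fixes M :: "'a measure"
    and N T :: "nat \<Rightarrow> nat"
    and r :: nat
    and \<Lambda> :: "nat \<Rightarrow> real mat"
    and F E X U V H :: "nat \<Rightarrow> 'a \<Rightarrow> real mat"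
    and d :: "nat \<Rightarrow> 'a \<Rightarrow> nat \<Rightarrow> real"
    and \<Sigma>F \<Sigma>\<Lambda> :: "real mat"
    and \<alpha> \<nu> :: real
    and a :: "nat \<Rightarrow> real"
  assumes prob: "prob_space M"
    and N_lim: "filterlim N at_top sequentially"
    and T_lim: "filterlim T at_top sequentially"
    and r_pos: "1 \<le> r"
    and Lambda_dim: "\<And>n. \<Lambda> n \<in> carrier_mat (N n) r"
    and F_dim: "\<And>n \<omega>. \<omega> \<in> space M \<Longrightarrow> F n \<omega> \<in> carrier_mat (T n) r"
    and E_dim: "\<And>n \<omega>. \<omega> \<in> space M \<Longrightarrow> E n \<omega> \<in> carrier_mat (N n) (T n)"
    and F_rv: "\<And>n t k. t < T n \<Longrightarrow> k < r \<Longrightarrow> (\<lambda>\<omega>. F n \<omega> $$ (t, k)) \<in> borel_measurable M"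
    and E_rv: "\<And>n i t. i < N n \<Longrightarrow> t < T n \<Longrightarrow> (\<lambda>\<omega>. E n \<omega> $$ (i, t)) \<in> borel_measurable M"
    and model: "\<And>n \<omega>. \<omega> \<in> space M \<Longrightarrow> X n \<omega> = \<Lambda> n * (F n \<omega>)\<^sup>T + E n \<omega>"
    and PC: "\<And>n \<omega>. \<omega> \<in> space M \<Longrightarrow> r \<le> min (N n) (T n) \<Longrightarrow>
               is_top_svd r (X n \<omega>) (U n \<omega>) (d n \<omega>) (V n \<omega>)"
    and H: "\<And>n \<omega>. \<omega> \<in> space M \<Longrightarrow>
              (\<exists>H'. is_matching_matrix r (T n) (\<Lambda> n) (F n \<omega>) (U n \<omega>) (d n \<omega>) (V n \<omega>) H') \<Longrightarrow>
              is_matching_matrix r (T n) (\<Lambda> n) (F n \<omega>) (U n \<omega>) (d n \<omega>) (V n \<omega>) (H n \<omega>)"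
    \<comment> \<open>(A)\<close>
    and A_i: "pos_def_mat r \<Sigma>F"
      "mat_tendsto_in_prob M (\<lambda>n \<omega>. (1 / real (T n)) \<cdot>\<^sub>m ((F n \<omega>)\<^sup>T * F n \<omega>)) \<Sigma>F"
    and A_ii: "0 < \<alpha>" "\<alpha> \<le> 1" "pos_def_mat r \<Sigma>\<Lambda>"
      "(\<lambda>n. spectral_norm ((real (N n) powr (- \<alpha>)) \<cdot>\<^sub>m ((\<Lambda> n)\<^sup>T * \<Lambda> n) - \<Sigma>\<Lambda>)) \<longlonglongrightarrow> 0"
    and A_iii: "card (spectrum (\<Sigma>\<Lambda> * \<Sigma>F)) = r"
    and A_iv: "\<exists>C>0. \<forall>n. \<forall>t<T n.
                 integrable M (\<lambda>\<omega>. (vec_l2_norm (row (F n \<omega>) t))\<^sup>2) \<and>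
                 (\<integral>\<omega>. (vec_l2_norm (row (F n \<omega>) t))\<^sup>2 \<partial>M) \<le> C"
      "\<forall>i. a i \<le> 1"
      "\<exists>C'>0. \<forall>n. \<forall>i<N n. vec_l2_norm (row (\<Lambda> n) i) \<le> C' * real (N n) powr ((a i - 1) / 2)"
    \<comment> \<open>(B'(i))\<close>
    and B_i: "\<And>n i t. i < N n \<Longrightarrow> t < T n \<Longrightarrow> (\<integral>\<omega>. E n \<omega> $$ (i, t) \<partial>M) = 0"
      "\<exists>C>0. \<forall>n. \<forall>i<N n. \<forall>t<T n.
         integrable M (\<lambda>\<omega>. (E n \<omega> $$ (i, t)) ^ 6) \<and> (\<integral>\<omega>. (E n \<omega> $$ (i, t)) ^ 6 \<partial>M) \<le> C"
      "\<And>n. prob_space.indep_var M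
         (PiM ({..<N n} \<times> {..<T n}) (\<lambda>_. borel)) (entries ({..<N n} \<times> {..<T n}) (E n))
         (PiM ({..<N n} \<times> {..<T n}) (\<lambda>_. borel))
         (entries ({..<N n} \<times> {..<T n}) (\<lambda>\<omega>. \<Lambda> n * (F n \<omega>)\<^sup>T))"
      "\<And>n. prob_space.indep_vars M (\<lambda>i. PiM ({i} \<times> {..<T n}) (\<lambda>_. borel))
         (\<lambda>i. entries ({i} \<times> {..<T n}) (E n)) {..<N n}"
    \<comment> \<open>(B'(ii))\<close>
    and B_ii: "\<exists>C>0. (\<lambda>n. measure M {\<omega> \<in> space M.
                 spectral_norm (E n \<omega>) \<le> C * max (sqrt (real (N n))) (sqrt (real (T n)))}) \<longlonglongrightarrow> 1"
    \<comment> \<open>(B'(iii))\<close>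
    and B_iii: "\<exists>C>0. \<forall>n. \<forall>i<N n. \<forall>t<T n.
       (\<Sum>s<T n. \<bar>covariance M (\<lambda>\<omega>. E n \<omega> $$ (i, t)) (\<lambda>\<omega>. E n \<omega> $$ (i, s))\<bar>) \<le> C \<and>
       (\<forall>k<T n. (\<Sum>s<T n. \<bar>covariance M (\<lambda>\<omega>. E n \<omega> $$ (i, t) * E n \<omega> $$ (i, k))
                                       (\<lambda>\<omega>. E n \<omega> $$ (i, s) * E n \<omega> $$ (i, k))\<bar>) \<le> C)"
    and nu_pos: "0 < \<nu>"
    and growth: "(\<lambda>n. real (max (N n) (T n)) * ln (real (N n)) powr (2 * \<nu>))
                   \<in> o(\<lambda>n. real (N n) powr \<alpha> * real (T n))"
  shows
    \<comment> \<open>(i)\<close>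
    "(\<forall>i. bounded_in_prob M
        (\<lambda>n \<omega>. vec_l2_norm (row (pc_loadings (T n) r (U n \<omega>) (d n \<omega>)) i
                            - the (mat_inverse (H n \<omega>)) *\<^sub>v row (\<Lambda> n) i))
        (\<lambda>n. 1 / sqrt (T n)
           + sqrt (N n powr a i / N n) * (max (N n) (T n) / (N n powr \<alpha> * T n)))) \<and>
     \<comment> \<open>(ii), under (B'(iv))\<close>
     ((\<exists>\<delta> :: nat \<Rightarrow> nat.
         filterlim \<delta> at_top sequentially \<and>
         (\<lambda>n. real (\<delta> n)) \<in> \<Theta>(\<lambda>n. ln (real (N n)) powr \<nu>) \<and>
         (\<forall>t. bounded_in_prob M
            (\<lambda>n \<omega>. \<Sum>j<N n.
               (real_cond_exp M (entries_sigma M ({j} \<times> nbhd_compl (T n) (\<delta> n) t) (E n))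
                  (\<lambda>\<omega>'. E n \<omega>' $$ (j, t)) \<omega>
                - (\<integral>\<omega>'. E n \<omega>' $$ (j, t) \<partial>M))\<^sup>2)
            (\<lambda>n. N n powr (1 / 3)))) \<longrightarrow>
      (\<forall>t. bounded_in_prob M
         (\<lambda>n \<omega>. vec_l2_norm (row (pc_factors (T n) (V n \<omega>)) t
                             - (H n \<omega>)\<^sup>T *\<^sub>v row (F n \<omega>) t))
         (\<lambda>n. 1 / sqrt (N n powr \<alpha>)
            + max (N n) (T n) * N n powr (1 / 6) / (N n powr \<alpha> * T n)
            + sqrt (N n) * max (N n powr (3 / 2)) (T n powr (3 / 2)) * ln (N n) powr (\<nu> / 2)
                / (N n powr (2 * \<alpha>) * T n powr (3 / 2)))) \<and>
      (\<forall>i t. bounded_in_prob M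
         (\<lambda>n \<omega>. row (pc_loadings (T n) r (U n \<omega>) (d n \<omega>)) i
                   \<bullet> row (pc_factors (T n) (V n \<omega>)) t
                 - (\<Lambda> n * (F n \<omega>)\<^sup>T) $$ (i, t))
         (\<lambda>n. 1 / sqrt (T n)
            + sqrt (N n powr a i / N n) * (1 / sqrt (N n powr \<alpha>))
            + sqrt (N n powr a i / N n) * (max (N n) (T n) * N n powr (1 / 6) / (N n powr \<alpha> * T n))
            + sqrt (N n powr a i) * max (N n powr (3 / 2)) (T n powr (3 / 2)) * ln (N n) powr (\<nu> / 2)
                / (N n powr (2 * \<alpha>) * T n powr (3 / 2))
            + max (N n) (T n) * N n powr (1 / 6) / (N n powr \<alpha> * T n powr (3 / 2))
            + sqrt (N n) * max (N n powr (3 / 2)) (T n powr (3 / 2)) * ln (N n) powr (\<nu> / 2)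
                / (N n powr (2 * \<alpha>) * (T n)\<^sup>2))))"
proof -
 interpret prob_space M by (rule prob)
 interpret rates N T \<alpha> \<nu> by (rule rates.intro[OF N_lim T_lim A_ii(1,2) nu_pos growth])
 obtain CF where CF: "0 < CF" "!!n t. t < T n ==> integrable M (%\<omega>. (vec_l2_norm (row (F n \<omega>) t))^2)"
   "!!n t. t < T n ==> (\<integral>\<omega>. (vec_l2_norm (row (F n \<omega>) t))^2 \<partial>M) <= CF" using A_iv(1) by blast
 obtain C6 where C6: "0 < C6" "!!n i t. i < N n ==> t < T n ==> integrable M (%\<omega>. (E n \<omega> $$ (i, t)) ^ 6)"
   "!!n i t. i < N n ==> t < T n ==> (\<integral>\<omega>. (E n \<omega> $$ (i, t)) ^ 6 \<partial>M) <= C6" using B_i(2) by blast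
 obtain Cv where Cv: "0 < Cv" "!!n i t. i < N n ==> t < T n ==>
   (\<Sum>s<T n. \<bar>covariance M (%\<omega>. E n \<omega> $$ (i, t)) (%\<omega>. E n \<omega> $$ (i, s))\<bar>) <= Cv" using B_iii by blast
 obtain CE where CE: "0 < CE" "(%n. prob {\<omega> : space M. spectral_norm (E n \<omega>) <= CE * max (sqrt (real (N n))) (sqrt (real (T n)))}) \<longlonglongrightarrow> 1"
  using B_ii by blast
 define C where "C = 1 + CF + C6 + Cv"
 have C: "1 <= C" "CF <= C" "C6 <= C" "Cv <= C" using CF(1) C6(1) Cv(1) by (simp_all add: C_def)
 have M0_rv: "(%\<omega>. (\<Lambda> n * (F n \<omega>)\<^sup>T) $$ (i, t)) : borel_measurable M" if "i < N n" "t < T n" for n i t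
 proof -
  have "(\<Lambda> n * (F n \<omega>)\<^sup>T) $$ (i, t) = (\<Sum>k<r. \<Lambda> n $$ (i, k) * F n \<omega> $$ (t, k))" if w: "\<omega> : space M" for \<omega>
   using \<open>i < N n\<close> \<open>t < T n\<close> Lambda_dim[of n] F_dim[OF w, of n] by (auto simp: scalar_prod_def lessThan_atLeast0)
  moreover have "(%\<omega>. \<Sum>k<r. \<Lambda> n $$ (i, k) * F n \<omega> $$ (t, k)) : borel_measurable M"
   using F_rv that by (intro borel_measurable_sum borel_measurable_times borel_measurable_const) auto
  ultimately show ?thesis by (simp cong: measurable_cong)
 qed
 have fn: "factor_noise M (N n) (T n) (E n) (%\<omega>. \<Lambda> n * (F n \<omega>)\<^sup>T) C" for n
 proof (intro factor_noise.intro prob factor_noise_axioms.intro)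
  show "(\<integral>\<omega>. (E n \<omega> $$ (i, t)) ^ 6 \<partial>M) <= C" if "i < N n" "t < T n" for i t using C6(3)[OF that] C(3) by linarith
  show "(\<Sum>s<T n. \<bar>covariance M (%\<omega>. E n \<omega> $$ (i, t)) (%\<omega>. E n \<omega> $$ (i, s))\<bar>) <= C" if "i < N n" "t < T n" for i t
   using Cv(2)[OF that] C(4) by linarith
 qed (use E_rv M0_rv B_i(1,3,4) C6(2) C(1) in auto)
 obtain kF where kF: "1 <= kF" "!!A x. 0 < x ==> A * idm r = A ==> opb ((1 / x^2) *\<^sub>R (tp A * A) - fm \<Sigma>F) (1 / kF)
   ==> (ALL W. x / kF * norm (idm r * W) <= norm (A * W)) & opb A (kF * x)"
  using gram_bounds[OF A_i(1) r_pos] by blast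
 obtain kL where kL: "1 <= kL" "!!A x. 0 < x ==> A * idm r = A ==> opb ((1 / x^2) *\<^sub>R (tp A * A) - fm \<Sigma>\<Lambda>) (1 / kL)
   ==> (ALL W. x / kL * norm (idm r * W) <= norm (A * W)) & opb A (kL * x)"
  using gram_bounds[OF A_ii(3) r_pos] by blast
 have gram: "fm (c \<cdot>\<^sub>m (A\<^sup>T * A) - S) = c *\<^sub>R (tp (fm A) * fm A) - fm S" "c \<cdot>\<^sub>m (A\<^sup>T * A) - S : carrier_mat r r"
  if "A : carrier_mat k r" "S : carrier_mat r r" for A S k c
 proof -
  have At: "A\<^sup>T : carrier_mat r k" using that by simp
  have P: "c \<cdot>\<^sub>m (A\<^sup>T * A) : carrier_mat r r" using mult_carrier_mat[OF At that(1)] by simp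
  show "fm (c \<cdot>\<^sub>m (A\<^sup>T * A) - S) = c *\<^sub>R (tp (fm A) * fm A) - fm S"
   by (simp add: fm_minus[OF P that(2)] fm_smult fm_mult[OF At that(1)] fm_transpose)
  show "c \<cdot>\<^sub>m (A\<^sup>T * A) - S : carrier_mat r r" by (rule minus_carrier_mat[OF that(2)])
 qed
 have SF: "\<Sigma>F : carrier_mat r r" and SL: "\<Sigma>\<Lambda> : carrier_mat r r" using A_i(1) A_ii(3) by (auto simp: pos_def_mat_def)
 have L_b: "EV n. (ALL W. p n / kL * norm (idm r * W) <= norm (fm (\<Lambda> n) * W)) & opb (fm (\<Lambda> n)) (kL * p n)"
 proof -
  have "0 < 1 / kL" using kL(1) by simp
  then have "EV n. spectral_norm ((real (N n) powr (- \<alpha>)) \<cdot>\<^sub>m ((\<Lambda> n)\<^sup>T * \<Lambda> n) - \<Sigma>\<Lambda>) < 1 / kL"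
   using order_tendstoD(2)[OF A_ii(4)] by blast
  then show ?thesis using ev_basic
  proof eventually_elim
   case (elim n)
   have "spectral_norm ((real (N n) powr (- \<alpha>)) \<cdot>\<^sub>m ((\<Lambda> n)\<^sup>T * \<Lambda> n) - \<Sigma>\<Lambda>) <= 1 / kL" using elim(1) by simp
   then have "opb ((real (N n) powr (- \<alpha>)) *\<^sub>R (tp (fm (\<Lambda> n)) * fm (\<Lambda> n)) - fm \<Sigma>\<Lambda>) (1 / kL)"
   unfolding spectral_norm_opb(2)[OF gram(2)[OF Lambda_dim SL]] gram(1)[OF Lambda_dim SL] .
   moreover have "real (N n) powr (- \<alpha>) = 1 / (p n)^2" by (simp add: p_def powr_minus_divide)
   ultimately show ?case using kL(2)[OF _ fm_idm(2)[OF Lambda_dim], of "p n" n] elim(2) by simp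
  qed
 qed
 have F_b: "tight M (%K n \<omega>. (ALL W. q n / K * norm (idm r * W) <= norm (fm (F n \<omega>) * W)) & opb (fm (F n \<omega>)) (K * q n))"
 proof -
  define S where "S = (%n \<omega>. (1 / real (T n)) \<cdot>\<^sub>m ((F n \<omega>)\<^sup>T * F n \<omega>) - \<Sigma>F)"
  \<comment> \<open>Stated with \<open>opb\<close>, whose measurability is available; its complement
    is the event in the convergence assumption.\<close>
  define B where "B = (%n. {\<omega> : space M. opb (fm (S n \<omega>)) (1 / kF)})"
  have Seq: "fm (S n \<omega>) = (1 / real (T n)) *\<^sub>R (tp (fm (F n \<omega>)) * fm (F n \<omega>)) - fm \<Sigma>F"
   "spectral_norm (S n \<omega>) <= c \<longleftrightarrow> opb (fm (S n \<omega>)) c" if "\<omega> : space M" for n \<omega> c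
   using gram[OF F_dim[OF that] SF] spectral_norm_opb(2) unfolding S_def by blast+
  have B_M: "B n : sets M" for n
  proof -
   have f: "(%\<omega>. fm (F n \<omega>)) : borel_measurable M" by (rule borel_measurable_fm[OF F_dim F_rv])
   have "(%\<omega>. (1 / real (T n)) *\<^sub>R (tp (fm (F n \<omega>)) * fm (F n \<omega>)) - fm \<Sigma>F) : borel_measurable M"
   by (intro borel_measurable_diff borel_measurable_scaleR borel_measurable_times borel_measurable_const f measurable_compose[OF f borel_measurable_tp])
   then have "(%\<omega>. fm (S n \<omega>)) : borel_measurable M" by (simp add: Seq(1) cong: measurable_cong)
   then show ?thesis unfolding B_def by (rule pred_opb_measurable)
  qed
  have "prob (B n) = 1 - prob {\<omega> : space M. spectral_norm (S n \<omega>) > 1 / kF}" for n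
  proof -
   have "{\<omega> : space M. spectral_norm (S n \<omega>) > 1 / kF} = space M - B n"
   by (auto simp: B_def Seq(2)[symmetric] not_le)
   then show ?thesis using prob_compl[OF B_M[of n]] by simp
  qed
  moreover have "(%n. 1 - prob {\<omega> : space M. spectral_norm (S n \<omega>) > 1 / kF}) \<longlonglongrightarrow> 1 - 0"
  proof (rule tendsto_diff[OF tendsto_const])
   have "0 < 1 / kF" using kF(1) by simp
   then show "(%n. prob {\<omega> : space M. spectral_norm (S n \<omega>) > 1 / kF}) \<longlonglongrightarrow> 0"
   using A_i(2) unfolding mat_tendsto_in_prob_def S_def by blast
  qed
  ultimately have "(%n. prob (B n)) \<longlonglongrightarrow> 1" by simp
  then have "tight M (%K n \<omega>. \<omega> : B n)" by (rule tight_prob_1)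
  then show ?thesis
  proof (rule tight_imp, intro exI[of _ kF] conjI)
   show "0 < kF" using kF(1) by simp
   show "EV n. ALL \<omega>:space M. \<omega> : B n -->
   (ALL W. q n / kF * norm (idm r * W) <= norm (fm (F n \<omega>) * W)) & opb (fm (F n \<omega>)) (kF * q n)"
   using ev_basic
   proof eventually_elim
   case (elim n)
   show ?case
   proof (intro ballI impI)
   fix \<omega> assume w: "\<omega> : space M" "\<omega> : B n"
   have "1 / real (T n) = 1 / (q n)^2" by (simp add: q_def)
   then have "opb ((1 / (q n)^2) *\<^sub>R (tp (fm (F n \<omega>)) * fm (F n \<omega>)) - fm \<Sigma>F) (1 / kF)"
   using w Seq(1)[OF w(1), of n] by (simp add: B_def)
   then show "(ALL W. q n / kF * norm (idm r * W) <= norm (fm (F n \<omega>) * W)) & opb (fm (F n \<omega>)) (kF * q n)"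
   using elim by (intro kF(2) fm_idm(2)[OF F_dim[OF w(1)]]) auto
   qed
   qed
  qed
 qed
 have E_b: "tight M (%K n \<omega>. opb (fm (E n \<omega>)) (K * sqrt (m n)))"
 proof -
  have mx: "max (sqrt (real (N n))) (sqrt (real (T n))) = sqrt (m n)" for n
   by (cases "N n <= T n") (auto simp: m_def max_def)
  have "tight M (%K n \<omega>. opb (fm (E n \<omega>)) (CE * sqrt (m n)))"
   by (rule tight_prob_1[OF CE(2)]) (use spectral_norm_opb(2)[OF E_dim] in "auto simp: mx")
  then show ?thesis by (rule tight_imp) (use CE(1) in auto)
 qed
 interpret pc_estimator M N T \<alpha> \<nu> r \<Lambda> F E C kL U V H d
 proof (intro pc_estimator.intro pc_asymp.intro pc_asymp_axioms.intro pc_estimator_axioms.intro prob_space_axioms rates_axioms)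
  show "is_top_svd r (\<Lambda> n * (F n \<omega>)\<^sup>T + E n \<omega>) (U n \<omega>) (d n \<omega>) (V n \<omega>)" if "\<omega> : space M" "r <= min (N n) (T n)" for n \<omega>
   using PC[OF that] model[OF that(1)] by simp
  show "(\<integral>\<omega>. (vec_l2_norm (row (F n \<omega>) t))^2 \<partial>M) <= C" if "t < T n" for n t using CF(3)[OF that] C(2) by linarith
 qed (use r_pos Lambda_dim F_dim E_dim F_rv fn CF(2) kL(1) L_b F_b E_b H in auto)
 \<comment> \<open>The order N^((a i - 1) / 2) of loading \<open>i\<close>, in the form in which it
   occurs in the rates.\<close>
 define \<rho> where "\<rho> = (%i n. sqrt (real (N n) powr a i / real (N n)))"
 obtain Cl where Cl: "0 < Cl" "!!n i. i < N n ==> vec_l2_norm (row (\<Lambda> n) i) <= Cl * real (N n) powr ((a i - 1) / 2)"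
  using A_iv(3) by blast
 have lam: "EV n. norm (tp (fm (\<Lambda> n)) * un i 0) <= Cl * \<rho> i n & 0 <= \<rho> i n & \<rho> i n <= 1" for i
  using ev_N[of "real (Suc i)"]
 proof eventually_elim
  case (elim n)
  then have i: "i < N n" and N1: "1 <= real (N n)" by auto
  have "real (N n) powr a i / real (N n) = real (N n) powr (a i - 1)" using N1 by (simp add: powr_diff)
  then have eq: "\<rho> i n = real (N n) powr ((a i - 1) / 2)"
   unfolding \<rho>_def by (simp add: powr_half_sqrt[symmetric] powr_powr)
  have "real (N n) powr ((a i - 1) / 2) <= real (N n) powr 0" using N1 A_iv(2) by (intro powr_mono) auto
  then show ?case using Cl(2)[OF i] N1 by (simp add: eq fv_row[OF Lambda_dim i, symmetric] norm_fv)
 qed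
 \<comment> \<open>The identities that follow rewrite the rates of the statement in
   \<open>p\<close>, \<open>q\<close>, \<open>m\<close> and \<open>s\<close>.\<close>
 have e1: "real (N n) powr \<alpha> * real (T n) = (s n)^2" for n by (simp add: s_sq)
 have e0: "sqrt (real (T n)) = q n" "sqrt (real (N n) powr \<alpha>) = p n" for n by (simp_all add: q_def p_def)
 have p32: "x powr (3 / 2) = x * sqrt x" if "0 <= x" for x :: real
  using powr_add[of x 1 "1 / 2"] that by (simp add: powr_half_sqrt)
 have e2: "max (real (N n) powr (3 / 2)) (real (T n) powr (3 / 2)) = m n * sqrt (m n)" for n
 proof -
  have "max (real (N n) powr (3 / 2)) (real (T n) powr (3 / 2)) = m n powr (3 / 2)"
   by (cases "N n <= T n") (auto simp: m_def max_def intro!: antisym powr_mono2)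
  then show ?thesis using p32[OF pqms_nonneg(3)] by simp
 qed
 have p4: "real (N n) powr (2 * \<alpha>) = (p n)^4" for n
  using powr_add[of "real (N n)" \<alpha> \<alpha>] by (simp add: p_def power4_eq_xxxx)
 have q3: "real (T n) powr (3 / 2) = (q n)^3" "(real (T n))^2 = (q n)^4" "real (T n) = (q n)^2" for n
  using p32[of "real (T n)"] by (simp_all add: q_def power3_eq_cube power4_eq_xxxx power2_eq_square)
 have e3: "real (N n) powr (2 * \<alpha>) * real (T n) powr (3 / 2) = (s n)^3 * p n" for n
  unfolding p4 q3(1) s_def by (simp add: power_mult_distrib eval_nat_numeral mult_ac)
 have e4: "real (N n) powr (2 * \<alpha>) * (real (T n))^2 = (s n)^3 * p n * q n" for n
  unfolding p4 q3(2) s_def by (simp add: power_mult_distrib eval_nat_numeral mult_ac)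
 \<comment> \<open>The square of \<open>T n\<close> may stand inside or outside the coercion to the
   reals; both forms are rewritten.\<close>
 have e4': "real (N n) powr (2 * \<alpha>) * real ((T n)^2) = (s n)^3 * p n * q n" for n
  using e4 by simp
 have e5: "real (N n) powr \<alpha> * real (T n) powr (3 / 2) = (s n)^2 * q n" for n
 proof -
  have "real (N n) powr \<alpha> = (p n)^2" by (simp add: p_def)
  then show ?thesis by (simp add: q3(1) s_def power_mult_distrib eval_nat_numeral mult_ac)
 qed
 have e6: "ln (real (N n)) powr (\<nu> / 2) = sqrt (Lg n)" for n
  by (simp add: Lg_def powr_half_sqrt[symmetric] powr_powr)
 have e7: "sqrt (real (N n) powr a i) = \<rho> i n * sqrt (real (N n))" for i n
  unfolding \<rho>_def by (cases "N n = 0") (simp_all add: real_sqrt_divide)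
 have e9: "sqrt (real (N n) powr a i / real (N n)) = \<rho> i n" for i n by (simp add: \<rho>_def)
 have e8: "real (max (N n) (T n)) = m n" for n by (simp add: m_def)
 have FR: "tight M (%K n \<omega>. ferr t n \<omega> <= K * (1 / p n + m n * N6 n / (s n)^2 + Gr n))"
  if ex: "EX \<delta> :: nat => nat.
   filterlim \<delta> at_top sequentially &
   (%n. real (\<delta> n)) : \<Theta>(%n. ln (real (N n)) powr \<nu>) &
   (ALL t. bounded_in_prob M
   (%n \<omega>. \<Sum>j<N n.
   (real_cond_exp M (entries_sigma M ({j} \<times> nbhd_compl (T n) (\<delta> n) t) (E n))
   (%\<omega>'. E n \<omega>' $$ (j, t)) \<omega>
   - (\<integral>\<omega>'. E n \<omega>' $$ (j, t) \<partial>M))^2)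
   (%n. N n powr (1 / 3)))" for t
 proof -
  obtain \<delta> where \<delta>: "(%n. real (\<delta> n)) : \<Theta>(%n. ln (real (N n)) powr \<nu>)"
   and bm: "bounded_in_prob M (%n \<omega>. \<Sum>j<N n.
   (real_cond_exp M (entries_sigma M ({j} \<times> nbhd_compl (T n) (\<delta> n) t) (E n))
   (%\<omega>'. E n \<omega>' $$ (j, t)) \<omega> - (\<integral>\<omega>'. E n \<omega>' $$ (j, t) \<partial>M))^2) (%n. N n powr (1 / 3))" for t
   using ex by blast
  have mu: "tight M (%K n \<omega>. (\<Sum>j<N n. (real_cond_exp M (entries_sigma M ({j} \<times> nbhd_compl (T n) (\<delta> n) t) (E n)) (%\<omega>'. E n \<omega>' $$ (j, t)) \<omega>)^2)
   <= K * real (N n) powr (1 / 3))"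
  proof (rule tight_imp[OF bm[of t, unfolded bounded_in_prob_tight]])
   fix K :: real assume "0 < K"
   have "EV n. ALL \<omega>:space M. \<bar>\<Sum>j<N n.
   (real_cond_exp M (entries_sigma M ({j} \<times> nbhd_compl (T n) (\<delta> n) t) (E n))
   (%\<omega>'. E n \<omega>' $$ (j, t)) \<omega> - (\<integral>\<omega>'. E n \<omega>' $$ (j, t) \<partial>M))^2\<bar> <= K * N n powr (1 / 3)
   --> (\<Sum>j<N n. (real_cond_exp M (entries_sigma M ({j} \<times> nbhd_compl (T n) (\<delta> n) t) (E n)) (%\<omega>'. E n \<omega>' $$ (j, t)) \<omega>)^2)
   <= K * real (N n) powr (1 / 3)"
   using ev_T[of "real (Suc t)"]
   proof eventually_elim
   case (elim n)
   \<comment> \<open>Once \<open>t < T n\<close>, the noise is centred and the deviations in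
     (B'(iv)) are the conditional means themselves.\<close>
   then have "(\<integral>\<omega>'. E n \<omega>' $$ (j, t) \<partial>M) = 0" if "j < N n" for j using B_i(1)[OF that, of t] by simp
   then show ?case by (simp add: sum_nonneg)
   qed
   then show "EX K'>0. EV n. ALL \<omega>:space M. \<bar>\<Sum>j<N n.
   (real_cond_exp M (entries_sigma M ({j} \<times> nbhd_compl (T n) (\<delta> n) t) (E n))
   (%\<omega>'. E n \<omega>' $$ (j, t)) \<omega> - (\<integral>\<omega>'. E n \<omega>' $$ (j, t) \<partial>M))^2\<bar> <= K * N n powr (1 / 3)
   --> (\<Sum>j<N n. (real_cond_exp M (entries_sigma M ({j} \<times> nbhd_compl (T n) (\<delta> n) t) (E n)) (%\<omega>'. E n \<omega>' $$ (j, t)) \<omega>)^2)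
   <= K' * real (N n) powr (1 / 3)" using \<open>0 < K\<close> by blast
  qed
  show ?thesis by (rule factor_rate[OF \<delta> mu])
 qed
 show ?thesis
 proof (intro conjI allI impI, goal_cases)
  case (1 i)
  show ?case
   unfolding bounded_in_prob_tight e1 e0 e8 e9
   using loading_rate[OF lam[of i] Cl(1)] by (simp add: lerr_def vec_l2_norm_nonneg)
 next
  case (2 t)
  note fr = FR[OF 2]
  show ?case
   unfolding bounded_in_prob_tight e1 e3 e0 e8 e2 e6
   using fr by (simp add: ferr_def vec_l2_norm_nonneg Gr_def N6_def)
 next
  case (3 i t)
  have eq: "K * (1 / q n + \<rho> i n * (1 / p n) + \<rho> i n * (m n * N6 n / (s n)^2) + \<rho> i n * Gr n + m n * N6 n / ((s n)^2 * q n) + Gr n / q n)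
   = K * (1 / q n + \<rho> i n * (1 / p n) + \<rho> i n * (m n * real (N n) powr (1 / 6) / (s n)^2)
   + \<rho> i n * sqrt (real (N n)) * (m n * sqrt (m n)) * sqrt (Lg n) / ((s n)^3 * p n)
   + m n * real (N n) powr (1 / 6) / ((s n)^2 * q n)
   + sqrt (real (N n)) * (m n * sqrt (m n)) * sqrt (Lg n) / ((s n)^3 * p n * q n))" for K n
   by (simp add: Gr_def N6_def mult.assoc)
  show ?case
   unfolding bounded_in_prob_tight e1 e3 e4 e4' e5 e7 e0 e8 e2 e6 e9
   using common_rate[OF lam[of i] Cl(1) FR[OF 3]] by (simp only: eq)
 qed
qed

end
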